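(* Let $(M,g)$ be a compact Riemannian surface without boundary and let $0<\delta\le\min\{i/6,\tau\}$ be the decision radius. Let $L$ be any one of the functions $1_{\mathfrak T_\delta}$, $E$, $V$, $F$ on the Poisson configuration space $\mathfrak P$. Then $L$ is measurable and $$\mathbb E_\lambda(L)=\mathbb E_\lambda(L\,1_{\mathfrak T_\delta})+O(\lambda^{-\infty}),$$ where $O(\lambda^{-\infty})$ denotes a quantity decaying faster than any polynomial in $\lambda$ as $\lambda\to\infty$.
   Context: $i$ is the injectivity radius of $(M,g)$; $\tau$ is the strong convexity radius (the largest number such that, for any disk of radius less than $\tau$, the interior of the unique minimal geodesic connecting any two points of the disk's closure lies in the disk's interior). $A$ is the area of $M$ and $dA$ the area measure. Configuration space: $\times^nM_-$ is the set of $(x_1,\dots,x_n)\in M^n$ with the $x_j$ pairwise distinct, no four of them on a circle of radius $\le\min\{i/6,\tau\}$, and no three of them on a circle of radius exactly $\delta$ (an open subset of full measure). $\mathfrak P=\bigsqcup_{n\ge0}\times^nM_-$ with its Borel $\sigma$-algebra, and the probability measure $\mathbb P_\lambda$ on $\mathfrak P$ (Poisson process of density $\lambda>0$) is $\frac{\lambda^n}{n!}e^{-\lambda A}\,dA^n$ on the component $\times^nM_-$. $\mathbb E_\lambda$ is the expected value with respect to $\mathbb P_\lambda$. For a configuration $\mathbf p$, the complex $K_{\mathbf p}$ has the points of $\mathbf p$ as vertices; a pair is an edge (a triple is a face) if it lies on the boundary of a disk (metric ball) of radius less than $\delta$ whose interior contains no point of $\mathbf p$. $V(\mathbf p),E(\mathbf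 p),F(\mathbf p)$ are the numbers of vertices, edges and faces of $K_{\mathbf p}$. $\mathfrak T_\delta\subset\mathfrak P$ is the set of configurations $\mathbf p$ forming a Delaunay triangulation, i.e. such that the natural continuous map $|K_{\mathbf p}|\to M$ (edges mapped onto minimal geodesics, faces onto the corresponding geodesic triangles) is a homeomorphism; $1_{\mathfrak T_\delta}$ is its indicator function. *)

theory Defs
  imports "HOL-Analysis.Analysis" "HOL-Library.Landau_Symbols"
begin

section \<open>Riemannian surfaces\<close>

text \<open>\<open>C\<^sup>k\<close> maps on an open set, via iterated directional derivatives.\<close>

primrec C_k_on :: "nat \<Rightarrow> ('v::real_normed_vector \<Rightarrow> 'w::real_normed_vector) \<Rightarrow> 'v set \<Rightarrow> bool"
where
  "C_k_on 0 f S \<longleftrightarrow> continuous_on S f"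
| "C_k_on (Suc k) f S \<longleftrightarrow>
     (\<forall>x\<in>S. f differentiable (at x)) \<and>
     (\<forall>v. C_k_on k (\<lambda>x. frechet_derivative f (at x) v) S)"

definition smooth_on :: "'v::real_normed_vector set \<Rightarrow> ('v \<Rightarrow> 'w::real_normed_vector) \<Rightarrow> bool" where
  "smooth_on S f \<longleftrightarrow> open S \<and> (\<forall>k. C_k_on k f S)"

text \<open>A chart is a pair (domain, coordinate map); the values of the coordinate map outside
  the domain are irrelevant.  The metric tensor is given by its coefficient matrix in each chart,
  as a function of the coordinates.\<close>

type_synonym 'a chart = "'a set \<times> ('a \<Rightarrow> real^2)"

record 'a riemannian_structure =
  atlas :: "'a chart set"
  metric :: "'a chart \<Rightarrow> real^2 \<Rightarrow> real^2^2"

definition chart_inv :: "'a chart \<Rightarrow> real^2 \<Rightarrow> 'a" where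
  "chart_inv c = inv_into (fst c) (snd c)"

definition transition :: "'a chart \<Rightarrow> 'a chart \<Rightarrow> real^2 \<Rightarrow> real^2" where
  "transition c d = snd d \<circ> chart_inv c"

text \<open>The surface itself is the whole type \<open>'a\<close>.  All chart images are open in the plane, so
  there is no boundary.\<close>

definition smooth_surface_atlas :: "'a::{t2_space,second_countable_topology} chart set \<Rightarrow> bool" where
  "smooth_surface_atlas \<A> \<longleftrightarrow>
     (\<Union>c\<in>\<A>. fst c) = UNIV \<and>
     (\<forall>c\<in>\<A>. open (fst c) \<and> open (snd c ` fst c) \<and>
        homeomorphism (fst c) (snd c ` fst c) (snd c) (chart_inv c)) \<and>
     (\<forall>c\<in>\<A>. \<forall>d\<in>\<A>. smooth_on (snd c ` (fst c \<inter> fst d)) (transition c d))"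

definition compact_riemannian_surface ::
  "'a::{t2_space,second_countable_topology} riemannian_structure \<Rightarrow> bool" where
  "compact_riemannian_surface M \<longleftrightarrow>
     compact (UNIV :: 'a set) \<and> connected (UNIV :: 'a set) \<and>
     smooth_surface_atlas (atlas M) \<and>
     (\<forall>c\<in>atlas M. smooth_on (snd c ` fst c) (metric M c) \<and>
        (\<forall>x\<in>snd c ` fst c. transpose (metric M c x) = metric M c x \<and>
           (\<forall>v. v \<noteq> 0 \<longrightarrow> v \<bullet> (metric M c x *v v) > 0))) \<and>
     (\<forall>c\<in>atlas M. \<forall>d\<in>atlas M. \<forall>p\<in>fst c \<inter> fst d. \<forall>v w.
        let D = frechet_derivative (transition c d) (at (snd c p)) in
          v \<bullet> (metric M c (snd c p) *v w) = D v \<bullet> (metric M d (snd d p) *v D w))"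

subsection \<open>Length and distance\<close>

text \<open>Derivatives at the end points of \<open>I\<close> are one-sided; \<open>u\<close> is the velocity in the chart.\<close>

definition C1_curve_on ::
  "'a::topological_space riemannian_structure \<Rightarrow> real set \<Rightarrow> (real \<Rightarrow> 'a) \<Rightarrow> bool" where
  "C1_curve_on M I \<gamma> \<longleftrightarrow> continuous_on I \<gamma> \<and>
     (\<forall>c\<in>atlas M. \<exists>u. continuous_on {t\<in>I. \<gamma> t \<in> fst c} u \<and>
        (\<forall>t\<in>I. \<gamma> t \<in> fst c \<longrightarrow> ((snd c \<circ> \<gamma>) has_vector_derivative u t) (at t within I)))"

definition piecewise_C1_curve ::
  "'a::topological_space riemannian_structure \<Rightarrow> (real \<Rightarrow> 'a) \<Rightarrow> bool" where
  "piecewise_C1_curve M \<gamma> \<longleftrightarrow> continuous_on {0..1} \<gamma> \<and>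
     (\<exists>S. finite S \<and>
        (\<forall>a b. 0 \<le> a \<and> a < b \<and> b \<le> 1 \<and> {a<..<b} \<inter> S = {} \<longrightarrow> C1_curve_on M {a..b} \<gamma>))"

text \<open>The speed does not depend on the chart chosen, by the transformation law of the metric.\<close>

definition speed :: "'a riemannian_structure \<Rightarrow> (real \<Rightarrow> 'a) \<Rightarrow> real \<Rightarrow> real" where
  "speed M \<gamma> t =
     (let c = (SOME c. c \<in> atlas M \<and> \<gamma> t \<in> fst c);
          v = vector_derivative (snd c \<circ> \<gamma>) (at t)
      in sqrt (v \<bullet> (metric M c (snd c (\<gamma> t)) *v v)))"

definition curve_length :: "'a riemannian_structure \<Rightarrow> (real \<Rightarrow> 'a) \<Rightarrow> real" where
  "curve_length M \<gamma> = integral {0..1} (speed M \<gamma>)"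

definition rdist :: "'a::topological_space riemannian_structure \<Rightarrow> 'a \<Rightarrow> 'a \<Rightarrow> real" where
  "rdist M p q = (INF \<gamma>\<in>{\<gamma>. piecewise_C1_curve M \<gamma> \<and> \<gamma> 0 = p \<and> \<gamma> 1 = q}. curve_length M \<gamma>)"

definition disk :: "'a::topological_space riemannian_structure \<Rightarrow> 'a \<Rightarrow> real \<Rightarrow> 'a set" where
  "disk M p r = {q. rdist M p q < r}"

definition circle :: "'a::topological_space riemannian_structure \<Rightarrow> 'a \<Rightarrow> real \<Rightarrow> 'a set" where
  "circle M p r = {q. rdist M p q = r}"

subsection \<open>Geodesics and the exponential map\<close>

definition partial_deriv :: "2 \<Rightarrow> (real^2 \<Rightarrow> real) \<Rightarrow> real^2 \<Rightarrow> real" where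
  "partial_deriv i f x = frechet_derivative f (at x) (axis i 1)"

text \<open>The Christoffel symbol with upper index \<open>k\<close> and lower indices \<open>i\<close>, \<open>j\<close>.\<close>

definition christoffel :: "(real^2 \<Rightarrow> real^2^2) \<Rightarrow> real^2 \<Rightarrow> 2 \<Rightarrow> 2 \<Rightarrow> 2 \<Rightarrow> real" where
  "christoffel G x k i j = 1/2 * (\<Sum>l\<in>UNIV. matrix_inv (G x) $ k $ l *
     (partial_deriv i (\<lambda>y. G y $ j $ l) x + partial_deriv j (\<lambda>y. G y $ i $ l) x
      - partial_deriv l (\<lambda>y. G y $ i $ j) x))"

definition geodesic_on ::
  "'a::topological_space riemannian_structure \<Rightarrow> real set \<Rightarrow> (real \<Rightarrow> 'a) \<Rightarrow> bool" where
  "geodesic_on M I \<gamma> \<longleftrightarrow> continuous_on I \<gamma> \<and>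
     (\<forall>c\<in>atlas M. \<exists>u :: real \<Rightarrow> real^2. \<forall>t\<in>I. \<gamma> t \<in> fst c \<longrightarrow>
        ((snd c \<circ> \<gamma>) has_vector_derivative u t) (at t within I) \<and>
        (u has_vector_derivative
           (\<chi> k. - (\<Sum>i\<in>UNIV. \<Sum>j\<in>UNIV.
                     christoffel (metric M c) (snd c (\<gamma> t)) k i j * u t $ i * u t $ j)))
          (at t within I))"

text \<open>Tangent vectors at \<open>p\<close> are represented by their coordinates in a chart \<open>c\<close> around \<open>p\<close>.\<close>

definition exp_map ::
  "'a::topological_space riemannian_structure \<Rightarrow> 'a chart \<Rightarrow> 'a \<Rightarrow> real^2 \<Rightarrow> 'a" where
  "exp_map M c p v = (THE q. \<exists>\<gamma>. geodesic_on M {0..1} \<gamma> \<and> \<gamma> 0 = p \<and> \<gamma> 1 = q \<and>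
     ((snd c \<circ> \<gamma>) has_vector_derivative v) (at 0 within {0..1}))"

definition tangent_ball :: "'a riemannian_structure \<Rightarrow> 'a chart \<Rightarrow> 'a \<Rightarrow> real \<Rightarrow> (real^2) set" where
  "tangent_ball M c p r = {v. sqrt (v \<bullet> (metric M c (snd c p) *v v)) < r}"

definition diffeomorphism_onto_image ::
  "'a::topological_space riemannian_structure \<Rightarrow> (real^2) set \<Rightarrow> (real^2 \<Rightarrow> 'a) \<Rightarrow> bool" where
  "diffeomorphism_onto_image M B f \<longleftrightarrow>
     inj_on f B \<and> continuous_on B f \<and> open (f ` B) \<and>
     (\<forall>d\<in>atlas M. smooth_on {v\<in>B. f v \<in> fst d} (snd d \<circ> f) \<and>
        smooth_on (snd d ` (fst d \<inter> f ` B)) (inv_into B f \<circ> chart_inv d))"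

text \<open>Radii are extended reals, so that no boundedness of the sets involved has to be presupposed.\<close>

definition inj_radius_at :: "'a::topological_space riemannian_structure \<Rightarrow> 'a \<Rightarrow> ereal" where
  "inj_radius_at M p = Sup {ereal r | r. 0 < r \<and>
     (\<forall>c\<in>atlas M. p \<in> fst c \<longrightarrow>
        diffeomorphism_onto_image M (tangent_ball M c p r) (exp_map M c p))}"

definition inj_radius :: "'a::topological_space riemannian_structure \<Rightarrow> ereal" where
  "inj_radius M = (INF p. inj_radius_at M p)"

definition minimal_geodesic ::
  "'a::topological_space riemannian_structure \<Rightarrow> 'a \<Rightarrow> 'a \<Rightarrow> (real \<Rightarrow> 'a) \<Rightarrow> bool" where
  "minimal_geodesic M p q \<gamma> \<longleftrightarrow> geodesic_on M {0..1} \<gamma> \<and> \<gamma> 0 = p \<and> \<gamma> 1 = q \<and>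
     curve_length M \<gamma> = rdist M p q"

text \<open>Existence and uniqueness of the minimal geodesic are part of the condition.  Uniqueness is
  that of the parametrization proportional to arc length on \<open>[0,1]\<close>.\<close>

definition strongly_convex_disk ::
  "'a::topological_space riemannian_structure \<Rightarrow> 'a set \<Rightarrow> bool" where
  "strongly_convex_disk M D \<longleftrightarrow> (\<forall>p\<in>closure D. \<forall>q\<in>closure D. p \<noteq> q \<longrightarrow>
     (\<exists>\<gamma>. minimal_geodesic M p q \<gamma> \<and>
        (\<forall>\<gamma>'. minimal_geodesic M p q \<gamma>' \<longrightarrow> (\<forall>t\<in>{0..1}. \<gamma>' t = \<gamma> t)) \<and>
        \<gamma> ` {0<..<1} \<subseteq> interior D))"

definition convexity_radius :: "'a::topological_space riemannian_structure \<Rightarrow> ereal" where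
  "convexity_radius M =
     Sup {ereal \<rho> | \<rho>. \<forall>p r. r < \<rho> \<longrightarrow> strongly_convex_disk M (disk M p r)}"

subsection \<open>Area\<close>

definition area_measure ::
  "'a::{t2_space,second_countable_topology} riemannian_structure \<Rightarrow> 'a measure" where
  "area_measure M = (THE \<mu>. sets \<mu> = sets borel \<and>
     (\<forall>c\<in>atlas M. \<forall>S\<in>sets borel. S \<subseteq> fst c \<longrightarrow>
        emeasure \<mu> S = (\<integral>\<^sup>+x. ennreal (sqrt (det (metric M c x))) * indicator (snd c ` S) x \<partial>lborel)))"

definition total_area ::
  "'a::{t2_space,second_countable_topology} riemannian_structure \<Rightarrow> real" where
  "total_area M = measure (area_measure M) UNIV"

section \<open>Configurations and the Poisson process\<close>

text \<open>The disjoint union of the configuration spaces is realized by pairs \<open>(n, x)\<close>, where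
  \<open>x\<close> is an \<open>n\<close>-tuple, i.e. an extensional function on \<open>{..<n}\<close>.\<close>

type_synonym 'a config = "nat \<times> (nat \<Rightarrow> 'a)"

definition points :: "'a config \<Rightarrow> 'a set" where
  "points p = snd p ` {..<fst p}"

definition config_component ::
  "'a::topological_space riemannian_structure \<Rightarrow> real \<Rightarrow> nat \<Rightarrow> (nat \<Rightarrow> 'a) set" where
  "config_component M \<delta> n = {x \<in> {..<n} \<rightarrow>\<^sub>E UNIV. inj_on x {..<n} \<and>
     \<not> (\<exists>S \<subseteq> x ` {..<n}. card S = 4 \<and>
          (\<exists>c r. ereal r \<le> min (inj_radius M / 6) (convexity_radius M) \<and> S \<subseteq> circle M c r)) \<and>
     \<not> (\<exists>S \<subseteq> x ` {..<n}. card S = 3 \<and> (\<exists>c. S \<subseteq> circle M c \<delta>))}"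

definition config_topology ::
  "'a::topological_space riemannian_structure \<Rightarrow> real \<Rightarrow> 'a config topology" where
  "config_topology M \<delta> = sum_topology
     (\<lambda>n. subtopology (product_topology (\<lambda>_. euclidean) {..<n}) (config_component M \<delta> n)) UNIV"

definition poisson_process ::
  "'a::{t2_space,second_countable_topology} riemannian_structure \<Rightarrow> real \<Rightarrow> real \<Rightarrow> 'a config measure"
where
  "poisson_process M \<delta> lam = measure_of (topspace (config_topology M \<delta>))
     {U. openin (config_topology M \<delta>) U}
     (\<lambda>S. \<Sum>n. ennreal (lam ^ n / fact n * exp (- lam * total_area M)) *
        emeasure (PiM {..<n} (\<lambda>_. area_measure M)) {x. (n, x) \<in> S})"

text \<open>The same \<open>\<sigma>\<close>-algebra, without a measure.\<close>

definition config_borel ::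
  "'a::topological_space riemannian_structure \<Rightarrow> real \<Rightarrow> 'a config measure" where
  "config_borel M \<delta> = sigma (topspace (config_topology M \<delta>)) {U. openin (config_topology M \<delta>) U}"

section \<open>Delaunay complexes\<close>

definition empty_disk ::
  "'a::topological_space riemannian_structure \<Rightarrow> real \<Rightarrow> 'a config \<Rightarrow> 'a set \<Rightarrow> bool" where
  "empty_disk M \<delta> p D \<longleftrightarrow> (\<exists>c r. r < \<delta> \<and> D = disk M c r) \<and> interior D \<inter> points p = {}"

definition edges ::
  "'a::topological_space riemannian_structure \<Rightarrow> real \<Rightarrow> 'a config \<Rightarrow> 'a set set" where
  "edges M \<delta> p =
     {S. S \<subseteq> points p \<and> card S = 2 \<and> (\<exists>D. empty_disk M \<delta> p D \<and> S \<subseteq> frontier D)}"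

definition faces ::
  "'a::topological_space riemannian_structure \<Rightarrow> real \<Rightarrow> 'a config \<Rightarrow> 'a set set" where
  "faces M \<delta> p =
     {S. S \<subseteq> points p \<and> card S = 3 \<and> (\<exists>D. empty_disk M \<delta> p D \<and> S \<subseteq> frontier D)}"

definition num_vertices :: "'a config \<Rightarrow> real" where
  "num_vertices p = real (card (points p))"

definition num_edges ::
  "'a::topological_space riemannian_structure \<Rightarrow> real \<Rightarrow> 'a config \<Rightarrow> real" where
  "num_edges M \<delta> p = real (card (edges M \<delta> p))"

definition num_faces ::
  "'a::topological_space riemannian_structure \<Rightarrow> real \<Rightarrow> 'a config \<Rightarrow> real" where
  "num_faces M \<delta> p = real (card (faces M \<delta> p))"

definition simplices ::
  "'a::topological_space riemannian_structure \<Rightarrow> real \<Rightarrow> 'a config \<Rightarrow> 'a set set" where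
  "simplices M \<delta> p = {{v} | v. v \<in> points p} \<union> edges M \<delta> p \<union> faces M \<delta> p"

text \<open>Geometric realization in barycentric coordinates, topologized as a subspace of the
  product space \<open>'a \<Rightarrow> real\<close>; \<open>cell S\<close> is the closed simplex spanned by \<open>S\<close>.\<close>

definition cell :: "'a set \<Rightarrow> ('a \<Rightarrow> real) set" where
  "cell S = {b. (\<forall>x. 0 \<le> b x) \<and> {x. b x \<noteq> 0} \<subseteq> S \<and> sum b S = 1}"

definition realization ::
  "'a::topological_space riemannian_structure \<Rightarrow> real \<Rightarrow> 'a config \<Rightarrow> ('a \<Rightarrow> real) set" where
  "realization M \<delta> p = (\<Union>S\<in>simplices M \<delta> p. cell S)"

definition geodesic_sides :: "'a::topological_space riemannian_structure \<Rightarrow> 'a set \<Rightarrow> 'a set" where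
  "geodesic_sides M S =
     \<Union>{\<gamma> ` {0..1} | \<gamma>. \<exists>x\<in>S. \<exists>y\<in>S. x \<noteq> y \<and> minimal_geodesic M x y \<gamma>}"

text \<open>For three points on the boundary of a small disk \<open>D\<close>, the filled triangle consists of the
  three sides and the part of the surface that they enclose inside \<open>D\<close>.\<close>

definition geodesic_triangle ::
  "'a::topological_space riemannian_structure \<Rightarrow> 'a set \<Rightarrow> 'a set \<Rightarrow> 'a set" where
  "geodesic_triangle M D S = geodesic_sides M S \<union>
     \<Union>{C \<in> components (- geodesic_sides M S). C \<subseteq> D}"

text \<open>The natural map is determined up to reparametrization of the cells by where it sends the
  vertices, edges and faces, and being a homeomorphism does not depend on the parametrization.\<close>

definition natural_map ::
  "'a::topological_space riemannian_structure \<Rightarrow> real \<Rightarrow> 'a config \<Rightarrow> (('a \<Rightarrow> real) \<Rightarrow> 'a) \<Rightarrow> bool"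
where
  "natural_map M \<delta> p f \<longleftrightarrow> continuous_on (realization M \<delta> p) f \<and>
     (\<forall>v\<in>points p. f ` cell {v} = {v}) \<and>
     (\<forall>S\<in>edges M \<delta> p. \<exists>x y \<gamma>. S = {x, y} \<and> minimal_geodesic M x y \<gamma> \<and>
        f ` cell S = \<gamma> ` {0..1}) \<and>
     (\<forall>S\<in>faces M \<delta> p. \<exists>D. empty_disk M \<delta> p D \<and> S \<subseteq> frontier D \<and>
        f ` cell S = geodesic_triangle M D S)"

definition delaunay_configs ::
  "'a::topological_space riemannian_structure \<Rightarrow> real \<Rightarrow> 'a config set" where
  "delaunay_configs M \<delta> = {p \<in> topspace (config_topology M \<delta>).
     \<exists>f g. natural_map M \<delta> p f \<and> homeomorphism (realization M \<delta> p) UNIV f g}"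

end

theory Submission
  imports Defs
begin

text \<open>
  The two expectations differ by the integral of \<open>L\<close> over the configurations that are not Delaunay
  triangulations.  The natural map of the complex, built from minimal geodesics and geodesic cones,
  is always injective: if two edges crossed, each could be deformed, inside its own empty disk, to
  the broken path through the centre of that disk; these two broken paths do not meet, whereas a
  single transversal crossing survives such a deformation.  If every point of the surface is within
  a suitable \<open>\<epsilon>\<close> of the configuration, the natural map is also onto, because its composition with
  the nerve map of a cover by slightly enlarged empty disks is close to the identity.  Hence a
  configuration that is not a Delaunay triangulation misses one of finitely many disks of radius
  \<open>\<epsilon>/2\<close>, an event whose probability decays exponentially in the density, while \<open>L\<close> is polynomially
  bounded in the number of points.

  For measurability, spanning an edge or a face is the projection of a closed condition along the
  compact set of centres and radii, and by injectivity of the natural map being a Delaunay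
  triangulation depends only on the homeomorphism type of the complex, that is, on finitely many
  combinatorial data.
\<close>

section \<open>Charts and the metric tensor\<close>

text \<open>The geometry has to be extracted from little: disks of radius below \<delta> are
  strongly convex, and \<delta> is at most a sixth of the injectivity radius, so the exponential
  chart at any point of such a disk contains the whole disk. No curvature bound is at hand. Edges
  and triangles are therefore compared by the triangle inequality, by uniqueness of geodesics, and
  by straightness of a geodesic in the exponential charts at its own points. The paths through two
  centres are disjoint because minimal geodesics do not branch; this fails only for equal disks, and
  there the condition on four cocircular points takes over. The same condition bounds the dimension
  of the nerve by two. Existence of a natural homeomorphism is not visibly a measurable condition.
  It becomes one because an injective continuous self-map of a connected closed surface is onto: a
  homeomorphism of any kind from the realization to the surface then suffices, and the realization
  is determined up to homeomorphism by the index sets of its edges and faces.\<close>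

lemma smooth_on_continuous_on: "smooth_on S f \<Longrightarrow> continuous_on S f"
  unfolding smooth_on_def using C_k_on.simps(1) by blast

lemma smooth_on_has_derivative:
  assumes "smooth_on S f" "x \<in> S"
  shows "(f has_derivative frechet_derivative f (at x)) (at x)"
proof -
  have "C_k_on (Suc 0) f S" using assms(1) unfolding smooth_on_def by blast
  then show ?thesis using assms(2) by (simp add: frechet_derivative_works)
qed

lemma smooth_on_directional:
  assumes "smooth_on S f"
  shows "smooth_on S (\<lambda>x. frechet_derivative f (at x) v)"
proof -
  have "C_k_on (Suc k) f S" for k using assms unfolding smooth_on_def by blast
  then have "C_k_on k (\<lambda>x. frechet_derivative f (at x) v) S" for k by simp
  then show ?thesis using assms by (simp add: smooth_on_def)
qed

lemma linear_real2_expand: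
  fixes f :: "real^2 \<Rightarrow> 'w::real_normed_vector"
  assumes "linear f"
  shows "f v = v$1 *\<^sub>R f (axis 1 1) + v$2 *\<^sub>R f (axis 2 1)"
proof -
  have "v = v$1 *\<^sub>R axis 1 1 + v$2 *\<^sub>R axis 2 1"
    by (simp add: vec_eq_iff forall_2 axis_def)
  then have "f v = f (v$1 *\<^sub>R axis 1 1 + v$2 *\<^sub>R axis 2 1)" by simp
  also have "\<dots> = v$1 *\<^sub>R f (axis 1 1) + v$2 *\<^sub>R f (axis 2 1)"
    using assms by (simp add: linear_add linear_scale)
  finally show ?thesis .
qed

lemma smooth_on_derivative_expand:
  fixes f :: "real^2 \<Rightarrow> 'w::real_normed_vector"
  assumes "smooth_on S f" "x \<in> S"
  shows "frechet_derivative f (at x) v =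
    v$1 *\<^sub>R frechet_derivative f (at x) (axis 1 1) + v$2 *\<^sub>R frechet_derivative f (at x) (axis 2 1)"
  using smooth_on_has_derivative[OF assms] has_derivative_linear linear_real2_expand by blast

text \<open>\<open>C_k_on\<close> controls the derivative only in each fixed direction. In the plane
  a direction splits along the two axes, so continuity in base point and direction together follows
  from linearity.\<close>

lemma smooth_on_derivative_continuous:
  fixes f :: "real^2 \<Rightarrow> 'w::real_normed_vector"
  assumes f: "smooth_on S f" and g: "continuous_on T g" and h: "continuous_on T h" and sub: "g ` T \<subseteq> S"
  shows "continuous_on T (\<lambda>t. frechet_derivative f (at (g t)) (h t))"
proof -
  have c: "continuous_on T (\<lambda>t. frechet_derivative f (at (g t)) e)" for e
    using continuous_on_compose2[OF smooth_on_continuous_on[OF smooth_on_directional[OF f]] g sub] .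
  have h': "continuous_on T (\<lambda>t. h t $ i)" for i
    using h by (intro continuous_intros)
  have "continuous_on T (\<lambda>t. h t $ 1 *\<^sub>R frechet_derivative f (at (g t)) (axis 1 1)
      + h t $ 2 *\<^sub>R frechet_derivative f (at (g t)) (axis 2 1))"
    by (intro continuous_intros c h')
  moreover have "frechet_derivative f (at (g t)) (h t) = h t $ 1 *\<^sub>R frechet_derivative f (at (g t)) (axis 1 1)
      + h t $ 2 *\<^sub>R frechet_derivative f (at (g t)) (axis 2 1)" if "t \<in> T" for t
    using smooth_on_derivative_expand[OF f] sub that by (metis image_subset_iff)
  ultimately show ?thesis by (simp cong: continuous_on_cong)
qed

text \<open>Bounds for the derivative along the two axes add up to a bound for its operator norm on
  the compact ball; convexity of the ball then allows the mean value estimate.\<close>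

lemma smooth_on_lipschitz:
  fixes f :: "real^2 \<Rightarrow> 'w::real_normed_vector"
  assumes f: "smooth_on S f" and sub: "cball x0 r \<subseteq> S"
  obtains K where "K > 0" "\<And>x y. x \<in> cball x0 r \<Longrightarrow> y \<in> cball x0 r \<Longrightarrow> norm (f x - f y) \<le> K * norm (x - y)"
proof -
  let ?D = "\<lambda>e x. frechet_derivative f (at x) e"
  have "\<exists>B. \<forall>x\<in>cball x0 r. norm (?D e x) \<le> B" for e
  proof -
    have "continuous_on (cball x0 r) (?D e)"
      using smooth_on_continuous_on[OF smooth_on_directional[OF f]] sub continuous_on_subset by blast
    then have "compact (?D e ` cball x0 r)" by (intro compact_continuous_image) auto
    then have "bounded (?D e ` cball x0 r)" by (rule compact_imp_bounded)
    then obtain B where "\<forall>y\<in>?D e ` cball x0 r. norm y \<le> B" unfolding bounded_iff by blast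
    then show ?thesis by blast
  qed
  then obtain B where B: "\<And>e x. x \<in> cball x0 r \<Longrightarrow> norm (?D e x) \<le> B e" by metis
  define K where "K = \<bar>B (axis 1 1)\<bar> + \<bar>B (axis 2 1)\<bar> + 1"
  have on: "onorm (\<lambda>v. frechet_derivative f (at x) v) \<le> K" if x: "x \<in> cball x0 r" for x
  proof (rule onorm_le)
    fix v :: "real^2"
    have "norm (frechet_derivative f (at x) v) = norm (v$1 *\<^sub>R ?D (axis 1 1) x + v$2 *\<^sub>R ?D (axis 2 1) x)"
      using smooth_on_derivative_expand[OF f] x sub by (metis subsetD)
    also have "\<dots> \<le> \<bar>v$1\<bar> * norm (?D (axis 1 1) x) + \<bar>v$2\<bar> * norm (?D (axis 2 1) x)"
      by (metis norm_triangle_ineq norm_scaleR)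
    also have "\<dots> \<le> norm v * \<bar>B (axis 1 1)\<bar> + norm v * \<bar>B (axis 2 1)\<bar>"
    proof -
      have "norm (?D e x) \<le> \<bar>B e\<bar>" for e using B[OF x, of e] by linarith
      then show ?thesis by (intro add_mono mult_mono component_le_norm_cart) auto
    qed
    also have "\<dots> \<le> K * norm v" by (simp add: K_def algebra_simps)
    finally show "norm (frechet_derivative f (at x) v) \<le> K * norm v" .
  qed
  have "norm (f x - f y) \<le> K * norm (x - y)" if "x \<in> cball x0 r" "y \<in> cball x0 r" for x y
  proof (rule differentiable_bound[of "cball x0 r" f "\<lambda>x. frechet_derivative f (at x)"])
    fix x assume "x \<in> cball x0 r"
    then show "(f has_derivative frechet_derivative f (at x)) (at x within cball x0 r)"
      using smooth_on_has_derivative[OF f] sub has_derivative_at_withinI by (metis subsetD)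
  qed (use that on in auto)
  moreover have "K > 0" by (simp add: K_def)
  ultimately show ?thesis using that by blast
qed

definition gnorm :: "'a riemannian_structure \<Rightarrow> 'a chart \<Rightarrow> real^2 \<Rightarrow> real^2 \<Rightarrow> real" where
  "gnorm M c x v = sqrt (v \<bullet> (metric M c x *v v))"

lemma gnorm_scale: "gnorm M c x (k *\<^sub>R v) = \<bar>k\<bar> * gnorm M c x v"
proof -
  have "(k *\<^sub>R v) \<bullet> (metric M c x *v (k *\<^sub>R v)) = k\<^sup>2 * (v \<bullet> (metric M c x *v v))"
    by (simp add: matrix_vector_mult_scaleR power2_eq_square)
  then show ?thesis by (simp add: gnorm_def real_sqrt_mult)
qed

lemma gnorm_zero [simp]: "gnorm M c x 0 = 0"
  by (simp add: gnorm_def)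

lemma inner_mult_expand:
  fixes A :: "real^2^2"
  shows "v \<bullet> (A *v w) = v$1 * (A$1$1 * w$1 + A$1$2 * w$2) + v$2 * (A$2$1 * w$1 + A$2$2 * w$2)"
  by (simp add: inner_vec_def matrix_vector_mult_def sum_2)

lemma continuous_on_inner_mult:
  fixes A :: "'b::topological_space \<Rightarrow> real^2^2"
  assumes "continuous_on T A" "continuous_on T v" "continuous_on T w"
  shows "continuous_on T (\<lambda>t. v t \<bullet> (A t *v w t))"
  unfolding inner_mult_expand using assms by (intro continuous_intros)

locale riem_surface =
  fixes M :: "'a::{t2_space,second_countable_topology} riemannian_structure"
  assumes surf: "compact_riemannian_surface M"
begin

abbreviation img :: "'a chart \<Rightarrow> (real^2) set" where "img c \<equiv> snd c ` fst c"
abbreviation \<nu> where "\<nu> \<equiv> gnorm M"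

lemma compact_surface: "compact (UNIV :: 'a set)" and connected_surface: "connected (UNIV :: 'a set)"
  and smooth_atlas: "smooth_surface_atlas (atlas M)"
  using surf by (auto simp: compact_riemannian_surface_def)

lemma chart_at: obtains c where "c \<in> atlas M" "p \<in> fst c"
  using smooth_atlas unfolding smooth_surface_atlas_def by blast

lemma
  assumes "c \<in> atlas M"
  shows open_dom: "open (fst c)" and open_img: "open (img c)"
    and chart_homeomorphism: "homeomorphism (fst c) (img c) (snd c) (chart_inv c)"
  using assms smooth_atlas unfolding smooth_surface_atlas_def by auto

lemma
  assumes c: "c \<in> atlas M"
  shows chart_inv_snd: "q \<in> fst c \<Longrightarrow> chart_inv c (snd c q) = q"
    and snd_chart_inv: "x \<in> img c \<Longrightarrow> snd c (chart_inv c x) = x"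
    and chart_inv_in: "x \<in> img c \<Longrightarrow> chart_inv c x \<in> fst c"
    and continuous_chart: "continuous_on (fst c) (snd c)"
    and continuous_chart_inv: "continuous_on (img c) (chart_inv c)"
    and chart_inv_image: "chart_inv c ` img c = fst c"
    and chart_inj: "inj_on (snd c) (fst c)"
  using chart_homeomorphism[OF c] unfolding homeomorphism_def by (auto intro: inj_on_inverseI)

lemma chart_inv_open:
  assumes c: "c \<in> atlas M" and "open U" "U \<subseteq> img c"
  shows "open (chart_inv c ` U)"
proof -
  have "chart_inv c ` U = fst c \<inter> snd c -` U"
    using assms(3) chart_inv_snd[OF c] snd_chart_inv[OF c] chart_inv_in[OF c] by force
  then show ?thesis
    using continuous_open_preimage[OF continuous_chart[OF c] open_dom[OF c] \<open>open U\<close>] by simp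
qed

lemma metric_smooth: "c \<in> atlas M \<Longrightarrow> smooth_on (img c) (metric M c)"
  using surf unfolding compact_riemannian_surface_def by blast

lemma metric_symmetric: "c \<in> atlas M \<Longrightarrow> x \<in> img c \<Longrightarrow> metric M c x $ i $ j = metric M c x $ j $ i"
proof -
  assume "c \<in> atlas M" "x \<in> img c"
  then have "transpose (metric M c x) = metric M c x"
    using surf unfolding compact_riemannian_surface_def by blast
  then have "transpose (metric M c x) $ i $ j = metric M c x $ i $ j" by simp
  then show ?thesis by (simp add: transpose_def)
qed

lemma metric_pos: "c \<in> atlas M \<Longrightarrow> x \<in> img c \<Longrightarrow> v \<noteq> 0 \<Longrightarrow> v \<bullet> (metric M c x *v v) > 0"
  using surf unfolding compact_riemannian_surface_def by blast

lemma gnorm_pos: "c \<in> atlas M \<Longrightarrow> x \<in> img c \<Longrightarrow> v \<noteq> 0 \<Longrightarrow> \<nu> c x v > 0"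
  using metric_pos by (simp add: gnorm_def)

lemma gnorm_nonneg: "c \<in> atlas M \<Longrightarrow> x \<in> img c \<Longrightarrow> \<nu> c x v \<ge> 0"
  using gnorm_pos[of c x v] by (cases "v = 0") auto

lemma gnorm_square: "c \<in> atlas M \<Longrightarrow> x \<in> img c \<Longrightarrow> (\<nu> c x v)\<^sup>2 = v \<bullet> (metric M c x *v v)"
  using metric_pos[of c x v] by (cases "v = 0") (auto simp: gnorm_def)

lemma continuous_on_gnorm:
  assumes c: "c \<in> atlas M" and x: "continuous_on T x" "x ` T \<subseteq> img c" and v: "continuous_on T v"
  shows "continuous_on T (\<lambda>t. \<nu> c (x t) (v t))"
  unfolding gnorm_def
  by (intro continuous_intros continuous_on_inner_mult v
      continuous_on_compose2[OF smooth_on_continuous_on[OF metric_smooth[OF c]] x])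

text \<open>The metric norm attains positive extrema on the compact set of Euclidean unit vectors
  over S, and homogeneity carries the bounds to all vectors. Distances on the surface and in
  coordinates are compared through these two constants.\<close>

lemma gnorm_bounds:
  assumes c: "c \<in> atlas M" and S: "compact S" "S \<subseteq> img c" 
  obtains \<kappa> K where "\<kappa> > 0" "K > 0" "\<And>x v. x \<in> S \<Longrightarrow> \<kappa> * norm v \<le> \<nu> c x v \<and> \<nu> c x v \<le> K * norm v"
proof (cases "S = {}")
  case True then show ?thesis using that[of 1 1] by simp
next
  case False
  let ?T = "S \<times> sphere (0::real^2) 1"
  have comp: "compact ?T" using S(1) by (intro compact_Times) auto
  have ne: "?T \<noteq> {}" using False by simp
  have cont: "continuous_on ?T (\<lambda>(x,v). \<nu> c x v)"
    unfolding case_prod_beta using S(2) by (intro continuous_on_gnorm[OF c] continuous_intros) auto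
  obtain z where z: "z \<in> ?T" "\<And>y. y \<in> ?T \<Longrightarrow> (case z of (x,v) \<Rightarrow> \<nu> c x v) \<le> (case y of (x,v) \<Rightarrow> \<nu> c x v)"
    using continuous_attains_inf[OF comp ne cont] by blast
  obtain w where w: "w \<in> ?T" "\<And>y. y \<in> ?T \<Longrightarrow> (case y of (x,v) \<Rightarrow> \<nu> c x v) \<le> (case w of (x,v) \<Rightarrow> \<nu> c x v)"
    using continuous_attains_sup[OF comp ne cont] by blast
  define \<kappa> where "\<kappa> = \<nu> c (fst z) (snd z)"
  define K where "K = \<nu> c (fst w) (snd w)"
  have pos: "\<nu> c (fst y) (snd y) > 0" if "y \<in> ?T" for y
    using that S(2) by (intro gnorm_pos[OF c]) auto
  have "\<kappa> * norm v \<le> \<nu> c x v \<and> \<nu> c x v \<le> K * norm v" if x: "x \<in> S" for x v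
  proof (cases "v = 0")
    case False
    have m: "(x, v /\<^sub>R norm v) \<in> ?T" using x False by simp
    have "\<nu> c x v = norm v * \<nu> c x (v /\<^sub>R norm v)"
      using False by (simp add: gnorm_scale)
    moreover have "\<kappa> \<le> \<nu> c x (v /\<^sub>R norm v)" "\<nu> c x (v /\<^sub>R norm v) \<le> K"
      using z(2)[OF m] w(2)[OF m] by (auto simp: \<kappa>_def K_def case_prod_beta)
    ultimately show ?thesis using mult_left_mono[of _ _ "norm v"] by (metis mult.commute norm_ge_zero)
  qed auto
  moreover have "\<kappa> > 0" "K > 0" unfolding \<kappa>_def K_def by (rule pos, fact)+
  ultimately show ?thesis using that by blast
qed

lemma transition_smooth:
  "c \<in> atlas M \<Longrightarrow> d \<in> atlas M \<Longrightarrow> smooth_on (snd c ` (fst c \<inter> fst d)) (transition c d)"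
  using smooth_atlas unfolding smooth_surface_atlas_def by blast

lemma transition_eq: "c \<in> atlas M \<Longrightarrow> p \<in> fst c \<Longrightarrow> transition c d (snd c p) = snd d p"
  by (simp add: transition_def chart_inv_snd)

abbreviation Dtrans where "Dtrans c d p \<equiv> frechet_derivative (transition c d) (at (snd c p))"

lemma gnorm_transition:
  assumes "c \<in> atlas M" "d \<in> atlas M" "p \<in> fst c" "p \<in> fst d"
  shows "\<nu> d (snd d p) (Dtrans c d p v) = \<nu> c (snd c p) v"
  proof -
  have "v \<bullet> (metric M c (snd c p) *v v) = Dtrans c d p v \<bullet> (metric M d (snd d p) *v Dtrans c d p v)"
    using surf assms unfolding compact_riemannian_surface_def Let_def by blast
  then show ?thesis by (simp add: gnorm_def)
qed

text \<open>Chain rule, with one-sided derivatives allowed. The curve is in the domain of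
  \<open>c\<close> only near t, which continuity at t provides.\<close>

lemma velocity_transition:
  assumes c: "c \<in> atlas M" and d: "d \<in> atlas M" and p: "\<gamma> t \<in> fst c" "\<gamma> t \<in> fst d"
    and t: "t \<in> I" and cont: "continuous (at t within I) \<gamma>"
    and der: "((snd c \<circ> \<gamma>) has_vector_derivative u) (at t within I)"
  shows "((snd d \<circ> \<gamma>) has_vector_derivative Dtrans c d (\<gamma> t) u) (at t within I)"
proof -
  have in_dom: "snd c (\<gamma> t) \<in> snd c ` (fst c \<inter> fst d)" using p by auto
  have tr: "(transition c d has_derivative Dtrans c d (\<gamma> t)) (at (snd c (\<gamma> t)))"
    by (rule smooth_on_has_derivative[OF transition_smooth[OF c d] in_dom])
  have "((\<lambda>s. transition c d ((snd c \<circ> \<gamma>) s)) has_derivative (\<lambda>h. Dtrans c d (\<gamma> t) (h *\<^sub>R u))) (at t within I)"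
    using has_derivative_compose[OF der[unfolded has_vector_derivative_def], of "transition c d"] tr
    by (simp add: o_def)
  moreover have "Dtrans c d (\<gamma> t) (h *\<^sub>R u) = h *\<^sub>R Dtrans c d (\<gamma> t) u" for h
    using has_derivative_linear[OF tr] linear_scale by blast
  ultimately have "((\<lambda>s. transition c d ((snd c \<circ> \<gamma>) s)) has_vector_derivative Dtrans c d (\<gamma> t) u) (at t within I)"
    by (simp add: has_vector_derivative_def)
  then have *: "((\<lambda>s. transition c d ((snd c \<circ> \<gamma>) s)) has_derivative (\<lambda>h. h *\<^sub>R Dtrans c d (\<gamma> t) u)) (at t within I)"
    by (simp add: has_vector_derivative_def)
  have "\<forall>\<^sub>F s in at t within I. \<gamma> s \<in> fst c"
    using cont p open_dom[OF c] by (metis continuous_within topological_tendstoD)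
  then have ev: "\<forall>\<^sub>F s in at t within I. transition c d ((snd c \<circ> \<gamma>) s) = (snd d \<circ> \<gamma>) s"
    by eventually_elim (simp add: transition_eq[OF c])
  show ?thesis unfolding has_vector_derivative_def
    by (rule has_derivative_transform_eventually[OF * ev]) (auto simp: transition_eq[OF c] p t)
qed

text \<open>The speed relative to an interval, with one-sided derivatives at its end points; \<open>speed\<close> is
  the case \<open>I = UNIV\<close>.\<close>

definition spd :: "real set \<Rightarrow> (real \<Rightarrow> 'a) \<Rightarrow> real \<Rightarrow> real" where
  "spd I \<gamma> t = (let c = (SOME c. c \<in> atlas M \<and> \<gamma> t \<in> fst c)
     in \<nu> c (snd c (\<gamma> t)) (vector_derivative (snd c \<circ> \<gamma>) (at t within I)))"

lemma speed_spd: "speed M \<gamma> t = spd UNIV \<gamma> t"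
  by (simp add: speed_def spd_def gnorm_def Let_def)

lemma some_chart: 
  defines "c' p \<equiv> SOME c. c \<in> atlas M \<and> p \<in> fst c"
  shows "c' p \<in> atlas M" "p \<in> fst (c' p)"
proof -
  have "\<exists>c. c \<in> atlas M \<and> p \<in> fst c" using chart_at by metis
  from someI_ex[OF this] show "c' p \<in> atlas M" "p \<in> fst (c' p)" by (auto simp: c'_def)
qed

lemma spd_nonneg: "spd I \<gamma> t \<ge> 0"
  unfolding spd_def Let_def using some_chart[of "\<gamma> t"] by (intro gnorm_nonneg) auto

lemma speed_nonneg: "speed M \<gamma> t \<ge> 0"
  by (simp add: speed_spd spd_nonneg)

text \<open>\<open>spd\<close> uses a chart picked by \<open>SOME\<close>; the transformation law of
  the metric lets it be evaluated in whichever chart is convenient. The filter must be nontrivial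
  for the derivative to be unique.\<close>

lemma spd_eq:
  assumes c: "c \<in> atlas M" and p: "\<gamma> t \<in> fst c"
    and t: "t \<in> I" and cont: "continuous (at t within I) \<gamma>" and nt: "at t within I \<noteq> bot"
    and der: "((snd c \<circ> \<gamma>) has_vector_derivative u) (at t within I)"
  shows "spd I \<gamma> t = \<nu> c (snd c (\<gamma> t)) u"
proof -
  define d where "d = (SOME c. c \<in> atlas M \<and> \<gamma> t \<in> fst c)"
  have d: "d \<in> atlas M" "\<gamma> t \<in> fst d" using some_chart[of "\<gamma> t"] by (auto simp: d_def)
  have "vector_derivative (snd d \<circ> \<gamma>) (at t within I) = Dtrans c d (\<gamma> t) u"
    using velocity_transition[OF c d(1) p d(2) t cont der] nt by (rule vector_derivative_within[rotated])
  then show ?thesis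
    unfolding spd_def Let_def d_def[symmetric] using gnorm_transition[OF c d(1) p d(2)] by simp
qed

end

section \<open>Curves and the distance function\<close>

text \<open>Induction on the number of break points inside the interval. It reduces claims about
  piecewise smooth curves to the smooth pieces and to concatenation.\<close>

lemma split_induct:
  fixes P :: "real \<Rightarrow> real \<Rightarrow> bool"
  assumes fin: "finite S"
    and base: "\<And>a b. a0 \<le> a \<Longrightarrow> a \<le> b \<Longrightarrow> b \<le> b0 \<Longrightarrow> {a<..<b} \<inter> S = {} \<Longrightarrow> P a b"
    and join: "\<And>a c b. a0 \<le> a \<Longrightarrow> a \<le> c \<Longrightarrow> c \<le> b \<Longrightarrow> b \<le> b0 \<Longrightarrow> P a c \<Longrightarrow> P c b \<Longrightarrow> P a b"
    and ab: "a0 \<le> a" "a \<le> b" "b \<le> b0"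
  shows "P a b"
  using ab
proof (induction "card (S \<inter> {a<..<b})" arbitrary: a b rule: less_induct)
  case less
  show ?case
  proof (cases "{a<..<b} \<inter> S = {}")
    case True then show ?thesis using base less.prems by blast
  next
    case False
    then obtain c where c: "c \<in> S" "a < c" "c < b" by auto
    have "card (S \<inter> {a<..<c}) < card (S \<inter> {a<..<b})" "card (S \<inter> {c<..<b}) < card (S \<inter> {a<..<b})"
      using c fin by (intro psubset_card_mono; auto)+
    then show ?thesis using less.hyps less.prems c join[of a c b] by fastforce
  qed
qed

lemma continuous_on_locally:
  fixes I :: "real set"
  assumes "\<And>t. t \<in> I \<Longrightarrow> \<exists>U. open U \<and> t \<in> U \<and> continuous_on (I \<inter> U) f"
  shows "continuous_on I f"
  unfolding continuous_on_eq_continuous_within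
proof
  fix t assume t: "t \<in> I"
  then obtain U where U: "open U" "t \<in> U" "continuous_on (I \<inter> U) f" using assms by blast
  have "at t within (I \<inter> U) = at t within I"
    by (rule at_within_nhd[of t U]) (use U in auto)
  moreover have "continuous (at t within (I \<inter> U)) f"
    using U t by (auto simp: continuous_on_eq_continuous_within)
  ultimately show "continuous (at t within I) f" by simp
qed

text \<open>\<open>piecewise_C1_curve\<close> is tied to the interval from 0 to 1; restricting and
  concatenating curves calls for arbitrary end points.\<close>

definition pwC1 :: "'a::topological_space riemannian_structure \<Rightarrow> real \<Rightarrow> real \<Rightarrow> (real \<Rightarrow> 'a) \<Rightarrow> bool" where
  "pwC1 M a b \<gamma> \<longleftrightarrow> continuous_on {a..b} \<gamma> \<and>
     (\<exists>S. finite S \<and> (\<forall>x y. a \<le> x \<and> x < y \<and> y \<le> b \<and> {x<..<y} \<inter> S = {} \<longrightarrow> C1_curve_on M {x..y} \<gamma>))"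

lemma piecewise_C1_curve_pwC1: "piecewise_C1_curve M \<gamma> \<longleftrightarrow> pwC1 M 0 1 \<gamma>"
  by (simp add: piecewise_C1_curve_def pwC1_def)

lemma C1_curve_on_subset:
  assumes "C1_curve_on M I \<gamma>" "J \<subseteq> I"
  shows "C1_curve_on M J \<gamma>"
  unfolding C1_curve_on_def
proof (intro conjI ballI)
  show "continuous_on J \<gamma>" using assms continuous_on_subset unfolding C1_curve_on_def by blast
  fix c assume "c \<in> atlas M"
  then obtain u where u: "continuous_on {t\<in>I. \<gamma> t \<in> fst c} u"
    "\<forall>t\<in>I. \<gamma> t \<in> fst c \<longrightarrow> ((snd c \<circ> \<gamma>) has_vector_derivative u t) (at t within I)"
    using assms(1) unfolding C1_curve_on_def by blast
  have "continuous_on {t\<in>J. \<gamma> t \<in> fst c} u"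
    by (rule continuous_on_subset[OF u(1)]) (use assms(2) in blast)
  moreover have "\<forall>t\<in>J. \<gamma> t \<in> fst c \<longrightarrow> ((snd c \<circ> \<gamma>) has_vector_derivative u t) (at t within J)"
    using u(2) assms(2) has_vector_derivative_within_subset by blast
  ultimately show "\<exists>u. continuous_on {t\<in>J. \<gamma> t \<in> fst c} u \<and>
        (\<forall>t\<in>J. \<gamma> t \<in> fst c \<longrightarrow> ((snd c \<circ> \<gamma>) has_vector_derivative u t) (at t within J))"
    by (intro exI[of _ u] conjI)
qed

lemma C1_curve_on_cong:
  assumes "C1_curve_on M I \<gamma>" and eq: "\<And>t. t \<in> I \<Longrightarrow> \<gamma>' t = \<gamma> t"
  shows "C1_curve_on M I \<gamma>'"
  unfolding C1_curve_on_def
proof (intro conjI ballI)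
  show "continuous_on I \<gamma>'"
    by (rule continuous_on_eq[of I \<gamma>]) (use assms in \<open>simp_all add: C1_curve_on_def\<close>)
  fix c assume "c \<in> atlas M"
  then obtain u where u: "continuous_on {t\<in>I. \<gamma> t \<in> fst c} u"
    "\<forall>t\<in>I. \<gamma> t \<in> fst c \<longrightarrow> ((snd c \<circ> \<gamma>) has_vector_derivative u t) (at t within I)"
    using assms(1) unfolding C1_curve_on_def by blast
  have "{t\<in>I. \<gamma>' t \<in> fst c} = {t\<in>I. \<gamma> t \<in> fst c}" using eq by auto
  moreover have "((snd c \<circ> \<gamma>') has_vector_derivative u t) (at t within I)" if "t \<in> I" "\<gamma>' t \<in> fst c" for t
    by (rule has_vector_derivative_transform[where f = "snd c \<circ> \<gamma>"]) (use that eq u in auto)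
  ultimately show "\<exists>u. continuous_on {t\<in>I. \<gamma>' t \<in> fst c} u \<and>
        (\<forall>t\<in>I. \<gamma>' t \<in> fst c \<longrightarrow> ((snd c \<circ> \<gamma>') has_vector_derivative u t) (at t within I))"
    using u(1) by auto
qed

lemma pwC1_subset: "pwC1 M a b \<gamma> \<Longrightarrow> a \<le> a' \<Longrightarrow> b' \<le> b \<Longrightarrow> pwC1 M a' b' \<gamma>"
proof -
  assume *: "pwC1 M a b \<gamma>" "a \<le> a'" "b' \<le> b"
  then have "continuous_on {a'..b'} \<gamma>" unfolding pwC1_def by (auto intro: continuous_on_subset)
  moreover have "\<exists>S. finite S \<and> (\<forall>x y. a' \<le> x \<and> x < y \<and> y \<le> b' \<and> {x<..<y} \<inter> S = {} \<longrightarrow> C1_curve_on M {x..y} \<gamma>)"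
    using * unfolding pwC1_def by (meson order_trans)
  ultimately show ?thesis by (simp add: pwC1_def)
qed

lemma pwC1_cong: "pwC1 M a b \<gamma> \<Longrightarrow> (\<And>t. t \<in> {a..b} \<Longrightarrow> \<gamma>' t = \<gamma> t) \<Longrightarrow> pwC1 M a b \<gamma>'"
proof -
  assume *: "pwC1 M a b \<gamma>" "\<And>t. t \<in> {a..b} \<Longrightarrow> \<gamma>' t = \<gamma> t"
  obtain S where S: "finite S" "\<And>x y. a \<le> x \<Longrightarrow> x < y \<Longrightarrow> y \<le> b \<Longrightarrow> {x<..<y} \<inter> S = {} \<Longrightarrow> C1_curve_on M {x..y} \<gamma>"
    using *(1) unfolding pwC1_def by blast
  have "continuous_on {a..b} \<gamma>'"
    by (rule continuous_on_eq[of _ \<gamma>]) (use * in \<open>simp_all add: pwC1_def\<close>)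
  moreover have "C1_curve_on M {x..y} \<gamma>'" if "a \<le> x" "x < y" "y \<le> b" "{x<..<y} \<inter> S = {}" for x y
    by (rule C1_curve_on_cong[OF S(2)[OF that] *(2)]) (use that in auto)
  ultimately show ?thesis unfolding pwC1_def using S(1) by blast
qed

lemma C1_curve_pwC1: "C1_curve_on M {a..b} \<gamma> \<Longrightarrow> pwC1 M a b \<gamma>"
proof -
  assume *: "C1_curve_on M {a..b} \<gamma>"
  then have "C1_curve_on M {x..y} \<gamma>" if "a \<le> x" "y \<le> b" for x y
    by (rule C1_curve_on_subset) (use that in auto)
  then have "\<exists>S::real set. finite S \<and> (\<forall>x y. a \<le> x \<and> x < y \<and> y \<le> b \<and> {x<..<y} \<inter> S = {} \<longrightarrow> C1_curve_on M {x..y} \<gamma>)"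
    by (intro exI[of _ "{}"]) auto
  then show ?thesis using * by (simp add: pwC1_def C1_curve_on_def)
qed

lemma pwC1_join:
  assumes 1: "pwC1 M a c \<gamma>" and 2: "pwC1 M c b \<gamma>"
  shows "pwC1 M a b \<gamma>"
proof (cases "a \<le> c \<and> c \<le> b")
  case False
  then consider "c < a" | "b < c" by linarith
  then show ?thesis
  proof cases
    case 1 then show ?thesis using 2 pwC1_subset by (metis less_imp_le order_refl)
  next
    case 2 then show ?thesis using 1 pwC1_subset by (metis less_imp_le order_refl)
  qed
next
  case True
  obtain S where S: "finite S" "\<And>x y. a \<le> x \<Longrightarrow> x < y \<Longrightarrow> y \<le> c \<Longrightarrow> {x<..<y} \<inter> S = {} \<Longrightarrow> C1_curve_on M {x..y} \<gamma>"
    using 1 unfolding pwC1_def by blast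
  obtain T where T: "finite T" "\<And>x y. c \<le> x \<Longrightarrow> x < y \<Longrightarrow> y \<le> b \<Longrightarrow> {x<..<y} \<inter> T = {} \<Longrightarrow> C1_curve_on M {x..y} \<gamma>"
    using 2 unfolding pwC1_def by blast
  have "continuous_on ({a..c} \<union> {c..b}) \<gamma>"
    using 1 2 by (intro continuous_on_closed_Un) (auto simp: pwC1_def)
  moreover have "{a..c} \<union> {c..b} = {a..b}" using True by auto
  moreover have "C1_curve_on M {x..y} \<gamma>" if "a \<le> x" "x < y" "y \<le> b" "{x<..<y} \<inter> (S \<union> T \<union> {c}) = {}" for x y
  proof -
    \<comment> \<open>The junction c is itself a break point, so an interval free of break points
      lies on one side of it.\<close>
    have "y \<le> c \<or> c \<le> x" using that by force
    moreover have "{x<..<y} \<inter> S = {}" "{x<..<y} \<inter> T = {}" using that by auto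
    ultimately show ?thesis using S(2)[of x y] T(2)[of x y] that by blast
  qed
  moreover have "finite (S \<union> T \<union> {c})" using S T by simp
  ultimately show ?thesis unfolding pwC1_def by metis
qed

lemma C1_curve_on_affine:
  assumes "C1_curve_on M ((\<lambda>t. k * t + s) ` I) \<gamma>"
  shows "C1_curve_on M I (\<lambda>t. \<gamma> (k * t + s))"
  unfolding C1_curve_on_def
proof (intro conjI ballI)
  let ?h = "\<lambda>t. k * t + s"
  have h: "continuous_on J ?h" for J by (intro continuous_intros)
  have g: "continuous_on (?h ` I) \<gamma>" using assms unfolding C1_curve_on_def by blast
  show "continuous_on I (\<lambda>t. \<gamma> (k * t + s))"
    by (rule continuous_on_compose2[OF g h]) auto
  fix c assume "c \<in> atlas M"
  then obtain u where u: "continuous_on {t\<in>?h ` I. \<gamma> t \<in> fst c} u"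
    "\<forall>t\<in>?h ` I. \<gamma> t \<in> fst c \<longrightarrow> ((snd c \<circ> \<gamma>) has_vector_derivative u t) (at t within ?h ` I)"
    using assms unfolding C1_curve_on_def by blast
  have "continuous_on {t\<in>I. \<gamma> (?h t) \<in> fst c} (\<lambda>t. k *\<^sub>R u (?h t))"
    by (intro continuous_intros continuous_on_compose2[OF u(1)]) auto
  moreover have "((snd c \<circ> (\<lambda>t. \<gamma> (?h t))) has_vector_derivative k *\<^sub>R u (?h t)) (at t within I)"
    if "t \<in> I" "\<gamma> (?h t) \<in> fst c" for t
  proof -
    have "(?h has_vector_derivative k) (at t within I)"
      by (auto intro!: derivative_eq_intros)
    from vector_diff_chain_within[OF this, of "snd c \<circ> \<gamma>" "u (?h t)"] show ?thesis
      using u(2) that by (auto simp: o_def)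
  qed
  ultimately show "\<exists>u. continuous_on {t\<in>I. \<gamma> (?h t) \<in> fst c} u \<and>
        (\<forall>t\<in>I. \<gamma> (?h t) \<in> fst c \<longrightarrow> ((snd c \<circ> (\<lambda>t. \<gamma> (?h t))) has_vector_derivative u t) (at t within I))"
    by (intro exI[of _ "\<lambda>t. k *\<^sub>R u (?h t)"]) blast
qed

text \<open>Negative k is included for the sake of reversed curves; the break points are pulled back
  along the affine map.\<close>

lemma pwC1_affine:
  assumes g: "pwC1 M a b \<gamma>" and k: "k \<noteq> 0" and sub: "\<And>t. t \<in> {a'..b'} \<Longrightarrow> k * t + s \<in> {a..b}"
  shows "pwC1 M a' b' (\<lambda>t. \<gamma> (k * t + s))"
proof -
  let ?h = "\<lambda>t. k * t + s"
  obtain S where S: "finite S" "\<And>x y. a \<le> x \<Longrightarrow> x < y \<Longrightarrow> y \<le> b \<Longrightarrow> {x<..<y} \<inter> S = {} \<Longrightarrow> C1_curve_on M {x..y} \<gamma>"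
    using g unfolding pwC1_def by blast
  have "continuous_on {a..b} \<gamma>" using g by (simp add: pwC1_def)
  then have "continuous_on {a'..b'} (\<lambda>t. \<gamma> (?h t))"
    by (rule continuous_on_compose2) (use sub in \<open>auto intro!: continuous_intros\<close>)
  moreover have "C1_curve_on M {x..y} (\<lambda>t. \<gamma> (?h t))"
    if xy: "a' \<le> x" "x < y" "y \<le> b'" "{x<..<y} \<inter> (\<lambda>t. (t - s) / k) ` S = {}" for x y
  proof (rule C1_curve_on_affine)
    have av: "z \<notin> S" if "z = ?h t" "x < t" "t < y" for z t
    proof
      assume "z \<in> S"
      then have "t \<in> (\<lambda>t. (t - s) / k) ` S" using that k by (intro image_eqI[of _ _ z]) auto
      then show False using that xy(4) by auto
    qed
    have hin: "?h x \<in> {a..b}" "?h y \<in> {a..b}" using sub xy by auto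
    show "C1_curve_on M (?h ` {x..y}) \<gamma>"
    proof (cases "k > 0")
      case True
      have im: "?h ` {x..y} = {?h x..?h y}" 
        using image_affinity_atLeastAtMost[of k s x y] True xy(2) by simp
      have "{?h x<..<?h y} \<inter> S = {}"
      proof -
        { fix z assume z: "?h x < z" "z < ?h y"
          have "z \<notin> S" by (rule av[of z "(z - s)/k"]) (use z True k in \<open>auto simp: field_simps\<close>) }
        then show ?thesis by auto
      qed
      then show ?thesis unfolding im using S(2)[of "?h x" "?h y"] hin True xy(2) by auto
    next
      case False
      then have neg: "k < 0" using k by auto
      have im: "?h ` {x..y} = {?h y..?h x}" 
        using image_affinity_atLeastAtMost[of k s x y] neg xy(2) by simp
      have "{?h y<..<?h x} \<inter> S = {}"
      proof -
        { fix z assume z: "?h y < z" "z < ?h x"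
          have "z \<notin> S" by (rule av[of z "(z - s)/k"]) (use z neg k in \<open>auto simp: field_simps\<close>) }
        then show ?thesis by auto
      qed
      then show ?thesis unfolding im using S(2)[of "?h y" "?h x"] hin neg xy(2) by auto
    qed
  qed
  moreover have "finite ((\<lambda>t. (t - s) / k) ` S)" using S by simp
  ultimately show ?thesis unfolding pwC1_def by metis
qed

context riem_surface
begin

lemma C1_chart_velocity:
  assumes g: "C1_curve_on M I \<gamma>" and c: "c \<in> atlas M" 
  obtains u where "continuous_on {t\<in>I. \<gamma> t \<in> fst c} u"
    "\<And>t. t \<in> I \<Longrightarrow> \<gamma> t \<in> fst c \<Longrightarrow> ((snd c \<circ> \<gamma>) has_vector_derivative u t) (at t within I)"
  using assms unfolding C1_curve_on_def by blast

lemma at_within_Icc_nontrivial: "a < b \<Longrightarrow> t \<in> {a..b} \<Longrightarrow> at t within {a..b::real} \<noteq> bot"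
  using islimpt_Icc[of a b t] by (simp add: trivial_limit_within)

text \<open>Continuity is local, and near each time a single chart expresses the speed through
  continuous coordinates and a continuous velocity.\<close>

lemma continuous_on_spd:
  assumes g: "C1_curve_on M {a..b} \<gamma>" and ab: "a < b"
  shows "continuous_on {a..b} (spd {a..b} \<gamma>)"
proof (rule continuous_on_locally)
  fix t assume t: "t \<in> {a..b}"
  obtain c where c: "c \<in> atlas M" "\<gamma> t \<in> fst c" using chart_at by blast
  obtain u where u: "continuous_on {t\<in>{a..b}. \<gamma> t \<in> fst c} u"
    "\<And>t. t \<in> {a..b} \<Longrightarrow> \<gamma> t \<in> fst c \<Longrightarrow> ((snd c \<circ> \<gamma>) has_vector_derivative u t) (at t within {a..b})"
    using C1_chart_velocity[OF g c(1)] by blast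
  have cont: "continuous_on {a..b} \<gamma>" using g by (simp add: C1_curve_on_def)
  obtain U where U: "open U" "U \<inter> {a..b} = \<gamma> -` fst c \<inter> {a..b}"
    using cont open_dom[OF c(1)] unfolding continuous_on_open_invariant by blast
  have sub: "{a..b} \<inter> U = {t\<in>{a..b}. \<gamma> t \<in> fst c}" using U(2) by blast
  have cg: "continuous_on ({a..b} \<inter> U) \<gamma>" using cont by (rule continuous_on_subset) simp
  have "continuous_on ({a..b} \<inter> U) (\<lambda>t. snd c (\<gamma> t))"
    by (rule continuous_on_compose2[OF continuous_chart[OF c(1)] cg]) (use sub in blast)
  moreover have "continuous_on ({a..b} \<inter> U) u" unfolding sub by (rule u(1))
  moreover have "(\<lambda>t. snd c (\<gamma> t)) ` ({a..b} \<inter> U) \<subseteq> img c" unfolding sub by blast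
  ultimately have cn: "continuous_on ({a..b} \<inter> U) (\<lambda>t. \<nu> c (snd c (\<gamma> t)) (u t))"
    by (intro continuous_on_gnorm[OF c(1)])
  have eq: "spd {a..b} \<gamma> s = \<nu> c (snd c (\<gamma> s)) (u s)" if "s \<in> {a..b} \<inter> U" for s
  proof (rule spd_eq[OF c(1)])
    have s: "s \<in> {a..b}" "\<gamma> s \<in> fst c" using that sub by blast+
    show "\<gamma> s \<in> fst c" "s \<in> {a..b}" using s by blast+
    show "continuous (at s within {a..b}) \<gamma>" using cont s(1) by (simp add: continuous_on_eq_continuous_within)
    show "at s within {a..b} \<noteq> bot" by (rule at_within_Icc_nontrivial[OF ab s(1)])
    show "((snd c \<circ> \<gamma>) has_vector_derivative u s) (at s within {a..b})" by (rule u(2)[OF s])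
  qed
  have "continuous_on ({a..b} \<inter> U) (spd {a..b} \<gamma>)"
    by (rule continuous_on_eq[OF cn]) (rule eq[symmetric])
  then show "\<exists>U. open U \<and> t \<in> U \<and> continuous_on ({a..b} \<inter> U) (spd {a..b} \<gamma>)"
    using U(1) t c(2) sub by blast
qed

lemma speed_eq_spd: "a < t \<Longrightarrow> t < b \<Longrightarrow> speed M \<gamma> t = spd {a..b} \<gamma> t"
  unfolding speed_spd spd_def Let_def by (simp add: at_within_Icc_at)

text \<open>On a smooth piece the two-sided \<open>speed\<close> differs from the continuous
  one-sided \<open>spd\<close> at most at the two end points, which the integral does not
  see.\<close>

lemma speed_integrable:
  assumes g: "pwC1 M a b \<gamma>"
  shows "speed M \<gamma> integrable_on {a..b}"
proof (cases "a \<le> b")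
  case False then show ?thesis by auto
next
  case True
  obtain S where S: "finite S" "\<And>x y. a \<le> x \<Longrightarrow> x < y \<Longrightarrow> y \<le> b \<Longrightarrow> {x<..<y} \<inter> S = {} \<Longrightarrow> C1_curve_on M {x..y} \<gamma>"
    using g unfolding pwC1_def by blast
  show ?thesis
  proof (rule split_induct[OF S(1), where a0 = a and b0 = b and P = "\<lambda>x y. speed M \<gamma> integrable_on {x..y}"])
    fix x y assume xy: "a \<le> x" "x \<le> y" "y \<le> b" "{x<..<y} \<inter> S = {}"
    show "speed M \<gamma> integrable_on {x..y}"
    proof (cases "x = y")
      case False
      then have "spd {x..y} \<gamma> integrable_on {x..y}"
        using xy S(2) by (intro integrable_continuous_real continuous_on_spd) auto
      then show ?thesis
        by (rule integrable_spike_finite[rotated 2, where S = "{x,y}"]) (use speed_eq_spd[of x _ y] in auto)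
    qed (use integrable_on_refl[of "speed M \<gamma>" y] in simp)
  qed (use True Henstock_Kurzweil_Integration.integrable_combine in auto)
qed

lemma pwC1_diff:
  assumes g: "pwC1 M a b \<gamma>"
  obtains S where "finite S" "a \<in> S" "b \<in> S"
    "\<And>t c. t \<in> {a..b} - S \<Longrightarrow> c \<in> atlas M \<Longrightarrow> \<gamma> t \<in> fst c \<Longrightarrow> 
      \<exists>u. ((snd c \<circ> \<gamma>) has_vector_derivative u) (at t)"
    "\<And>t. t \<in> {a..b} - S \<Longrightarrow> isCont \<gamma> t"
proof -
  obtain S where S: "finite S" "\<And>x y. a \<le> x \<Longrightarrow> x < y \<Longrightarrow> y \<le> b \<Longrightarrow> {x<..<y} \<inter> S = {} \<Longrightarrow> C1_curve_on M {x..y} \<gamma>"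
    using g unfolding pwC1_def by blast
  \<comment> \<open>Adding the end points to the exceptional set leaves only times at which
    one-sided derivatives are ordinary ones.\<close>
  define S' where "S' = S \<union> {a,b}"
  have "(\<forall>c. c \<in> atlas M \<longrightarrow> \<gamma> t \<in> fst c \<longrightarrow> (\<exists>u. ((snd c \<circ> \<gamma>) has_vector_derivative u) (at t))) \<and> isCont \<gamma> t"
    if t: "t \<in> {a..b} - S'" for t
  proof -
    have ab: "a < t" "t < b" using t by (auto simp: S'_def)
    have "open ({a<..<b} - S)" using S(1) by (intro open_Diff finite_imp_closed) auto
    moreover have "t \<in> {a<..<b} - S" using t ab by (auto simp: S'_def)
    ultimately obtain e where e: "e > 0" "cball t e \<subseteq> {a<..<b} - S" using open_contains_cball by meson
    define x y where "x = t - e" "y = t + e"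
    have xy: "x < t" "t < y" using e by (auto simp: x_y_def)
    have sub: "{x..y} \<subseteq> {a<..<b} - S" using e(2) by (auto simp: x_y_def cball_def dist_real_def subset_iff)
    have C: "C1_curve_on M {x..y} \<gamma>"
    proof (rule S(2))
      have "x \<in> {x..y}" "y \<in> {x..y}" using xy by auto
      then show "a \<le> x" "y \<le> b" using sub by (auto simp: subset_iff)
      show "{x<..<y} \<inter> S = {}" using sub by (auto simp: subset_iff)
    qed (use xy in auto)
    have "at t within {x..y} = at t" using xy by (simp add: at_within_Icc_at)
    moreover have "continuous (at t within {x..y}) \<gamma>"
      using C xy by (auto simp: C1_curve_on_def continuous_on_eq_continuous_within)
    moreover have "\<exists>u. ((snd c \<circ> \<gamma>) has_vector_derivative u) (at t within {x..y})" if "c \<in> atlas M" "\<gamma> t \<in> fst c" for c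
      using C1_chart_velocity[OF C that(1)] that(2) xy by (metis atLeastAtMost_iff less_imp_le)
    ultimately show ?thesis by auto
  qed
  moreover have "finite S'" "a \<in> S'" "b \<in> S'" using S(1) by (auto simp: S'_def)
  ultimately show ?thesis using that by blast
qed

lemma speed_eq:
  assumes "c \<in> atlas M" "\<gamma> t \<in> fst c" "isCont \<gamma> t" "((snd c \<circ> \<gamma>) has_vector_derivative u) (at t)"
  shows "speed M \<gamma> t = \<nu> c (snd c (\<gamma> t)) u"
  unfolding speed_spd by (rule spd_eq) (use assms in auto)

lemma speed_cong:
  assumes "open U" "t \<in> U" "\<And>s. s \<in> U \<Longrightarrow> \<gamma> s = \<gamma>' s"
  shows "speed M \<gamma> t = speed M \<gamma>' t"
proof -
  have "vector_derivative (snd c \<circ> \<gamma>) (at t) = vector_derivative (snd c \<circ> \<gamma>') (at t)" for c :: "'a chart"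
    by (rule vector_derivative_cong_eq) (use assms eventually_nhds in \<open>auto simp: eventually_nhds\<close>)
  then show ?thesis using assms by (simp add: speed_def)
qed

text \<open>The substitution rule contributes 1/|k| and the rescaled velocity contributes |k|, so
  the factors cancel.\<close>

lemma length_affine:
  assumes g: "pwC1 M a b \<gamma>" and k: "k \<noteq> 0" and im: "(\<lambda>t. k * t + s) ` {a'..b'} = {a..b}" and le: "a \<le> b"
  shows "integral {a'..b'} (speed M (\<lambda>t. \<gamma> (k * t + s))) = integral {a..b} (speed M \<gamma>)"
proof -
  let ?h = "\<lambda>t. k * t + s"
  obtain S where S: "finite S" "a \<in> S" "b \<in> S"
    "\<And>t c. t \<in> {a..b} - S \<Longrightarrow> c \<in> atlas M \<Longrightarrow> \<gamma> t \<in> fst c \<Longrightarrow> 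
      \<exists>u. ((snd c \<circ> \<gamma>) has_vector_derivative u) (at t)"
    "\<And>t. t \<in> {a..b} - S \<Longrightarrow> isCont \<gamma> t" using pwC1_diff[OF g] by metis
  have inv: "(\<lambda>x. (1 / k) *\<^sub>R x + - ((1 / k) *\<^sub>R s)) ` cbox a b = {a'..b'}"
    unfolding box_real im[symmetric] image_image using k by (auto simp: field_simps)
  have "(speed M \<gamma> has_integral integral {a..b} (speed M \<gamma>)) (cbox a b)"
    using speed_integrable[OF g] by auto
  from has_integral_affinity[OF this k, of s]
  have "((\<lambda>x. speed M \<gamma> (?h x)) has_integral (1 / \<bar>k\<bar>) * integral {a..b} (speed M \<gamma>)) {a'..b'}"
    unfolding inv by simp
  from has_integral_mult_right[OF this, of "\<bar>k\<bar>"]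
  have 1: "((\<lambda>x. \<bar>k\<bar> * speed M \<gamma> (?h x)) has_integral integral {a..b} (speed M \<gamma>)) {a'..b'}"
    using k by simp
  have "((speed M (\<lambda>t. \<gamma> (?h t))) has_integral integral {a..b} (speed M \<gamma>)) {a'..b'}"
  proof (rule has_integral_spike_finite[OF _ _ 1, where S = "(\<lambda>t. (t - s) / k) ` S"])
    fix t assume t: "t \<in> {a'..b'} - (\<lambda>t. (t - s) / k) ` S"
    have "?h t \<notin> S"
    proof
      assume "?h t \<in> S"
      then have "t \<in> (\<lambda>t. (t - s) / k) ` S" using k by (intro image_eqI[of _ _ "?h t"]) auto
      then show False using t by blast
    qed
    moreover have "?h t \<in> {a..b}" using t im by blast
    ultimately have ht: "?h t \<in> {a..b} - S" by blast
    obtain c where c: "c \<in> atlas M" "\<gamma> (?h t) \<in> fst c" using chart_at by blast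
    obtain u where u: "((snd c \<circ> \<gamma>) has_vector_derivative u) (at (?h t))" using S(4)[OF ht c] by blast
    have cont: "isCont \<gamma> (?h t)" using S(5)[OF ht] .
    have "(?h has_vector_derivative k) (at t)" by (auto intro!: derivative_eq_intros)
    from vector_diff_chain_at[OF this u]
    have "((snd c \<circ> (\<lambda>t. \<gamma> (?h t))) has_vector_derivative k *\<^sub>R u) (at t)" by (simp add: o_def)
    moreover have "isCont (\<lambda>t. \<gamma> (?h t)) t" by (rule isCont_o2[where g = \<gamma> and f = ?h]) (auto intro!: continuous_intros cont)
    ultimately have "speed M (\<lambda>t. \<gamma> (?h t)) t = \<nu> c (snd c (\<gamma> (?h t))) (k *\<^sub>R u)"
      using speed_eq[of c "\<lambda>t. \<gamma> (?h t)" t] c by blast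
    then show "speed M (\<lambda>t. \<gamma> (?h t)) t = \<bar>k\<bar> * speed M \<gamma> (?h t)"
      using speed_eq[OF c cont u] by (simp add: gnorm_scale)
  qed (use S in auto)
  then show ?thesis by (rule integral_unique)
qed

end

section \<open>The Riemannian distance and the topology it induces\<close>

context riem_surface
begin

abbreviation d where "d \<equiv> rdist M"

text \<open>Coordinate segments are the comparison curves behind all upper bounds for the distance
  in a chart.\<close>

definition chart_line :: "'a chart \<Rightarrow> real^2 \<Rightarrow> real^2 \<Rightarrow> real \<Rightarrow> 'a" where
  "chart_line c x y t = chart_inv c (x + t *\<^sub>R (y - x))"

lemma
  assumes c: "c \<in> atlas M" and sub: "closed_segment x y \<subseteq> img c"
  shows chart_line_C1: "C1_curve_on M {0..1} (chart_line c x y)"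
    and chart_line_speed: "t \<in> {0<..<1} \<Longrightarrow> speed M (chart_line c x y) t = \<nu> c (x + t *\<^sub>R (y - x)) (y - x)"
proof -
  let ?l = "\<lambda>t. x + t *\<^sub>R (y - x)" and ?\<sigma> = "chart_line c x y"
  have l: "?l t \<in> img c" if "t \<in> {0..1}" for t
  proof -
    have "?l t = (1 - t) *\<^sub>R x + t *\<^sub>R y" by (simp add: algebra_simps)
    then have "?l t \<in> closed_segment x y" using that unfolding closed_segment_def by auto
    then show ?thesis using sub by blast
  qed
  have dom: "?\<sigma> t \<in> fst c" "snd c (?\<sigma> t) = ?l t" if "t \<in> {0..1}" for t
    using chart_inv_in[OF c l[OF that]] snd_chart_inv[OF c l[OF that]] by (auto simp: chart_line_def)
  have lc: "continuous_on {0..1} ?l" by (intro continuous_intros)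
  have cont: "continuous_on {0..1} ?\<sigma>" unfolding chart_line_def
    by (rule continuous_on_compose2[OF continuous_chart_inv[OF c] lc]) (use l in blast)
  have ld: "(?l has_vector_derivative (y - x)) (at t within {0..1})" for t
    by (auto intro!: derivative_eq_intros)
  have der: "((snd c \<circ> ?\<sigma>) has_vector_derivative (y - x)) (at t within {0..1})" if t: "t \<in> {0..1}" for t
    by (rule has_vector_derivative_transform[OF t _ ld]) (simp add: dom)
  have ct: "continuous (at t within {0..1}) ?\<sigma>" if "t \<in> {0..1}" for t
    using cont that by (simp add: continuous_on_eq_continuous_within)
  show "C1_curve_on M {0..1} ?\<sigma>" unfolding C1_curve_on_def
  proof (intro conjI ballI cont)
    fix e assume e: "e \<in> atlas M"
    let ?u = "\<lambda>t. frechet_derivative (transition c e) (at (?l t)) (y - x)"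
    have "continuous_on {t\<in>{0..1}. ?\<sigma> t \<in> fst e} ?u"
    proof (rule smooth_on_derivative_continuous[OF transition_smooth[OF c e]])
      show "continuous_on {t\<in>{0..1}. ?\<sigma> t \<in> fst e} ?l" by (rule continuous_on_subset[OF lc]) blast
      show "?l ` {t\<in>{0..1}. ?\<sigma> t \<in> fst e} \<subseteq> snd c ` (fst c \<inter> fst e)"
      proof
        fix z assume "z \<in> ?l ` {t\<in>{0..1}. ?\<sigma> t \<in> fst e}"
        then obtain t where t: "t \<in> {0..1}" "?\<sigma> t \<in> fst e" "z = ?l t" by blast
        then have "z = snd c (?\<sigma> t)" using dom by simp
        then show "z \<in> snd c ` (fst c \<inter> fst e)" using t dom(1) by blast
      qed
    qed simp
    moreover have "((snd e \<circ> ?\<sigma>) has_vector_derivative ?u t) (at t within {0..1})"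
      if t: "t \<in> {0..1}" and te: "?\<sigma> t \<in> fst e" for t
      using velocity_transition[OF c e dom(1)[OF t] te t ct[OF t] der[OF t]] by (simp add: dom(2)[OF t])
    ultimately show "\<exists>u. continuous_on {t\<in>{0..1}. ?\<sigma> t \<in> fst e} u \<and>
        (\<forall>t\<in>{0..1}. ?\<sigma> t \<in> fst e \<longrightarrow> ((snd e \<circ> ?\<sigma>) has_vector_derivative u t) (at t within {0..1}))"
      by (intro exI[of _ ?u] conjI ballI impI) 
  qed
  show "speed M ?\<sigma> t = \<nu> c (?l t) (y - x)" if "t \<in> {0<..<1}"
  proof -
    have t: "t \<in> {0..1}" and a: "at t within {0..1} = at t" using that by (auto simp: at_within_Icc_at)
    show ?thesis
      using speed_eq[OF c dom(1)[OF t] ct[OF t, unfolded a] der[OF t, unfolded a]] dom(2)[OF t] by simp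
  qed
qed

lemma curve_length_nonneg: "0 \<le> curve_length M \<gamma>"
proof (cases "speed M \<gamma> integrable_on {0..1}")
  case True then show ?thesis unfolding curve_length_def by (rule integral_nonneg) (simp add: speed_nonneg)
\<comment> \<open>By convention the integral of a non-integrable function is 0.\<close>
qed (simp add: curve_length_def not_integrable_integral)

lemma rdist_le_curve_length: 
  assumes "pwC1 M 0 1 \<gamma>" "\<gamma> 0 = p" "\<gamma> 1 = q" shows "d p q \<le> curve_length M \<gamma>"
  unfolding rdist_def
  by (rule cINF_lower) (use assms curve_length_nonneg in \<open>auto simp: piecewise_C1_curve_pwC1 bdd_below_def\<close>)

lemma rdist_le_length:
  assumes g: "pwC1 M a b \<gamma>" and ab: "a < b"
  shows "d (\<gamma> a) (\<gamma> b) \<le> integral {a..b} (speed M \<gamma>)"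
proof -
  let ?\<sigma> = "\<lambda>t. \<gamma> ((b - a) * t + a)"
  have k: "b - a \<noteq> 0" using ab by simp
  have im: "(\<lambda>t. (b - a) * t + a) ` {0..1} = {a..b}"
    using image_affinity_atLeastAtMost[of "b - a" a 0 1] ab by simp
  have "pwC1 M 0 1 ?\<sigma>" by (rule pwC1_affine[OF g k]) (use im in blast)
  then have "d (?\<sigma> 0) (?\<sigma> 1) \<le> curve_length M ?\<sigma>" by (rule rdist_le_curve_length) auto
  then show ?thesis using length_affine[OF g k im] ab by (simp add: curve_length_def)
qed

lemma curve_join:
  assumes 1: "pwC1 M 0 1 \<gamma>1" and 2: "pwC1 M 0 1 \<gamma>2" and eq: "\<gamma>1 1 = \<gamma>2 0"
  obtains \<gamma> where "pwC1 M 0 1 \<gamma>" "\<gamma> 0 = \<gamma>1 0" "\<gamma> 1 = \<gamma>2 1"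
    "curve_length M \<gamma> = curve_length M \<gamma>1 + curve_length M \<gamma>2"
proof -
  define \<gamma> where "\<gamma> t = (if t \<le> 1/2 then \<gamma>1 (2 * t + 0) else \<gamma>2 (2 * t + -1))" for t :: real
  have im1: "(\<lambda>t::real. 2 * t + 0) ` {0..1/2} = {0..1}"
    using image_affinity_atLeastAtMost[of "2::real" 0 0 "1/2"] by simp
  have im2: "(\<lambda>t::real. 2 * t + -1) ` {1/2..1} = {0..1}"
    using image_affinity_atLeastAtMost[of "2::real" "-1" "1/2" 1] by simp
  have p1: "pwC1 M 0 (1/2) (\<lambda>t. \<gamma>1 (2 * t + 0))" by (rule pwC1_affine[OF 1]) (use im1 in auto)
  have p2: "pwC1 M (1/2) 1 (\<lambda>t. \<gamma>2 (2 * t + -1))" by (rule pwC1_affine[OF 2]) (use im2 in auto)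
  have q1: "pwC1 M 0 (1/2) \<gamma>" by (rule pwC1_cong[OF p1]) (simp add: \<gamma>_def)
  have q2: "pwC1 M (1/2) 1 \<gamma>" 
  proof (rule pwC1_cong[OF p2])
    fix t :: real assume "t \<in> {1/2..1}"
    \<comment> \<open>At the junction the definition takes the first branch; the condition on the
      end points makes both branches agree there.\<close>
    moreover have "\<gamma> (1/2) = \<gamma>2 (2 * (1/2) + -1)" using eq by (simp add: \<gamma>_def)
    ultimately show "\<gamma> t = \<gamma>2 (2 * t + -1)" by (cases "t = 1/2") (blast, simp add: \<gamma>_def)
  qed
  have q: "pwC1 M 0 1 \<gamma>" by (rule pwC1_join[OF q1 q2])
  have "integral {0..1/2} (speed M \<gamma>) = integral {0..1/2} (speed M (\<lambda>t. \<gamma>1 (2 * t + 0)))"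
  proof (rule integral_spike[where S = "{0,1/2}"])
    fix t :: real assume "t \<in> {0..1/2} - {0,1/2}"
    then show "speed M (\<lambda>t. \<gamma>1 (2 * t + 0)) t = speed M \<gamma> t"
      by (intro speed_cong[of "{..<1/2}"]) (auto simp: \<gamma>_def)
  qed auto
  moreover have "integral {1/2..1} (speed M \<gamma>) = integral {1/2..1} (speed M (\<lambda>t. \<gamma>2 (2 * t + -1)))"
  proof (rule integral_spike[where S = "{1,1/2}"])
    fix t :: real assume "t \<in> {1/2..1} - {1,1/2}"
    then show "speed M (\<lambda>t. \<gamma>2 (2 * t + -1)) t = speed M \<gamma> t"
      by (intro speed_cong[of "{1/2<..}"]) (auto simp: \<gamma>_def)
  qed auto
  moreover have "integral {0..1/2} (speed M (\<lambda>t. \<gamma>1 (2 * t + 0))) = curve_length M \<gamma>1"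
    unfolding curve_length_def by (rule length_affine[OF 1 _ im1]) auto
  moreover have "integral {1/2..1} (speed M (\<lambda>t. \<gamma>2 (2 * t + -1))) = curve_length M \<gamma>2"
    unfolding curve_length_def by (rule length_affine[OF 2 _ im2]) auto
  moreover have "integral {0..1/2} (speed M \<gamma>) + integral {1/2..1} (speed M \<gamma>) = curve_length M \<gamma>"
    unfolding curve_length_def
    by (rule Henstock_Kurzweil_Integration.integral_combine) (use speed_integrable[OF q] in auto)
  ultimately have "curve_length M \<gamma> = curve_length M \<gamma>1 + curve_length M \<gamma>2" by simp
  moreover have "\<gamma> 0 = \<gamma>1 0" "\<gamma> 1 = \<gamma>2 1" by (auto simp: \<gamma>_def)
  ultimately show ?thesis using that q by blast
qed

lemma curve_reverse:
  assumes g: "pwC1 M 0 1 \<gamma>"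
  obtains \<gamma>' where "pwC1 M 0 1 \<gamma>'" "\<gamma>' 0 = \<gamma> 1" "\<gamma>' 1 = \<gamma> 0" "curve_length M \<gamma>' = curve_length M \<gamma>"
proof -
  have im: "(\<lambda>t::real. -1 * t + 1) ` {0..1} = {0..1}"
    using image_affinity_atLeastAtMost[of "-1::real" 1 0 1] by simp
  have "pwC1 M 0 1 (\<lambda>t. \<gamma> (-1 * t + 1))" by (rule pwC1_affine[OF g]) (use im in auto)
  moreover have "curve_length M (\<lambda>t. \<gamma> (-1 * t + 1)) = curve_length M \<gamma>"
    unfolding curve_length_def by (rule length_affine[OF g _ im]) auto
  ultimately show ?thesis by (intro that[of "\<lambda>t. \<gamma> (-1 * t + 1)"]) auto
qed

lemma chart_ball:
  assumes "open U" "p \<in> U"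
  obtains c \<rho> where "c \<in> atlas M" "p \<in> fst c" "\<rho> > 0" "cball (snd c p) \<rho> \<subseteq> img c"
    "chart_inv c ` cball (snd c p) \<rho> \<subseteq> U"
proof -
  obtain c where c: "c \<in> atlas M" "p \<in> fst c" using chart_at by blast
  have "open (img c \<inter> chart_inv c -` U)"
    by (rule continuous_open_preimage[OF continuous_chart_inv[OF c(1)] open_img[OF c(1)] assms(1)])
  moreover have "snd c p \<in> img c \<inter> chart_inv c -` U" using c assms(2) by (auto simp: chart_inv_snd)
  ultimately obtain \<rho> where "\<rho> > 0" "cball (snd c p) \<rho> \<subseteq> img c \<inter> chart_inv c -` U"
    unfolding open_contains_cball by blast
  then show ?thesis using that[OF c] by blast
qed

text \<open>Small coordinate balls are joined to their centres by coordinate segments, so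
  reachability classes are open and hence also closed; connectedness leaves a single class. The
  infimum in \<open>rdist\<close> is thus taken over a nonempty set.\<close>

lemma curve_exists: obtains \<gamma> where "pwC1 M 0 1 \<gamma>" "\<gamma> 0 = p" "\<gamma> 1 = q"
proof -
  define R where "R p q \<longleftrightarrow> (\<exists>\<gamma>. pwC1 M 0 1 \<gamma> \<and> \<gamma> 0 = p \<and> \<gamma> 1 = q)" for p q
  have trans: "R p r" if "R p q" "R q r" for p q r
    using that curve_join unfolding R_def by metis
  have sym: "R q p" if "R p q" for p q
    using that curve_reverse unfolding R_def by metis
  have loc: "\<exists>U. open U \<and> p \<in> U \<and> (\<forall>q\<in>U. R p q)" for p
  proof -
    obtain c \<rho> where c: "c \<in> atlas M" "p \<in> fst c" "\<rho> > 0" "cball (snd c p) \<rho> \<subseteq> img c"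
      by (rule chart_ball[OF open_UNIV UNIV_I, of p], rule that)
    let ?U = "chart_inv c ` ball (snd c p) \<rho>"
    have "open ?U" by (rule chart_inv_open[OF c(1)]) (use c(4) ball_subset_cball in auto)
    moreover have "p \<in> ?U" using c chart_inv_snd by (intro image_eqI[of _ _ "snd c p"]) auto
    moreover have "R p q" if q: "q \<in> ?U" for q
    proof -
      obtain y where y: "y \<in> ball (snd c p) \<rho>" "q = chart_inv c y" using q by blast
      have "closed_segment (snd c p) y \<subseteq> cball (snd c p) \<rho>"
        using y(1) c(3) by (intro closed_segment_subset) auto
      then have "pwC1 M 0 1 (chart_line c (snd c p) y)"
        using c(4) by (intro C1_curve_pwC1 chart_line_C1[OF c(1)]) blast
      moreover have "chart_line c (snd c p) y 0 = p" "chart_line c (snd c p) y 1 = q"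
        using y c chart_inv_snd by (auto simp: chart_line_def)
      ultimately show ?thesis unfolding R_def by blast
    qed
    ultimately show ?thesis by blast
  qed
  have "open {q. R p q}"
    unfolding open_subopen[of "{q. R p q}"]
  proof (intro ballI)
    fix q assume q: "q \<in> {q. R p q}"
    obtain U where "open U" "q \<in> U" "\<forall>r\<in>U. R q r" using loc by blast
    moreover have "r \<in> {q. R p q}" if "r \<in> U" for r
      using q trans[of p q r] calculation(3) that by blast
    ultimately show "\<exists>T. open T \<and> q \<in> T \<and> T \<subseteq> {q. R p q}" by blast
  qed
  moreover have "open (- {q. R p q})"
    unfolding open_subopen[of "- {q. R p q}"]
  proof (intro ballI)
    fix q assume q: "q \<in> - {q. R p q}"
    obtain U where "open U" "q \<in> U" "\<forall>r\<in>U. R q r" using loc by blast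
    moreover have "r \<notin> {q. R p q}" if "r \<in> U" for r
      using q trans[of p r q] sym[of q r] calculation(3) that by blast
    ultimately show "\<exists>T. open T \<and> q \<in> T \<and> T \<subseteq> - {q. R p q}" by blast
  qed
  moreover have "p \<in> {q. R p q}" using loc by blast
  ultimately have "{q. R p q} = UNIV"
    using connected_surface unfolding connected_clopen closed_def by auto
  then have "R p q" by blast
  then show ?thesis using that unfolding R_def by blast
qed

lemma rdist_approx:
  assumes "e > 0"
  obtains \<gamma> where "pwC1 M 0 1 \<gamma>" "\<gamma> 0 = p" "\<gamma> 1 = q" "curve_length M \<gamma> < d p q + e"
proof -
  let ?C = "{\<gamma>. piecewise_C1_curve M \<gamma> \<and> \<gamma> 0 = p \<and> \<gamma> 1 = q}"
  obtain \<gamma> where "pwC1 M 0 1 \<gamma>" "\<gamma> 0 = p" "\<gamma> 1 = q" using curve_exists by blast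
  then have ne: "?C \<noteq> {}" by (auto simp: piecewise_C1_curve_pwC1)
  have "(INF \<gamma>\<in>?C. curve_length M \<gamma>) < d p q + e" using assms by (simp add: rdist_def)
  then obtain \<gamma> where "\<gamma> \<in> ?C" "curve_length M \<gamma> < d p q + e"
    using cInf_lessD[of "curve_length M ` ?C"] ne by (metis (no_types, lifting) image_iff image_is_empty)
  then show ?thesis using that by (auto simp: piecewise_C1_curve_pwC1)
qed

lemma rdist_nonneg [simp]: "0 \<le> d p q"
proof (rule field_le_epsilon)
  fix e :: real assume "e > 0"
  then obtain \<gamma> where "curve_length M \<gamma> < d p q + e" using rdist_approx by blast
  then show "0 \<le> d p q + e" using curve_length_nonneg[of \<gamma>] by linarith
qed

lemma rdist_triangle: "d p r \<le> d p q + d q r"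
proof (rule field_le_epsilon)
  fix e :: real assume e: "e > 0"
  then obtain \<gamma>1 where 1: "pwC1 M 0 1 \<gamma>1" "\<gamma>1 0 = p" "\<gamma>1 1 = q" "curve_length M \<gamma>1 < d p q + e/2"
    using rdist_approx[of "e/2"] by (metis half_gt_zero)
  obtain \<gamma>2 where 2: "pwC1 M 0 1 \<gamma>2" "\<gamma>2 0 = q" "\<gamma>2 1 = r" "curve_length M \<gamma>2 < d q r + e/2"
    using rdist_approx[of "e/2"] e by (metis half_gt_zero)
  have "\<gamma>1 1 = \<gamma>2 0" using 1 2 by simp
  from curve_join[OF 1(1) 2(1) this] obtain \<gamma> where g: "pwC1 M 0 1 \<gamma>" "\<gamma> 0 = \<gamma>1 0" "\<gamma> 1 = \<gamma>2 1"
    "curve_length M \<gamma> = curve_length M \<gamma>1 + curve_length M \<gamma>2" by blast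
  have "d p r \<le> curve_length M \<gamma>" by (rule rdist_le_curve_length) (use g 1 2 in auto)
  then show "d p r \<le> d p q + d q r + e" using g 1 2 by linarith
qed

lemma rdist_sym: "d p q = d q p"
proof -
  have "d p q \<le> d q p" for p q
  proof (rule field_le_epsilon)
    fix e :: real assume e: "e > 0"
    then obtain \<gamma> where 1: "pwC1 M 0 1 \<gamma>" "\<gamma> 0 = q" "\<gamma> 1 = p" "curve_length M \<gamma> < d q p + e"
      using rdist_approx by blast
    obtain \<gamma>' where "pwC1 M 0 1 \<gamma>'" "\<gamma>' 0 = \<gamma> 1" "\<gamma>' 1 = \<gamma> 0" "curve_length M \<gamma>' = curve_length M \<gamma>"
      using curve_reverse[OF 1(1)] by blast
    moreover from this have "d p q \<le> curve_length M \<gamma>'" using 1 by (intro rdist_le_curve_length) auto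
    ultimately show "d p q \<le> d q p + e" using 1 by linarith
  qed
  then show ?thesis by (simp add: order_antisym)
qed

lemma rdist_chart_upper:
  assumes c: "c \<in> atlas M" and sub: "closed_segment x y \<subseteq> img c"
    and B: "\<And>z. z \<in> closed_segment x y \<Longrightarrow> \<nu> c z (y - x) \<le> B"
  shows "d (chart_inv c x) (chart_inv c y) \<le> B"
proof -
  let ?\<sigma> = "chart_line c x y"
  have p: "pwC1 M 0 1 ?\<sigma>" using chart_line_C1[OF c sub] by (rule C1_curve_pwC1)
  have "d (?\<sigma> 0) (?\<sigma> 1) \<le> integral {0..1} (speed M ?\<sigma>)" using rdist_le_length[OF p] by simp
  also have "\<dots> \<le> integral {0..1} (\<lambda>t::real. B)"
  proof -
    \<comment> \<open>The pointwise formula for the speed holds strictly between the end points,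
      hence the open interval.\<close>
    have "integral {0<..<1} (speed M ?\<sigma>) \<le> integral {0<..<1} (\<lambda>t::real. B)"
    proof (rule integral_le)
      show "speed M ?\<sigma> integrable_on {0<..<1}"
        using speed_integrable[OF p] integrable_on_Icc_iff_Ioo by blast
      show "(\<lambda>t::real. B) integrable_on {0<..<1}"
        using integrable_const_ivl[of B 0 1] integrable_on_Icc_iff_Ioo by blast
      fix t :: real assume t: "t \<in> {0<..<1}"
      have "x + t *\<^sub>R (y - x) = (1 - t) *\<^sub>R x + t *\<^sub>R y" by (simp add: algebra_simps)
      then have "x + t *\<^sub>R (y - x) \<in> closed_segment x y" using t unfolding closed_segment_def by auto
      then show "speed M ?\<sigma> t \<le> B" using chart_line_speed[OF c sub t] B by simp
    qed
    then show ?thesis by (simp only: integral_open_interval_real)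
  qed
  finally show ?thesis by (simp add: chart_line_def)
qed

lemma rdist_self [simp]: "d p p = 0"
proof -
  obtain c where c: "c \<in> atlas M" "p \<in> fst c" using chart_at by blast
  have "d (chart_inv c (snd c p)) (chart_inv c (snd c p)) \<le> 0"
    by (rule rdist_chart_upper[OF c(1)]) (use c in auto)
  then show ?thesis using chart_inv_snd[OF c] rdist_nonneg[of p p] by simp
qed

text \<open>The coordinate displacement is the integral of the coordinate velocity, whose norm is at
  most the speed divided by \<kappa> outside finitely many times.\<close>

lemma length_chart_lower:
  assumes g: "pwC1 M a b \<gamma>" and ab: "a \<le> b" and c: "c \<in> atlas M"
    and dom: "\<And>t. t \<in> {a..b} \<Longrightarrow> \<gamma> t \<in> fst c"
    and low: "\<And>t v. t \<in> {a..b} \<Longrightarrow> \<kappa> * norm v \<le> \<nu> c (snd c (\<gamma> t)) v" and \<kappa>: "\<kappa> > 0"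
  shows "\<kappa> * norm (snd c (\<gamma> b) - snd c (\<gamma> a)) \<le> integral {a..b} (speed M \<gamma>)"
proof -
  obtain S where S: "finite S" "a \<in> S" "b \<in> S"
    "\<And>t c. t \<in> {a..b} - S \<Longrightarrow> c \<in> atlas M \<Longrightarrow> \<gamma> t \<in> fst c \<Longrightarrow> 
      \<exists>u. ((snd c \<circ> \<gamma>) has_vector_derivative u) (at t)"
    "\<And>t. t \<in> {a..b} - S \<Longrightarrow> isCont \<gamma> t" using pwC1_diff[OF g] by metis
  define u where "u t = (if t \<in> S then 0 else vector_derivative (snd c \<circ> \<gamma>) (at t))" for t
  have der: "((snd c \<circ> \<gamma>) has_vector_derivative u t) (at t)" if t: "t \<in> {a..b} - S" for t
  proof -
    obtain v where v: "((snd c \<circ> \<gamma>) has_vector_derivative v) (at t)" using S(4)[OF t c dom] t by blast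
    then have "u t = v" using t vector_derivative_at by (auto simp: u_def)
    then show ?thesis using v by simp
  qed
  have cont: "continuous_on {a..b} (snd c \<circ> \<gamma>)"
    using g dom by (intro continuous_on_compose continuous_on_subset[OF continuous_chart[OF c]]) (auto simp: pwC1_def)
  have ui: "(u has_integral ((snd c \<circ> \<gamma>) b - (snd c \<circ> \<gamma>) a)) {a..b}"
    by (rule fundamental_theorem_of_calculus_interior_strong[OF S(1) ab _ cont]) (use der in auto)
  have si: "(\<lambda>t. speed M \<gamma> t / \<kappa>) integrable_on {a..b}" 
    using integrable_on_cmult_right[OF speed_integrable[OF g], of "1/\<kappa>"] by simp
  have "norm (integral {a..b} u) \<le> integral {a..b} (\<lambda>t. speed M \<gamma> t / \<kappa>)"
  proof (rule Henstock_Kurzweil_Integration.integral_norm_bound_integral)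
    show "norm (u t) \<le> speed M \<gamma> t / \<kappa>" if t: "t \<in> {a..b}" for t
    proof (cases "t \<in> S")
      case True then show ?thesis using \<kappa> speed_nonneg by (simp add: u_def)
    next
      case False
      then have t': "t \<in> {a..b} - S" using t by blast
      have "speed M \<gamma> t = \<nu> c (snd c (\<gamma> t)) (u t)"
        by (rule speed_eq[OF c dom[OF t] S(5)[OF t'] der[OF t']])
      then show ?thesis using low[OF t, of "u t"] \<kappa> by (simp add: field_simps)
    qed
  qed (use ui si in auto)
  then show ?thesis using ui \<kappa> by (simp add: integral_unique field_simps)
qed

text \<open>Only the part of a curve up to its first exit from the coordinate ball is estimated.
  There the chart is available, and the coordinates have moved by at least \<rho>.\<close>

lemma rdist_exit_lower:
  assumes c: "c \<in> atlas M" "p \<in> fst c" and \<rho>: "\<rho> > 0" "cball (snd c p) \<rho> \<subseteq> img c"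
    and low: "\<And>x v. x \<in> cball (snd c p) \<rho> \<Longrightarrow> \<kappa> * norm v \<le> \<nu> c x v" and \<kappa>: "\<kappa> > 0"
    and q: "q \<notin> chart_inv c ` ball (snd c p) \<rho>"
  shows "\<kappa> * \<rho> \<le> d p q"
proof (rule field_le_epsilon)
  fix e :: real assume e: "e > 0"
  then obtain \<gamma> where g: "pwC1 M 0 1 \<gamma>" "\<gamma> 0 = p" "\<gamma> 1 = q" "curve_length M \<gamma> < d p q + e"
    using rdist_approx by blast
  let ?B = "chart_inv c ` ball (snd c p) \<rho>" and ?K = "chart_inv c ` cball (snd c p) \<rho>"
  have oB: "open ?B" by (rule chart_inv_open[OF c(1)]) (use \<rho> ball_subset_cball in auto)
  have "compact ?K"
    by (intro compact_continuous_image continuous_on_subset[OF continuous_chart_inv[OF c(1)]] \<rho>(2)) auto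
  then have cK: "closed ?K" by (rule compact_imp_closed)
  have pB: "p \<in> ?B" using \<rho>(1) chart_inv_snd[OF c] by (intro image_eqI[of _ _ "snd c p"]) auto
  have cg: "continuous_on {0..1} \<gamma>" using g(1) by (simp add: pwC1_def)
  \<comment> \<open>Closed set of times outside the open ball; its minimum \<open>t1\<close> is the
    first exit time.\<close>
  define T where "T = {0..1} \<inter> \<gamma> -` (- ?B)"
  have "closed T" unfolding T_def
    by (rule continuous_closed_preimage[OF cg]) (use oB in auto)
  then have cT: "compact T" unfolding T_def by (metis compact_Int_closed compact_Icc inf.left_idem)
  have "1 \<in> T" using q g by (auto simp: T_def)
  then obtain t1 where t1: "t1 \<in> T" "\<And>t. t \<in> T \<Longrightarrow> t1 \<le> t" using compact_attains_inf[OF cT] by blast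
  have t1': "0 < t1" "t1 \<le> 1" using t1(1) pB g(2) by (auto simp: T_def less_le)
  have "\<gamma> ` {0..<t1} \<subseteq> ?B" using t1 t1' by (fastforce simp: T_def)
  then have "\<gamma> ` {0..<t1} \<subseteq> ?K" using ball_subset_cball by blast
  \<comment> \<open>Passing to the closure puts the exit point itself into the closed ball, so it is
    still covered by the chart.\<close>
  moreover have "closure {0..<t1} = {0..t1}" using t1'(1) by simp
  ultimately have inK: "\<gamma> ` {0..t1} \<subseteq> ?K"
    using image_closure_subset[of "{0..<t1}" \<gamma> ?K] cK continuous_on_subset[OF cg, of "{0..t1}"] t1' by auto
  have K: "\<gamma> t \<in> fst c \<and> snd c (\<gamma> t) \<in> cball (snd c p) \<rho>" if t: "t \<in> {0..t1}" for t
  proof -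
    obtain y where y: "y \<in> cball (snd c p) \<rho>" "\<gamma> t = chart_inv c y" using inK t by blast
    then have "y \<in> img c" using \<rho>(2) by blast
    then show ?thesis using chart_inv_in[OF c(1), of y] snd_chart_inv[OF c(1), of y] y by simp
  qed
  have "\<gamma> t1 \<notin> ?B" using t1(1) by (simp add: T_def)
  moreover have "\<gamma> t1 = chart_inv c (snd c (\<gamma> t1))" using chart_inv_snd[OF c(1)] K t1' by simp
  ultimately have "snd c (\<gamma> t1) \<notin> ball (snd c p) \<rho>" using imageI[of "snd c (\<gamma> t1)"] by force
  then have far: "\<rho> \<le> norm (snd c (\<gamma> t1) - snd c (\<gamma> 0))" by (simp add: g(2) dist_norm norm_minus_commute)
  have g1: "pwC1 M 0 t1 \<gamma>" by (rule pwC1_subset[OF g(1)]) (use t1' in auto)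
  have "\<kappa> * \<rho> \<le> \<kappa> * norm (snd c (\<gamma> t1) - snd c (\<gamma> 0))" using far \<kappa> by simp
  also have "\<dots> \<le> integral {0..t1} (speed M \<gamma>)"
    by (rule length_chart_lower[OF g1 _ c(1)]) (use K low \<kappa> t1' in auto)
  also have "\<dots> \<le> integral {0..1} (speed M \<gamma>)"
    using t1' by (intro integral_subset_le speed_integrable g1 g(1)) (auto simp: speed_nonneg)
  finally show "\<kappa> * \<rho> \<le> d p q + e" using g(4) by (simp add: curve_length_def)
qed

text \<open>The two directions use the two bounds on the metric norm: leaving a coordinate ball
  costs length, and points with close coordinates can be joined cheaply. From here on the given
  topology may be treated as that of the metric \<open>rdist\<close>.\<close>

lemma open_iff_rdist: "open U \<longleftrightarrow> (\<forall>x\<in>U. \<exists>e>0. \<forall>y. d x y < e \<longrightarrow> y \<in> U)"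
proof
  assume U: "open U"
  show "\<forall>x\<in>U. \<exists>e>0. \<forall>y. d x y < e \<longrightarrow> y \<in> U"
  proof
    fix p assume p: "p \<in> U"
    obtain c \<rho> where c: "c \<in> atlas M" "p \<in> fst c" "\<rho> > 0" "cball (snd c p) \<rho> \<subseteq> img c"
      "chart_inv c ` cball (snd c p) \<rho> \<subseteq> U" using chart_ball[OF U p] by blast
    obtain \<kappa> K where K: "\<kappa> > 0" "\<And>x v. x \<in> cball (snd c p) \<rho> \<Longrightarrow> \<kappa> * norm v \<le> \<nu> c x v \<and> \<nu> c x v \<le> K * norm v"
      using gnorm_bounds[OF c(1) compact_cball c(4)] by metis
    have "y \<in> U" if "d p y < \<kappa> * \<rho>" for y
    proof (rule ccontr)
      assume "y \<notin> U"
      then have "y \<notin> chart_inv c ` ball (snd c p) \<rho>" using c(5) ball_subset_cball by blast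
      then have "\<kappa> * \<rho> \<le> d p y" using rdist_exit_lower[OF c(1-4)] K by blast
      then show False using that by simp
    qed
    then show "\<exists>e>0. \<forall>y. d p y < e \<longrightarrow> y \<in> U" using K(1) c(3) by (intro exI[of _ "\<kappa> * \<rho>"]) auto
  qed
next
  assume U: "\<forall>x\<in>U. \<exists>e>0. \<forall>y. d x y < e \<longrightarrow> y \<in> U"
  show "open U" unfolding open_subopen[of U]
  proof
    fix p assume "p \<in> U"
    then obtain e where e: "e > 0" "\<And>y. d p y < e \<Longrightarrow> y \<in> U" using U by blast
    obtain c \<rho> where c: "c \<in> atlas M" "p \<in> fst c" "\<rho> > 0" "cball (snd c p) \<rho> \<subseteq> img c"
      by (rule chart_ball[OF open_UNIV UNIV_I, of p], rule that)
    obtain \<kappa> K where K: "K > 0" "\<And>x v. x \<in> cball (snd c p) \<rho> \<Longrightarrow> \<kappa> * norm v \<le> \<nu> c x v \<and> \<nu> c x v \<le> K * norm v"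
      using gnorm_bounds[OF c(1) compact_cball c(4)] by metis
    define r where "r = min \<rho> (e / (2 * K))"
    have r: "r > 0" "r \<le> \<rho>" "K * r < e" using e(1) c(3) K(1) by (auto simp: r_def min_def field_simps)
    have "chart_inv c y \<in> U" if y: "y \<in> ball (snd c p) r" for y
    proof -
      have ny: "norm (y - snd c p) < r" using y by (simp add: dist_norm norm_minus_commute)
      have seg: "closed_segment (snd c p) y \<subseteq> cball (snd c p) \<rho>"
        using y r c(3) by (intro closed_segment_subset) auto
      have "d (chart_inv c (snd c p)) (chart_inv c y) \<le> K * norm (y - snd c p)"
        by (rule rdist_chart_upper[OF c(1)]) (use seg c(4) K in blast)+
      also have "\<dots> \<le> K * r" using ny K(1) by simp
      also have "\<dots> < e" by (rule r(3))
      finally show ?thesis using e(2) chart_inv_snd[OF c(1,2)] by simp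
    qed
    then have "chart_inv c ` ball (snd c p) r \<subseteq> U" by blast
    moreover have "open (chart_inv c ` ball (snd c p) r)"
      by (rule chart_inv_open[OF c(1)]) (use r c(4) subset_ball ball_subset_cball in \<open>auto simp: subset_iff\<close>)
    moreover have "p \<in> chart_inv c ` ball (snd c p) r"
      using r chart_inv_snd[OF c(1,2)] by (intro image_eqI[of _ _ "snd c p"]) auto
    ultimately show "\<exists>T. open T \<and> p \<in> T \<and> T \<subseteq> U" by blast
  qed
qed

lemma rdist_eq_0 [simp]: "d p q = 0 \<longleftrightarrow> p = q"
proof
  assume 0: "d p q = 0"
  show "p = q"
  proof (rule ccontr)
    assume "p \<noteq> q"
    moreover have "open (- {q})" by auto
    ultimately obtain e where "e > 0" "d p q < e \<longrightarrow> q \<in> - {q}" unfolding open_iff_rdist by blast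
    then show False using 0 by simp
  qed
qed simp

lemma rdist_pos: "p \<noteq> q \<Longrightarrow> 0 < d p q"
  using rdist_eq_0 rdist_nonneg by (metis less_le)

lemma open_disk [simp]: "open (disk M p r)"
  unfolding open_iff_rdist
proof
  fix x assume "x \<in> disk M p r"
  then have "d p x < r" by (simp add: disk_def)
  moreover have "y \<in> disk M p r" if "d x y < r - d p x" for y
    using rdist_triangle[of p y x] that by (simp add: disk_def)
  ultimately show "\<exists>e>0. \<forall>y. d x y < e \<longrightarrow> y \<in> disk M p r"
    by (intro exI[of _ "r - d p x"]) simp
qed

lemma rdist_tendsto_0:
  assumes "(f \<longlongrightarrow> l) F"
  shows "((\<lambda>t. d l (f t)) \<longlongrightarrow> 0) F"
proof (rule tendstoI)
  fix e :: real assume "e > 0"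
  then have "\<forall>\<^sub>F t in F. f t \<in> disk M l e"
    by (intro topological_tendstoD[OF assms] open_disk) (simp add: disk_def)
  then show "\<forall>\<^sub>F t in F. dist (d l (f t)) 0 < e" by eventually_elim (auto simp: disk_def)
qed

text \<open>Quadrilateral inequality: replacing both arguments changes the distance by at most the
  sum of the two displacements.\<close>

lemma tendsto_rdist:
  assumes "(f \<longlongrightarrow> l) F" "(g \<longlongrightarrow> m) F"
  shows "((\<lambda>t. d (f t) (g t)) \<longlongrightarrow> d l m) F"
proof -
  have "((\<lambda>t. d l (f t) + d m (g t)) \<longlongrightarrow> 0 + 0) F"
    by (intro tendsto_add rdist_tendsto_0 assms)
  then have 0: "((\<lambda>t. d l (f t) + d m (g t)) \<longlongrightarrow> 0) F" by simp
  have "\<bar>d (f t) (g t) - d l m\<bar> \<le> d l (f t) + d m (g t)" for t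
    using rdist_triangle[of "f t" "g t" l] rdist_triangle[of l "g t" m] rdist_triangle[of l m "f t"]
      rdist_triangle[of "f t" m "g t"] rdist_sym[of "f t" l] rdist_sym[of "g t" m] by linarith
  then have "((\<lambda>t. d (f t) (g t) - d l m) \<longlongrightarrow> 0) F"
    by (intro tendsto_rabs_zero_cancel[OF tendsto_sandwich[OF _ _ tendsto_const 0]]) auto
  then show ?thesis by (rule LIM_zero_cancel)
qed

lemma continuous_on_rdist [continuous_intros]:
  "continuous_on T f \<Longrightarrow> continuous_on T g \<Longrightarrow> continuous_on T (\<lambda>t. d (f t) (g t))"
  unfolding continuous_on_def by (auto intro: tendsto_rdist)

lemma approx_between:
  assumes s: "0 \<le> s" "s \<le> d p q" and e: "e > 0"
  obtains m where "d p m = s" "d m q < d p q - s + e"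
proof -
  obtain \<gamma> where g: "pwC1 M 0 1 \<gamma>" "\<gamma> 0 = p" "\<gamma> 1 = q" "curve_length M \<gamma> < d p q + e"
    using rdist_approx e by blast
  have cont: "continuous_on {0..1} (\<lambda>t. d p (\<gamma> t))" using g(1) by (intro continuous_intros) (simp add: pwC1_def)
  obtain t where t: "0 \<le> t" "t \<le> 1" "d p (\<gamma> t) = s"
    using IVT'[of "\<lambda>t. d p (\<gamma> t)" 0 s 1] cont s g by auto
  have "d p (\<gamma> t) + d (\<gamma> t) q \<le> curve_length M \<gamma>"
  proof (cases "t = 0 \<or> t = 1")
    case True then show ?thesis using g rdist_le_curve_length[OF g(1-3)] by auto
  next
    case False
    have 1: "d (\<gamma> 0) (\<gamma> t) \<le> integral {0..t} (speed M \<gamma>)"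
      by (rule rdist_le_length[OF pwC1_subset[OF g(1)]]) (use t False in auto)
    have 2: "d (\<gamma> t) (\<gamma> 1) \<le> integral {t..1} (speed M \<gamma>)"
      by (rule rdist_le_length[OF pwC1_subset[OF g(1)]]) (use t False in auto)
    have "integral {0..t} (speed M \<gamma>) + integral {t..1} (speed M \<gamma>) = curve_length M \<gamma>"
      unfolding curve_length_def
      by (rule Henstock_Kurzweil_Integration.integral_combine[OF t(1,2) speed_integrable[OF g(1)]])
    then show ?thesis using 1 2 g by simp
  qed
  then show ?thesis using that[of "\<gamma> t"] t g(4) by auto
qed

text \<open>That each point q at distance r is a limit of points of the disk rests on the length
  structure: a nearly shortest curve from p passes through points slightly closer to p and close to
  q.\<close>

lemma frontier_disk: 
  assumes "r > 0" shows "frontier (disk M p r) = circle M p r"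
proof -
  have sub: "closure (disk M p r) \<subseteq> {q. d p q \<le> r}"
    by (rule closure_minimal) (auto simp: disk_def intro!: closed_Collect_le continuous_intros)
  have "q \<in> closure (disk M p r)" if q: "d p q = r" for q
    unfolding closure_iff_nhds_not_empty
  proof (intro allI impI)
    fix A U assume A: "U \<subseteq> A" "q \<in> U" "open U"
    then obtain e where e: "e > 0" "\<And>y. d q y < e \<Longrightarrow> y \<in> U" unfolding open_iff_rdist by blast
    \<comment> \<open>The maximum with 0 takes care of radii below e/2.\<close>
    define s where "s = max 0 (r - e/2)"
    have s: "0 \<le> s" "s \<le> d p q" "s < r" "r - s + e/4 < e" using e(1) assms q by (auto simp: s_def)
    obtain m where m: "d p m = s" "d m q < d p q - s + e/4" using approx_between[OF s(1,2), of "e/4"] e(1) by auto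
    have "m \<in> U" by (rule e(2)) (use m q s rdist_sym[of q m] in linarith)
    moreover have "m \<in> disk M p r" using m s by (simp add: disk_def)
    ultimately show "disk M p r \<inter> A \<noteq> {}" using A by blast
  qed
  then show ?thesis using sub interior_open[OF open_disk[of p r]]
    by (auto simp: frontier_def circle_def disk_def)
qed

end

section \<open>Geodesics\<close>

lemma has_vector_derivative_inner_mult:
  fixes A :: "real \<Rightarrow> real^2^2"
  assumes "(A has_vector_derivative A') (at t within I)" "(v has_vector_derivative v') (at t within I)"
    "(w has_vector_derivative w') (at t within I)"
  shows "((\<lambda>t. v t \<bullet> (A t *v w t)) has_vector_derivative
    (v' \<bullet> (A t *v w t) + v t \<bullet> (A' *v w t) + v t \<bullet> (A t *v w'))) (at t within I)"
proof -
  have c: "((\<lambda>t. f t $ i) has_real_derivative f' $ i) (at t within I)"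
    if "(f has_vector_derivative f') (at t within I)" for f :: "real \<Rightarrow> real^2" and f' i
    using bounded_linear.has_vector_derivative[OF bounded_linear_vec_nth that]
    by (simp add: has_real_derivative_iff_has_vector_derivative)
  have m: "((\<lambda>t. A t $ i $ j) has_real_derivative A' $ i $ j) (at t within I)" for i j
    by (rule c[OF bounded_linear.has_vector_derivative[OF bounded_linear_vec_nth assms(1)]])
  show ?thesis
    unfolding inner_mult_expand has_real_derivative_iff_has_vector_derivative[symmetric]
    by (rule derivative_eq_intros m c assms refl)+ (simp add: algebra_simps)
qed

lemma vector_derivative_bound:
  fixes f :: "real \<Rightarrow> 'b::real_normed_vector"
  assumes "\<And>t. t \<in> I \<Longrightarrow> (f has_vector_derivative f' t) (at t within I)" "convex I"
    "\<And>t. t \<in> I \<Longrightarrow> norm (f' t) \<le> B" "s \<in> I" "t \<in> I"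
  shows "norm (f s - f t) \<le> B * \<bar>s - t\<bar>"
proof -
  have "norm (f s - f t) \<le> B * norm (s - t)"
  proof (rule differentiable_bound[of I f "\<lambda>t h. h *\<^sub>R f' t"])
    show "onorm (\<lambda>h. h *\<^sub>R f' x) \<le> B" if "x \<in> I" for x
    proof (rule onorm_le)
      fix h :: real
      show "norm (h *\<^sub>R f' x) \<le> B * norm h"
        using mult_right_mono[OF assms(3)[OF that] abs_ge_zero[of h]] by (simp add: mult.commute)
    qed
  qed (use assms in \<open>auto simp: has_vector_derivative_def\<close>)
  then show ?thesis by simp
qed

text \<open>The adjugate divided by the determinant. The Lipschitz estimate for the Christoffel
  symbols inspects the entries of the inverse metric and needs them as explicit quotients.\<close>

definition adj_inv :: "real^2^2 \<Rightarrow> real^2^2" where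
  "adj_inv A = (\<chi> i j. (if i = j then A $ (if i = 1 then 2 else 1) $ (if i = 1 then 2 else 1) else - A $ i $ j)
     / (A$1$1 * A$2$2 - A$1$2 * A$2$1))"

lemma matrix_inv_2:
  fixes A :: "real^2^2"
  assumes "A$1$1 * A$2$2 - A$1$2 * A$2$1 \<noteq> 0"
  shows "matrix_inv A = adj_inv A" "A ** matrix_inv A = mat 1"
proof -
  have 1: "A ** adj_inv A = mat 1" "adj_inv A ** A = mat 1"
    using assms by (auto simp: vec_eq_iff forall_2 matrix_matrix_mult_def sum_2 adj_inv_def mat_def 
        diff_divide_distrib[symmetric] add_divide_distrib[symmetric] algebra_simps)
  then have "\<exists>B. A ** B = mat 1 \<and> B ** A = mat 1" by blast
  then have 2: "A ** matrix_inv A = mat 1 \<and> matrix_inv A ** A = mat 1"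
    unfolding matrix_inv_def by (rule someI_ex)
  have "matrix_inv A = adj_inv A ** (A ** matrix_inv A)" using 1 by (simp add: matrix_mul_assoc)
  then show "matrix_inv A = adj_inv A" using 2 by simp
  show "A ** matrix_inv A = mat 1" using 2 by simp
qed

text \<open>Boundedness accompanies the Lipschitz condition because products preserve only the
  conjunction of the two. The coefficients of the geodesic equation are then handled by closure
  rules alone.\<close>

definition lipb :: "'b::metric_space set \<Rightarrow> ('b \<Rightarrow> real) \<Rightarrow> bool" where
  "lipb S f \<longleftrightarrow> (\<exists>K. \<forall>p\<in>S. \<forall>q\<in>S. \<bar>f p - f q\<bar> \<le> K * dist p q) \<and> (\<exists>B. \<forall>p\<in>S. \<bar>f p\<bar> \<le> B)"

lemma lipb_const: "lipb S (\<lambda>p. k)"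
  unfolding lipb_def by (auto intro: exI[of _ 0])

lemma lipb_add:
  assumes "lipb S f" "lipb S g" shows "lipb S (\<lambda>p. f p + g p)"
proof -
  obtain K B K' B' where f: "\<And>p q. p \<in> S \<Longrightarrow> q \<in> S \<Longrightarrow> \<bar>f p - f q\<bar> \<le> K * dist p q" "\<And>p. p \<in> S \<Longrightarrow> \<bar>f p\<bar> \<le> B"
    and g: "\<And>p q. p \<in> S \<Longrightarrow> q \<in> S \<Longrightarrow> \<bar>g p - g q\<bar> \<le> K' * dist p q" "\<And>p. p \<in> S \<Longrightarrow> \<bar>g p\<bar> \<le> B'"
    using assms unfolding lipb_def by metis
  have "\<bar>(f p + g p) - (f q + g q)\<bar> \<le> (K + K') * dist p q" if "p \<in> S" "q \<in> S" for p q
    using f(1)[OF that] g(1)[OF that] by (simp add: distrib_right)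
  moreover have "\<bar>f p + g p\<bar> \<le> B + B'" if "p \<in> S" for p using f(2)[OF that] g(2)[OF that] by linarith
  ultimately show ?thesis unfolding lipb_def by blast
qed

lemma lipb_mult:
  assumes "lipb S f" "lipb S g" shows "lipb S (\<lambda>p. f p * g p)"
proof -
  obtain K B K' B' where f: "\<And>p q. p \<in> S \<Longrightarrow> q \<in> S \<Longrightarrow> \<bar>f p - f q\<bar> \<le> K * dist p q" "\<And>p. p \<in> S \<Longrightarrow> \<bar>f p\<bar> \<le> B"
    and g: "\<And>p q. p \<in> S \<Longrightarrow> q \<in> S \<Longrightarrow> \<bar>g p - g q\<bar> \<le> K' * dist p q" "\<And>p. p \<in> S \<Longrightarrow> \<bar>g p\<bar> \<le> B'"
    using assms unfolding lipb_def by metis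
  have "\<bar>f p * g p - f q * g q\<bar> \<le> (B * K' + K * B') * dist p q" if "p \<in> S" "q \<in> S" for p q
  proof -
    have "f p * g p - f q * g q = f p * (g p - g q) + (f p - f q) * g q" by (simp add: algebra_simps)
    then have "\<bar>f p * g p - f q * g q\<bar> \<le> \<bar>f p\<bar> * \<bar>g p - g q\<bar> + \<bar>f p - f q\<bar> * \<bar>g q\<bar>"
      by (metis abs_mult abs_triangle_ineq)
    also have "\<dots> \<le> B * (K' * dist p q) + (K * dist p q) * B'"
    proof (intro add_mono mult_mono f g that)
      show "0 \<le> B" using f(2)[OF that(1)] by linarith
      show "0 \<le> K * dist p q" using f(1)[OF that] by linarith
    qed auto
    finally show ?thesis by (simp add: algebra_simps)
  qed
  moreover have "\<bar>f p * g p\<bar> \<le> B * B'" if "p \<in> S" for p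
    unfolding abs_mult by (intro mult_mono f g that) (use f(2)[OF that] in auto)
  ultimately show ?thesis unfolding lipb_def by blast
qed

lemma lipb_minus: "lipb S f \<Longrightarrow> lipb S (\<lambda>p. - f p)"
  using lipb_mult[OF lipb_const[of S "-1"], of f] by simp

lemma lipb_diff: "lipb S f \<Longrightarrow> lipb S g \<Longrightarrow> lipb S (\<lambda>p. f p - g p)"
  using lipb_add[OF _ lipb_minus, of S f g] by simp

lemma lipb_sum: "finite I \<Longrightarrow> (\<And>i. i \<in> I \<Longrightarrow> lipb S (f i)) \<Longrightarrow> lipb S (\<lambda>p. \<Sum>i\<in>I. f i p)"
  by (induction I rule: finite_induct) (auto intro: lipb_const lipb_add)

lemma lipb_divide:
  assumes f: "lipb S f" and g: "lipb S g" and m: "m > 0" "\<And>p. p \<in> S \<Longrightarrow> m \<le> \<bar>g p\<bar>"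
  shows "lipb S (\<lambda>p. f p / g p)"
proof -
  obtain K where K: "\<And>p q. p \<in> S \<Longrightarrow> q \<in> S \<Longrightarrow> \<bar>g p - g q\<bar> \<le> K * dist p q"
    using g unfolding lipb_def by metis
  have "\<bar>1 / g p - 1 / g q\<bar> \<le> (K / (m * m)) * dist p q" if "p \<in> S" "q \<in> S" for p q
  proof -
    have nz: "g p \<noteq> 0" "g q \<noteq> 0" using m that by fastforce+
    have "1 / g p - 1 / g q = (g q - g p) / (g p * g q)" using nz by (simp add: field_simps)
    then have "\<bar>1 / g p - 1 / g q\<bar> = \<bar>g p - g q\<bar> / (\<bar>g p\<bar> * \<bar>g q\<bar>)" by (simp add: abs_mult abs_minus_commute)
    also have "\<dots> \<le> (K * dist p q) / (m * m)"
    proof (rule frac_le)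
      show "0 \<le> K * dist p q" using K[OF that] by linarith
      show "m * m \<le> \<bar>g p\<bar> * \<bar>g q\<bar>" using m that by (intro mult_mono) auto
    qed (use K that m in auto)
    finally show ?thesis by simp
  qed
  moreover have "\<bar>1 / g p\<bar> \<le> 1 / m" if "p \<in> S" for p using m that by (simp add: frac_le)
  ultimately have "lipb S (\<lambda>p. 1 / g p)" unfolding lipb_def by blast
  from lipb_mult[OF f this] show ?thesis by simp
qed

context riem_surface
begin

abbreviation Dmet where "Dmet c x v \<equiv> frechet_derivative (metric M c) (at x) v"

definition geo_acc :: "'a chart \<Rightarrow> real^2 \<Rightarrow> real^2 \<Rightarrow> real^2" where
  "geo_acc c x u = (\<chi> k. - (\<Sum>i\<in>UNIV. \<Sum>j\<in>UNIV. christoffel (metric M c) x k i j * u $ i * u $ j))"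

lemma metric_has_derivative: "c \<in> atlas M \<Longrightarrow> x \<in> img c \<Longrightarrow> (metric M c has_derivative Dmet c x) (at x)"
  by (rule smooth_on_has_derivative[OF metric_smooth])

lemma partial_deriv_metric:
  assumes "c \<in> atlas M" "x \<in> img c"
  shows "partial_deriv i (\<lambda>y. metric M c y $ j $ l) x = Dmet c x (axis i 1) $ j $ l"
proof -
  have "((\<lambda>y. metric M c y $ j $ l) has_derivative (\<lambda>h. Dmet c x h $ j $ l)) (at x)"
    by (intro bounded_linear.has_derivative[OF bounded_linear_vec_nth] metric_has_derivative assms)
  from frechet_derivative_at[OF this, symmetric] show ?thesis by (simp add: partial_deriv_def)
qed

lemma Dmet_symmetric:
  assumes c: "c \<in> atlas M" "x \<in> img c"
  shows "Dmet c x v $ i $ j = Dmet c x v $ j $ i"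
proof -
  have D: "((\<lambda>y. metric M c y $ j $ l) has_derivative (\<lambda>h. Dmet c x h $ j $ l)) (at x)" for j l
    by (intro bounded_linear.has_derivative[OF bounded_linear_vec_nth] metric_has_derivative c)
  have "((\<lambda>y. metric M c y $ j $ i) has_derivative (\<lambda>h. Dmet c x h $ i $ j)) (at x)"
    by (rule has_derivative_transform_within_open[OF D[of i j] open_img[OF c(1)] c(2)])
      (rule metric_symmetric[OF c(1)])
  then have "(\<lambda>h. Dmet c x h $ i $ j) = (\<lambda>h. Dmet c x h $ j $ i)"
    using D[of j i] by (rule has_derivative_unique)
  then show ?thesis by meson
qed

lemma Dmet_expand:
  assumes "c \<in> atlas M" "x \<in> img c"
  shows "Dmet c x u = u$1 *\<^sub>R Dmet c x (axis 1 1) + u$2 *\<^sub>R Dmet c x (axis 2 1)"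
  by (rule smooth_on_derivative_expand[OF metric_smooth assms(2)]) (rule assms(1))

lemma metric_det_pos:
  assumes c: "c \<in> atlas M" "x \<in> img c"
  shows "metric M c x $ 1 $ 1 * metric M c x $ 2 $ 2 - metric M c x $ 1 $ 2 * metric M c x $ 2 $ 1 > 0"
proof -
  let ?G = "metric M c x"
  \<comment> \<open>On this vector the quadratic form of the metric equals its entry at 2,2 times
    the determinant.\<close>
  define v :: "real^2" where "v = vector [ ?G$2$2, - ?G$1$2]"
  have "axis 2 1 \<noteq> (0 :: real^2)" by simp
  from metric_pos[OF c this] have 2: "?G$2$2 > 0" unfolding inner_mult_expand by (simp add: axis_def)
  have "v \<noteq> 0" using 2 by (auto simp: v_def vec_eq_iff forall_2 vector_2)
  from metric_pos[OF c this] have "?G$2$2 * (?G$1$1 * ?G$2$2 - ?G$1$2 * ?G$2$1) > 0"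
    unfolding inner_mult_expand v_def vector_2 using metric_symmetric[OF c, of 1 2] by (simp add: algebra_simps)
  then show ?thesis using 2 by (simp add: zero_less_mult_iff)
qed

text \<open>Multiplication by the metric cancels its inverse in the Christoffel symbols. What
  remains is the Euler-Lagrange form of the geodesic equation, which contains only first derivatives
  of the metric.\<close>

lemma geo_acc_lowered:
  assumes c: "c \<in> atlas M" "x \<in> img c"
  shows "w \<bullet> (metric M c x *v geo_acc c x u) =
    (u \<bullet> (Dmet c x w *v u)) / 2 - w \<bullet> (Dmet c x u *v u)"
proof -
  let ?G = "metric M c x" and ?D = "\<lambda>i. Dmet c x (axis i 1)"
  define C where "C i j l = ?D i $ j $ l + ?D j $ i $ l - ?D l $ i $ j" for i j l :: 2
  define y :: "real^2" where "y = (\<chi> l. \<Sum>i\<in>UNIV. \<Sum>j\<in>UNIV. C i j l * u$i * u$j)"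
  have "geo_acc c x u = (-1/2) *\<^sub>R (matrix_inv ?G *v y)"
    unfolding geo_acc_def christoffel_def partial_deriv_metric[OF c] y_def vec_eq_iff
    by (simp add: matrix_vector_mult_def sum_2 C_def algebra_simps)
  moreover have "?G ** matrix_inv ?G = mat 1" by (rule matrix_inv_2) (use metric_det_pos[OF c] in simp)
  ultimately have 1: "?G *v geo_acc c x u = (-1/2) *\<^sub>R y"
    by (simp only: matrix_vector_mult_scaleR matrix_vector_mul_assoc matrix_vector_mul_lid)
  have sym: "?D i $ 2 $ 1 = ?D i $ 1 $ 2" for i using Dmet_symmetric[OF c] .
  show ?thesis unfolding 1 y_def Dmet_expand[OF c, of u] Dmet_expand[OF c, of w] inner_mult_expand
    by (simp add: inner_vec_def sum_2 C_def sym algebra_simps)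
qed

lemma geodesic_velocity:
  assumes "geodesic_on M I \<gamma>" "c \<in> atlas M"
  obtains u where "\<And>t. t \<in> I \<Longrightarrow> \<gamma> t \<in> fst c \<Longrightarrow> ((snd c \<circ> \<gamma>) has_vector_derivative u t) (at t within I)"
    "\<And>t. t \<in> I \<Longrightarrow> \<gamma> t \<in> fst c \<Longrightarrow> (u has_vector_derivative geo_acc c (snd c (\<gamma> t)) (u t)) (at t within I)"
  using assms unfolding geodesic_on_def geo_acc_def by blast

lemma geodesic_C1: assumes g: "geodesic_on M I \<gamma>" shows "C1_curve_on M I \<gamma>"
  unfolding C1_curve_on_def
proof (intro conjI ballI)
  show "continuous_on I \<gamma>" using g by (simp add: geodesic_on_def)
  fix c assume c: "c \<in> atlas M"
  obtain u where u: "\<And>t. t \<in> I \<Longrightarrow> \<gamma> t \<in> fst c \<Longrightarrow> ((snd c \<circ> \<gamma>) has_vector_derivative u t) (at t within I)"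
    "\<And>t. t \<in> I \<Longrightarrow> \<gamma> t \<in> fst c \<Longrightarrow> (u has_vector_derivative geo_acc c (snd c (\<gamma> t)) (u t)) (at t within I)"
    using geodesic_velocity[OF g c] by metis
  have "continuous_on {t\<in>I. \<gamma> t \<in> fst c} u"
    unfolding continuous_on_eq_continuous_within
  proof
    fix t assume t: "t \<in> {t\<in>I. \<gamma> t \<in> fst c}"
    have "continuous (at t within I) u"
      by (rule has_vector_derivative_continuous[OF u(2)]) (use t in auto)
    then show "continuous (at t within {t\<in>I. \<gamma> t \<in> fst c}) u"
      by (rule continuous_within_subset) blast
  qed
  then show "\<exists>u. continuous_on {t\<in>I. \<gamma> t \<in> fst c} u \<and>
        (\<forall>t\<in>I. \<gamma> t \<in> fst c \<longrightarrow> ((snd c \<circ> \<gamma>) has_vector_derivative u t) (at t within I))"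
    using u(1) by (intro exI[of _ u] conjI) auto
qed

lemma geodesic_chart_nhd:
  fixes I :: "real set"
  assumes g: "continuous_on I \<gamma>" and c: "c \<in> atlas M" and t: "t \<in> I" "\<gamma> t \<in> fst c"
  obtains e where "e > 0" "\<And>s. s \<in> I \<Longrightarrow> \<bar>s - t\<bar> < e \<Longrightarrow> \<gamma> s \<in> fst c"
proof -
  obtain U where U: "open U" "U \<inter> I = \<gamma> -` fst c \<inter> I"
    using g open_dom[OF c] unfolding continuous_on_open_invariant by blast
  have "t \<in> U" using U t by blast
  then obtain e where "e > 0" "ball t e \<subseteq> U" using U(1) open_contains_ball by blast
  moreover have "s \<in> ball t e" if "\<bar>s - t\<bar> < e" for s using that by (simp add: dist_real_def abs_minus_commute)
  ultimately show ?thesis using U(2) that by blast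
qed

text \<open>The derivative of the squared speed is the derivative of the metric applied to u, u plus
  twice the product of u with the acceleration. \<open>geo_acc_lowered\<close> with w = u shows that
  the second part cancels the first.\<close>

lemma geodesic_spd_constant:
  assumes g: "geodesic_on M {0..1} \<gamma>"
  obtains l where "l \<ge> 0" "\<And>t. t \<in> {0..1} \<Longrightarrow> spd {0..1} \<gamma> t = l"
proof -
  let ?I = "{0..1::real}"
  have cont: "continuous_on ?I \<gamma>" using g by (simp add: geodesic_on_def)
  have "((\<lambda>t. (spd ?I \<gamma> t)\<^sup>2) has_vector_derivative 0) (at t within ?I)" if t: "t \<in> ?I" for t
  proof -
    obtain c where c: "c \<in> atlas M" "\<gamma> t \<in> fst c" using chart_at by blast
    obtain u where u: "\<And>t. t \<in> ?I \<Longrightarrow> \<gamma> t \<in> fst c \<Longrightarrow> ((snd c \<circ> \<gamma>) has_vector_derivative u t) (at t within ?I)"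
      "\<And>t. t \<in> ?I \<Longrightarrow> \<gamma> t \<in> fst c \<Longrightarrow> (u has_vector_derivative geo_acc c (snd c (\<gamma> t)) (u t)) (at t within ?I)"
      using geodesic_velocity[OF g c(1)] by metis
    obtain e where e: "e > 0" "\<And>s. s \<in> ?I \<Longrightarrow> \<bar>s - t\<bar> < e \<Longrightarrow> \<gamma> s \<in> fst c"
      using geodesic_chart_nhd[OF cont c(1) t c(2)] by blast
    let ?x = "\<lambda>s. snd c (\<gamma> s)"
    have xi: "?x s \<in> img c" if "\<gamma> s \<in> fst c" for s using that by blast
    have eq: "(spd ?I \<gamma> s)\<^sup>2 = u s \<bullet> (metric M c (?x s) *v u s)" if s: "s \<in> ?I" "\<gamma> s \<in> fst c" for s
    proof -
      have "spd ?I \<gamma> s = \<nu> c (?x s) (u s)"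
      proof (rule spd_eq[OF c(1) s(2,1) _ _ u(1)[OF s]])
        show "continuous (at s within ?I) \<gamma>" using cont s(1) by (simp add: continuous_on_eq_continuous_within)
        show "at s within ?I \<noteq> bot" by (rule at_within_Icc_nontrivial[OF _ s(1)]) simp
      qed
      then show ?thesis using gnorm_square[OF c(1) xi[OF s(2)]] by simp
    qed
    have "((\<lambda>s. metric M c ((snd c \<circ> \<gamma>) s)) has_derivative (\<lambda>h. Dmet c (?x t) (h *\<^sub>R u t))) (at t within ?I)"
      using has_derivative_compose[OF u(1)[OF t c(2), unfolded has_vector_derivative_def], of "metric M c"]
        metric_has_derivative[OF c(1) xi[OF c(2)]] by (simp add: o_def)
    then have mv: "((\<lambda>s. metric M c (?x s)) has_vector_derivative Dmet c (?x t) (u t)) (at t within ?I)"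
      using has_derivative_linear[OF metric_has_derivative[OF c(1) xi[OF c(2)]]]
      by (simp add: has_vector_derivative_def linear_scale)
    let ?a = "geo_acc c (?x t) (u t)"
    note der = has_vector_derivative_inner_mult[OF mv u(2)[OF t c(2)] u(2)[OF t c(2)]]
    have G: "?a \<bullet> (metric M c (?x t) *v u t) = u t \<bullet> (metric M c (?x t) *v ?a)"
      unfolding inner_mult_expand using metric_symmetric[OF c(1) xi[OF c(2)], of 1 2] by (simp add: algebra_simps)
    have z: "?a \<bullet> (metric M c (?x t) *v u t) + u t \<bullet> (Dmet c (?x t) (u t) *v u t)
        + u t \<bullet> (metric M c (?x t) *v ?a) = 0"
      unfolding G geo_acc_lowered[OF c(1) xi[OF c(2)]] by simp
    show ?thesis
    proof (rule has_vector_derivative_transform_within[OF der[unfolded z] e(1) t])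
      fix s assume s: "s \<in> ?I" "dist s t < e"
      show "u s \<bullet> (metric M c (?x s) *v u s) = (spd ?I \<gamma> s)\<^sup>2"
        using eq[OF s(1) e(2)[OF s(1)]] s(2) by (simp add: dist_real_def)
    qed
  qed
  then obtain k where k: "\<And>t. t \<in> ?I \<Longrightarrow> (spd ?I \<gamma> t)\<^sup>2 = k"
    by (rule has_vector_derivative_zero_constant[of ?I, rotated]) auto
  have "spd ?I \<gamma> t = sqrt k" if "t \<in> ?I" for t
    using k[OF that] spd_nonneg by (metis real_sqrt_abs abs_of_nonneg)
  moreover from this[of 0] have "sqrt k \<ge> 0" using spd_nonneg[of ?I \<gamma> 0] by simp
  ultimately show ?thesis using that by blast
qed

lemma geodesic_speed:
  assumes g: "geodesic_on M {0..1} \<gamma>"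
  shows "c \<in> atlas M \<Longrightarrow> t \<in> {0..1} \<Longrightarrow> \<gamma> t \<in> fst c \<Longrightarrow>
      ((snd c \<circ> \<gamma>) has_vector_derivative v) (at t within {0..1}) \<Longrightarrow> \<nu> c (snd c (\<gamma> t)) v = curve_length M \<gamma>"
    and "0 \<le> s \<Longrightarrow> s \<le> t \<Longrightarrow> t \<le> 1 \<Longrightarrow> d (\<gamma> s) (\<gamma> t) \<le> curve_length M \<gamma> * (t - s)"
proof -
  let ?I = "{0..1::real}"
  obtain l where l: "l \<ge> 0" "\<And>t. t \<in> ?I \<Longrightarrow> spd ?I \<gamma> t = l" using geodesic_spd_constant[OF g] by blast
  have p: "pwC1 M 0 1 \<gamma>" by (rule C1_curve_pwC1[OF geodesic_C1[OF g]])
  have int: "integral {s..t} (speed M \<gamma>) = l * (t - s)" if "0 \<le> s" "s \<le> t" "t \<le> 1" for s t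
  proof -
    have "integral {s..t} (speed M \<gamma>) = integral {s..t} (\<lambda>x. l)"
    proof (rule integral_spike[where S = "{s,t}"])
      fix x assume x: "x \<in> {s..t} - {s,t}"
      then have "speed M \<gamma> x = spd ?I \<gamma> x" using that by (intro speed_eq_spd) auto
      then show "l = speed M \<gamma> x" using l(2)[of x] x that by simp
    qed auto
    then show ?thesis using that by simp
  qed
  have len: "curve_length M \<gamma> = l" using int[of 0 1] by (simp add: curve_length_def)
  { assume c: "c \<in> atlas M" "t \<in> ?I" "\<gamma> t \<in> fst c" "((snd c \<circ> \<gamma>) has_vector_derivative v) (at t within ?I)"
    have "continuous (at t within ?I) \<gamma>"
      using g c(2) by (simp add: geodesic_on_def continuous_on_eq_continuous_within)
    then have "spd ?I \<gamma> t = \<nu> c (snd c (\<gamma> t)) v"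
      by (rule spd_eq[OF c(1,3,2) _ _ c(4)]) (rule at_within_Icc_nontrivial[OF _ c(2)], simp)
    then show "\<nu> c (snd c (\<gamma> t)) v = curve_length M \<gamma>" using l(2) c(2) len by simp }
  { assume st: "0 \<le> s" "s \<le> t" "t \<le> 1"
    show "d (\<gamma> s) (\<gamma> t) \<le> curve_length M \<gamma> * (t - s)"
    proof (cases "s = t")
      case False
      have "d (\<gamma> s) (\<gamma> t) \<le> integral {s..t} (speed M \<gamma>)"
        by (rule rdist_le_length[OF pwC1_subset[OF p]]) (use st False in auto)
      then show ?thesis using int[OF st] len by simp
    qed simp }
qed

text \<open>Constant speed bounds the distances on the three pieces from above, while by the
  triangle inequality they must add up to at least \<open>d p q\<close>. Hence no piece can be
  shorter than its share.\<close>

lemma minimal_geodesic_dist: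
  assumes g: "minimal_geodesic M p q \<gamma>" and st: "s \<in> {0..1}" "t \<in> {0..1}"
  shows "d (\<gamma> s) (\<gamma> t) = d p q * \<bar>t - s\<bar>"
proof -
  have geo: "geodesic_on M {0..1} \<gamma>" "\<gamma> 0 = p" "\<gamma> 1 = q" "curve_length M \<gamma> = d p q"
    using g by (auto simp: minimal_geodesic_def)
  have le: "d (\<gamma> s) (\<gamma> t) \<le> d p q * (t - s)" if "0 \<le> s" "s \<le> t" "t \<le> 1" for s t
    using geodesic_speed(2)[OF geo(1) that] geo(4) by simp
  have eq: "d (\<gamma> s) (\<gamma> t) = d p q * (t - s)" if "0 \<le> s" "s \<le> t" "t \<le> 1" for s t
  proof (rule antisym[OF le[OF that]])
    have "d p q \<le> d p (\<gamma> s) + d (\<gamma> s) (\<gamma> t) + d (\<gamma> t) q"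
      using rdist_triangle[of p q "\<gamma> s"] rdist_triangle[of "\<gamma> s" q "\<gamma> t"] by linarith
    moreover have "d p (\<gamma> s) \<le> d p q * s" using le[of 0 s] that geo by simp
    moreover have "d (\<gamma> t) q \<le> d p q * (1 - t)" using le[of t 1] that geo by simp
    ultimately show "d p q * (t - s) \<le> d (\<gamma> s) (\<gamma> t)" by (simp add: algebra_simps)
  qed
  show ?thesis
  proof (cases "s \<le> t")
    case True then show ?thesis using eq[of s t] st by simp
  next
    case False then show ?thesis using eq[of t s] st rdist_sym[of "\<gamma> s" "\<gamma> t"] by simp
  qed
qed

end

lemma lipb_cong: "lipb S f \<Longrightarrow> (\<And>p. p \<in> S \<Longrightarrow> g p = f p) \<Longrightarrow> lipb S g"
  unfolding lipb_def by simp

context riem_surface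
begin

text \<open>The acceleration is quadratic in the velocity, with coefficients made from the metric,
  its first derivatives and its inverse; all of these are bounded and Lipschitz on the product of a
  coordinate ball and a ball of velocities.\<close>

lemma geo_acc_lipschitz:
  assumes c: "c \<in> atlas M" and r: "r > 0" "cball x0 r \<subseteq> img c"
  obtains L where "L > 0" "\<And>x y u v. x \<in> cball x0 r \<Longrightarrow> y \<in> cball x0 r \<Longrightarrow> norm u \<le> U \<Longrightarrow> norm v \<le> U \<Longrightarrow>
     norm (geo_acc c x u - geo_acc c y v) \<le> L * (norm (x - y) + norm (u - v))"
proof -
  define S where "S = cball x0 r \<times> cball (0::real^2) U"
  have in_img: "fst p \<in> img c" if "p \<in> S" for p using that r(2) by (auto simp: S_def)
  have sm: "lipb S (\<lambda>p. f (fst p) $ i $ j)" if f: "smooth_on (img c) f" for f :: "real^2 \<Rightarrow> real^2^2" and i j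
  proof -
    obtain K where K: "K > 0" "\<And>x y. x \<in> cball x0 r \<Longrightarrow> y \<in> cball x0 r \<Longrightarrow> norm (f x - f y) \<le> K * norm (x - y)"
      using smooth_on_lipschitz[OF f r(2)] by metis
    have e: "\<bar>A $ i $ j\<bar> \<le> norm A" for A :: "real^2^2"
      by (rule order_trans[OF component_le_norm_cart Finite_Cartesian_Product.norm_nth_le])
    have 1: "\<bar>f (fst p) $ i $ j - f (fst q) $ i $ j\<bar> \<le> K * dist p q" if "p \<in> S" "q \<in> S" for p q
    proof -
      have "\<bar>f (fst p) $ i $ j - f (fst q) $ i $ j\<bar> \<le> norm (f (fst p) - f (fst q))"
        using e[of "f (fst p) - f (fst q)"] by simp
      also have "\<dots> \<le> K * norm (fst p - fst q)" using K(2) that by (auto simp: S_def)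
      also have "\<dots> \<le> K * dist p q" using K(1) dist_fst_le[of p q] by (simp add: dist_norm)
      finally show ?thesis .
    qed
    have 2: "\<bar>f (fst p) $ i $ j\<bar> \<le> K * r + norm (f x0)" if "p \<in> S" for p
    proof -
      have "\<bar>f (fst p) $ i $ j\<bar> \<le> norm (f (fst p))" by (rule e)
      also have "\<dots> \<le> norm (f (fst p) - f x0) + norm (f x0)" by (metis diff_add_cancel norm_triangle_ineq)
      also have "norm (f (fst p) - f x0) \<le> K * norm (fst p - x0)" using K(2) that r(1) by (auto simp: S_def)
      also have "\<dots> \<le> K * r" using K(1) that by (auto simp: S_def dist_norm norm_minus_commute)
      finally show ?thesis by simp
    qed
    show ?thesis unfolding lipb_def using 1 2 by blast
  qed
  have su: "lipb S (\<lambda>p. snd p $ i)" for i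
  proof -
    have "\<bar>snd p $ i - snd q $ i\<bar> \<le> 1 * dist p q" for p q :: "(real^2) \<times> (real^2)"
      using component_le_norm_cart[of "snd p - snd q" i] dist_snd_le[of p q] by (simp add: dist_norm)
    moreover have "\<bar>snd p $ i\<bar> \<le> U" if "p \<in> S" for p
      using component_le_norm_cart[of "snd p" i] that by (auto simp: S_def)
    ultimately show ?thesis unfolding lipb_def by blast
  qed
  let ?G = "\<lambda>p. metric M c (fst p)"
  let ?det = "\<lambda>x. metric M c x $ 1 $ 1 * metric M c x $ 2 $ 2 - metric M c x $ 1 $ 2 * metric M c x $ 2 $ 1"
  have G: "lipb S (\<lambda>p. ?G p $ i $ j)" for i j by (rule sm[OF metric_smooth[OF c]])
  have D: "lipb S (\<lambda>p. Dmet c (fst p) e $ i $ j)" for i j e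
    by (rule sm[OF smooth_on_directional[OF metric_smooth[OF c]]])
  have "continuous_on (cball x0 r) ?det"
    using continuous_on_subset[OF smooth_on_continuous_on[OF metric_smooth[OF c]] r(2)] by (intro continuous_intros)
  then obtain y0 where y0: "y0 \<in> cball x0 r" "\<And>y. y \<in> cball x0 r \<Longrightarrow> ?det y0 \<le> ?det y"
    using continuous_attains_inf[of "cball x0 r" ?det] r(1) by auto
  \<comment> \<open>The least determinant over the compact ball bounds the denominators in the
    inverse metric away from 0.\<close>
  have m: "?det y0 > 0" using metric_det_pos[OF c] y0(1) r(2) by blast
  have mle: "?det y0 \<le> \<bar>?det (fst p)\<bar>" if "p \<in> S" for p using y0(2)[of "fst p"] that by (auto simp: S_def)
  have dt: "lipb S (\<lambda>p. ?det (fst p))" by (intro lipb_diff lipb_mult G)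
  have inv: "lipb S (\<lambda>p. matrix_inv (?G p) $ k $ l)" for k l
  proof -
    have "lipb S (\<lambda>p. adj_inv (?G p) $ k $ l)"
      unfolding adj_inv_def vec_lambda_beta
      by (rule lipb_divide[OF _ dt m mle]) (cases "k = l"; simp add: G lipb_minus)
    then show ?thesis
    proof (rule lipb_cong)
      fix p assume "p \<in> S"
      then have "?det (fst p) > 0" using metric_det_pos[OF c in_img] by blast
      then show "matrix_inv (?G p) $ k $ l = adj_inv (?G p) $ k $ l" by (simp add: matrix_inv_2(1))
    qed
  qed
  have chr: "lipb S (\<lambda>p. christoffel (metric M c) (fst p) k i j)" for k i j
  proof -
    have "lipb S (\<lambda>p. 1/2 * (\<Sum>l\<in>UNIV. matrix_inv (?G p) $ k $ l *
      (Dmet c (fst p) (axis i 1) $ j $ l + Dmet c (fst p) (axis j 1) $ i $ l - Dmet c (fst p) (axis l 1) $ i $ j)))"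
      by (intro lipb_mult lipb_const lipb_sum lipb_add lipb_diff inv D) auto
    then show ?thesis
      by (rule lipb_cong) (simp add: christoffel_def partial_deriv_metric[OF c in_img])
  qed
  have acc: "lipb S (\<lambda>p. geo_acc c (fst p) (snd p) $ k)" for k
    unfolding geo_acc_def vec_lambda_beta by (intro lipb_minus lipb_sum lipb_mult chr su) auto
  then obtain K where K: "\<And>k p q. p \<in> S \<Longrightarrow> q \<in> S \<Longrightarrow>
      \<bar>geo_acc c (fst p) (snd p) $ k - geo_acc c (fst q) (snd q) $ k\<bar> \<le> K k * dist p q"
    unfolding lipb_def by metis
  define L where "L = \<bar>K 1\<bar> + \<bar>K 2\<bar> + 1"
  have "norm (geo_acc c x u - geo_acc c y v) \<le> L * (norm (x - y) + norm (u - v))"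
    if "x \<in> cball x0 r" "y \<in> cball x0 r" "norm u \<le> U" "norm v \<le> U" for x y u v
  proof -
    have S: "(x,u) \<in> S" "(y,v) \<in> S" using that by (auto simp: S_def)
    have dd: "dist (x,u) (y,v) \<le> norm (x - y) + norm (u - v)"
      unfolding dist_Pair_Pair using sqrt_sum_squares_le_sum[of "dist x y" "dist u v"] by (simp add: dist_norm)
    have k: "\<bar>(geo_acc c x u - geo_acc c y v) $ k\<bar> \<le> \<bar>K k\<bar> * (norm (x - y) + norm (u - v))" for k
    proof -
      have "\<bar>(geo_acc c x u - geo_acc c y v) $ k\<bar> \<le> K k * dist (x,u) (y,v)" using K[OF S, of k] by simp
      also have "\<dots> \<le> \<bar>K k\<bar> * (norm (x - y) + norm (u - v))" using dd by (intro mult_mono) auto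
      finally show ?thesis .
    qed
    have "norm (geo_acc c x u - geo_acc c y v) \<le> (\<Sum>k\<in>UNIV. \<bar>(geo_acc c x u - geo_acc c y v) $ k\<bar>)"
      by (rule norm_le_l1_cart)
    also have "\<dots> \<le> \<bar>K 1\<bar> * (norm (x - y) + norm (u - v)) + \<bar>K 2\<bar> * (norm (x - y) + norm (u - v))"
      unfolding sum_2 by (intro add_mono k)
    also have "\<dots> \<le> L * (norm (x - y) + norm (u - v))" by (simp add: L_def algebra_simps)
    finally show ?thesis .
  qed
  moreover have "L > 0" by (simp add: L_def)
  ultimately show ?thesis using that by blast
qed

text \<open>Picard's uniqueness argument. Integrating over a short interval bounds the maximum m of
  the norm of the position difference plus that of the velocity difference by (1 + L) e m, which
  forces m = 0.\<close>

lemma geodesic_local_unique: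
  assumes g: "geodesic_on M {0..1} \<gamma>1" "geodesic_on M {0..1} \<gamma>2" and t0: "t0 \<in> {0..1}"
    and c: "c \<in> atlas M" "\<gamma>1 t0 \<in> fst c" and eq: "\<gamma>1 t0 = \<gamma>2 t0"
    and v: "((snd c \<circ> \<gamma>1) has_vector_derivative v) (at t0 within {0..1})"
      "((snd c \<circ> \<gamma>2) has_vector_derivative v) (at t0 within {0..1})"
  obtains e where "e > 0" "\<And>t. t \<in> {0..1} \<Longrightarrow> \<bar>t - t0\<bar> < e \<Longrightarrow> \<gamma>1 t = \<gamma>2 t"
proof -
  let ?I = "{0..1::real}"
  have nt: "at t0 within ?I \<noteq> bot" by (rule at_within_Icc_nontrivial[OF _ t0]) simp
  obtain r where r: "r > 0" "cball (snd c (\<gamma>1 t0)) r \<subseteq> img c"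
    using open_img[OF c(1)] c(2) open_contains_cball by blast
  define U where "U = norm v + 1"
  have loc: "\<exists>u e. e > 0 \<and> (\<forall>t\<in>?I. \<bar>t - t0\<bar> < e \<longrightarrow> \<gamma> t \<in> fst c \<and> snd c (\<gamma> t) \<in> cball (snd c (\<gamma>1 t0)) r \<and> norm (u t) \<le> U
      \<and> ((snd c \<circ> \<gamma>) has_vector_derivative u t) (at t within ?I)
      \<and> (u has_vector_derivative geo_acc c (snd c (\<gamma> t)) (u t)) (at t within ?I)) \<and> u t0 = v"
    if gam: "geodesic_on M ?I \<gamma>" "\<gamma> t0 = \<gamma>1 t0" "((snd c \<circ> \<gamma>) has_vector_derivative v) (at t0 within ?I)" for \<gamma>
  proof -
    obtain u where u: "\<And>t. t \<in> ?I \<Longrightarrow> \<gamma> t \<in> fst c \<Longrightarrow> ((snd c \<circ> \<gamma>) has_vector_derivative u t) (at t within ?I)"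
      "\<And>t. t \<in> ?I \<Longrightarrow> \<gamma> t \<in> fst c \<Longrightarrow> (u has_vector_derivative geo_acc c (snd c (\<gamma> t)) (u t)) (at t within ?I)"
      using geodesic_velocity[OF gam(1) c(1)] by metis
    have dom0: "\<gamma> t0 \<in> fst c" using c(2) gam(2) by simp
    have cont: "continuous_on ?I \<gamma>" using gam(1) by (simp add: geodesic_on_def)
    obtain e1 where e1: "e1 > 0" "\<And>s. s \<in> ?I \<Longrightarrow> \<bar>s - t0\<bar> < e1 \<Longrightarrow> \<gamma> s \<in> fst c"
      using geodesic_chart_nhd[OF cont c(1) t0 dom0] by blast
    have ut0: "u t0 = v" using vector_derivative_within[OF nt gam(3)] vector_derivative_within[OF nt u(1)[OF t0 dom0]] by simp
    have "continuous (at t0 within ?I) (snd c \<circ> \<gamma>)" by (rule has_vector_derivative_continuous[OF gam(3)])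
    then obtain e2 where e2: "e2 > 0" "\<And>s. s \<in> ?I \<Longrightarrow> \<bar>s - t0\<bar> < e2 \<Longrightarrow> dist (snd c (\<gamma> s)) (snd c (\<gamma> t0)) < r"
      unfolding continuous_within_eps_delta using r(1) by (auto simp: dist_real_def)
    have "continuous (at t0 within ?I) u" by (rule has_vector_derivative_continuous[OF u(2)[OF t0 dom0]])
    then obtain e3 where e3: "e3 > 0" "\<And>s. s \<in> ?I \<Longrightarrow> \<bar>s - t0\<bar> < e3 \<Longrightarrow> dist (u s) (u t0) < 1"
      unfolding continuous_within_eps_delta dist_real_def using zero_less_one by blast
    have nU: "norm (u s) \<le> U" if "s \<in> ?I" "\<bar>s - t0\<bar> < e3" for s
    proof -
      have "norm (u s) \<le> norm (u s - u t0) + norm (u t0)" by (metis diff_add_cancel norm_triangle_ineq)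
      then show ?thesis using e3(2)[OF that] by (simp add: U_def ut0 dist_norm)
    qed
    have inb: "snd c (\<gamma> s) \<in> cball (snd c (\<gamma>1 t0)) r" if "s \<in> ?I" "\<bar>s - t0\<bar> < e2" for s
      using e2(2)[OF that] gam(2) by (simp add: dist_commute)
    have "min e1 (min e2 e3) > 0" using e1 e2 e3 by simp
    then show ?thesis using ut0 u e1(2) inb nU
      by (intro exI[of _ u] exI[of _ "min e1 (min e2 e3)"] conjI ballI impI) auto
  qed
  obtain u1 e1 where 1: "e1 > 0" "\<forall>t\<in>?I. \<bar>t - t0\<bar> < e1 \<longrightarrow> \<gamma>1 t \<in> fst c \<and> snd c (\<gamma>1 t) \<in> cball (snd c (\<gamma>1 t0)) r \<and> norm (u1 t) \<le> U
      \<and> ((snd c \<circ> \<gamma>1) has_vector_derivative u1 t) (at t within ?I)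
      \<and> (u1 has_vector_derivative geo_acc c (snd c (\<gamma>1 t)) (u1 t)) (at t within ?I)" "u1 t0 = v"
    using loc[OF g(1) refl v(1)] by blast
  obtain u2 e2 where 2: "e2 > 0" "\<forall>t\<in>?I. \<bar>t - t0\<bar> < e2 \<longrightarrow> \<gamma>2 t \<in> fst c \<and> snd c (\<gamma>2 t) \<in> cball (snd c (\<gamma>1 t0)) r \<and> norm (u2 t) \<le> U
      \<and> ((snd c \<circ> \<gamma>2) has_vector_derivative u2 t) (at t within ?I)
      \<and> (u2 has_vector_derivative geo_acc c (snd c (\<gamma>2 t)) (u2 t)) (at t within ?I)" "u2 t0 = v"
    using loc[OF g(2) eq[symmetric] v(2)] by blast
  obtain L where L: "L > 0" "\<And>x y u v. x \<in> cball (snd c (\<gamma>1 t0)) r \<Longrightarrow> y \<in> cball (snd c (\<gamma>1 t0)) r \<Longrightarrow> norm u \<le> U \<Longrightarrow> norm v \<le> U \<Longrightarrow>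
     norm (geo_acc c x u - geo_acc c y v) \<le> L * (norm (x - y) + norm (u - v))"
    using geo_acc_lipschitz[OF c(1) r, of U] by metis
  \<comment> \<open>The first bound keeps both geodesics in the coordinate ball with controlled
    velocity; the second makes (1 + L) e at most 1/2.\<close>
  define e where "e = min (min e1 e2 / 2) (1 / (2 * (1 + L)))"
  have e: "e > 0" "e < e1" "e < e2" "(1 + L) * e < 1"
  proof -
    show "e > 0" "e < e1" "e < e2" using 1(1) 2(1) L(1) by (auto simp: e_def)
    have "(1 + L) * e \<le> (1 + L) * (1 / (2 * (1 + L)))" using L(1) by (intro mult_left_mono) (auto simp: e_def)
    also have "\<dots> = 1/2" using L(1) by (simp add: field_simps)
    finally show "(1 + L) * e < 1" by simp
  qed
  define J where "J = {max 0 (t0 - e)..min 1 (t0 + e)}"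
  have J: "J \<subseteq> ?I" "t0 \<in> J" "compact J" "convex J" "\<And>t. t \<in> J \<Longrightarrow> \<bar>t - t0\<bar> \<le> e"
    using t0 e(1) by (auto simp: J_def)
  define x where "x t = snd c (\<gamma>1 t) - snd c (\<gamma>2 t)" for t
  define w where "w t = u1 t - u2 t" for t
  have dx: "(x has_vector_derivative w t) (at t within J)"
    and dw: "(w has_vector_derivative geo_acc c (snd c (\<gamma>1 t)) (u1 t) - geo_acc c (snd c (\<gamma>2 t)) (u2 t)) (at t within J)"
    and ba: "norm (geo_acc c (snd c (\<gamma>1 t)) (u1 t) - geo_acc c (snd c (\<gamma>2 t)) (u2 t)) \<le> L * (norm (x t) + norm (w t))"
    if t: "t \<in> J" for t
  proof -
    have tt: "t \<in> ?I" "\<bar>t - t0\<bar> < e1" "\<bar>t - t0\<bar> < e2" using J t e by fastforce+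
    note a = 1(2)[rule_format, OF tt(1,2)] and b = 2(2)[rule_format, OF tt(1,3)]
    have "((\<lambda>t. snd c (\<gamma>1 t) - snd c (\<gamma>2 t)) has_vector_derivative u1 t - u2 t) (at t within ?I)"
      using a b unfolding o_def by (intro has_vector_derivative_diff) blast+
    then show "(x has_vector_derivative w t) (at t within J)"
      using J(1) by (simp add: x_def[abs_def] w_def has_vector_derivative_within_subset)
    have "((\<lambda>t. u1 t - u2 t) has_vector_derivative geo_acc c (snd c (\<gamma>1 t)) (u1 t) - geo_acc c (snd c (\<gamma>2 t)) (u2 t)) (at t within ?I)"
      using a b by (intro has_vector_derivative_diff) auto
    then show "(w has_vector_derivative geo_acc c (snd c (\<gamma>1 t)) (u1 t) - geo_acc c (snd c (\<gamma>2 t)) (u2 t)) (at t within J)"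
      using J(1) by (simp add: w_def[abs_def] has_vector_derivative_within_subset)
    show "norm (geo_acc c (snd c (\<gamma>1 t)) (u1 t) - geo_acc c (snd c (\<gamma>2 t)) (u2 t)) \<le> L * (norm (x t) + norm (w t))"
      unfolding x_def w_def using a b by (intro L(2)) auto
  qed
  have "continuous_on J x" "continuous_on J w"
    using dx dw by (auto simp: continuous_on_eq_continuous_within intro: has_vector_derivative_continuous)
  then have "continuous_on J (\<lambda>t. norm (x t) + norm (w t))" by (intro continuous_intros)
  then obtain s where s: "s \<in> J" "\<And>t. t \<in> J \<Longrightarrow> norm (x t) + norm (w t) \<le> norm (x s) + norm (w s)"
    using continuous_attains_sup[OF J(3)] J(2) by blast
  define m where "m = norm (x s) + norm (w s)"
  have 0: "x t0 = 0" "w t0 = 0" using 1(3) 2(3) eq by (auto simp: x_def w_def)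
  have m0: "0 \<le> m" by (simp add: m_def)
  have "norm (w t) \<le> m" if "t \<in> J" for t using s(2)[OF that] norm_ge_zero[of "x t"] unfolding m_def by linarith
  from vector_derivative_bound[OF dx J(4) this s(1) J(2)] have bx: "norm (x s) \<le> m * e"
    using 0 J(5)[OF s(1)] m0 by (metis diff_zero mult_left_mono order_trans)
  have "norm (geo_acc c (snd c (\<gamma>1 t)) (u1 t) - geo_acc c (snd c (\<gamma>2 t)) (u2 t)) \<le> L * m" if "t \<in> J" for t
    using ba[OF that] s(2)[OF that] L(1) unfolding m_def by (meson less_imp_le mult_left_mono order_trans)
  from vector_derivative_bound[OF dw J(4) this s(1) J(2)] have bw: "norm (w s) \<le> (L * m) * e"
    using 0 J(5)[OF s(1)] m0 L(1) by (metis diff_zero mult_left_mono order_trans mult_nonneg_nonneg less_imp_le)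
  have "m \<le> ((1 + L) * e) * m" using bx bw by (simp add: m_def algebra_simps)
  then have "m = 0" using e(4) m0 mult_strict_right_mono[of "(1+L)*e" 1 m] by (cases "m = 0") auto
  have "\<gamma>1 t = \<gamma>2 t" if t: "t \<in> ?I" "\<bar>t - t0\<bar> < e" for t
  proof -
    have tJ: "t \<in> J" using t by (auto simp: J_def)
    have "norm (x t) + norm (w t) \<le> 0" using s(2)[OF tJ] \<open>m = 0\<close> unfolding m_def by linarith
    then have "x t = 0" using norm_ge_zero[of "w t"] by (metis add_nonneg_eq_0_iff norm_eq_zero norm_ge_zero order_antisym add_nonneg_nonneg)
    then have "snd c (\<gamma>1 t) = snd c (\<gamma>2 t)" by (simp add: x_def)
    moreover have "\<gamma>1 t \<in> fst c" "\<gamma>2 t \<in> fst c" using 1(2) 2(2) t e by auto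
    ultimately show ?thesis using chart_inj[OF c(1)] by (meson inj_onD)
  qed
  then show ?thesis using that e(1) by blast
qed

text \<open>Equal positions at one time would not propagate, so the clopen set of times records
  equal positions together with equal velocities, the latter in every chart around the
  point.\<close>

lemma geodesic_unique:
  assumes g: "geodesic_on M {0..1} \<gamma>1" "geodesic_on M {0..1} \<gamma>2"
    and c: "c \<in> atlas M" "\<gamma>1 0 \<in> fst c" and eq: "\<gamma>1 0 = \<gamma>2 0"
    and v: "((snd c \<circ> \<gamma>1) has_vector_derivative v) (at 0 within {0..1})"
      "((snd c \<circ> \<gamma>2) has_vector_derivative v) (at 0 within {0..1})"
    and t: "t \<in> {0..1}"
  shows "\<gamma>1 t = \<gamma>2 t"
proof -
  let ?I = "{0..1::real}"
  have nt: "at t within ?I \<noteq> bot" if "t \<in> ?I" for t by (rule at_within_Icc_nontrivial[OF _ that]) simp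
  have cont: "continuous_on ?I \<gamma>1" "continuous_on ?I \<gamma>2" using g by (auto simp: geodesic_on_def)
  have ct: "continuous (at t within ?I) \<gamma>1" "continuous (at t within ?I) \<gamma>2" if "t \<in> ?I" for t
    using cont that by (auto simp: continuous_on_eq_continuous_within)
  define V where "V c t v \<longleftrightarrow> ((snd c \<circ> \<gamma>1) has_vector_derivative v) (at t within ?I) \<and>
     ((snd c \<circ> \<gamma>2) has_vector_derivative v) (at t within ?I)" for c :: "'a chart" and t v
  define Z where "Z = {t\<in>?I. \<gamma>1 t = \<gamma>2 t \<and> (\<forall>c\<in>atlas M. \<gamma>1 t \<in> fst c \<longrightarrow> (\<exists>v. V c t v))}"
  have "0 \<in> Z"
  proof -
    have "V c' 0 (Dtrans c c' (\<gamma>1 0) v)" if c': "c' \<in> atlas M" "\<gamma>1 0 \<in> fst c'" for c'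
      unfolding V_def
      using velocity_transition[OF c(1) c'(1) c(2) c'(2) _ ct(1) v(1)]
        velocity_transition[of c c' \<gamma>2, OF c(1) c'(1) _ _ _ ct(2) v(2)] c c' eq by simp
    then show ?thesis using eq by (auto simp: Z_def)
  qed
  moreover have "openin (top_of_set ?I) Z"
    unfolding openin_euclidean_subtopology_iff
  proof (intro conjI ballI)
    show "Z \<subseteq> ?I" by (auto simp: Z_def)
    fix t0 assume t0: "t0 \<in> Z"
    obtain c where c: "c \<in> atlas M" "\<gamma>1 t0 \<in> fst c" using chart_at by blast
    obtain v where "V c t0 v" using t0 c by (auto simp: Z_def)
    then obtain e where e: "e > 0" "\<And>t. t \<in> ?I \<Longrightarrow> \<bar>t - t0\<bar> < e \<Longrightarrow> \<gamma>1 t = \<gamma>2 t"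
      using geodesic_local_unique[OF g _ c, of v] t0 by (auto simp: Z_def V_def)
    have "t \<in> Z" if t: "t \<in> ?I" "dist t t0 < e" for t
    proof -
      have "\<exists>v. V c' t v" if c': "c' \<in> atlas M" "\<gamma>1 t \<in> fst c'" for c'
      proof -
        obtain v where v: "((snd c' \<circ> \<gamma>1) has_vector_derivative v) (at t within ?I)"
          using geodesic_velocity[OF g(1) c'(1)] t(1) c'(2) by metis
        have "((snd c' \<circ> \<gamma>2) has_vector_derivative v) (at t within ?I)"
        proof (rule has_vector_derivative_transform_within[OF v _ t(1)])
          show "e - dist t t0 > 0" using t(2) by simp
          fix s assume s: "s \<in> ?I" "dist s t < e - dist t t0"
          then have "\<bar>s - t0\<bar> < e" using dist_triangle[of s t0 t] by (simp add: dist_real_def)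
          then show "(snd c' \<circ> \<gamma>1) s = (snd c' \<circ> \<gamma>2) s" using e(2)[OF s(1)] by simp
        qed
        then show ?thesis using v by (auto simp: V_def)
      qed
      then show ?thesis using t e(2)[OF t(1)] by (auto simp: Z_def dist_real_def)
    qed
    then show "\<exists>e>0. \<forall>x'\<in>?I. dist x' t0 < e \<longrightarrow> x' \<in> Z" using e(1) by blast
  qed
  moreover have "closedin (top_of_set ?I) Z"
    unfolding closedin_limpt
  proof (intro conjI allI impI)
    show "Z \<subseteq> ?I" by (auto simp: Z_def)
    fix t0 assume "t0 islimpt Z \<and> t0 \<in> ?I"
    then have lim: "at t0 within Z \<noteq> bot" and t0: "t0 \<in> ?I" by (auto simp: trivial_limit_within)
    have evZ: "\<forall>\<^sub>F t in at t0 within Z. t \<in> Z" by (simp add: eventually_at_filter)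
    have sub: "Z \<subseteq> ?I" by (auto simp: Z_def)
    have tl: "(f \<longlongrightarrow> f t0) (at t0 within Z)" if "continuous (at t0 within ?I) f" for f :: "real \<Rightarrow> 'b::t2_space"
      using continuous_within_subset[OF that sub] by (simp add: continuous_within)
    have eq0: "\<gamma>1 t0 = \<gamma>2 t0"
    proof (rule tendsto_unique[OF lim tl[OF ct(1)[OF t0]]])
      have "\<forall>\<^sub>F t in at t0 within Z. \<gamma>2 t = \<gamma>1 t" using evZ by eventually_elim (simp add: Z_def)
      then show "(\<gamma>1 \<longlongrightarrow> \<gamma>2 t0) (at t0 within Z)"
        by (rule Lim_transform_eventually[OF tl[OF ct(2)[OF t0]]])
    qed
    have "\<exists>v. V c t0 v" if c: "c \<in> atlas M" "\<gamma>1 t0 \<in> fst c" for c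
    proof -
      obtain u1 where u1: "\<And>t. t \<in> ?I \<Longrightarrow> \<gamma>1 t \<in> fst c \<Longrightarrow> ((snd c \<circ> \<gamma>1) has_vector_derivative u1 t) (at t within ?I)"
        "\<And>t. t \<in> ?I \<Longrightarrow> \<gamma>1 t \<in> fst c \<Longrightarrow> (u1 has_vector_derivative geo_acc c (snd c (\<gamma>1 t)) (u1 t)) (at t within ?I)"
        using geodesic_velocity[OF g(1) c(1)] by metis
      obtain u2 where u2: "\<And>t. t \<in> ?I \<Longrightarrow> \<gamma>2 t \<in> fst c \<Longrightarrow> ((snd c \<circ> \<gamma>2) has_vector_derivative u2 t) (at t within ?I)"
        "\<And>t. t \<in> ?I \<Longrightarrow> \<gamma>2 t \<in> fst c \<Longrightarrow> (u2 has_vector_derivative geo_acc c (snd c (\<gamma>2 t)) (u2 t)) (at t within ?I)"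
        using geodesic_velocity[OF g(2) c(1)] by metis
      have c2: "\<gamma>2 t0 \<in> fst c" using c(2) eq0 by simp
      have cu: "continuous (at t0 within ?I) u1" "continuous (at t0 within ?I) u2"
        by (rule has_vector_derivative_continuous[OF u1(2)[OF t0 c(2)]])
          (rule has_vector_derivative_continuous[OF u2(2)[OF t0 c2]])
      have "\<forall>\<^sub>F t in at t0 within Z. \<gamma>1 t \<in> fst c"
        using topological_tendstoD[OF tl[OF ct(1)[OF t0]] open_dom[OF c(1)] c(2)] .
      with evZ have ev: "\<forall>\<^sub>F t in at t0 within Z. u2 t = u1 t"
      proof eventually_elim
        fix t assume t: "t \<in> Z" "\<gamma>1 t \<in> fst c"
        then have tt: "t \<in> ?I" "\<gamma>1 t = \<gamma>2 t" by (auto simp: Z_def)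
        obtain v where v: "V c t v" using t c(1) by (auto simp: Z_def)
        have "u1 t = v" using vector_derivative_within[OF nt[OF tt(1)] u1(1)[OF tt(1) t(2)]]
            vector_derivative_within[OF nt[OF tt(1)]] v unfolding V_def by metis
        moreover have "u2 t = v" using vector_derivative_within[OF nt[OF tt(1)] u2(1)[OF tt(1)]]
            vector_derivative_within[OF nt[OF tt(1)]] v t(2) tt(2) unfolding V_def by metis
        ultimately show "u2 t = u1 t" by simp
      qed
      \<comment> \<open>The velocities are continuous since they are differentiable by the geodesic
        equation, so their agreement passes to limit points.\<close>
      have "u1 t0 = u2 t0"
        by (rule tendsto_unique[OF lim tl[OF cu(1)] Lim_transform_eventually[OF tl[OF cu(2)] ev]])
      then show ?thesis using u1(1)[OF t0 c(2)] u2(1)[OF t0 c2] by (auto simp: V_def)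
    qed
    then show "t0 \<in> Z" using t0 eq0 by (auto simp: Z_def)
  qed
  ultimately have "Z = ?I"
    using connected_clopen[of ?I] by (metis connected_Icc empty_iff)
  then show ?thesis using t by (auto simp: Z_def)
qed

end

section \<open>Affine reparametrization of geodesics and the exponential map\<close>

context riem_surface
begin

lemma geodesic_onI:
  assumes "continuous_on I \<gamma>"
    "\<And>c. c \<in> atlas M \<Longrightarrow> \<exists>u. \<forall>t\<in>I. \<gamma> t \<in> fst c \<longrightarrow> ((snd c \<circ> \<gamma>) has_vector_derivative u t) (at t within I) \<and>
       (u has_vector_derivative geo_acc c (snd c (\<gamma> t)) (u t)) (at t within I)"
  shows "geodesic_on M I \<gamma>"
  using assms unfolding geodesic_on_def geo_acc_def by blast

lemma geo_acc_scale: "geo_acc c x (k *\<^sub>R u) = k *\<^sub>R k *\<^sub>R geo_acc c x u"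
  by (simp add: geo_acc_def vec_eq_iff sum_distrib_left algebra_simps)

lemma geodesic_affine:
  assumes g: "geodesic_on M {0..1} \<gamma>" and h: "\<And>t. t \<in> {0..1} \<Longrightarrow> k * t + s \<in> {0..1}"
  shows "geodesic_on M {0..1} (\<lambda>t. \<gamma> (k * t + s))"
proof (rule geodesic_onI)
  let ?I = "{0..1::real}" and ?h = "\<lambda>t. k * t + s"
  have cont: "continuous_on ?I \<gamma>" using g by (simp add: geodesic_on_def)
  show "continuous_on ?I (\<lambda>t. \<gamma> (?h t))"
    by (rule continuous_on_compose2[OF cont]) (use h in \<open>auto intro!: continuous_intros\<close>)
  fix c assume c: "c \<in> atlas M"
  obtain u where u: "\<And>t. t \<in> ?I \<Longrightarrow> \<gamma> t \<in> fst c \<Longrightarrow> ((snd c \<circ> \<gamma>) has_vector_derivative u t) (at t within ?I)"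
    "\<And>t. t \<in> ?I \<Longrightarrow> \<gamma> t \<in> fst c \<Longrightarrow> (u has_vector_derivative geo_acc c (snd c (\<gamma> t)) (u t)) (at t within ?I)"
    using geodesic_velocity[OF g c] by metis
  have sub: "?h ` ?I \<subseteq> ?I" using h by blast
  have ch: "((\<lambda>t. f (?h t)) has_vector_derivative k *\<^sub>R f') (at t within ?I)"
    if f: "(f has_vector_derivative f') (at (?h t) within ?I)" and t: "t \<in> ?I" for f :: "real \<Rightarrow> real^2" and f' t
  proof -
    have "(?h has_vector_derivative k) (at t within ?I)" by (auto intro!: derivative_eq_intros)
    from vector_diff_chain_within[OF this has_vector_derivative_within_subset[OF f sub]]
    show ?thesis by (simp add: o_def)
  qed
  have "((snd c \<circ> (\<lambda>t. \<gamma> (?h t))) has_vector_derivative k *\<^sub>R u (?h t)) (at t within ?I) \<and>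
       ((\<lambda>t. k *\<^sub>R u (?h t)) has_vector_derivative geo_acc c (snd c (\<gamma> (?h t))) (k *\<^sub>R u (?h t))) (at t within ?I)"
    if t: "t \<in> ?I" "\<gamma> (?h t) \<in> fst c" for t
  proof
    show "((snd c \<circ> (\<lambda>t. \<gamma> (?h t))) has_vector_derivative k *\<^sub>R u (?h t)) (at t within ?I)"
      using ch[OF u(1)[OF h[OF t(1)] t(2)] t(1)] by (simp add: o_def)
    have "((\<lambda>t. u (?h t)) has_vector_derivative k *\<^sub>R geo_acc c (snd c (\<gamma> (?h t))) (u (?h t))) (at t within ?I)"
      by (rule ch[OF u(2)[OF h[OF t(1)] t(2)] t(1)])
    from bounded_linear.has_vector_derivative[OF bounded_linear_scaleR_right this, of k]
    show "((\<lambda>t. k *\<^sub>R u (?h t)) has_vector_derivative geo_acc c (snd c (\<gamma> (?h t))) (k *\<^sub>R u (?h t))) (at t within ?I)"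
      by (simp add: geo_acc_scale)
  qed
  then show "\<exists>u. \<forall>t\<in>?I. \<gamma> (?h t) \<in> fst c \<longrightarrow> ((snd c \<circ> (\<lambda>t. \<gamma> (?h t))) has_vector_derivative u t) (at t within ?I) \<and>
       (u has_vector_derivative geo_acc c (snd c (\<gamma> (?h t))) (u t)) (at t within ?I)"
    by (intro exI[of _ "\<lambda>t. k *\<^sub>R u (?h t)"] ballI impI)
qed

lemma geodesic_const: "geodesic_on M {0..1} (\<lambda>t. p)"
proof (rule geodesic_onI)
  fix c assume "c \<in> atlas M"
  have "geo_acc c x 0 = 0" for x using geo_acc_scale[of c x 0 0] by simp
  then show "\<exists>u. \<forall>t\<in>{0..1}. p \<in> fst c \<longrightarrow> ((snd c \<circ> (\<lambda>t. p)) has_vector_derivative u t) (at t within {0..1}) \<and>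
       (u has_vector_derivative geo_acc c (snd c p) (u t)) (at t within {0..1})"
    by (intro exI[of _ "\<lambda>t. 0"]) (simp add: o_def)
qed (rule continuous_on_const)

text \<open>Tangent vectors at z are always written in this one chart, so that exponential and
  logarithm at z become maps from and to the plane.\<close>

definition ch :: "'a \<Rightarrow> 'a chart" where "ch z = (SOME c. c \<in> atlas M \<and> z \<in> fst c)"

lemma ch: "ch z \<in> atlas M" "z \<in> fst (ch z)"
  using some_chart by (auto simp: ch_def)

definition E :: "'a \<Rightarrow> real^2 \<Rightarrow> 'a" where "E z = exp_map M (ch z) z"

abbreviation nz :: "'a \<Rightarrow> real^2 \<Rightarrow> real" where "nz z \<equiv> \<nu> (ch z) (snd (ch z) z)"

lemma ch_img: "snd (ch z) z \<in> img (ch z)" using ch by blast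

lemma nz_nonneg: "0 \<le> nz z v" by (rule gnorm_nonneg[OF ch(1) ch_img])

lemma nz_eq_0 [simp]: "nz z v = 0 \<longleftrightarrow> v = 0"
  using gnorm_pos[OF ch(1) ch_img, of v z] by (cases "v = 0") auto

lemma continuous_on_nz: "continuous_on T f \<Longrightarrow> continuous_on T (\<lambda>t. nz z (f t))"
  by (rule continuous_on_gnorm[OF ch(1)]) (use ch_img in auto)

text \<open>\<open>exp_map\<close> is a definite description; uniqueness of geodesics makes it
  denote the end point of any geodesic with the given initial velocity.\<close>

lemma exp_eq:
  assumes g: "geodesic_on M {0..1} \<gamma>" "\<gamma> 0 = z"
    and v: "((snd (ch z) \<circ> \<gamma>) has_vector_derivative v) (at 0 within {0..1})"
  shows "E z v = \<gamma> 1"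
  unfolding E_def exp_map_def
proof (rule the_equality)
  fix q assume "\<exists>\<gamma>. geodesic_on M {0..1} \<gamma> \<and> \<gamma> 0 = z \<and> \<gamma> 1 = q \<and>
     ((snd (ch z) \<circ> \<gamma>) has_vector_derivative v) (at 0 within {0..1})"
  then obtain \<gamma>' where g': "geodesic_on M {0..1} \<gamma>'" "\<gamma>' 0 = z" "\<gamma>' 1 = q"
     "((snd (ch z) \<circ> \<gamma>') has_vector_derivative v) (at 0 within {0..1})" by blast
  have "\<gamma>' 1 = \<gamma> 1"
    by (rule geodesic_unique[OF g'(1) g(1) ch(1)[of z] _ _ g'(4) v]) (use g'(2) g(2) ch(2)[of z] in simp_all)
  then show "q = \<gamma> 1" using g'(3) by simp
next
  show "\<exists>\<gamma>'. geodesic_on M {0..1} \<gamma>' \<and> \<gamma>' 0 = z \<and> \<gamma>' 1 = \<gamma> 1 \<and>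
     ((snd (ch z) \<circ> \<gamma>') has_vector_derivative v) (at 0 within {0..1})"
    by (intro exI[of _ \<gamma>] conjI g v refl)
qed

text \<open>The geodesic is restarted at time \<open>s0\<close> and run to time s, backwards if s is
  smaller. In the exponential chart at any of its own points a geodesic is thus a straight line
  through the origin.\<close>

lemma exp_along:
  assumes g: "geodesic_on M {0..1} \<gamma>" and s0: "s0 \<in> {0..1}" and z: "\<gamma> s0 = z"
    and v: "((snd (ch z) \<circ> \<gamma>) has_vector_derivative v) (at s0 within {0..1})" and s: "s \<in> {0..1}"
  shows "E z ((s - s0) *\<^sub>R v) = \<gamma> s"
proof -
  let ?h = "\<lambda>t. (s - s0) * t + s0"
  have h: "?h t \<in> {0..1}" if "t \<in> {0..1}" for t
  proof -
    have "?h t = (1 - t) * s0 + t * s" by (simp add: algebra_simps)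
    moreover have "(1 - t) * s0 + t * s \<le> (1 - t) * 1 + t * 1"
      using that s s0 by (intro add_mono mult_left_mono) auto
    ultimately show ?thesis using that s s0 by auto
  qed
  have "E z ((s - s0) *\<^sub>R v) = \<gamma> (?h 1)"
  proof (rule exp_eq[OF geodesic_affine[OF g h]])
    have "(?h has_vector_derivative (s - s0)) (at 0 within {0..1})" by (auto intro!: derivative_eq_intros)
    moreover have "?h ` {0..1} \<subseteq> {0..1}" using h by blast
    from has_vector_derivative_within_subset[OF v this]
    have "((snd (ch z) \<circ> \<gamma>) has_vector_derivative v) (at (?h 0) within ?h ` {0..1})" by simp
    ultimately show "((snd (ch z) \<circ> (\<lambda>t. \<gamma> (?h t))) has_vector_derivative (s - s0) *\<^sub>R v) (at 0 within {0..1})"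
      using vector_diff_chain_within[of ?h "s - s0" 0 "{0..1}"] by (simp add: o_def)
  qed (use z in auto)
  then show ?thesis by simp
qed

text \<open>The two-sided derivatives at 0 and 1 depend on values outside the interval, but two
  times do not affect the integral.\<close>

lemma curve_length_cong:
  assumes "\<And>t. t \<in> {0..1} \<Longrightarrow> \<gamma> t = \<gamma>' t"
  shows "curve_length M \<gamma> = curve_length M \<gamma>'"
  unfolding curve_length_def
proof (rule integral_spike[where S = "{0,1}"])
  fix t :: real assume "t \<in> {0..1} - {0,1}"
  then show "speed M \<gamma>' t = speed M \<gamma> t"
    by (intro speed_cong[of "{0<..<1}"]) (use assms in auto)
qed auto

lemma geodesic_cong:
  assumes g: "geodesic_on M I \<gamma>" and eq: "\<And>t. t \<in> I \<Longrightarrow> \<gamma>' t = \<gamma> t"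
  shows "geodesic_on M I \<gamma>'"
proof (rule geodesic_onI)
  show "continuous_on I \<gamma>'"
    by (rule continuous_on_eq[of I \<gamma>]) (use assms in \<open>simp_all add: geodesic_on_def\<close>)
  fix c assume c: "c \<in> atlas M"
  obtain u where u: "\<And>t. t \<in> I \<Longrightarrow> \<gamma> t \<in> fst c \<Longrightarrow> ((snd c \<circ> \<gamma>) has_vector_derivative u t) (at t within I)"
    "\<And>t. t \<in> I \<Longrightarrow> \<gamma> t \<in> fst c \<Longrightarrow> (u has_vector_derivative geo_acc c (snd c (\<gamma> t)) (u t)) (at t within I)"
    using geodesic_velocity[OF g c] by metis
  have "((snd c \<circ> \<gamma>') has_vector_derivative u t) (at t within I)" if "t \<in> I" "\<gamma>' t \<in> fst c" for t
    by (rule has_vector_derivative_transform[where f = "snd c \<circ> \<gamma>"]) (use that eq u in auto)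
  then show "\<exists>u. \<forall>t\<in>I. \<gamma>' t \<in> fst c \<longrightarrow> ((snd c \<circ> \<gamma>') has_vector_derivative u t) (at t within I) \<and>
       (u has_vector_derivative geo_acc c (snd c (\<gamma>' t)) (u t)) (at t within I)"
    using u(2) eq by (intro exI[of _ u]) auto
qed

lemma minimal_geodesic_cong:
  "minimal_geodesic M p q \<gamma> \<Longrightarrow> (\<And>t. t \<in> {0..1} \<Longrightarrow> \<gamma>' t = \<gamma> t) \<Longrightarrow> minimal_geodesic M p q \<gamma>'"
  unfolding minimal_geodesic_def using geodesic_cong[of "{0..1}" \<gamma> \<gamma>'] curve_length_cong[of \<gamma>' \<gamma>] by simp

lemma minimal_geodesic_reverse:
  assumes g: "minimal_geodesic M p q \<gamma>"
  shows "minimal_geodesic M q p (\<lambda>t. \<gamma> (-1 * t + 1))"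
proof -
  have geo: "geodesic_on M {0..1} \<gamma>" using g by (simp add: minimal_geodesic_def)
  have im: "(\<lambda>t::real. -1 * t + 1) ` {0..1} = {0..1}"
    using image_affinity_atLeastAtMost[of "-1::real" 1 0 1] by simp
  have "geodesic_on M {0..1} (\<lambda>t. \<gamma> (-1 * t + 1))" by (rule geodesic_affine[OF geo]) auto
  moreover have "curve_length M (\<lambda>t. \<gamma> (-1 * t + 1)) = curve_length M \<gamma>"
    unfolding curve_length_def by (rule length_affine[OF C1_curve_pwC1[OF geodesic_C1[OF geo]] _ im]) auto
  ultimately show ?thesis using g by (simp add: minimal_geodesic_def rdist_sym[of q p])
qed

lemma minimal_geodesic_const: "minimal_geodesic M p p (\<lambda>t. p)"
proof -
  have "((snd (ch p) \<circ> (\<lambda>t. p)) has_vector_derivative 0) (at 0 within {0..1})" by (simp add: o_def)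
  from geodesic_speed(1)[OF geodesic_const ch(1) _ ch(2) this]
  show ?thesis by (simp add: minimal_geodesic_def geodesic_const)
qed

end

section \<open>Exponential charts and minimal segments at scale \<delta>\<close>

locale delta_surface = riem_surface M for M :: "'a::{t2_space,second_countable_topology} riemannian_structure" +
  fixes \<delta> :: real
  assumes delta_pos: "0 < \<delta>"
    and delta_le: "ereal \<delta> \<le> min (inj_radius M / 6) (convexity_radius M)"
begin

lemma strongly_convex: 
  assumes "r < \<delta>" shows "strongly_convex_disk M (disk M p r)"
proof -
  have "ereal r < ereal \<delta>" using assms by simp
  also have "ereal \<delta> \<le> convexity_radius M" using delta_le by simp
  finally have "ereal r < convexity_radius M" .
  then obtain \<rho> where "ereal r < ereal \<rho>" "\<forall>p r. r < \<rho> \<longrightarrow> strongly_convex_disk M (disk M p r)"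
    unfolding convexity_radius_def less_Sup_iff by blast
  then show ?thesis by simp
qed

lemma exp_radius: "\<exists>r>2 * \<delta>. diffeomorphism_onto_image M (tangent_ball M (ch z) z r) (E z)"
proof -
  \<comment> \<open>If the injectivity radius at z were at most 2\<delta>, a sixth of the global one
    would be at most \<delta>/3, against the assumption that it is at least \<delta>.\<close>
  have "ereal (2 * \<delta>) < inj_radius_at M z"
  proof (rule ccontr)
    assume "\<not> ereal (2 * \<delta>) < inj_radius_at M z"
    moreover have "inj_radius M \<le> inj_radius_at M z" unfolding inj_radius_def by (rule INF_lower) simp
    ultimately have "inj_radius M \<le> ereal (2 * \<delta>)" by (meson not_le order_trans)
    then have "inj_radius M / 6 \<le> ereal (2 * \<delta>) / 6" by (rule ereal_divide_right_mono) simp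
    moreover have "ereal (2 * \<delta>) / 6 = ereal (\<delta> / 3)"
      by (simp only: numeral_eq_ereal ereal_divide) simp
    moreover have "ereal \<delta> \<le> inj_radius M / 6" using delta_le by simp
    ultimately have "ereal \<delta> \<le> ereal (\<delta> / 3)" by (simp only:)
    then show False using delta_pos by simp
  qed
  then obtain r where r: "ereal (2 * \<delta>) < ereal r" "\<forall>c\<in>atlas M. z \<in> fst c \<longrightarrow>
        diffeomorphism_onto_image M (tangent_ball M c z r) (exp_map M c z)"
    unfolding inj_radius_at_def less_Sup_iff by blast
  then show ?thesis using ch[of z] unfolding E_def by auto
qed

text \<open>Two points of a closed disk of radius below \<delta> are less than 2\<delta> apart, so
  an exponential chart of radius above 2\<delta> at one of them reaches the other.\<close>

definition R :: "'a \<Rightarrow> real" where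
  "R z = (SOME r. r > 2 * \<delta> \<and> diffeomorphism_onto_image M (tangent_ball M (ch z) z r) (E z))"

definition B :: "'a \<Rightarrow> (real^2) set" where "B z = {v. nz z v < R z}"

lemma R_gt: "R z > 2 * \<delta>" and E_diffeo: "diffeomorphism_onto_image M (B z) (E z)"
proof -
  have 1: "R z > 2 * \<delta> \<and> diffeomorphism_onto_image M (tangent_ball M (ch z) z (R z)) (E z)"
    unfolding R_def using someI_ex[OF exp_radius[of z, unfolded Bex_def]] by blast
  then show "R z > 2 * \<delta>" by simp
  have "B z = tangent_ball M (ch z) z (R z)" by (simp add: B_def tangent_ball_def gnorm_def)
  then show "diffeomorphism_onto_image M (B z) (E z)" using 1 by simp
qed

lemma E_inj: "inj_on (E z) (B z)" and E_cont: "continuous_on (B z) (E z)" and E_open: "open (E z ` B z)"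
  using E_diffeo[of z] unfolding diffeomorphism_onto_image_def by blast+

text \<open>The Riemannian logarithm at z.\<close>

definition Lg :: "'a \<Rightarrow> 'a \<Rightarrow> real^2" where "Lg z = inv_into (B z) (E z)"

lemma Lg_E: "v \<in> B z \<Longrightarrow> Lg z (E z v) = v"
  unfolding Lg_def by (rule inv_into_f_f[OF E_inj])

lemma Lg_cont: "continuous_on (E z ` B z) (Lg z)"
proof -
  have "continuous (at q within E z ` B z) (Lg z)" if q: "q \<in> E z ` B z" for q
  proof -
    obtain c where c: "c \<in> atlas M" "q \<in> fst c" using chart_at by blast
    let ?V = "fst c \<inter> E z ` B z"
    have V: "open ?V" using open_dom[OF c(1)] E_open by blast
    have "smooth_on (snd c ` ?V) (Lg z \<circ> chart_inv c)"
      using E_diffeo[of z] c(1) unfolding diffeomorphism_onto_image_def Lg_def by blast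
    then have "continuous_on (snd c ` ?V) (Lg z \<circ> chart_inv c)" by (rule smooth_on_continuous_on)
    then have "continuous_on ?V (\<lambda>p. (Lg z \<circ> chart_inv c) (snd c p))"
      by (rule continuous_on_compose2[OF _ continuous_on_subset[OF continuous_chart[OF c(1)]]]) auto
    then have "continuous_on ?V (Lg z)"
      by (rule continuous_on_eq) (simp add: chart_inv_snd[OF c(1)])
    then have "continuous (at q) (Lg z)" using V q c(2) by (simp add: continuous_on_eq_continuous_at)
    then show ?thesis by (rule continuous_at_imp_continuous_at_within)
  qed
  then show ?thesis by (simp add: continuous_on_eq_continuous_within)
qed

text \<open>An approximate midpoint is the centre of a disk of radius below \<delta> that contains
  both points, and strong convexity of this disk supplies the geodesic together with its
  uniqueness.\<close>

lemma minimal_exists_unique: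
  assumes "d a b < 2 * \<delta>" "a \<noteq> b"
  obtains \<gamma> where "minimal_geodesic M a b \<gamma>"
    "\<And>\<gamma>' t. minimal_geodesic M a b \<gamma>' \<Longrightarrow> t \<in> {0..1} \<Longrightarrow> \<gamma>' t = \<gamma> t"
proof -
  \<comment> \<open>Half of the slack between \<delta> and half the distance.\<close>
  define e where "e = (\<delta> - d a b / 2) / 2"
  have e: "e > 0" "d a b / 2 + e < \<delta>" using assms(1) by (auto simp: e_def field_simps)
  obtain m where m: "d a m = d a b / 2" "d m b < d a b - d a b / 2 + e"
    using approx_between[of "d a b / 2" a b e] e(1) rdist_nonneg[of a b] by (metis divide_nonneg_pos field_sum_of_halves le_add_same_cancel1 zero_less_numeral)
  have "a \<in> disk M m (d a b / 2 + e)" "b \<in> disk M m (d a b / 2 + e)"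
    using m e(1) rdist_sym[of a m] by (auto simp: disk_def)
  then have "a \<in> closure (disk M m (d a b / 2 + e))" "b \<in> closure (disk M m (d a b / 2 + e))"
    using closure_subset by blast+
  then show ?thesis
    using strongly_convex[OF e(2), of m] assms(2) that unfolding strongly_convex_disk_def by metis
qed

text \<open>The minimal geodesic is written with exponential and logarithm instead of being chosen,
  so that joint continuity in the end point and the parameter can be read off.\<close>

definition seg :: "'a \<Rightarrow> 'a \<Rightarrow> real \<Rightarrow> 'a" where
  "seg a b t = E a (t *\<^sub>R Lg a b)"

lemma geodesic_velocity_at:
  assumes "geodesic_on M {0..1} \<gamma>" "s \<in> {0..1}" "\<gamma> s = z"
  obtains v where "((snd (ch z) \<circ> \<gamma>) has_vector_derivative v) (at s within {0..1})"
  using geodesic_velocity[OF assms(1) ch(1)[of z]] assms(2,3) ch(2)[of z] by metis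

text \<open>The length is below 2\<delta>, so the whole segment stays in the injective exponential
  chart at each of its own points. There it is a straight line, and the logarithm is linear along
  it.\<close>

lemma minimal_through:
  assumes g: "minimal_geodesic M a b \<gamma>" and ab: "d a b < 2 * \<delta>" and s0: "s0 \<in> {0..1}" "\<gamma> s0 = z"
    and v: "((snd (ch z) \<circ> \<gamma>) has_vector_derivative v) (at s0 within {0..1})"
  shows "nz z v = d a b" "s \<in> {0..1} \<Longrightarrow> \<gamma> s = E z ((s - s0) *\<^sub>R v)" 
    "s \<in> {0..1} \<Longrightarrow> (s - s0) *\<^sub>R v \<in> B z" "s \<in> {0..1} \<Longrightarrow> Lg z (\<gamma> s) = (s - s0) *\<^sub>R v"
proof -
  have geo: "geodesic_on M {0..1} \<gamma>" "curve_length M \<gamma> = d a b" using g by (auto simp: minimal_geodesic_def)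
  show n: "nz z v = d a b"
    using geodesic_speed(1)[OF geo(1) ch(1)[of z] s0(1) _ v] s0(2) ch(2)[of z] geo(2) by simp
  show 1: "\<gamma> s = E z ((s - s0) *\<^sub>R v)" if s: "s \<in> {0..1}" 
    using exp_along[OF geo(1) s0 v s] by simp
  show 2: "(s - s0) *\<^sub>R v \<in> B z" if s: "s \<in> {0..1}"
  proof -
    have "\<bar>s - s0\<bar> * d a b \<le> 1 * d a b" using s s0(1) by (intro mult_right_mono) auto
    then show ?thesis using ab R_gt[of z] by (simp add: B_def gnorm_scale n)
  qed
  show "Lg z (\<gamma> s) = (s - s0) *\<^sub>R v" if s: "s \<in> {0..1}"
    unfolding 1[OF s] by (rule Lg_E[OF 2[OF s]])
qed

lemma minimal_eq_seg:
  assumes g: "minimal_geodesic M a b \<gamma>" and ab: "d a b < 2 * \<delta>" and t: "t \<in> {0..1}"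
  shows "\<gamma> t = seg a b t"
proof -
  have geo: "geodesic_on M {0..1} \<gamma>" "\<gamma> 0 = a" "\<gamma> 1 = b" using g by (auto simp: minimal_geodesic_def)
  obtain v where v: "((snd (ch a) \<circ> \<gamma>) has_vector_derivative v) (at 0 within {0..1})"
    using geodesic_velocity_at[OF geo(1) _ geo(2)] by auto
  have "Lg a (\<gamma> 1) = (1 - 0) *\<^sub>R v" by (rule minimal_through(4)[OF g ab _ geo(2) v]) auto
  moreover have "\<gamma> t = E a ((t - 0) *\<^sub>R v)" by (rule minimal_through(2)[OF g ab _ geo(2) v t]) auto
  ultimately show ?thesis using geo by (simp add: seg_def)
qed

lemma seg_minimal:
  assumes ab: "d a b < 2 * \<delta>" shows "minimal_geodesic M a b (seg a b)"
proof -
  obtain \<gamma> where g: "minimal_geodesic M a b \<gamma>"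
    using minimal_exists_unique[OF ab] minimal_geodesic_const by metis
  show ?thesis by (rule minimal_geodesic_cong[OF g]) (use minimal_eq_seg[OF g ab] in simp)
qed

lemma seg_ends: assumes "d a b < 2 * \<delta>" shows "seg a b 0 = a" "seg a b 1 = b"
  using seg_minimal[OF assms] by (auto simp: minimal_geodesic_def)

lemma seg_dist:
  assumes "d a b < 2 * \<delta>" "s \<in> {0..1}" "t \<in> {0..1}"
  shows "d (seg a b s) (seg a b t) = d a b * \<bar>t - s\<bar>"
  by (rule minimal_geodesic_dist[OF seg_minimal[OF assms(1)] assms(2,3)])

lemma seg_dist_left: "d a b < 2 * \<delta> \<Longrightarrow> t \<in> {0..1} \<Longrightarrow> d a (seg a b t) = d a b * t"
  using seg_dist[of a b 0 t] seg_ends[of a b] by simp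

lemma seg_dist_right: "d a b < 2 * \<delta> \<Longrightarrow> t \<in> {0..1} \<Longrightarrow> d (seg a b t) b = d a b * (1 - t)"
  using seg_dist[of a b t 1] seg_ends[of a b] by simp

lemma seg_cont: "d a b < 2 * \<delta> \<Longrightarrow> continuous_on {0..1} (seg a b)"
  using seg_minimal[of a b] by (auto simp: minimal_geodesic_def geodesic_on_def)

lemma seg_sym:
  assumes ab: "d a b < 2 * \<delta>" "t \<in> {0..1}" shows "seg b a t = seg a b (1 - t)"
proof -
  have "d b a < 2 * \<delta>" using ab rdist_sym by simp
  from minimal_eq_seg[OF minimal_geodesic_reverse[OF seg_minimal[OF ab(1)]] this ab(2)]
  show ?thesis by (simp add: algebra_simps)
qed

lemma seg_through:
  assumes ab: "d a b < 2 * \<delta>" and s0: "s0 \<in> {0..1}" "seg a b s0 = z"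
  obtains v where "((snd (ch z) \<circ> seg a b) has_vector_derivative v) (at s0 within {0..1})"
    "nz z v = d a b" "\<And>s. s \<in> {0..1} \<Longrightarrow> seg a b s = E z ((s - s0) *\<^sub>R v)"
    "\<And>s. s \<in> {0..1} \<Longrightarrow> (s - s0) *\<^sub>R v \<in> B z" "\<And>s. s \<in> {0..1} \<Longrightarrow> Lg z (seg a b s) = (s - s0) *\<^sub>R v"
proof -
  note m = seg_minimal[OF ab]
  have geo: "geodesic_on M {0..1} (seg a b)" using m by (simp add: minimal_geodesic_def)
  obtain v where v: "((snd (ch z) \<circ> seg a b) has_vector_derivative v) (at s0 within {0..1})"
    using geodesic_velocity_at[OF geo s0] by blast
  show ?thesis by (rule that[OF v]) (use minimal_through[OF m ab s0 v] in auto)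
qed

lemma Lg:
  assumes "d z q < 2 * \<delta>"
  shows Lg_B: "Lg z q \<in> B z" and E_Lg: "E z (Lg z q) = q" and nz_Lg: "nz z (Lg z q) = d z q"
    and Lg_seg: "t \<in> {0..1} \<Longrightarrow> Lg z (seg z q t) = t *\<^sub>R Lg z q"
proof -
  obtain v where v: "nz z v = d z q" "\<And>s. s \<in> {0..1} \<Longrightarrow> seg z q s = E z ((s - 0) *\<^sub>R v)"
    "\<And>s. s \<in> {0..1} \<Longrightarrow> (s - 0) *\<^sub>R v \<in> B z" "\<And>s. s \<in> {0..1} \<Longrightarrow> Lg z (seg z q s) = (s - 0) *\<^sub>R v"
    by (rule seg_through[OF assms, of 0 z]) (use seg_ends[OF assms] in simp, simp add: seg_ends[OF assms], blast)
  have Lv: "Lg z q = v" using v(4)[of 1] seg_ends[OF assms] by simp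
  show "Lg z q \<in> B z" "E z (Lg z q) = q" "nz z (Lg z q) = d z q"
    using v(1) v(2,3)[of 1] seg_ends[OF assms] Lv by auto
  show "Lg z (seg z q t) = t *\<^sub>R Lg z q" if "t \<in> {0..1}" using v(4)[OF that] Lv by simp
qed

lemma disk_sub_E: "disk M z (2 * \<delta>) \<subseteq> E z ` B z"
proof
  fix q assume "q \<in> disk M z (2 * \<delta>)"
  then have "d z q < 2 * \<delta>" by (simp add: disk_def)
  from E_Lg[OF this] Lg_B[OF this] show "q \<in> E z ` B z" by (metis imageI)
qed

lemma Lg_self: "Lg z z = 0"
proof -
  have "d z z < 2 * \<delta>" using delta_pos by simp
  from nz_Lg[OF this] show ?thesis by simp
qed

lemma continuous_on_Lg:
  assumes "continuous_on T f" "\<And>t. t \<in> T \<Longrightarrow> d z (f t) < 2 * \<delta>"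
  shows "continuous_on T (\<lambda>t. Lg z (f t))"
  by (rule continuous_on_compose2[OF Lg_cont assms(1)]) (use assms(2) disk_sub_E[of z] in \<open>auto simp: disk_def\<close>)

lemma B_scale: "v \<in> B z \<Longrightarrow> \<bar>k\<bar> \<le> 1 \<Longrightarrow> k *\<^sub>R v \<in> B z"
  using mult_right_mono[of "\<bar>k\<bar>" 1 "nz z v"] nz_nonneg[of z v] by (auto simp: B_def gnorm_scale)

lemma continuous_on_seg:
  assumes f: "continuous_on T f" "\<And>t. t \<in> T \<Longrightarrow> d a (f t) < 2 * \<delta>"
    and g: "continuous_on T g" "\<And>t. t \<in> T \<Longrightarrow> g t \<in> {0..1}"
  shows "continuous_on T (\<lambda>t. seg a (f t) (g t))"
  unfolding seg_def
proof (rule continuous_on_compose2[OF E_cont])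
  show "continuous_on T (\<lambda>t. g t *\<^sub>R Lg a (f t))"
    by (intro continuous_intros continuous_on_Lg f g)
  show "(\<lambda>t. g t *\<^sub>R Lg a (f t)) ` T \<subseteq> B a"
  proof (intro image_subsetI B_scale Lg_B f)
    show "\<bar>g t\<bar> \<le> 1" if "t \<in> T" for t using g(2)[OF that] by simp
  qed
qed

text \<open>The geodesic provided by strong convexity is \<open>seg\<close> by uniqueness, since the
  two end points are less than 2\<delta> apart.\<close>

lemma disk_convex:
  assumes r: "r < \<delta>" and a: "a \<in> closure (disk M c r)" and b: "b \<in> closure (disk M c r)" and ab: "a \<noteq> b"
    and t: "0 < t" "t < 1"
  shows "d c (seg a b t) < r"
proof -
  obtain \<gamma> where g: "minimal_geodesic M a b \<gamma>" "\<gamma> ` {0<..<1} \<subseteq> interior (disk M c r)"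
    using strongly_convex[OF r, of c] a b ab unfolding strongly_convex_disk_def by blast
  have cl: "d c q \<le> r" if "q \<in> closure (disk M c r)" for q
  proof -
    have "closure (disk M c r) \<subseteq> {q. d c q \<le> r}"
      by (rule closure_minimal) (auto simp: disk_def intro!: closed_Collect_le continuous_intros)
    then show ?thesis using that by blast
  qed
  have "d a b < 2 * \<delta>" using rdist_triangle[of a b c] cl[OF a] cl[OF b] rdist_sym[of a c] r by linarith
  from minimal_eq_seg[OF g(1) this, of t] have "seg a b t = \<gamma> t" using t by simp
  moreover have "\<gamma> t \<in> disk M c r" using g(2) t interior_subset by fastforce
  ultimately show ?thesis by (simp add: disk_def)
qed

end

section \<open>Broken minimal geodesics and the absence of branching\<close>

lemma vector_derivative_slope:
  fixes f :: "real \<Rightarrow> 'b::real_normed_vector"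
  assumes "(f has_vector_derivative D) (at t0 within I)"
  shows "((\<lambda>s. (f s - f t0) /\<^sub>R (s - t0)) \<longlongrightarrow> D) (at t0 within I)"
proof -
  have "((\<lambda>y. (1 / norm (y - t0)) *\<^sub>R (f y - (f t0 + (y - t0) *\<^sub>R D))) \<longlongrightarrow> 0) (at t0 within I)"
    using assms unfolding has_vector_derivative_def has_derivative_within by blast
  then have 0: "((\<lambda>y. norm ((1 / norm (y - t0)) *\<^sub>R (f y - (f t0 + (y - t0) *\<^sub>R D)))) \<longlongrightarrow> 0) (at t0 within I)"
    by (rule tendsto_norm_zero)
  have eq: "norm ((1 / norm (y - t0)) *\<^sub>R (f y - (f t0 + (y - t0) *\<^sub>R D))) = norm ((f y - f t0) /\<^sub>R (y - t0) - D)"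
    if "y \<noteq> t0" for y
  proof -
    have "(f y - f t0) /\<^sub>R (y - t0) - D = (f y - (f t0 + (y - t0) *\<^sub>R D)) /\<^sub>R (y - t0)"
      using that unfolding diff_diff_eq[symmetric] by (simp add: scaleR_right_diff_distrib[of _ "f y - f t0"])
    then show ?thesis by (simp add: divide_inverse)
  qed
  have "\<forall>\<^sub>F y in at t0 within I. norm ((1 / norm (y - t0)) *\<^sub>R (f y - (f t0 + (y - t0) *\<^sub>R D)))
       = norm ((f y - f t0) /\<^sub>R (y - t0) - D)"
    unfolding eventually_at_filter by (rule always_eventually) (use eq in auto)
  from Lim_transform_eventually[OF 0 this]
  have "((\<lambda>y. (f y - f t0) /\<^sub>R (y - t0) - D) \<longlongrightarrow> 0) (at t0 within I)"
    by (simp add: tendsto_norm_zero_iff)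
  then show ?thesis by (rule LIM_zero_cancel)
qed

lemma norm_mult_le:
  fixes A :: "real^2^2"
  shows "norm (A *v e) \<le> 2 * norm A * norm e"
proof -
  have "\<bar>(A *v e) $ i\<bar> \<le> norm A * norm e" for i
  proof -
    have "\<bar>(A *v e) $ i\<bar> \<le> norm (A $ i) * norm e"
      by (simp add: matrix_vector_mul_component Cauchy_Schwarz_ineq2)
    also have "\<dots> \<le> norm A * norm e"
      by (intro mult_right_mono Finite_Cartesian_Product.norm_nth_le) auto
    finally show ?thesis .
  qed
  then have "(\<Sum>i\<in>UNIV. \<bar>(A *v e) $ i\<bar>) \<le> (\<Sum>i\<in>(UNIV::2 set). norm A * norm e)" by (intro sum_mono)
  then show ?thesis using norm_le_l1_cart[of "A *v e"] by simp
qed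

context riem_surface
begin

text \<open>Freezing the metric at w costs an error that is small compared with the Euclidean length
  of the chord, by continuity of the metric. This is the first-order comparison behind cutting
  corners.\<close>

lemma rdist_chart_near:
  assumes c: "c \<in> atlas M" "w \<in> fst c" and \<eta>: "\<eta> > 0"
  obtains \<rho> where "\<rho> > 0" "cball (snd c w) \<rho> \<subseteq> img c"
    "\<And>x y. x \<in> cball (snd c w) \<rho> \<Longrightarrow> y \<in> cball (snd c w) \<rho> \<Longrightarrow>
       d (chart_inv c x) (chart_inv c y) \<le> \<nu> c (snd c w) (y - x) + \<eta> * norm (y - x)"
proof -
  let ?w = "snd c w"
  have w: "?w \<in> img c" using c by blast
  have "continuous (at ?w) (metric M c)"
    using smooth_on_continuous_on[OF metric_smooth[OF c(1)]] open_img[OF c(1)] c(2) by (simp add: continuous_on_eq_continuous_at)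
  \<comment> \<open>The bound \<eta>^2/2 is doubled by \<open>norm_mult_le\<close>, and its square
    root then contributes \<eta> times the norm.\<close>
  then obtain e where e: "e > 0" "\<And>z. dist z ?w < e \<Longrightarrow> dist (metric M c z) (metric M c ?w) < \<eta>\<^sup>2 / 2"
    unfolding continuous_at_eps_delta using \<eta> by (metis half_gt_zero zero_less_power)
  obtain \<rho>0 where r0: "\<rho>0 > 0" "cball ?w \<rho>0 \<subseteq> img c" using open_img[OF c(1)] w open_contains_cball by blast
  define \<rho> where "\<rho> = min \<rho>0 (e/2)"
  have \<rho>: "\<rho> > 0" "cball ?w \<rho> \<subseteq> img c" using r0 e by (auto simp: \<rho>_def)
  have nu: "\<nu> c z v \<le> \<nu> c ?w v + \<eta> * norm v" if z: "z \<in> cball ?w \<rho>" for z v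
  proof -
    have "dist z ?w < e" using z e(1) by (simp add: \<rho>_def dist_commute)
    then have n: "norm (metric M c z - metric M c ?w) \<le> \<eta>\<^sup>2 / 2" using e(2)[of z] by (simp add: dist_norm)
    have "v \<bullet> ((metric M c z - metric M c ?w) *v v) \<le> norm v * norm ((metric M c z - metric M c ?w) *v v)"
      by (rule norm_cauchy_schwarz)
    also have "\<dots> \<le> norm v * (2 * norm (metric M c z - metric M c ?w) * norm v)"
      by (intro mult_left_mono norm_mult_le) auto
    also have "\<dots> \<le> norm v * (2 * (\<eta>\<^sup>2 / 2) * norm v)"
      using n by (intro mult_left_mono mult_right_mono) auto
    finally have "v \<bullet> (metric M c z *v v) \<le> v \<bullet> (metric M c ?w *v v) + (\<eta> * norm v)\<^sup>2"
      by (simp add: matrix_vector_mult_diff_rdistrib inner_diff_right power2_eq_square algebra_simps)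
    then have "\<nu> c z v \<le> sqrt ((\<nu> c ?w v)\<^sup>2 + (\<eta> * norm v)\<^sup>2)"
      using gnorm_square[OF c(1) w, of v] by (simp add: gnorm_def)
    also have "\<dots> \<le> \<nu> c ?w v + \<eta> * norm v"
      by (rule sqrt_sum_squares_le_sum) (use gnorm_nonneg[OF c(1) w] \<eta> in auto)
    finally show ?thesis .
  qed
  show ?thesis
  proof (rule that[OF \<rho>])
    fix x y assume xy: "x \<in> cball ?w \<rho>" "y \<in> cball ?w \<rho>"
    have seg: "closed_segment x y \<subseteq> cball ?w \<rho>" using xy by (intro closed_segment_subset) auto
    show "d (chart_inv c x) (chart_inv c y) \<le> \<nu> c ?w (y - x) + \<eta> * norm (y - x)"
      by (rule rdist_chart_upper[OF c(1)]) (use seg \<rho>(2) nu in blast)+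
  qed
qed

lemma gnorm_parallelogram:
  assumes "c \<in> atlas M" "x \<in> img c"
  shows "(\<nu> c x (u + v))\<^sup>2 + (\<nu> c x (u - v))\<^sup>2 = 2 * (\<nu> c x u)\<^sup>2 + 2 * (\<nu> c x v)\<^sup>2"
  unfolding gnorm_square[OF assms] inner_mult_expand by (simp add: algebra_simps)

end

context delta_surface
begin

text \<open>Cutting the corner at \<open>w\<close> along a straight chord in a chart shortens a broken geodesic to
  first order, unless there is no corner.\<close>

lemma no_corner:
  assumes xw: "x \<noteq> w" "d x w < 2 * \<delta>" and wy: "w \<noteq> y" "d w y < 2 * \<delta>"
    and sum: "d x w + d w y = d x y"
  obtains e where "nz w e = 1" "Lg w x = - d x w *\<^sub>R e" "Lg w y = d w y *\<^sub>R e"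
proof -
  define l1 l2 where "l1 = d x w" "l2 = d w y"
  have l: "l1 > 0" "l2 > 0" using rdist_pos xw(1) wy(1) by (auto simp: l1_l2_def)
  let ?c = "ch w" and ?w = "snd (ch w) w"
  note c = ch[of w]
  obtain u where u: "((snd ?c \<circ> seg x w) has_vector_derivative u) (at 1 within {0..1})" "nz w u = l1"
    "\<And>s. s \<in> {0..1} \<Longrightarrow> Lg w (seg x w s) = (s - 1) *\<^sub>R u"
    by (rule seg_through[OF xw(2), of 1 w]) (simp, simp add: seg_ends[OF xw(2)], simp add: l1_l2_def)
  obtain v where v: "((snd ?c \<circ> seg w y) has_vector_derivative v) (at 0 within {0..1})" "nz w v = l2"
    "\<And>s. s \<in> {0..1} \<Longrightarrow> Lg w (seg w y s) = (s - 0) *\<^sub>R v"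
    by (rule seg_through[OF wy(2), of 0 w]) (simp, simp add: seg_ends[OF wy(2)], simp add: l1_l2_def)
  \<comment> \<open>Unit directions of arrival at w and of departure from it.\<close>
  define a b where "a = u /\<^sub>R l1" "b = v /\<^sub>R l2"
  have ab1: "nz w a = 1" "nz w b = 1" using u(2) v(2) l by (auto simp: a_b_def gnorm_scale)
  let ?A = "\<lambda>h. seg x w (1 - h / l1)" and ?B = "\<lambda>h. seg w y (h / l2)"
  let ?X = "\<lambda>h. snd ?c (?A h)" and ?Y = "\<lambda>h. snd ?c (?B h)"
  have ev0: "\<forall>\<^sub>F h in at_right 0. 0 < h \<and> h < min l1 l2"
    using l by (intro eventually_conj eventually_at_right_less eventually_at_right_real[of 0 "min l1 l2", THEN eventually_mono]) auto
  have f1: "filterlim (\<lambda>h. 1 - h / l1) (at 1 within {0..1}) (at_right 0)"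
    unfolding filterlim_at
  proof
    have "((\<lambda>h. 1 - h / l1) \<longlongrightarrow> 1 - 0 / l1) (at_right 0)" by (intro tendsto_intros) (use l in auto)
    then show "((\<lambda>h. 1 - h / l1) \<longlongrightarrow> 1) (at_right 0)" by simp
    show "\<forall>\<^sub>F h in at_right 0. 1 - h / l1 \<in> {0..1} \<and> 1 - h / l1 \<noteq> 1"
      using ev0 by eventually_elim (use l in auto)
  qed
  have f2: "filterlim (\<lambda>h. h / l2) (at 0 within {0..1}) (at_right 0)"
    unfolding filterlim_at
  proof
    have "((\<lambda>h. h / l2) \<longlongrightarrow> 0 / l2) (at_right 0)" by (intro tendsto_intros) (use l in auto)
    then show "((\<lambda>h. h / l2) \<longlongrightarrow> 0) (at_right 0)" by simp
    show "\<forall>\<^sub>F h in at_right 0. h / l2 \<in> {0..1} \<and> h / l2 \<noteq> 0"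
      using ev0 by eventually_elim (use l in auto)
  qed
  have lim1: "((\<lambda>h. (?X h - ?w) /\<^sub>R (1 - h / l1 - 1)) \<longlongrightarrow> u) (at_right 0)"
    using filterlim_compose[OF vector_derivative_slope[OF u(1)] f1] seg_ends[OF xw(2)] by simp
  have lim2: "((\<lambda>h. (?Y h - ?w) /\<^sub>R (h / l2 - 0)) \<longlongrightarrow> v) (at_right 0)"
    using filterlim_compose[OF vector_derivative_slope[OF v(1)] f2] seg_ends[OF wy(2)] by simp
  \<comment> \<open>Rescaled coordinate chord between the points at distance h before and after w;
    it tends to a + b.\<close>
  define q where "q h = (?Y h - ?X h) /\<^sub>R h" for h
  have "((\<lambda>h. ((?Y h - ?w) /\<^sub>R (h / l2 - 0)) /\<^sub>R l2 + ((?X h - ?w) /\<^sub>R (1 - h / l1 - 1)) /\<^sub>R l1) \<longlongrightarrow> b + a) (at_right 0)"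
    unfolding a_b_def by (intro tendsto_intros lim1 lim2)
  moreover have "\<forall>\<^sub>F h in at_right 0. ((?Y h - ?w) /\<^sub>R (h / l2 - 0)) /\<^sub>R l2 + ((?X h - ?w) /\<^sub>R (1 - h / l1 - 1)) /\<^sub>R l1 = q h"
    using ev0
  proof eventually_elim
    case (elim h)
    have 1: "((?Y h - ?w) /\<^sub>R (h / l2 - 0)) /\<^sub>R l2 = (?Y h - ?w) /\<^sub>R h" using elim l by (simp add: field_simps)
    have 2: "((?X h - ?w) /\<^sub>R (1 - h / l1 - 1)) /\<^sub>R l1 = - ((?X h - ?w) /\<^sub>R h)" using elim l by (simp add: field_simps)
    show ?case unfolding 1 2 q_def by (simp add: scaleR_right_diff_distrib)
  qed
  ultimately have lq: "(q \<longlongrightarrow> b + a) (at_right 0)" by (rule Lim_transform_eventually)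
  have cn: "isCont (\<lambda>v. nz w v) z" for z
    using continuous_on_nz[of UNIV "\<lambda>v. v" w] by (simp add: continuous_on_eq_continuous_at)
  have key: "2 \<le> nz w (b + a) + \<eta> * norm (b + a)" if \<eta>: "\<eta> > 0" for \<eta>
  proof -
    obtain \<rho> where \<rho>: "\<rho> > 0" "cball ?w \<rho> \<subseteq> img ?c"
      "\<And>x y. x \<in> cball ?w \<rho> \<Longrightarrow> y \<in> cball ?w \<rho> \<Longrightarrow>
       d (chart_inv ?c x) (chart_inv ?c y) \<le> nz w (y - x) + \<eta> * norm (y - x)"
      using rdist_chart_near[OF c \<eta>] by metis
    let ?U = "chart_inv ?c ` ball ?w \<rho>"
    have oU: "open ?U" by (rule chart_inv_open[OF c(1)]) (use \<rho>(2) ball_subset_cball in auto)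
    have wU: "w \<in> ?U" using \<rho>(1) chart_inv_snd[OF c] by (intro image_eqI[of _ _ ?w]) auto
    have Uin: "p \<in> fst ?c \<and> snd ?c p \<in> cball ?w \<rho>" if p: "p \<in> ?U" for p
    proof -
      obtain y where y: "y \<in> ball ?w \<rho>" "p = chart_inv ?c y" using p by blast
      then have "y \<in> img ?c" using \<rho>(2) ball_subset_cball by blast
      then show ?thesis using y chart_inv_in[OF c(1), of y] snd_chart_inv[OF c(1), of y] by auto
    qed
    obtain \<epsilon> where \<epsilon>: "\<epsilon> > 0" "\<And>p. d w p < \<epsilon> \<Longrightarrow> p \<in> ?U" using oU wU unfolding open_iff_rdist by blast
    have "\<forall>\<^sub>F h in at_right 0. h < \<epsilon>" using eventually_at_right_real[OF \<epsilon>(1)] by (rule eventually_mono) simp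
    with ev0 have "\<forall>\<^sub>F h in at_right 0. 2 \<le> nz w (q h) + \<eta> * norm (q h)"
    proof eventually_elim
      case (elim h)
      have h: "h > 0" "1 - h / l1 \<in> {0..1}" "h / l2 \<in> {0..1}" using elim l by auto
      have dA: "d (?A h) w = h" using seg_dist_right[OF xw(2) h(2)] l xw(1) by (simp add: l1_l2_def)
      have dxA: "d x (?A h) = l1 - h" using seg_dist_left[OF xw(2) h(2)] l xw(1) by (simp add: l1_l2_def right_diff_distrib)
      have dB: "d w (?B h) = h" using seg_dist_left[OF wy(2) h(3)] l wy(1) by (simp add: l1_l2_def)
      have dBy: "d (?B h) y = l2 - h" using seg_dist_right[OF wy(2) h(3)] l wy(1) by (simp add: l1_l2_def right_diff_distrib)
      have AU: "?A h \<in> ?U" by (rule \<epsilon>(2)) (use dA elim rdist_sym[of w "?A h"] in simp)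
      have BU: "?B h \<in> ?U" by (rule \<epsilon>(2)) (use dB elim in simp)
      have "d x y \<le> d x (?A h) + d (?A h) (?B h) + d (?B h) y"
        using rdist_triangle[of x y "?A h"] rdist_triangle[of "?A h" y "?B h"] by linarith
      \<comment> \<open>A shorter connection would make the path from x to y shorter than
        \<open>d x y\<close>.\<close>
      then have "2 * h \<le> d (?A h) (?B h)" using dxA dBy sum by (simp add: l1_l2_def)
      also have "d (?A h) (?B h) \<le> nz w (?Y h - ?X h) + \<eta> * norm (?Y h - ?X h)"
        using \<rho>(3)[of "?X h" "?Y h"] Uin[OF AU] Uin[OF BU] chart_inv_snd[OF c(1)] by auto
      also have "?Y h - ?X h = h *\<^sub>R q h" using h(1) by (simp add: q_def)
      also have "nz w (h *\<^sub>R q h) + \<eta> * norm (h *\<^sub>R q h) = h * (nz w (q h) + \<eta> * norm (q h))"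
        using h(1) by (simp add: gnorm_scale algebra_simps)
      finally show ?case using h(1) by (simp add: mult.commute[of 2])
    qed
    moreover have "((\<lambda>h. nz w (q h) + \<eta> * norm (q h)) \<longlongrightarrow> nz w (b + a) + \<eta> * norm (b + a)) (at_right 0)"
      by (intro tendsto_intros lq isCont_tendsto_compose[OF cn])
    ultimately show ?thesis
      by (intro tendsto_lowerbound[of "\<lambda>h. nz w (q h) + \<eta> * norm (q h)" _ "at_right 0"]) auto
  qed
  have "2 \<le> nz w (b + a)"
  proof (rule field_le_epsilon)
    fix e :: real assume e: "e > 0"
    have "2 \<le> nz w (b + a) + (e / (norm (b + a) + 1)) * norm (b + a)"
      by (rule key) (use e in \<open>simp add: add_nonneg_pos\<close>)
    also have "(e / (norm (b + a) + 1)) * norm (b + a) \<le> e"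
    proof -
      have "norm (b + a) / (norm (b + a) + 1) \<le> 1" by (simp add: divide_le_eq_1 add_nonneg_pos)
      then have "e * (norm (b + a) / (norm (b + a) + 1)) \<le> e * 1" using e by (intro mult_left_mono) auto
      then show ?thesis by simp
    qed
    finally show "2 \<le> nz w (b + a) + e" by simp
  qed
  then have "4 \<le> (nz w (b + a))\<^sup>2" using power_mono[of 2 "nz w (b + a)" 2] by simp
  \<comment> \<open>Equality case of the triangle inequality: by the parallelogram law two unit
    vectors with a sum of norm at least 2 coincide.\<close>
  moreover have "(nz w (b + a))\<^sup>2 + (nz w (b - a))\<^sup>2 = 4"
    unfolding gnorm_parallelogram[OF c(1) ch_img] ab1 by simp
  ultimately have "(nz w (b - a))\<^sup>2 \<le> 0" by linarith
  then have "(nz w (b - a))\<^sup>2 = 0" using zero_le_power2 order_antisym by blast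
  then have "nz w (b - a) = 0" by (simp only: power_eq_0_iff)
  then have eq: "a = b" by simp
  show ?thesis
  proof (rule that[of a])
    have "Lg w x = - u" using u(3)[of 0] seg_ends[OF xw(2)] by simp
    then show "Lg w x = - d x w *\<^sub>R a" using xw(1) by (simp add: a_b_def l1_l2_def)
    have "Lg w y = v" using v(3)[of 1] seg_ends[OF wy(2)] by simp
    then show "Lg w y = d w y *\<^sub>R a" unfolding eq using wy(1) by (simp add: a_b_def l1_l2_def)
  qed (rule ab1)
qed

text \<open>Having no corner at w, both continuations leave in the direction of arrival from x;
  being equally long, they have the same logarithm at w.\<close>

lemma no_branch:
  assumes "x \<noteq> w" "d x w < 2 * \<delta>" "d w p < 2 * \<delta>" 
    "d x w + d w p = d x p" "d x w + d w q = d x q" "d w p = d w q"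
  shows "p = q"
proof (cases "w = p")
  case True then show ?thesis using assms(6) rdist_eq_0[of w q] by simp
next
  case False
  then have "w \<noteq> q" using assms(6) rdist_eq_0[of w q] rdist_eq_0[of w p] by metis
  obtain e where e: "Lg w x = - d x w *\<^sub>R e" "Lg w p = d w p *\<^sub>R e"
    using no_corner[OF assms(1,2) False assms(3,4)] by metis
  have dq: "d w q < 2 * \<delta>" using assms(3,6) by simp
  obtain e' where e': "Lg w x = - d x w *\<^sub>R e'" "Lg w q = d w q *\<^sub>R e'"
    using no_corner[OF assms(1,2) \<open>w \<noteq> q\<close> dq assms(5)] by metis
  have "d x w > 0" using rdist_pos assms(1) .
  then have "e = e'" using e(1) e'(1) assms(1) by auto
  then have "Lg w p = Lg w q" using e e' assms(6) by simp
  then show ?thesis using E_Lg[OF assms(3)] E_Lg[OF dq] by metis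
qed

lemma Lg_inj: "d z p < 2 * \<delta> \<Longrightarrow> d z q < 2 * \<delta> \<Longrightarrow> Lg z p = Lg z q \<Longrightarrow> p = q"
  using E_Lg by metis

lemma in_closure_disk: "d c q \<le> r \<Longrightarrow> 0 < r \<Longrightarrow> q \<in> closure (disk M c r)"
  using frontier_disk[of r c] closure_subset[of "disk M c r"]
  by (cases "d c q = r") (auto simp: circle_def disk_def frontier_def)

lemma seg_in_disk:
  assumes "0 < r" "r < \<delta>" "d c p \<le> r" "d c q \<le> r" "p \<noteq> q" "0 < t" "t < 1" shows "d c (seg p q t) < r"
  by (rule disk_convex[OF _ in_closure_disk in_closure_disk]) (use assms in auto)

end

section \<open>Geodesic triangles inscribed in small circles\<close>

locale disk_triangle = delta_surface M \<delta>
  for M :: "'a::{t2_space,second_countable_topology} riemannian_structure" and \<delta> :: real +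
  fixes c a b e :: 'a and r :: real
  assumes r: "r < \<delta>" and dist: "a \<noteq> b" "a \<noteq> e" "b \<noteq> e"
    and on_circle: "d c a = r" "d c b = r" "d c e = r"
begin

lemma r_pos: "r > 0"
  using on_circle dist rdist_nonneg[of c a] by (cases "r = 0") auto

lemma d_closed_disk: "d c p \<le> r \<Longrightarrow> d c q \<le> r \<Longrightarrow> d p q < 2 * \<delta>"
  using rdist_triangle[of p q c] rdist_sym[of p c] r by linarith

lemma chord_in_disk:
  assumes "d c p \<le> r" "d c q \<le> r" "p \<noteq> q" "0 < t" "t < 1" shows "d c (seg p q t) < r"
  by (rule seg_in_disk[OF r_pos r assms])

text \<open>The nearer of two circle points on one ray from z would be an inner point of a segment
  between points of the closed disk, hence strictly inside the circle.\<close>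

lemma not_on_ray:
  assumes z: "d c z \<le> r" and p: "d c p = r" and q: "d c q = r" and pq: "p \<noteq> q"
    and L: "Lg z p = \<alpha> *\<^sub>R v" "Lg z q = \<beta> *\<^sub>R v" and ab: "0 < \<alpha>" "\<alpha> \<le> \<beta>"
  shows False
proof -
  have dz: "d z p < 2 * \<delta>" "d z q < 2 * \<delta>" using d_closed_disk z p q by auto
  have \<beta>: "\<beta> > 0" using ab by simp
  have "p = E z (\<alpha> *\<^sub>R v)" using E_Lg[OF dz(1)] L by simp
  also have "\<alpha> *\<^sub>R v = (\<alpha> / \<beta>) *\<^sub>R Lg z q" using \<beta> L by simp
  finally have p': "p = seg z q (\<alpha> / \<beta>)" by (simp add: seg_def)
  show False
  proof (cases "\<alpha> = \<beta>")
    case True then show ?thesis using p' seg_ends[OF dz(2)] \<beta> pq by simp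
  next
    case False
    have "z \<noteq> q"
    proof
      assume "z = q"
      then have "\<beta> *\<^sub>R v = 0" using L(2) Lg_self by simp
      then have "v = 0" using \<beta> by simp
      then have "p = z" using L(1) nz_Lg[OF dz(1)] by simp
      then show False using \<open>z = q\<close> pq by simp
    qed
    then have "d c p < r"
      unfolding p' using z q ab False by (intro chord_in_disk) auto
    then show False using p by simp
  qed
qed

lemma not_on_ray':
  assumes z: "d c z \<le> r" and p: "d c p = r" and q: "d c q = r" and pq: "p \<noteq> q"
    and L: "Lg z p = \<alpha> *\<^sub>R v" "Lg z q = \<beta> *\<^sub>R v" 
  shows "\<alpha> * \<beta> \<le> 0"
proof (rule ccontr)
  assume "\<not> \<alpha> * \<beta> \<le> 0"
  then consider "0 < \<alpha>" "0 < \<beta>" | "\<alpha> < 0" "\<beta> < 0" by (auto simp: not_le zero_less_mult_iff)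
  then show False
  proof cases
    case 1
    then show False using not_on_ray[OF z p q pq L] not_on_ray[OF z q p pq[symmetric] L(2,1)]
      by (cases "\<alpha> \<le> \<beta>") auto
  next
    case 2
    have L': "Lg z p = (-\<alpha>) *\<^sub>R (-v)" "Lg z q = (-\<beta>) *\<^sub>R (-v)" using L by auto
    show False using 2 not_on_ray[OF z p q pq L'] not_on_ray[OF z q p pq[symmetric] L'(2,1)]
      by (cases "-\<alpha> \<le> -\<beta>") auto
  qed
qed

text \<open>Cone with apex a over the side from b to e: t runs along the side, s along the segment
  from the apex.\<close>

definition \<kappa> :: "real \<Rightarrow> real \<Rightarrow> 'a" where "\<kappa> s t = seg a (seg b e t) s"

lemma side_in_disk: "t \<in> {0..1} \<Longrightarrow> d c (seg b e t) \<le> r"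
  using chord_in_disk[of b e t] on_circle dist seg_ends[of b e] d_closed_disk[of b e]
  by (cases "t = 0 \<or> t = 1") (auto intro: less_imp_le)

lemma side_neq: assumes t: "t \<in> {0..1}" shows "seg b e t \<noteq> a"
proof (cases "t = 0 \<or> t = 1")
  case True then show ?thesis using seg_ends[of b e] d_closed_disk[of b e] on_circle dist by auto
next
  case False then show ?thesis using chord_in_disk[of b e t] on_circle dist t by auto
qed

lemma d_side: "t \<in> {0..1} \<Longrightarrow> d a (seg b e t) < 2 * \<delta>"
  using d_closed_disk side_in_disk on_circle by simp

lemma d_be: "d b e < 2 * \<delta>" and d_ab: "d a b < 2 * \<delta>" and d_ae: "d a e < 2 * \<delta>"
  using d_closed_disk on_circle by auto

lemma \<kappa>_interior: assumes "s \<in> {0<..<1}" "t \<in> {0..1}" shows "d c (\<kappa> s t) < r"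
  unfolding \<kappa>_def by (rule chord_in_disk) (use assms side_in_disk side_neq[of t] on_circle in auto)

lemma \<kappa>_in_disk: assumes "s \<in> {0..1}" "t \<in> {0..1}" shows "d c (\<kappa> s t) \<le> r"
proof -
  consider "s \<in> {0<..<1}" | "s = 0" | "s = 1" using assms by fastforce
  then show ?thesis
    using \<kappa>_interior[of s t] assms side_in_disk on_circle seg_ends[OF d_side[OF assms(2)]]
    by cases (auto simp: \<kappa>_def)
qed

lemma \<kappa>_side:
  assumes "s \<in> {0..1}"
  shows "t \<in> {0..1} \<Longrightarrow> \<kappa> 0 t = a" "t \<in> {0..1} \<Longrightarrow> \<kappa> 1 t = seg b e t" "\<kappa> s 0 = seg a b s" "\<kappa> s 1 = seg a e s"
  using seg_ends[OF d_side] seg_ends[OF d_be] by (auto simp: \<kappa>_def)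

lemma Lg_\<kappa>: "s \<in> {0..1} \<Longrightarrow> t \<in> {0..1} \<Longrightarrow> Lg a (\<kappa> s t) = s *\<^sub>R Lg a (seg b e t)"
  unfolding \<kappa>_def by (rule Lg_seg[OF d_side])

text \<open>Suppose a ray from a met the opposite side at q and, nearer, at z. In the exponential
  chart at z the ray and the side lie on one line, so a, b and e do as well. The two halves of this
  line are occupied by b and e, and by \<open>not_on_ray'\<close> the point a can share neither
  half.\<close>

lemma apex_rays_distinct:
  assumes t: "t \<in> {0..1}" "t' \<in> {0..1}" and k: "0 < k" "k \<le> 1"
    and eq: "Lg a (seg b e t') = k *\<^sub>R Lg a (seg b e t)"
  shows "t = t'"
proof (rule ccontr)
  assume neq: "t \<noteq> t'"
  let ?q = "seg b e t" and ?z = "seg b e t'"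
  have zq: "?z \<noteq> ?q"
  proof
    assume "?z = ?q"
    then have "d b e * \<bar>t - t'\<bar> = 0" using seg_dist[OF d_be t(2,1)] by simp
    then show False using neq dist rdist_eq_0[of b e] by simp
  qed
  have z: "?z = seg a ?q k"
    using E_Lg[OF d_side[OF t(2)]] eq by (simp add: seg_def)
  have k1: "k < 1"
  proof (rule ccontr)
    assume "\<not> k < 1"
    then have "k = 1" using k by simp
    then show False using z zq seg_ends[OF d_side[OF t(1)]] by simp
  qed
  \<comment> \<open>Being strictly inside the circle, z is neither b nor e, so these two lie on
    opposite rays from z.\<close>
  have zr: "d c ?z < r" unfolding z
    by (rule chord_in_disk) (use side_in_disk[OF t(1)] side_neq[OF t(1)] on_circle k k1 in auto)
  then have t': "0 < t'" "t' < 1"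
    using t(2) seg_ends[OF d_be] on_circle by (auto simp: less_le)
  obtain v where v: "\<And>s. s \<in> {0..1} \<Longrightarrow> Lg ?z (seg b e s) = (s - t') *\<^sub>R v"
    using seg_through[OF d_be t(2) refl] by metis
  obtain w where w: "\<And>s. s \<in> {0..1} \<Longrightarrow> Lg ?z (seg a ?q s) = (s - k) *\<^sub>R w"
    using seg_through[OF d_side[OF t(1)], of k ?z] z k by (metis atLeastAtMost_iff less_imp_le)
  have "(t - t') *\<^sub>R v = (1 - k) *\<^sub>R w"
    using v[OF t(1)] w[of 1] seg_ends[OF d_side[OF t(1)]] by simp
  then have "w = (1 / (1 - k)) *\<^sub>R (t - t') *\<^sub>R v" using k1 by simp
  then have la: "Lg ?z a = (- k * (t - t') / (1 - k)) *\<^sub>R v"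
    using w[of 0] seg_ends[OF d_side[OF t(1)]] by simp
  have lb: "Lg ?z b = (- t') *\<^sub>R v" and le: "Lg ?z e = (1 - t') *\<^sub>R v"
    using v[of 0] v[of 1] seg_ends[OF d_be] by auto
  define \<mu> where "\<mu> = - k * (t - t') / (1 - k)"
  have "\<mu> * (- t') \<le> 0" "\<mu> * (1 - t') \<le> 0"
    using not_on_ray'[OF _ on_circle(1,2) dist(1) la lb] not_on_ray'[OF _ on_circle(1,3) dist(2) la le] zr
    by (auto simp: \<mu>_def)
  then have "\<mu> = 0" using t' by (auto simp: mult_le_0_iff zero_le_mult_iff)
  then show False using neq k k1 by (simp add: \<mu>_def)
qed

text \<open>Logarithms at the apex reduce equality to two points of the opposite side on one ray,
  which fixes t; the distance from the apex then fixes s.\<close>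

lemma \<kappa>_inj:
  assumes s: "0 < s" "s \<le> 1" "0 < s'" "s' \<le> 1" and t: "t \<in> {0..1}" "t' \<in> {0..1}" and eq: "\<kappa> s t = \<kappa> s' t'"
  shows "s = s'" "t = t'"
proof -
  have *: "t = t'" if s: "0 < s" "s \<le> s'" "s' \<le> 1" and t: "t \<in> {0..1}" "t' \<in> {0..1}" and eq: "\<kappa> s t = \<kappa> s' t'" for s s' t t'
  proof -
    have "s *\<^sub>R Lg a (seg b e t) = s' *\<^sub>R Lg a (seg b e t')"
      using Lg_\<kappa>[of s t] Lg_\<kappa>[of s' t'] s t eq by simp
    then have "(1/s') *\<^sub>R s *\<^sub>R Lg a (seg b e t) = (1/s') *\<^sub>R s' *\<^sub>R Lg a (seg b e t')" by simp
    then have "Lg a (seg b e t') = (s / s') *\<^sub>R Lg a (seg b e t)" using s by simp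
    then show ?thesis using apex_rays_distinct[OF t, of "s / s'"] s by simp
  qed
  show tt: "t = t'"
    using *[of s s' t t'] *[of s' s t' t] s t eq by (cases "s \<le> s'") auto
  have "d a (\<kappa> s t) = d a (seg b e t) * s" "d a (\<kappa> s' t') = d a (seg b e t) * s'"
    unfolding \<kappa>_def tt using seg_dist_left[OF d_side] s t by auto
  moreover have "d a (seg b e t) \<noteq> 0" using side_neq[OF t(1)] rdist_eq_0[of a "seg b e t"] by metis
  ultimately show "s = s'" using eq by simp
qed

lemma \<kappa>_neq_a: assumes "0 < s" "s \<le> 1" "t \<in> {0..1}" shows "\<kappa> s t \<noteq> a"
proof
  assume "\<kappa> s t = a"
  then have "d a (seg b e t) * s = 0" using seg_dist_left[OF d_side, of t s] assms by (simp add: \<kappa>_def)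
  then show False using side_neq[OF assms(3)] rdist_eq_0[of a "seg b e t"] assms(1) by auto
qed

definition tri where "tri = (\<lambda>(s,t). \<kappa> s t) ` ({0..1} \<times> {0..1})"
definition tri_int where "tri_int = (\<lambda>(s,t). \<kappa> s t) ` ({0<..<1} \<times> {0<..<1})"
definition sides where "sides = seg a b ` {0..1} \<union> seg a e ` {0..1} \<union> seg b e ` {0..1}"

lemma continuous_on_\<kappa>: "continuous_on ({0..1} \<times> {0..1}) (\<lambda>(s,t). \<kappa> s t)"
  unfolding \<kappa>_def case_prod_beta
  by (rule continuous_on_seg)
    (use d_side in \<open>auto intro!: continuous_intros continuous_on_compose2[OF seg_cont[OF d_be]]\<close>)

lemma compact_tri: "compact tri"
  unfolding tri_def by (rule compact_continuous_image[OF continuous_on_\<kappa>]) (intro compact_Times compact_Icc)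

lemma tri_eq: "tri = tri_int \<union> sides"
proof
  show "tri \<subseteq> tri_int \<union> sides"
  proof
    fix p assume "p \<in> tri"
    then obtain s t where st: "s \<in> {0..1}" "t \<in> {0..1}" "p = \<kappa> s t" by (auto simp: tri_def)
    consider "s = 0" | "s = 1" | "t = 0" | "t = 1" | "s \<in> {0<..<1}" "t \<in> {0<..<1}" using st by fastforce
    then show "p \<in> tri_int \<union> sides"
    proof cases
      case 1
      then have "p = seg a b 0" using st \<kappa>_side[of 0] seg_ends[OF d_ab] by simp
      then show ?thesis by (auto simp: sides_def)
    next
      case 5
      then have "p \<in> tri_int" unfolding tri_int_def st(3) by (intro image_eqI[of _ _ "(s,t)"]) auto
      then show ?thesis by blast
    qed (use st \<kappa>_side in \<open>auto simp: sides_def\<close>)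
  qed
  have "tri_int \<subseteq> tri" unfolding tri_int_def tri_def by (rule image_mono) auto
  moreover have "seg a b s \<in> tri" "seg a e s \<in> tri" "seg b e s \<in> tri" if "s \<in> {0..1}" for s
    unfolding tri_def using that \<kappa>_side[of s] \<kappa>_side(2)[of 1 s]
    by (auto intro: image_eqI[of _ _ "(s,0)"] image_eqI[of _ _ "(s,1)"] image_eqI[of _ _ "(1,s)"])
  ultimately show "tri_int \<union> sides \<subseteq> tri" by (auto simp: sides_def)
qed

lemma tri_int_sides: "tri_int \<inter> sides = {}"
proof -
  { fix s t assume st: "s \<in> {0<..<1}" "t \<in> {0<..<1}" and x: "\<kappa> s t \<in> sides"
    from x consider s' where "s' \<in> {0..1}" "\<kappa> s t = \<kappa> s' 0" | s' where "s' \<in> {0..1}" "\<kappa> s t = \<kappa> s' 1"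
      | s' where "s' \<in> {0..1}" "\<kappa> s t = \<kappa> 1 s'"
      using \<kappa>_side by (auto simp: sides_def)
    then have False
    proof cases
      case 1
      show False
      proof (cases "s' = 0")
        case True then show False using 1 \<kappa>_side(1)[of 0 0] \<kappa>_neq_a[of s t] st by simp
      next
        case False then show False using \<kappa>_inj(2)[of s s' t 0] 1 st by auto
      qed
    next
      case 2
      show False
      proof (cases "s' = 0")
        case True then show False using 2 \<kappa>_side(1)[of 0 1] \<kappa>_neq_a[of s t] st by simp
      next
        case False then show False using \<kappa>_inj(2)[of s s' t 1] 2 st by auto
      qed
    next
      case 3 then show False using \<kappa>_inj(1)[of s 1 t s'] st by auto
    qed }
  then have *: "\<And>s t. s \<in> {0<..<1} \<Longrightarrow> t \<in> {0<..<1} \<Longrightarrow> \<kappa> s t \<notin> sides" by (rule notI)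
  show ?thesis
  proof (rule equals0I)
    fix p assume "p \<in> tri_int \<inter> sides"
    then obtain z where "z \<in> {0<..<1} \<times> {0<..<1}" "(case z of (s,t) \<Rightarrow> \<kappa> s t) \<in> sides" unfolding tri_int_def by blast
    then show False using *[of "fst z" "snd z"] by (simp add: case_prod_beta mem_Times_iff)
  qed
qed

lemma E_open_image: assumes "open W" "W \<subseteq> B z" shows "open (E z ` W)"
proof -
  have "E z ` W = E z ` B z \<inter> Lg z -` W"
    using assms(2) Lg_E by (auto simp: image_iff)
  then show ?thesis using continuous_open_preimage[OF Lg_cont E_open assms(1)] by simp
qed

text \<open>The cone is injective on the open square. Read in the exponential chart at c it becomes
  a map between plane sets, where invariance of domain applies.\<close>

lemma open_tri_int: "open tri_int"
proof -
  let ?U = "{0<..<1::real} \<times> {0<..<1::real}"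
  let ?\<Phi> = "\<lambda>(s,t). Lg c (\<kappa> s t)"
  have near: "d c (\<kappa> s t) < 2 * \<delta>" if "s \<in> {0..1}" "t \<in> {0..1}" for s t
    using \<kappa>_in_disk[OF that] r delta_pos by simp
  have cont: "continuous_on ?U ?\<Phi>"
    unfolding case_prod_beta
    by (rule continuous_on_Lg) (use near in \<open>auto intro!: continuous_on_subset[OF continuous_on_\<kappa>[unfolded case_prod_beta]]\<close>)
  have inj: "inj_on ?\<Phi> ?U"
  proof (rule inj_onI, clarify)
    fix s t s' t' :: real assume *: "s \<in> {0<..<1}" "t \<in> {0<..<1}" "s' \<in> {0<..<1}" "t' \<in> {0<..<1}"
      "Lg c (\<kappa> s t) = Lg c (\<kappa> s' t')"
    then have "\<kappa> s t = \<kappa> s' t'" by (intro Lg_inj[of c]) (auto intro: near)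
    then show "s = s' \<and> t = t'" using \<kappa>_inj[of s s' t t'] * by auto
  qed
  have "open (?\<Phi> ` ?U)"
    by (rule invariance_of_domain_gen[OF _ cont inj]) (auto intro: open_Times)
  moreover have "?\<Phi> ` ?U \<subseteq> B c"
    using Lg_B[OF near] by auto
  ultimately have "open (E c ` ?\<Phi> ` ?U)" by (rule E_open_image)
  moreover have "E c ` ?\<Phi> ` ?U = tri_int"
    unfolding tri_int_def image_image using E_Lg[OF near] by (intro image_cong) auto
  ultimately show ?thesis by simp
qed

lemma connected_tri_int: "connected tri_int"
  unfolding tri_int_def
  by (rule connected_continuous_image[OF continuous_on_subset[OF continuous_on_\<kappa>]])
    (auto intro!: connected_Times)

text \<open>Away from the sides the open triangle agrees with the compact one, so it is open and
  closed there.\<close>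

lemma tri_int_clopen:
  assumes "connected X" "X \<inter> sides = {}" "X \<inter> tri_int \<noteq> {}" shows "X \<subseteq> tri_int"
proof -
  have "openin (top_of_set X) (X \<inter> tri_int)" using open_tri_int by (rule openin_open_Int)
  moreover have "X \<inter> tri_int = X \<inter> tri" using assms(2) by (auto simp: tri_eq)
  then have "closedin (top_of_set X) (X \<inter> tri_int)"
    using closedin_closed_Int[OF compact_imp_closed[OF compact_tri]] by simp
  ultimately show ?thesis using assms(1,3) unfolding connected_clopen by blast
qed

lemma tri_int_nonempty: "tri_int \<noteq> {}"
  by (auto simp: tri_int_def)

lemma tri_int_component: "tri_int \<in> components (- sides)"
  unfolding in_components_maximal
  using tri_int_sides connected_tri_int tri_int_nonempty tri_int_clopen by blast

text \<open>A second component in the disk is ruled out by pushing one of its points y radially away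
  from a. The triangle is star-shaped about a, so the ray beyond y avoids it and stays in the
  component until its distance from a is 2r; no point of the disk is that far from a.\<close>

lemma component_in_disk:
  assumes C: "C \<in> components (- sides)" "C \<subseteq> disk M c r" shows "C = tri_int"
proof -
  have Cc: "connected C" "C \<noteq> {}" "C \<inter> sides = {}" 
    using C(1) in_components_connected in_components_nonempty in_components_subset by blast+
  have "C \<inter> tri_int \<noteq> {}"
  proof (rule ccontr)
    assume no: "\<not> C \<inter> tri_int \<noteq> {}"
    obtain y where y: "y \<in> C" using Cc(2) by blast
    have ytri: "y \<notin> tri" using y no Cc(3) by (auto simp: tri_eq)
    have dy: "d c y < r" using y C(2) by (auto simp: disk_def)
    define v where "v = Lg a y"
    have day: "d a y < 2 * r" using rdist_triangle[of a y c] rdist_sym[of a c] dy on_circle by simp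
    then have day': "d a y < 2 * \<delta>" using r by simp
    have nv: "nz a v = d a y" "E a v = y" using nz_Lg[OF day'] E_Lg[OF day'] by (auto simp: v_def)
    have "y \<noteq> a" using dy on_circle by auto
    then have dpos: "d a y > 0" using rdist_pos[of a y] by auto
    \<comment> \<open>The factor that stretches v to length 2r.\<close>
    define s1 where "s1 = 2 * r / d a y"
    have s1: "s1 > 1" using day dpos by (simp add: s1_def)
    have inB: "s *\<^sub>R v \<in> B a" if "s \<in> {1..s1}" for s
    proof -
      have "s * d a y \<le> s1 * d a y" using that dpos by (intro mult_right_mono) auto
      then have "s * d a y \<le> 2 * r" using \<open>y \<noteq> a\<close> by (simp add: s1_def)
      then show ?thesis using R_gt[of a] r nv that by (simp add: B_def gnorm_scale)
    qed
    define P where "P = (\<lambda>s. E a (s *\<^sub>R v)) ` {1..s1}"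
    have "connected P" unfolding P_def
      by (rule connected_continuous_image)
        (use inB in \<open>auto intro!: continuous_on_compose2[OF E_cont] continuous_intros\<close>)
    moreover have "P \<inter> tri = {}"
    proof (rule ccontr)
      assume "P \<inter> tri \<noteq> {}"
      then obtain p where p: "p \<in> P" "p \<in> tri" by blast
      obtain s where s: "s \<in> {1..s1}" "p = E a (s *\<^sub>R v)" using p(1) by (auto simp: P_def)
      obtain s' t where "s' \<in> {0..1}" "t \<in> {0..1}" "p = \<kappa> s' t" using p(2) by (auto simp: tri_def)
      with s have st: "s \<in> {1..s1}" "s' \<in> {0..1}" "t \<in> {0..1}" "E a (s *\<^sub>R v) = \<kappa> s' t" by auto
      have "s *\<^sub>R v = s' *\<^sub>R Lg a (seg b e t)"
        using Lg_E[OF inB[OF st(1)]] Lg_\<kappa>[OF st(2,3)] st(4) by simp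
      then have "(1/s) *\<^sub>R s *\<^sub>R v = (1/s) *\<^sub>R s' *\<^sub>R Lg a (seg b e t)" by simp
      then have "v = (s'/s) *\<^sub>R Lg a (seg b e t)" using st(1) by simp
      then have "y = \<kappa> (s'/s) t" using nv(2) by (simp add: \<kappa>_def seg_def)
      then have "y \<in> tri" unfolding tri_def using st by (intro image_eqI[of _ _ "(s'/s,t)"]) auto
      then show False using ytri by simp
    qed
    then have "P \<subseteq> - sides" by (auto simp: tri_eq)
    moreover have "y \<in> P" unfolding P_def using nv s1 by (intro image_eqI[of _ _ 1]) auto
    ultimately have "P \<subseteq> C" using C(1) y components_maximal by (metis disjoint_iff)
    moreover have "E a (s1 *\<^sub>R v) \<in> P" unfolding P_def using s1 by auto
    ultimately have q: "d c (E a (s1 *\<^sub>R v)) < r" (is "d c ?q < r") using C(2) by (auto simp: disk_def)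
    have "d a ?q < 2 * r" using rdist_triangle[of a ?q c] rdist_sym[of a c] q on_circle by simp
    moreover from this have "d a ?q < 2 * \<delta>" using r by simp
    then have "d a ?q = nz a (Lg a ?q)" using nz_Lg by simp
    moreover have "Lg a ?q = s1 *\<^sub>R v" by (rule Lg_E[OF inB]) (use s1 in auto)
    ultimately show False using nv s1 dpos \<open>y \<noteq> a\<close> by (auto simp: gnorm_scale s1_def)
  qed
  then have "C \<subseteq> tri_int" using tri_int_clopen Cc by blast
  then show ?thesis using C(1) tri_int_component components_eq by (metis Cc(2) Int_absorb2)
qed

lemma geodesic_sides_eq: "geodesic_sides M {a,b,e} = sides"
proof -
  have mg: "\<gamma> ` {0..1} = seg x y ` {0..1}" if "minimal_geodesic M x y \<gamma>" "d x y < 2 * \<delta>" for \<gamma> x y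
    by (rule image_cong[OF refl]) (rule minimal_eq_seg[OF that])
  have sym: "seg y x ` {0..1} = seg x y ` {0..1}" if xy: "d x y < 2 * \<delta>" for x y
  proof -
    have "seg y x ` {0..1} = seg x y ` (\<lambda>t. 1 - t) ` {0..1}"
      unfolding image_image by (rule image_cong[OF refl]) (rule seg_sym[OF xy])
    also have "(\<lambda>t. 1 - t) ` {0..1::real} = {0..1}" by (simp add: image_diff_atLeastAtMost)
    finally show ?thesis .
  qed
  have small: "d x y < 2 * \<delta>" if "x \<in> {a,b,e}" "y \<in> {a,b,e}" for x y
    using that on_circle d_closed_disk[of x y] by auto
  have "geodesic_sides M {a,b,e} = (\<Union>x\<in>{a,b,e}. \<Union>y\<in>{a,b,e}-{x}. seg x y ` {0..1})" (is "?L = ?R")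
  proof
    show "?L \<subseteq> ?R"
    proof
      fix p assume "p \<in> ?L"
      then obtain x y \<gamma> where p: "p \<in> \<gamma> ` {0..1}" "x \<in> {a,b,e}" "y \<in> {a,b,e}" "x \<noteq> y" "minimal_geodesic M x y \<gamma>"
        unfolding geodesic_sides_def by blast
      then have "p \<in> seg x y ` {0..1}" using mg[OF p(5) small[OF p(2,3)]] by blast
      then show "p \<in> ?R" using p(2-4) by blast
    qed
    show "?R \<subseteq> ?L"
    proof
      fix p assume "p \<in> ?R"
      then obtain x y where p: "p \<in> seg x y ` {0..1}" "x \<in> {a,b,e}" "y \<in> {a,b,e}" "x \<noteq> y" by blast
      then show "p \<in> ?L" using seg_minimal[OF small[OF p(2,3)]] unfolding geodesic_sides_def by blast
    qed
  qed
  also have "?R = sides"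
    using dist sym[OF d_ab] sym[OF d_ae] sym[OF d_be] unfolding sides_def by auto
  finally show ?thesis .
qed

text \<open>Exactly one component of the complement of the sides fits into the disk, so the filled
  triangle is the image of the cone.\<close>

lemma geodesic_triangle_eq: "geodesic_triangle M (disk M c r) {a,b,e} = tri"
proof -
  have "tri_int \<subseteq> disk M c r" using \<kappa>_interior by (auto simp: tri_int_def disk_def)
  then have "{C \<in> components (- sides). C \<subseteq> disk M c r} = {tri_int}"
    using component_in_disk tri_int_component by blast
  then show ?thesis unfolding geodesic_triangle_def geodesic_sides_eq tri_eq by auto
qed

end

section \<open>Delaunay edges do not cross\<close>

text \<open>Brouwer's theorem for x - g x, clamped to the square. Clamping could create a spurious
  fixed point only on the boundary, and there the sign conditions push inwards.\<close>

lemma poincare_miranda: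
  fixes g :: "real \<times> real \<Rightarrow> real \<times> real"
  assumes cont: "continuous_on ({0..1} \<times> {0..1}) g"
    and s0: "\<And>t. t \<in> {0..1} \<Longrightarrow> fst (g (0,t)) < 0" and s1: "\<And>t. t \<in> {0..1} \<Longrightarrow> fst (g (1,t)) > 0"
    and t0: "\<And>s. s \<in> {0..1} \<Longrightarrow> snd (g (s,0)) < 0" and t1: "\<And>s. s \<in> {0..1} \<Longrightarrow> snd (g (s,1)) > 0"
  obtains s t where "s \<in> {0..1}" "t \<in> {0..1}" "g (s,t) = 0"
proof -
  let ?Q = "{0..1::real} \<times> {0..1::real}"
  define cl where "cl y = max 0 (min 1 y)" for y :: real
  define f where "f x = (cl (fst x - fst (g x)), cl (snd x - snd (g x)))" for x
  have "continuous_on ?Q f" unfolding f_def cl_def by (intro continuous_intros cont)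
  moreover have "f \<in> ?Q \<rightarrow> ?Q" by (auto simp: f_def cl_def)
  moreover have "convex ?Q" "compact ?Q" by (auto intro: convex_Times compact_Times)
  moreover have "?Q \<noteq> {}" by auto
  ultimately obtain x where x: "x \<in> ?Q" "f x = x" using brouwer[of ?Q f] by blast
  obtain s t where st: "x = (s,t)" "s \<in> {0..1}" "t \<in> {0..1}" using x(1) by auto
  have c: "cl (s - fst (g (s,t))) = s" "cl (t - snd (g (s,t))) = t" using x(2) st by (auto simp: f_def)
  have z: "y = 0" if "cl (v - y) = v" "v \<in> {0..1}" "v = 0 \<longrightarrow> y < 0" "v = 1 \<longrightarrow> y > 0" for v y
    using that by (auto simp: cl_def max_def min_def split: if_splits)
  have "fst (g (s,t)) = 0" by (rule z[OF c(1)]) (use st s0 s1 in auto)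
  moreover have "snd (g (s,t)) = 0" by (rule z[OF c(2)]) (use st t0 t1 in auto)
  ultimately show ?thesis using that[OF st(2,3)] by (simp add: prod_eq_iff)
qed

text \<open>Two arcs that cross transversally once cannot be pulled apart as long as neither meets the
  end points of the other: the difference of the two arcs, as a map of the square, keeps its
  nonzero winding number along the boundary.\<close>

lemma crossing_arcs_not_separable:
  fixes A C :: "real \<times> real \<Rightarrow> real^2" and u v :: "real^2"
  assumes A: "continuous_on ({0..1} \<times> {0..1}) A" and C: "continuous_on ({0..1} \<times> {0..1}) C"
    and A0: "\<And>s. s \<in> {0..1} \<Longrightarrow> A (0,s) = (n s - s0) *\<^sub>R u"
    and C0: "\<And>t. t \<in> {0..1} \<Longrightarrow> C (0,t) = (n t - t0) *\<^sub>R v"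
    and n: "n 0 = (0::real)" "n 1 = 1" and s0: "0 < s0" "s0 < 1" and t0: "0 < t0" "t0 < 1"
    and indep: "\<And>x y. x *\<^sub>R u = y *\<^sub>R v \<Longrightarrow> x = 0 \<and> y = 0"
    and bdry: "\<And>h s t. h \<in> {0..1} \<Longrightarrow> s \<in> {0..1} \<Longrightarrow> t \<in> {0..1} \<Longrightarrow> s \<in> {0,1} \<or> t \<in> {0,1} \<Longrightarrow> A (h,s) \<noteq> C (h,t)"
    and sep: "\<And>s t. s \<in> {0..1} \<Longrightarrow> t \<in> {0..1} \<Longrightarrow> A (1,s) \<noteq> C (1,t)"
  shows False
proof -
  let ?I = "{0..1::real}"
  let ?Q = "?I \<times> ?I"
  define S where "S = ?Q \<inter> {x. fst x = 0 \<or> fst x = 1 \<or> snd x = 0 \<or> snd x = 1}"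
  define F where "F h x = A (h, fst x) - C (h, snd x)" for h :: real and x :: "real \<times> real"
  have cF: "continuous_on (?I \<times> ?Q) (\<lambda>y. F (fst y) (snd y))"
    unfolding F_def
    by (intro continuous_intros continuous_on_compose2[OF A] continuous_on_compose2[OF C]) auto
  have cl: "closedin (top_of_set ?Q) S"
    unfolding S_def by (intro closedin_closed_Int closed_Collect_disj closed_Collect_eq continuous_intros)
  have "continuous_on ?Q (\<lambda>x. F (fst (1::real, x)) (snd (1::real, x)))"
    by (rule continuous_on_compose2[OF cF]) (auto intro!: continuous_intros)
  then have c1: "continuous_on ?Q (F 1)" by simp
  have r1: "F 1 \<in> ?Q \<rightarrow> - {0}" using sep by (auto simp: F_def)
  have hom: "homotopic_with_canon (\<lambda>x. True) S (- {0}) (F 1) (F 0)"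
  proof -
    let ?h = "\<lambda>y. F (1 - fst y) (snd y)"
    have "continuous_on (?I \<times> S) (\<lambda>y. F (fst (1 - fst y, snd y)) (snd (1 - fst y, snd y)))"
      by (rule continuous_on_compose2[OF cF]) (auto intro!: continuous_intros simp: S_def)
    then have "continuous_on (?I \<times> S) ?h" by simp
    moreover have "F (1 - x) (y, y') \<noteq> 0" if "x \<in> ?I" "(y,y') \<in> S" for x y y'
      using bdry[of "1 - x" y y'] that by (auto simp: F_def S_def)
    ultimately show ?thesis
      unfolding homotopic_with_def
      by (intro exI[of _ ?h]) (auto simp: prod_topology_subtopology_eu continuous_map_subtopology_eu)
  qed
  \<comment> \<open>At h = 1 the difference of the arcs has no zero on the square, and its boundary
    values are homotopic without zeros to those at h = 0. Homotopy extension yields a zero-free map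
    of the square with the boundary values of the original crossing.\<close>
  obtain G where G: "continuous_on ?Q G" "G ` ?Q \<subseteq> - {0}" "\<And>x. x \<in> S \<Longrightarrow> G x = F 0 x"
  proof (rule Borsuk_homotopy_extension_homotopic[OF cl _ c1 r1 hom])
    show "ANR S \<and> ANR ?Q \<or> ANR (- {0::real^2})" using ENR_imp_ANR[OF open_imp_ENR[OF open_Compl[OF closed_singleton[of "0::real^2"]]]] by blast
  qed blast
  define D where "D = u$1 * v$2 - u$2 * v$1"
  have D: "D \<noteq> 0"
  proof
    assume D0: "D = 0"
    have "(v$2) *\<^sub>R u = (u$2) *\<^sub>R v" "(v$1) *\<^sub>R u = (u$1) *\<^sub>R v"
      using D0 by (auto simp: vec_eq_iff forall_2 D_def algebra_simps)
    then have "u$2 = 0" "u$1 = 0" using indep by blast+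
    then have "u = 0" by (simp add: vec_eq_iff forall_2)
    then show False using indep[of 1 0] by simp
  qed
  \<comment> \<open>Coordinates with respect to u and -v; in them the boundary values satisfy the
    sign conditions of \<open>poincare_miranda\<close>.\<close>
  define T where "T w = ((w$1 * v$2 - w$2 * v$1) / D, (w$1 * u$2 - w$2 * u$1) / D)" for w :: "real^2"
  have T0: "T (x *\<^sub>R u - y *\<^sub>R v) = (x,y)" for x y
  proof -
    have "(x * u$1 - y * v$1) * v$2 - (x * u$2 - y * v$2) * v$1 = x * D"
      "(x * u$1 - y * v$1) * u$2 - (x * u$2 - y * v$2) * u$1 = y * D" by (simp_all add: D_def algebra_simps)
    then show ?thesis using D by (simp add: T_def)
  qed
  have cT: "continuous_on ?Q (\<lambda>x. T (G x))" unfolding T_def using D by (intro continuous_intros G(1)) auto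
  have bd: "T (G (s,t)) = (n s - s0, n t - t0)" if "s \<in> ?I" "t \<in> ?I" "s \<in> {0,1} \<or> t \<in> {0,1}" for s t
  proof -
    have "(s,t) \<in> S" using that by (auto simp: S_def)
    then have "G (s,t) = (n s - s0) *\<^sub>R u - (n t - t0) *\<^sub>R v" using G(3) A0 C0 that by (simp add: F_def)
    then show ?thesis using T0 by simp
  qed
  obtain s t where st: "s \<in> ?I" "t \<in> ?I" "T (G (s,t)) = 0"
    by (rule poincare_miranda[OF cT]) (use bd n s0 t0 in auto)
  have "T w = 0 \<Longrightarrow> w = 0" for w
  proof -
    assume "T w = 0"
    then have e: "w$1 * v$2 = w$2 * v$1" "w$1 * u$2 = w$2 * u$1" using D by (auto simp: T_def zero_prod_def)
    have "w$1 * D = u$1 * (w$1 * v$2) - v$1 * (w$1 * u$2)" by (simp add: D_def algebra_simps)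
    also have "\<dots> = 0" unfolding e by (simp add: algebra_simps)
    finally have "w$1 = 0" using D by simp
    have "w$2 * D = v$2 * (w$2 * u$1) - u$2 * (w$2 * v$1)" by (simp add: D_def algebra_simps)
    also have "\<dots> = 0" unfolding e[symmetric] by (simp add: algebra_simps)
    finally show "w = 0" using D \<open>w$1 = 0\<close> by (simp add: vec_eq_iff forall_2)
  qed
  then show False using st G(2) by blast
qed

context delta_surface
begin

text \<open>Of two different points on one ray from z the nearer is an inner point of the segment
  from z to the farther. Convexity puts it into the open disk that has the farther one on its
  circle, but that disk may not contain it.\<close>

lemma same_ray_eq:
  assumes r: "r1 < \<delta>" "r2 < \<delta>" and z: "d o1 z < r1" "d o2 z < r2"
    and x: "d o1 x = r1" "r2 \<le> d o2 x" and y: "d o2 y = r2" "r1 \<le> d o1 y"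
    and L: "Lg z x = \<alpha> *\<^sub>R w" "Lg z y = \<beta> *\<^sub>R w" "0 < \<alpha>" "0 < \<beta>"
  shows "x = y"
proof -
  have dz: "d z x < 2 * \<delta>" "d z y < 2 * \<delta>"
    using rdist_triangle[of z x o1] rdist_triangle[of z y o2] rdist_sym[of z o1] rdist_sym[of z o2] z x y r by linarith+
  have *: False
    if r: "r2 < \<delta>" and z: "d o2 z < r2" and x: "r2 \<le> d o2 x" and y: "d o2 y = r2" 
      and dz: "d z x < 2 * \<delta>" "d z y < 2 * \<delta>"
      and L: "Lg z x = \<alpha> *\<^sub>R w" "Lg z y = \<beta> *\<^sub>R w" "0 < \<alpha>" "\<alpha> < \<beta>" for o2 r2 x y \<alpha> \<beta>
  proof -
    have "x = seg z y (\<alpha> / \<beta>)" using E_Lg[OF dz(1)] L by (simp add: seg_def)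
    moreover have "r2 > 0" using z rdist_nonneg[of o2 z] by linarith
    then have "d o2 (seg z y (\<alpha> / \<beta>)) < r2"
      by (intro seg_in_disk) (use r z y L in auto)
    ultimately show False using x by simp
  qed
  consider "\<alpha> < \<beta>" | "\<beta> < \<alpha>" | "\<alpha> = \<beta>" by linarith
  then show ?thesis
  proof cases
    case 1 then show ?thesis using *[of r2 o2 x y \<alpha> \<beta>] r z x y dz L by auto
  next
    case 2 then show ?thesis using *[of r1 o1 y x \<beta> \<alpha>] r z x y dz L by auto
  next
    case 3 then show ?thesis using Lg_inj[OF dz] L by simp
  qed
qed

text \<open>At a common point w of the two radii the triangle inequalities are tight: x and y are
  equally far from w, and both end a minimal continuation of the way from \<open>o1\<close> to w.
  Since minimal geodesics do not branch, w is \<open>o1\<close>; in the same way it is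
  \<open>o2\<close>.\<close>

lemma radii_disjoint:
  assumes r: "r1 < \<delta>" "r2 < \<delta>" 
    and x: "d o1 x = r1" "r2 \<le> d o2 x" and y: "d o2 y = r2" "r1 \<le> d o1 y" and xy: "x \<noteq> y"
    and l: "l \<in> {0..1}" and m: "m \<in> {0..1}" and eq: "seg o1 x l = seg o2 y m"
  shows "o1 = o2 \<and> r1 = r2"
proof -
  let ?w = "seg o1 x l"
  have dd: "d o1 x < 2 * \<delta>" "d o2 y < 2 * \<delta>" using r x y delta_pos by auto
  have w1: "d o1 ?w = r1 * l" "d ?w x = r1 * (1 - l)" using seg_dist_left[OF dd(1) l] seg_dist_right[OF dd(1) l] x by auto
  have w2: "d o2 ?w = r2 * m" "d ?w y = r2 * (1 - m)" unfolding eq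
    using seg_dist_left[OF dd(2) m] seg_dist_right[OF dd(2) m] y by auto
  have s1: "d o1 ?w + d ?w x = r1" "d o2 ?w + d ?w y = r2" using w1 w2 by (simp_all add: algebra_simps)
  have e: "d ?w x = d ?w y"
    using rdist_triangle[of o1 y ?w] rdist_triangle[of o2 x ?w] s1 x y by linarith
  have f: "d o1 ?w + d ?w y = d o1 y" "d o2 ?w + d ?w x = d o2 x"
    using rdist_triangle[of o1 y ?w] rdist_triangle[of o2 x ?w] s1 x y e by linarith+
  have rn: "0 \<le> r1" "0 \<le> r2" using x(1) y(1) rdist_nonneg by metis+
  have small: "d o1 ?w < 2 * \<delta>" "d o2 ?w < 2 * \<delta>" "d ?w x < 2 * \<delta>" "d ?w y < 2 * \<delta>"
    using s1 r rn rdist_nonneg[of o1 ?w] rdist_nonneg[of o2 ?w] rdist_nonneg[of ?w x] rdist_nonneg[of ?w y] by linarith+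
  have "o1 = ?w"
  proof (rule ccontr)
    assume "o1 \<noteq> ?w"
    from no_branch[OF this small(1,3), of y] show False using s1 x f e xy by simp
  qed
  moreover have "o2 = ?w"
  proof (rule ccontr)
    assume "o2 \<noteq> ?w"
    from no_branch[OF this small(2,3), of y] show False using s1 y f e xy by simp
  qed
  ultimately have w: "d o1 ?w = 0" "d o2 ?w = 0" "o1 = o2" using rdist_eq_0 by metis+
  then show ?thesis using s1 e by linarith
qed

text \<open>A common inner point z is viewed in the exponential chart at z. Parallel directions make
  the edges equal by \<open>same_ray_eq\<close>. A transversal crossing would survive the
  deformation to the paths through the centres, which can meet only if the disks are equal;
  \<open>gen\<close> excludes that case.\<close>

lemma edges_meet:
  assumes r: "r1 < \<delta>" "r2 < \<delta>" and ab: "a \<noteq> b" "d o1 a = r1" "d o1 b = r1" and pq: "p \<noteq> q" "d o2 p = r2" "d o2 q = r2"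
    and far: "r1 \<le> d o1 p" "r1 \<le> d o1 q" "r2 \<le> d o2 a" "r2 \<le> d o2 b"
    and gen: "\<not> (card {a,b,p,q} = 4 \<and> {a,b,p,q} \<subseteq> circle M o1 r1)"
    and s0: "s0 \<in> {0..1}" and t0: "t0 \<in> {0..1}" and eq: "seg a b s0 = seg p q t0"
  shows "{a,b} = {p,q} \<or> seg a b s0 \<in> {a,b} \<inter> {p,q}"
proof -
  have r1: "r1 > 0" using ab rdist_nonneg[of o1 a] by (cases "r1 = 0") auto
  have r2: "r2 > 0" using pq rdist_nonneg[of o2 p] by (cases "r2 = 0") auto
  have dab: "d a b < 2 * \<delta>" using rdist_triangle[of a b o1] rdist_sym[of a o1] ab r by linarith
  have dpq: "d p q < 2 * \<delta>" using rdist_triangle[of p q o2] rdist_sym[of p o2] pq r by linarith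
  have in1: "d o1 (seg a b s) < r1" if "0 < s" "s < 1" for s
    by (rule seg_in_disk[OF r1 r(1)]) (use ab that in auto)
  have in2: "d o2 (seg p q s) < r2" if "0 < s" "s < 1" for s
    by (rule seg_in_disk[OF r2 r(2)]) (use pq that in auto)
  define z where "z = seg a b s0"
  show ?thesis
  proof (cases "s0 \<in> {0,1} \<or> t0 \<in> {0,1}")
    case True
    have "z \<in> {a,b} \<inter> {p,q}"
    proof (cases "s0 \<in> {0,1}")
      case s: True
      then have z: "z \<in> {a,b}" using seg_ends[OF dab] by (auto simp: z_def)
      \<comment> \<open>An inner point of the second edge lies in its open disk, where no end point
        of the first edge can be.\<close>
      have "t0 \<in> {0,1}"
      proof (rule ccontr)
        assume "t0 \<notin> {0,1}"
        then have "d o2 z < r2" using in2[of t0] t0 eq by (auto simp: z_def)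
        then show False using z far by auto
      qed
      then show ?thesis using z seg_ends[OF dpq] eq by (auto simp: z_def)
    next
      case s: False
      then have "t0 \<in> {0,1}" using True by simp
      then have "z \<in> {p,q}" using seg_ends[OF dpq] eq by (auto simp: z_def)
      moreover have "d o1 z < r1" using in1[of s0] s s0 by (auto simp: z_def)
      ultimately show ?thesis using far by auto
    qed
    then show ?thesis by (simp add: z_def)
  next
    case False
    then have s0': "0 < s0" "s0 < 1" and t0': "0 < t0" "t0 < 1" using s0 t0 by auto
    have z1: "d o1 z < r1" and z2: "d o2 z < r2" using in1[OF s0'] in2[OF t0'] eq by (auto simp: z_def)
    have near1: "d z x < 2 * \<delta>" if "d o1 x \<le> r1" for x
      using rdist_triangle[of z x o1] rdist_sym[of z o1] z1 that r by linarith
    have near2: "d z x < 2 * \<delta>" if "d o2 x \<le> r2" for x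
      using rdist_triangle[of z x o2] rdist_sym[of z o2] z2 that r by linarith
    obtain u where u: "nz z u = d a b" "\<And>s. s \<in> {0..1} \<Longrightarrow> Lg z (seg a b s) = (s - s0) *\<^sub>R u"
      using seg_through[OF dab s0 z_def[symmetric]] by metis
    obtain v where v: "nz z v = d p q" "\<And>s. s \<in> {0..1} \<Longrightarrow> Lg z (seg p q s) = (s - t0) *\<^sub>R v"
      using seg_through[OF dpq t0 z_def[unfolded eq, symmetric]] by metis
    have La: "Lg z a = (- s0) *\<^sub>R u" "Lg z b = (1 - s0) *\<^sub>R u" using u(2)[of 0] u(2)[of 1] seg_ends[OF dab] by auto
    have Lp: "Lg z p = (- t0) *\<^sub>R v" "Lg z q = (1 - t0) *\<^sub>R v" using v(2)[of 0] v(2)[of 1] seg_ends[OF dpq] by auto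
    have u0: "u \<noteq> 0" using u(1) ab(1) by auto
    have v0: "v \<noteq> 0" using v(1) pq(1) by auto
    note same = same_ray_eq[OF r z1 z2]
    show ?thesis
    proof (cases "\<exists>k. v = k *\<^sub>R u")
      case True
      then obtain k where k: "v = k *\<^sub>R u" by blast
      then have "k \<noteq> 0" using v0 by auto
      then consider "k > 0" | "k < 0" by linarith
      then have "{a,b} = {p,q}"
      proof cases
        case 1
        have "b = q" by (rule same[of b q "1 - s0" u "(1 - t0) * k"]) (use ab pq far La Lp k 1 s0' t0' in auto)
        moreover have "a = p" by (rule same[of a p s0 "- u" "t0 * k"]) (use ab pq far La Lp k 1 s0' t0' in auto)
        ultimately show ?thesis by simp
      next
        case 2
        have "b = p" by (rule same[of b p "1 - s0" u "t0 * (- k)"])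
            (use ab pq far La Lp k 2 s0' t0' in \<open>auto simp: mult_pos_neg\<close>)
        moreover have "a = q" by (rule same[of a q s0 "- u" "(1 - t0) * (- k)"])
            (use ab pq far La Lp k 2 s0' t0' in \<open>auto simp: mult_pos_neg\<close>)
        ultimately show ?thesis by auto
      qed
      then show ?thesis by simp
    next
      case nk: False
      have indep: "x = 0 \<and> y = 0" if "x *\<^sub>R u = y *\<^sub>R v" for x y
      proof (cases "y = 0")
        case True then show ?thesis using that u0 by simp
      next
        case False
        then have "v = (1/y) *\<^sub>R (y *\<^sub>R v)" by simp
        also have "\<dots> = (x / y) *\<^sub>R u" using that[symmetric] by simp
        finally show ?thesis using nk by blast
      qed
      have apq: "a \<noteq> p" "a \<noteq> q" "b \<noteq> p" "b \<noteq> q"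
        using La Lp indep[of "-s0" "-t0"] indep[of "-s0" "1-t0"] indep[of "1-s0" "-t0"] indep[of "1-s0" "1-t0"] s0' t0' by auto
      then have card: "card {a,b,p,q} = 4" using ab(1) pq(1) by simp
      \<comment> \<open>n runs along the edge during the middle third, and m measures how far the
        path is pulled towards the centre, with fixed ends. At h = 1 the first third leads from one
        end to the centre, the second rests there, and the last leads to the other end.\<close>
      define n where "n s = max 0 (min 1 (3 * s - 1))" for s :: real
      define m where "m s = min 1 (min (3 * s) (3 * (1 - s)))" for s :: real
      have n01: "n s \<in> {0..1}" for s by (auto simp: n_def)
      have hm: "1 - h * m s \<in> {0..1}" if "h \<in> {0..1}" "s \<in> {0..1}" for h s
      proof -
        have "0 \<le> m s" "m s \<le> 1" using that by (auto simp: m_def)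
        then show ?thesis using that mult_mono[of h 1 "m s" 1] by auto
      qed
      define g1 where "g1 x = seg o1 (seg a b (n (snd x))) (1 - fst x * m (snd x))" for x
      define g2 where "g2 x = seg o2 (seg p q (n (snd x))) (1 - fst x * m (snd x))" for x
      let ?Q = "{0..1::real} \<times> {0..1::real}"
      \<comment> \<open>Throughout the deformation the path meets the circle only at the two ends of
        its edge. It therefore avoids the ends of the other edge, which are not in the open
        disk.\<close>
      have cone: "continuous_on ?Q (\<lambda>x. seg cc (seg p q (n (snd x))) (1 - fst x * m (snd x))) \<and>
          (\<forall>h\<in>{0..1}. \<forall>s\<in>{0..1}. (let y = seg cc (seg p q (n s)) (1 - h * m s) in d cc y \<le> r \<and> (y \<in> {p,q} \<or> d cc y < r)))"
        if r: "r < \<delta>" "0 < r" and pq: "d cc p = r" "d cc q = r" "p \<noteq> q" for cc p q r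
      proof -
        have dpq: "d p q < 2 * \<delta>" using rdist_triangle[of p q cc] rdist_sym[of p cc] pq r by linarith
        have le: "seg p q t \<in> {p,q} \<or> d cc (seg p q t) < r" if "t \<in> {0..1}" for t
        proof (cases "t \<in> {0,1}")
          case False
          then show ?thesis using seg_in_disk[OF r(2,1), of cc p q t] pq that by auto
        qed (use seg_ends[OF dpq] in auto)
        then have le': "d cc (seg p q t) \<le> r" if "t \<in> {0..1}" for t
          using pq that by (metis insert_iff less_imp_le order_refl singletonD)
        have lt: "d cc (seg p q t) < 2 * \<delta>" if "t \<in> {0..1}" for t using le'[OF that] r delta_pos by simp
        have "continuous_on ?Q (\<lambda>x. seg p q (n (snd x)))"
          by (rule continuous_on_compose2[OF seg_cont[OF dpq]]) (auto simp: n_def intro!: continuous_intros)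
        then have c: "continuous_on ?Q (\<lambda>x. seg cc (seg p q (n (snd x))) (1 - fst x * m (snd x)))"
        proof (rule continuous_on_seg)
          show "continuous_on ?Q (\<lambda>x. 1 - fst x * m (snd x))" unfolding m_def by (intro continuous_intros)
        qed (use lt n01 hm in auto)
        have "let y = seg cc (seg p q (n s)) (1 - h * m s) in d cc y \<le> r \<and> (y \<in> {p,q} \<or> d cc y < r)"
          if hs: "h \<in> {0..1}" "s \<in> {0..1}" for h s
        proof -
          let ?w = "seg p q (n s)" and ?l = "1 - h * m s"
          have ds: "d cc (seg cc ?w ?l) = d cc ?w * ?l" by (rule seg_dist_left[OF lt[OF n01] hm[OF hs]])
          show ?thesis
          proof (cases "?l = 1")
            case True
            show ?thesis unfolding Let_def True using le[OF n01] le'[OF n01] seg_ends(2)[OF lt[OF n01]] by simp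
          next
            case False
            moreover have "?l \<le> 1" using hm[OF hs] by (simp only: atLeastAtMost_iff)
            ultimately have "?l < 1" by linarith
            have "d cc ?w * ?l \<le> r * ?l" using le'[OF n01] hm[OF hs] by (intro mult_right_mono) auto
            also have "\<dots> < r * 1" using \<open>?l < 1\<close> r by (intro mult_strict_left_mono) auto
            finally show ?thesis using ds by (simp add: Let_def)
          qed
        qed
        then show ?thesis using c by blast
      qed
      have G1: "continuous_on ?Q g1" 
        and G1': "\<And>h s. h \<in> {0..1} \<Longrightarrow> s \<in> {0..1} \<Longrightarrow> d o1 (g1 (h,s)) \<le> r1 \<and> (g1 (h,s) \<in> {a,b} \<or> d o1 (g1 (h,s)) < r1)"
        using cone[OF r(1) r1 ab(2,3,1)] by (auto simp: g1_def[abs_def] Let_def)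
      have G2: "continuous_on ?Q g2" 
        and G2': "\<And>h s. h \<in> {0..1} \<Longrightarrow> s \<in> {0..1} \<Longrightarrow> d o2 (g2 (h,s)) \<le> r2 \<and> (g2 (h,s) \<in> {p,q} \<or> d o2 (g2 (h,s)) < r2)"
        using cone[OF r(2) r2 pq(2,3,1)] by (auto simp: g2_def[abs_def] Let_def)
      have end1: "\<exists>x\<in>{oa,ob}. \<exists>l\<in>{0..1}. seg cc (seg oa ob (n s)) (1 - m s) = seg cc x l" 
        if s: "s \<in> {0..1}" and o: "d cc oa < 2 * \<delta>" "d oa ob < 2 * \<delta>" "\<And>t. t \<in> {0..1} \<Longrightarrow> d cc (seg oa ob t) < 2 * \<delta>" for cc oa ob s
      proof -
        consider "s \<le> 1/3" | "1/3 < s" "s < 2/3" | "2/3 \<le> s" by linarith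
        then show ?thesis
        proof cases
          case 1
          then have "n s = 0" by (simp add: n_def)
          then show ?thesis using seg_ends[OF o(2)] hm[of 1 s] s by (intro bexI[of _ oa] bexI[of _ "1 - m s"]) auto
        next
          case 2
          then have "m s = 1" by (simp add: m_def)
          then show ?thesis using seg_ends[OF o(1)] seg_ends[OF o(3)[OF n01]] by (intro bexI[of _ oa] bexI[of _ 0]) auto
        next
          case 3
          then have "n s = 1" by (simp add: n_def)
          then show ?thesis using seg_ends[OF o(2)] hm[of 1 s] s by (intro bexI[of _ ob] bexI[of _ "1 - m s"]) auto
        qed
      qed
      have n01e: "n 0 = 0" "n 1 = 1" "m 0 = 0" "m 1 = 0" by (auto simp: n_def m_def)
      have nr1: "d o1 (seg a b t) < 2 * \<delta>" "d o1 (seg a b t) \<le> r1" if "t \<in> {0..1}" for t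
        using in1[of t] that seg_ends[OF dab] ab r(1) delta_pos by (cases "t = 0 \<or> t = 1"; auto)+
      have nr2: "d o2 (seg p q t) < 2 * \<delta>" "d o2 (seg p q t) \<le> r2" if "t \<in> {0..1}" for t
        using in2[of t] that seg_ends[OF dpq] pq r(2) delta_pos by (cases "t = 0 \<or> t = 1"; auto)+
      have e1: "g1 (h,0) = a" "g1 (h,1) = b" for h
        using seg_ends[OF dab] seg_ends(2)[OF nr1(1)[of 0]] seg_ends(2)[OF nr1(1)[of 1]] by (auto simp: g1_def n01e)
      have e2: "g2 (h,0) = p" "g2 (h,1) = q" for h
        using seg_ends[OF dpq] seg_ends(2)[OF nr2(1)[of 0]] seg_ends(2)[OF nr2(1)[of 1]] by (auto simp: g2_def n01e)
      have inj: "g1 (h,s) = g2 (h',t)" if "Lg z (g1 (h,s)) = Lg z (g2 (h',t))" "h \<in> {0..1}" "s \<in> {0..1}" "h' \<in> {0..1}" "t \<in> {0..1}" for h s h' t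
        by (rule Lg_inj[of z]) (use that G1' G2' near1 near2 in auto)
      have False
      proof (rule crossing_arcs_not_separable[of "\<lambda>x. Lg z (g1 x)" "\<lambda>x. Lg z (g2 x)" n s0 u t0 v])
        show "continuous_on ?Q (\<lambda>x. Lg z (g1 x))" by (rule continuous_on_Lg[OF G1]) (use G1' near1 in auto)
        show "continuous_on ?Q (\<lambda>x. Lg z (g2 x))" by (rule continuous_on_Lg[OF G2]) (use G2' near2 in auto)
        show "Lg z (g1 (0,s)) = (n s - s0) *\<^sub>R u" if "s \<in> {0..1}" for s
          using u(2)[OF n01] seg_ends[OF nr1(1)[OF n01]] by (simp add: g1_def)
        show "Lg z (g2 (0,s)) = (n s - t0) *\<^sub>R v" if "s \<in> {0..1}" for s
          using v(2)[OF n01] seg_ends[OF nr2(1)[OF n01]] by (simp add: g2_def)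
        show "Lg z (g1 (h,s)) \<noteq> Lg z (g2 (h,t))"
          if hst: "h \<in> {0..1}" "s \<in> {0..1}" "t \<in> {0..1}" and st: "s \<in> {0,1} \<or> t \<in> {0,1}" for h s t
        proof
          assume "Lg z (g1 (h,s)) = Lg z (g2 (h,t))"
          then have e: "g1 (h,s) = g2 (h,t)" using inj hst by blast
          from st show False
          proof
            assume "s \<in> {0,1}"
            then have "g1 (h,s) \<in> {a,b}" using e1 by auto
            then show False using G2'[OF hst(1,3)] e apq far by auto
          next
            assume "t \<in> {0,1}"
            then have "g2 (h,t) \<in> {p,q}" using e2 by auto
            then show False using G1'[OF hst(1,2)] e apq far by auto
          qed
        qed
        show "Lg z (g1 (1,s)) \<noteq> Lg z (g2 (1,t))" if st: "s \<in> {0..1}" "t \<in> {0..1}" for s t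
        proof
          assume "Lg z (g1 (1,s)) = Lg z (g2 (1,t))"
          then have e: "g1 (1,s) = g2 (1,t)" using inj st by auto
          have do: "d o1 a < 2 * \<delta>" "d o2 p < 2 * \<delta>" using ab pq r delta_pos by auto
          obtain x l where x: "x \<in> {a,b}" "l \<in> {0..1}" "g1 (1,s) = seg o1 x l"
            using end1[OF st(1) do(1) dab nr1(1)] unfolding g1_def fst_conv snd_conv mult_1 by blast
          obtain y k where y: "y \<in> {p,q}" "k \<in> {0..1}" "g2 (1,t) = seg o2 y k"
            using end1[OF st(2) do(2) dpq nr2(1)] unfolding g2_def fst_conv snd_conv mult_1 by blast
          \<comment> \<open>Each final path consists of two radii, so a common point forces equal
            disks and puts all four end points on one circle.\<close>
          have "o1 = o2 \<and> r1 = r2"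
            by (rule radii_disjoint[of r1 r2 o1 x o2 y l k, OF r _ _ _ _ _ x(2) y(2)]) (use x y e ab pq far apq in auto)
          then show False using gen card ab pq by (auto simp: circle_def)
        qed
      qed (use n01e s0' t0' indep in auto)
      then show ?thesis ..
    qed
  qed
qed

end

section \<open>The natural map of a Delaunay complex\<close>

text \<open>At the apex of a cone the parameter along the opposite side has no limit. It enters only
  through a bounded vector, which is multiplied by the vanishing radial parameter.\<close>

lemma continuous_on_scaleR_vanishing:
  fixes L :: "'b::topological_space \<Rightarrow> 'c::real_normed_vector" and s :: "'b \<Rightarrow> real"
  assumes s: "continuous_on T s" "\<And>w. w \<in> T \<Longrightarrow> 0 \<le> s w"
    and L: "continuous_on (T \<inter> {w. 0 < s w}) L" "\<And>w. w \<in> T \<Longrightarrow> norm (L w) \<le> C"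
  shows "continuous_on T (\<lambda>w. s w *\<^sub>R L w)"
  unfolding continuous_on_def
proof
  fix w0 assume w0: "w0 \<in> T"
  have st: "(s \<longlongrightarrow> s w0) (at w0 within T)" using s(1) w0 by (simp add: continuous_on_def)
  show "((\<lambda>w. s w *\<^sub>R L w) \<longlongrightarrow> s w0 *\<^sub>R L w0) (at w0 within T)"
  proof (cases "s w0 = 0")
    case True
    have "((\<lambda>w. s w * C) \<longlongrightarrow> 0) (at w0 within T)"
      using tendsto_mult_left_zero[of s _ C] st True by simp
    moreover have "\<forall>\<^sub>F w in at w0 within T. norm (s w *\<^sub>R L w) \<le> s w * C"
      unfolding eventually_at_filter
      by (rule always_eventually) (use s(2) L(2) in \<open>auto intro!: mult_left_mono\<close>)
    ultimately show ?thesis using True by (auto intro: Lim_null_comparison)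
  next
    case False
    then have pos: "0 < s w0" using s(2)[OF w0] by simp
    obtain U where U: "open U" "U \<inter> T = s -` {0<..} \<inter> T"
      using s(1) open_greaterThan[of "0::real"] unfolding continuous_on_open_invariant by blast
    have eq: "T \<inter> {w. 0 < s w} = T \<inter> U" using U(2) by auto
    have "w0 \<in> U" using U(2) w0 pos by auto
    then have "at w0 within (T \<inter> U) = at w0 within T" by (rule at_within_nhd[OF _ U(1)]) auto
    moreover have "(L \<longlongrightarrow> L w0) (at w0 within (T \<inter> U))"
      using L(1) w0 \<open>w0 \<in> U\<close> unfolding eq continuous_on_def by blast
    ultimately show ?thesis using st by (auto intro: tendsto_scaleR)
  qed
qed

lemma cell_nonneg: "w \<in> cell S \<Longrightarrow> 0 \<le> w v" and cell_outside: "w \<in> cell S \<Longrightarrow> v \<notin> S \<Longrightarrow> w v = 0"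
  and cell_sum: "w \<in> cell S \<Longrightarrow> sum w S = 1"
  by (auto simp: cell_def)

lemma cell_support:
  assumes "w \<in> cell S" "finite S"
  shows "{v. w v \<noteq> 0} \<noteq> {}" "{v. w v \<noteq> 0} \<subseteq> S" "\<And>T. finite T \<Longrightarrow> {v. w v \<noteq> 0} \<subseteq> T \<Longrightarrow> w \<in> cell T"
proof -
  show sub: "{v. w v \<noteq> 0} \<subseteq> S" using assms by (auto simp: cell_def)
  have eq: "sum w T = sum w {v. w v \<noteq> 0}" if "finite T" "{v. w v \<noteq> 0} \<subseteq> T" for T
    by (rule sum.mono_neutral_right[OF that]) auto
  have "sum w {v. w v \<noteq> 0} = 1" using eq[OF assms(2) sub] cell_sum[OF assms(1)] by simp
  then show "{v. w v \<noteq> 0} \<noteq> {}" by force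
  show "w \<in> cell T" if "finite T" "{v. w v \<noteq> 0} \<subseteq> T" for T
    using eq[OF that] eq[OF assms(2) sub] cell_sum[OF assms(1)] cell_nonneg[OF assms(1)] that(2) by (simp add: cell_def)
qed

text \<open>A cell is a closed subset of a power of the unit interval, compact by Tychonoff's
  theorem even for an infinite index type.\<close>

lemma compact_cell:
  assumes "finite S" shows "compact (cell S :: ('a \<Rightarrow> real) set)"
proof -
  have "compactin euclidean (Pi\<^sub>E UNIV (\<lambda>_::'a. {0..1::real}))"
    unfolding euclidean_product_topology[symmetric] compactin_PiE by simp
  then have c: "compact (Pi\<^sub>E UNIV (\<lambda>_::'a. {0..1::real}))" by simp
  have co: "continuous_on UNIV (\<lambda>w. w v)" for v :: 'a by (rule continuous_on_product_coordinates)
  have "closed {w :: 'a \<Rightarrow> real. sum w S = 1}"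
    by (intro closed_Collect_eq continuous_intros continuous_on_sum co)
  moreover have "closed (\<Inter>v\<in>-S. {w :: 'a \<Rightarrow> real. w v = 0})"
    by (intro closed_INT ballI closed_Collect_eq continuous_intros co)
  moreover have "cell S = Pi\<^sub>E UNIV (\<lambda>_. {0..1}) \<inter> ({w. sum w S = 1} \<inter> (\<Inter>v\<in>-S. {w. w v = 0}))"
  proof (intro equalityI subsetI)
    fix w assume w: "w \<in> cell S"
    have "w v \<le> 1" for v
    proof (cases "v \<in> S")
      case True
      then have "w v \<le> sum w S" using assms cell_nonneg[OF w] by (intro member_le_sum) auto
      then show ?thesis using cell_sum[OF w] by simp
    qed (use cell_outside[OF w] in simp)
    then show "w \<in> Pi\<^sub>E UNIV (\<lambda>_. {0..1}) \<inter> ({w. sum w S = 1} \<inter> (\<Inter>v\<in>-S. {w. w v = 0}))"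
      using cell_nonneg[OF w] cell_sum[OF w] cell_outside[OF w] by auto
  qed (auto simp: cell_def PiE_iff)
  ultimately show ?thesis using compact_Int_closed[OF c closed_Int] by metis
qed

lemma closed_cell: "finite S \<Longrightarrow> closed (cell S :: ('a \<Rightarrow> real) set)"
proof -
  assume S: "finite S"
  have co: "continuous_on UNIV (\<lambda>w. w v)" for v :: 'a by (rule continuous_on_product_coordinates)
  have "cell S = (\<Inter>v. {w :: 'a \<Rightarrow> real. 0 \<le> w v}) \<inter> {w. sum w S = 1} \<inter> (\<Inter>v\<in>-S. {w. w v = 0})"
    by (auto simp: cell_def)
  also have "closed \<dots>"
    by (intro closed_Int closed_INT ballI closed_Collect_eq closed_Collect_le continuous_intros continuous_on_sum co)
  finally show ?thesis .
qed

locale config_complex = delta_surface M \<delta>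
  for M :: "'a::{t2_space,second_countable_topology} riemannian_structure" and \<delta> :: real +
  fixes p :: "'a config"
  assumes p: "p \<in> topspace (config_topology M \<delta>)"
begin

abbreviation V where "V \<equiv> points p"
abbreviation K where "K \<equiv> simplices M \<delta> p"

lemma p_component: "snd p \<in> config_component M \<delta> (fst p)"
proof -
  have "p \<in> Sigma UNIV (topspace \<circ> (\<lambda>n. subtopology (product_topology (\<lambda>_. euclidean) {..<n}) (config_component M \<delta> n)))"
    using p unfolding config_topology_def topspace_sum_topology .
  then have "snd p \<in> topspace (subtopology (product_topology (\<lambda>_. euclidean) {..<fst p}) (config_component M \<delta> (fst p)))"
    unfolding Sigma_def by force
  then show ?thesis unfolding topspace_subtopology by blast
qed

lemma finite_V: "finite V" by (simp add: points_def)

lemma no_four: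
  assumes "S \<subseteq> V" "card S = 4" "r < \<delta>" shows "\<not> S \<subseteq> circle M c r"
proof -
  have "ereal r \<le> min (inj_radius M / 6) (convexity_radius M)"
    by (rule order_trans[OF _ delta_le]) (use assms(3) in simp)
  then show ?thesis using p_component assms(1,2) unfolding config_component_def points_def by blast
qed

lemma empty_disk_data:
  assumes D: "empty_disk M \<delta> p D" and S: "S \<subseteq> frontier D" "S \<noteq> {}"
  obtains c r where "D = disk M c r" "r < \<delta>" "0 < r" "\<And>v. v \<in> S \<Longrightarrow> d c v = r" "\<And>v. v \<in> V \<Longrightarrow> r \<le> d c v"
proof -
  obtain c r where cr: "r < \<delta>" "D = disk M c r" "interior D \<inter> V = {}"
    using D unfolding empty_disk_def by blast
  \<comment> \<open>A disk of radius at most 0 is empty, and its frontier then contains no point of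
    S.\<close>
  have r0: "0 < r"
  proof (rule ccontr)
    assume "\<not> 0 < r"
    then have "disk M c r = {}" using order_trans[OF _ rdist_nonneg[of c]] by (auto simp: disk_def not_less)
    then show False using S cr by simp
  qed
  have 1: "d c v = r" if "v \<in> S" for v using S(1) cr(2) frontier_disk[OF r0, of c] that by (auto simp: circle_def)
  have 2: "r \<le> d c v" if "v \<in> V" for v
    using cr(2,3) that interior_open[OF open_disk[of c r]] by (auto simp: disk_def)
  show ?thesis by (rule that[OF cr(2,1) r0 1 2])
qed

lemma empty_diskI:
  assumes "r < \<delta>" "0 < r" "\<And>v. v \<in> S \<Longrightarrow> d c v = r" "\<And>v. v \<in> V \<Longrightarrow> r \<le> d c v"
  shows "empty_disk M \<delta> p (disk M c r)" "S \<subseteq> frontier (disk M c r)"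
proof -
  show "empty_disk M \<delta> p (disk M c r)"
    unfolding empty_disk_def interior_open[OF open_disk[of c r]] using assms(1,4) by (fastforce simp: disk_def)
  show "S \<subseteq> frontier (disk M c r)" using assms(3) frontier_disk[OF assms(2), of c] by (auto simp: circle_def)
qed

lemma edge_data:
  assumes "{u,v} \<in> edges M \<delta> p" "u \<noteq> v"
  obtains c r where "r < \<delta>" "0 < r" "d c u = r" "d c v = r" "\<And>y. y \<in> V \<Longrightarrow> r \<le> d c y" "u \<in> V" "v \<in> V"
proof -
  obtain D where D: "empty_disk M \<delta> p D" "{u,v} \<subseteq> frontier D" "{u,v} \<subseteq> V" using assms(1) by (auto simp: edges_def)
  obtain c r where "D = disk M c r" "r < \<delta>" "0 < r" "\<And>y. y \<in> {u,v} \<Longrightarrow> d c y = r" "\<And>v. v \<in> V \<Longrightarrow> r \<le> d c v"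
    using empty_disk_data[OF D(1,2)] by blast
  then show ?thesis using that D(3) by blast
qed

lemma edge_small: "{u,v} \<in> edges M \<delta> p \<Longrightarrow> u \<noteq> v \<Longrightarrow> d u v < 2 * \<delta>"
proof -
  assume "{u,v} \<in> edges M \<delta> p" "u \<noteq> v"
  then obtain c r where "r < \<delta>" "d c u = r" "d c v = r" using edge_data by metis
  then show ?thesis using rdist_triangle[of u v c] rdist_sym[of u c] by simp
qed

text \<open>Fixed orderings of the vertices. On an edge reversal of segments makes the result
  independent of the ordering; on a face the ordering selects the apex of the cone.\<close>

definition pr :: "'a set \<Rightarrow> 'a \<times> 'a" where "pr S = (SOME x. S = {fst x, snd x} \<and> fst x \<noteq> snd x)"
definition tr :: "'a set \<Rightarrow> 'a \<times> 'a \<times> 'a" where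
  "tr S = (SOME x. S = {fst x, fst (snd x), snd (snd x)} \<and> fst x \<noteq> fst (snd x) \<and> fst x \<noteq> snd (snd x) \<and> fst (snd x) \<noteq> snd (snd x))"

lemma pr: assumes "card S = 2" obtains u v where "pr S = (u,v)" "S = {u,v}" "u \<noteq> v"
proof -
  obtain u v where "S = {u,v}" "u \<noteq> v" using assms by (auto simp: card_2_iff)
  then have "S = {fst (u,v), snd (u,v)} \<and> fst (u,v) \<noteq> snd (u,v)" by simp
  from someI[of "\<lambda>x. S = {fst x, snd x} \<and> fst x \<noteq> snd x", OF this]
  have "S = {fst (pr S), snd (pr S)} \<and> fst (pr S) \<noteq> snd (pr S)" by (simp add: pr_def)
  then show ?thesis using that[of "fst (pr S)" "snd (pr S)"] by simp
qed

lemma tr: assumes "card S = 3" obtains a b e where "tr S = (a,b,e)" "S = {a,b,e}" "a \<noteq> b" "a \<noteq> e" "b \<noteq> e"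
proof -
  let ?P = "\<lambda>x. S = {fst x, fst (snd x), snd (snd x)} \<and> fst x \<noteq> fst (snd x) \<and> fst x \<noteq> snd (snd x) \<and> fst (snd x) \<noteq> snd (snd x)"
  obtain a b e where "S = {a,b,e}" "a \<noteq> b" "a \<noteq> e" "b \<noteq> e" using assms by (auto simp: card_3_iff)
  then have "?P (a,b,e)" by simp
  from someI[of ?P, OF this] have "?P (tr S)" by (simp add: tr_def)
  then show ?thesis using that[of "fst (tr S)" "fst (snd (tr S))" "snd (snd (tr S))"] by simp
qed

text \<open>On a triangle the map is the cone with apex \<open>a\<close> over the opposite side.  At \<open>a\<close> itself the
  quotient is \<open>0 / 0 = 0\<close>, which is harmless.\<close>

definition cmap :: "('a \<Rightarrow> real) \<Rightarrow> 'a" where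
  "cmap w = (let S = {v. w v \<noteq> 0} in
     if card S = 1 then the_elem S
     else if card S = 2 then (case pr S of (u,v) \<Rightarrow> seg u v (w v))
     else (case tr S of (a,b,e) \<Rightarrow> seg a (seg b e (w e / (w b + w e))) (w b + w e)))"

lemma cmap_vertex: "{v. w v \<noteq> 0} = {a} \<Longrightarrow> cmap w = a"
  by (simp add: cmap_def)

lemma cmap_edge:
  assumes uv: "u \<noteq> v" "d u v < 2 * \<delta>" and w: "w \<in> cell {u,v}"
  shows "cmap w = seg u v (w v)" "w v \<in> {0..1}" "w u = 1 - w v"
proof -
  have s: "w u + w v = 1" "0 \<le> w u" "0 \<le> w v" "\<And>y. y \<noteq> u \<Longrightarrow> y \<noteq> v \<Longrightarrow> w y = 0"
    using cell_sum[OF w] cell_nonneg[OF w] cell_outside[OF w] uv by auto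
  then show b: "w v \<in> {0..1}" "w u = 1 - w v" by auto
  consider "w v = 0" | "w u = 0" | "w u \<noteq> 0" "w v \<noteq> 0" by blast
  then show "cmap w = seg u v (w v)"
  proof cases
    case 1
    then have "{y. w y \<noteq> 0} = {u}" using s by fastforce
    then show ?thesis using cmap_vertex 1 seg_ends[OF uv(2)] by simp
  next
    case 2
    then have "{y. w y \<noteq> 0} = {v}" using s by fastforce
    then show ?thesis using cmap_vertex 2 seg_ends[OF uv(2)] s by simp
  next
    case 3
    then have S: "{y. w y \<noteq> 0} = {u,v}" using s by fastforce
    have card: "card {u,v} = 2" using uv by simp
    obtain u' v' where pr': "pr {u,v} = (u',v')" "{u,v} = {u',v'}" "u' \<noteq> v'" using pr[OF card] .
    have "cmap w = seg u' v' (w v')" unfolding cmap_def Let_def S using card pr'(1) by simp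
    moreover have wv: "1 - w u = w v" using s(1) by simp
    have "w u \<in> {0..1}" using s(1-3) by simp
    \<comment> \<open>Both orderings give the same point, because reversing the segment exchanges
      the two weights.\<close>
    from seg_sym[OF uv(2) this] have "seg v u (w u) = seg u v (w v)" unfolding wv .
    moreover have "u' = u \<and> v' = v \<or> u' = v \<and> v' = u" using pr'(2,3) by (metis doubleton_eq_iff)
    ultimately show ?thesis by auto
  qed
qed

definition face_at where
  "face_at S c r a b e \<longleftrightarrow> S \<in> faces M \<delta> p \<and> tr S = (a,b,e) \<and> S = {a,b,e} \<and> disk_triangle M \<delta> c a b e r \<and> 
     empty_disk M \<delta> p (disk M c r) \<and> (\<forall>v\<in>V. r \<le> d c v)"

lemma face_data:
  assumes "S \<in> faces M \<delta> p"
  obtains c r a b e where "face_at S c r a b e"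
proof -
  obtain D where D: "empty_disk M \<delta> p D" "S \<subseteq> frontier D" "S \<subseteq> V" "card S = 3" using assms by (auto simp: faces_def)
  obtain a b e where t: "tr S = (a,b,e)" "S = {a,b,e}" "a \<noteq> b" "a \<noteq> e" "b \<noteq> e" using tr[OF D(4)] .
  have "S \<noteq> {}" using t by blast
  from empty_disk_data[OF D(1,2) this] obtain c r where cr: "D = disk M c r" "r < \<delta>" "0 < r"
    "\<And>v. v \<in> S \<Longrightarrow> d c v = r" "\<And>v. v \<in> V \<Longrightarrow> r \<le> d c v" by blast
  have "disk_triangle M \<delta> c a b e r"
    by (intro disk_triangle.intro disk_triangle_axioms.intro delta_surface_axioms) (use cr t in auto)
  then show ?thesis using that[of c r a b e] assms t cr D by (auto simp: face_at_def)
qed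

lemma face_edges:
  assumes "S \<in> faces M \<delta> p" "u \<in> S" "v \<in> S" "u \<noteq> v"
  shows "{u,v} \<in> edges M \<delta> p"
  using assms unfolding faces_def edges_def by (auto simp: card_2_iff)

text \<open>\<open>cmap\<close> looks only at the support of w, so on the sides of a face it uses
  the edge segments. The cone restricts to these segments, hence a single formula holds on the
  closed cell.\<close>

lemma cmap_face:
  assumes f: "face_at S c r a b e" and w: "w \<in> cell S"
  shows "cmap w = disk_triangle.\<kappa> M \<delta> a b e (w b + w e) (w e / (w b + w e))"
    "w b + w e \<in> {0..1}" "w e / (w b + w e) \<in> {0..1}" "w a = 1 - (w b + w e)"
proof -
  interpret disk_triangle M \<delta> c a b e r using f by (simp add: face_at_def)
  have S: "S = {a,b,e}" "tr S = (a,b,e)" using f by (auto simp: face_at_def)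
  have s: "w a + w b + w e = 1" "0 \<le> w a" "0 \<le> w b" "0 \<le> w e" "\<And>y. y \<noteq> a \<Longrightarrow> y \<noteq> b \<Longrightarrow> y \<noteq> e \<Longrightarrow> w y = 0"
    using cell_sum[OF w] cell_nonneg[OF w] cell_outside[OF w] dist by (auto simp: S(1) add.assoc)
  then show 1: "w b + w e \<in> {0..1}" "w e / (w b + w e) \<in> {0..1}" "w a = 1 - (w b + w e)"
    by (auto simp: divide_le_eq_1)
  have sub: "w \<in> cell T" if "finite T" "{y. w y \<noteq> 0} \<subseteq> T" for T
    by (rule cell_support(3)[OF w _ that]) (simp add: S(1))
  note ends = seg_ends[OF d_be] seg_ends[OF d_ab] seg_ends[OF d_ae]
  consider "w a = 0" | "w b = 0" | "w e = 0" | "w a \<noteq> 0" "w b \<noteq> 0" "w e \<noteq> 0" by blast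
  then show "cmap w = \<kappa> (w b + w e) (w e / (w b + w e))"
  proof cases
    case 1
    then have be: "w b + w e = 1" using s by simp
    have "w \<in> cell {b,e}" by (rule sub) (use s 1 in fastforce)+
    from cmap_edge[OF dist(3) d_be this] show ?thesis unfolding be
      using \<kappa>_side(2)[of 1 "w e"] by simp
  next
    case 2
    show ?thesis
    proof (cases "w e = 0")
      case True
      then have "{y. w y \<noteq> 0} = {a}" using s 2 by fastforce
      then show ?thesis using cmap_vertex \<kappa>_side(1)[of 0 0] 2 True by simp
    next
      case False
      have "w \<in> cell {a,e}" by (rule sub) (use s 2 in fastforce)+
      from cmap_edge[OF dist(2) d_ae this] show ?thesis using 2 False \<kappa>_side(4)[of "w e"] by simp
    qed
  next
    case 3
    have "w \<in> cell {a,b}" by (rule sub) (use s 3 in fastforce)+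
    from cmap_edge[OF dist(1) d_ab this] show ?thesis using 3 \<kappa>_side(3)[of "w b"] by simp
  next
    case 4
    then have "{y. w y \<noteq> 0} = S" unfolding S using s by fastforce
    moreover have "card S = 3" using S dist by simp
    ultimately show ?thesis unfolding cmap_def Let_def using S(2) by (simp add: \<kappa>_def)
  qed
qed

lemma continuous_on_coordinate: "continuous_on T (\<lambda>w::'a \<Rightarrow> real. w v)"
  by (rule continuous_on_subset[OF continuous_on_product_coordinates]) simp

lemma continuous_on_cmap_face:
  assumes f: "face_at S c r a b e" shows "continuous_on (cell S) cmap"
proof -
  interpret disk_triangle M \<delta> c a b e r using f by (simp add: face_at_def)
  let ?s = "\<lambda>w. w b + w e" and ?t = "\<lambda>w. w e / (w b + w e)"
  let ?L = "\<lambda>w. Lg a (seg b e (?t w))"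
  have "continuous_on {0..1} (\<lambda>t. Lg a (seg b e t))"
    by (rule continuous_on_Lg[OF seg_cont[OF d_be]]) (rule d_side)
  then have cL: "continuous_on {0..1} (\<lambda>t. Lg a (seg b e t))" .
  then have "bounded ((\<lambda>t. Lg a (seg b e t)) ` {0..1})"
    by (intro compact_imp_bounded compact_continuous_image) auto
  then obtain C where C: "\<And>t. t \<in> {0..1} \<Longrightarrow> norm (Lg a (seg b e t)) \<le> C"
    unfolding bounded_iff by blast
  have "continuous_on (cell S) (\<lambda>w. ?s w *\<^sub>R ?L w)"
  proof (rule continuous_on_scaleR_vanishing)
    show "continuous_on (cell S) ?s" by (intro continuous_intros continuous_on_coordinate)
    show "0 \<le> ?s w" if "w \<in> cell S" for w using cmap_face(2)[OF f that] by simp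
    show "norm (?L w) \<le> C" if "w \<in> cell S" for w using C cmap_face(3)[OF f that] by blast
    show "continuous_on (cell S \<inter> {w. 0 < ?s w}) ?L"
    proof (rule continuous_on_compose2[OF cL])
      show "continuous_on (cell S \<inter> {w. 0 < ?s w}) ?t"
        by (intro continuous_intros continuous_on_coordinate) auto
    qed (use cmap_face(3)[OF f] in blast)
  qed
  then have "continuous_on (cell S) (\<lambda>w. E a (?s w *\<^sub>R ?L w))"
  proof (rule continuous_on_compose2[OF E_cont])
    show "(\<lambda>w. ?s w *\<^sub>R ?L w) ` cell S \<subseteq> B a"
    proof (intro image_subsetI B_scale Lg_B d_side)
      fix w assume w: "w \<in> cell S"
      show "?t w \<in> {0..1}" by (rule cmap_face(3)[OF f w])
      have "0 \<le> ?s w" "?s w \<le> 1" using cmap_face(2)[OF f w] by auto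
      then show "\<bar>?s w\<bar> \<le> 1" by (simp only: abs_of_nonneg)
    qed
  qed
  then show ?thesis
    by (rule continuous_on_eq) (simp add: cmap_face(1)[OF f] \<kappa>_def seg_def[of a])
qed

lemma continuous_on_cmap_edge:
  assumes "{u,v} \<in> edges M \<delta> p" "u \<noteq> v" shows "continuous_on (cell {u,v}) cmap"
proof -
  note s = edge_small[OF assms]
  have "continuous_on (cell {u,v}) (\<lambda>w. seg u v (w v))"
    by (rule continuous_on_compose2[OF seg_cont[OF s] continuous_on_coordinate])
      (use cmap_edge(2)[OF assms(2) s] in blast)
  then show ?thesis by (rule continuous_on_eq) (simp add: cmap_edge(1)[OF assms(2) s])
qed

lemma cell_singleton: "cell {v} = {\<lambda>y. if y = v then 1 else 0}"
proof (intro equalityI subsetI)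
  fix w assume "w \<in> cell {v}"
  then have "w v = 1" "\<And>y. y \<noteq> v \<Longrightarrow> w y = 0" by (auto simp: cell_def)
  then show "w \<in> {\<lambda>y. if y = v then 1 else 0}" by auto
qed (auto simp: cell_def)

lemma cmap_cell_vertex: "cmap ` cell {v} = {v}"
  using cmap_vertex[of "\<lambda>y. if y = v then 1 else 0" v] by (simp add: cell_singleton)

lemma simplex_cases:
  assumes "S \<in> K"
  obtains (vertex) v where "v \<in> V" "S = {v}"
  | (edge) u v where "S = {u,v}" "u \<noteq> v" "{u,v} \<in> edges M \<delta> p"
  | (face) c r a b e where "face_at S c r a b e"
proof -
  consider "S \<in> {{v} |v. v \<in> V}" | "S \<in> edges M \<delta> p" | "S \<in> faces M \<delta> p" using assms by (auto simp: simplices_def)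
  then show ?thesis
  proof cases
    case 1 then show ?thesis using vertex by blast
  next
    case 2
    then have "card S = 2" by (simp add: edges_def)
    then show ?thesis using edge 2 by (auto simp: card_2_iff)
  next
    case 3 then show ?thesis using face_data face by blast
  qed
qed

lemma simplex_finite: "S \<in> K \<Longrightarrow> finite S" and simplex_sub: "S \<in> K \<Longrightarrow> S \<subseteq> V"
  by (auto simp: simplices_def edges_def faces_def intro: card_ge_0_finite)

lemma finite_K: "finite K"
  by (rule finite_subset[of _ "Pow V"]) (use simplex_sub finite_V in auto)

lemma continuous_on_cmap: "continuous_on (realization M \<delta> p) cmap"
  unfolding realization_def
proof (rule continuous_on_closed_Union[OF finite_K])
  fix S assume S: "S \<in> K"
  show "closed (cell S)" by (rule closed_cell[OF simplex_finite[OF S]])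
  show "continuous_on (cell S) cmap"
    using S
  proof (cases rule: simplex_cases)
    case vertex then show ?thesis by (simp add: cell_singleton)
  qed (use continuous_on_cmap_edge continuous_on_cmap_face in auto)
qed

lemma compact_realization: "compact (realization M \<delta> p)"
  unfolding realization_def by (intro compact_UN finite_K compact_cell simplex_finite)

lemma subsimplex:
  assumes "S \<in> K" "T \<subseteq> S" "T \<noteq> {}" shows "T \<in> K"
proof -
  have Sf: "finite S" and SV: "S \<subseteq> V" using simplex_finite simplex_sub assms(1) by auto
  have cS: "card S \<le> 3" using assms(1) by (auto simp: simplices_def edges_def faces_def)
  have cT: "card T \<le> card S" "card T \<noteq> 0"
    using card_mono[OF Sf assms(2)] finite_subset[OF assms(2) Sf] assms(3) by auto
  show ?thesis
  proof (cases "T = S")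
    case True then show ?thesis using assms by simp
  next
    case False
    then have lt: "card T < card S" using assms Sf by (simp add: psubset_card_mono psubsetI)
    then consider "card T = 1" | "card T = 2" "card S = 3" using cT cS by linarith
    then show ?thesis
    proof cases
      case 1 then show ?thesis using assms(2) SV by (auto simp: card_1_singleton_iff simplices_def)
    next
      case 2
      then have "S \<in> faces M \<delta> p" using assms(1) by (auto simp: simplices_def edges_def)
      moreover obtain u v where "T = {u,v}" "u \<noteq> v" using 2 by (auto simp: card_2_iff)
      ultimately show ?thesis using face_edges[of S u v] assms(2) by (auto simp: simplices_def)
    qed
  qed
qed

text \<open>Each point of the realization lies in exactly one open cell, that of its support.
  Injectivity thereby splits into injectivity on open cells and disjointness of their
  images.\<close>

definition ocell :: "'a set \<Rightarrow> ('a \<Rightarrow> real) set" where "ocell S = {w \<in> cell S. {v. w v \<noteq> 0} = S}"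

lemma realization_ocell: 
  assumes "w \<in> realization M \<delta> p"
  shows "{v. w v \<noteq> 0} \<in> K" "w \<in> ocell {v. w v \<noteq> 0}"
proof -
  obtain S where S: "S \<in> K" "w \<in> cell S" using assms by (auto simp: realization_def)
  note c = cell_support[OF S(2) simplex_finite[OF S(1)]]
  show "{v. w v \<noteq> 0} \<in> K" by (rule subsimplex[OF S(1) c(2,1)])
  show "w \<in> ocell {v. w v \<noteq> 0}"
    using c(3)[OF finite_subset[OF c(2) simplex_finite[OF S(1)]] subset_refl] by (simp add: ocell_def)
qed

lemma ocell_edge:
  assumes "{u,v} \<in> edges M \<delta> p" "u \<noteq> v"
  shows "cmap ` ocell {u,v} \<subseteq> seg u v ` {0<..<1}" "inj_on cmap (ocell {u,v})"
    and "cmap ` cell {u,v} = seg u v ` {0..1}"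
proof -
  note s = edge_small[OF assms]
  note ce = cmap_edge[OF assms(2) s]
  have o: "w \<in> cell {u,v}" "w v \<in> {0<..<1}" if w: "w \<in> ocell {u,v}" for w
  proof -
    show 1: "w \<in> cell {u,v}" using w by (simp add: ocell_def)
    have "w u \<noteq> 0" "w v \<noteq> 0" using w by (auto simp: ocell_def)
    then show "w v \<in> {0<..<1}" using ce(2,3)[OF 1] by auto
  qed
  show "cmap ` ocell {u,v} \<subseteq> seg u v ` {0<..<1}" using o ce(1) by auto
  show "inj_on cmap (ocell {u,v})"
  proof (rule inj_onI)
    fix w w' assume w: "w \<in> ocell {u,v}" "w' \<in> ocell {u,v}" and eq: "cmap w = cmap w'"
    have "d u v * w v = d u v * w' v"
      using seg_dist_left[OF s, of "w v"] seg_dist_left[OF s, of "w' v"] ce(1,2)[OF o(1)[OF w(1)]] ce(1,2)[OF o(1)[OF w(2)]] eq by simp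
    then have "w v = w' v" using assms(2) by simp
    moreover from this have "w u = w' u" using ce(3)[OF o(1)[OF w(1)]] ce(3)[OF o(1)[OF w(2)]] by simp
    ultimately show "w = w'" using cell_outside[OF o(1)[OF w(1)]] cell_outside[OF o(1)[OF w(2)]] by (metis ext insertE singletonD)
  qed
  show "cmap ` cell {u,v} = seg u v ` {0..1}"
  proof
    show "cmap ` cell {u,v} \<subseteq> seg u v ` {0..1}" using ce(1,2) by auto
    show "seg u v ` {0..1} \<subseteq> cmap ` cell {u,v}"
    proof
      fix y assume "y \<in> seg u v ` {0..1}"
      then obtain t where t: "t \<in> {0..1}" "y = seg u v t" by blast
      let ?w = "\<lambda>x. if x = v then t else if x = u then 1 - t else 0"
      have "?w \<in> cell {u,v}" using t(1) assms(2) by (auto simp: cell_def)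
      from imageI[OF this, of cmap] ce(1)[OF this] show "y \<in> cmap ` cell {u,v}" using t(2) by simp
    qed
  qed
qed

lemma ocell_face:
  assumes f: "face_at S c r a b e"
  shows "cmap ` ocell S \<subseteq> disk_triangle.tri_int M \<delta> a b e" "inj_on cmap (ocell S)"
    and "cmap ` cell S = disk_triangle.tri M \<delta> a b e"
proof -
  interpret disk_triangle M \<delta> c a b e r using f by (simp add: face_at_def)
  have S: "S = {a,b,e}" using f by (auto simp: face_at_def)
  note cf = cmap_face[OF f]
  have o: "w \<in> cell S" "w b + w e \<in> {0<..<1}" "w e / (w b + w e) \<in> {0<..<1}" if w: "w \<in> ocell S" for w
  proof -
    show 1: "w \<in> cell S" using w by (simp add: ocell_def)
    have "w a \<noteq> 0" "w b \<noteq> 0" "w e \<noteq> 0" using w by (auto simp: ocell_def S)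
    moreover have "0 \<le> w a" "0 \<le> w b" "0 \<le> w e" using cell_nonneg[OF 1] by auto
    ultimately have pos: "0 < w a" "0 < w b" "0 < w e" by auto
    then show "w b + w e \<in> {0<..<1}" "w e / (w b + w e) \<in> {0<..<1}" using cf(4)[OF 1] by auto
  qed
  show "cmap ` ocell S \<subseteq> tri_int"
  proof (rule image_subsetI)
    fix w assume "w \<in> ocell S"
    from o[OF this] show "cmap w \<in> tri_int"
      unfolding tri_int_def cf(1)[OF o(1)[OF \<open>w \<in> ocell S\<close>]]
      by (intro image_eqI[of _ _ "(w b + w e, w e / (w b + w e))"]) (simp, blast)
  qed
  show "inj_on cmap (ocell S)"
  proof (rule inj_onI)
    fix w w' assume w: "w \<in> ocell S" "w' \<in> ocell S" and eq: "cmap w = cmap w'"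
    note a = o[OF w(1)] and a' = o[OF w(2)]
    have eqk: "\<kappa> (w b + w e) (w e / (w b + w e)) = \<kappa> (w' b + w' e) (w' e / (w' b + w' e))"
      using eq cf(1)[OF a(1)] cf(1)[OF a'(1)] by simp
    have *: "w b + w e = w' b + w' e" "w e / (w b + w e) = w' e / (w' b + w' e)"
      by (rule \<kappa>_inj[OF _ _ _ _ _ _ eqk]; use a(2,3) a'(2,3) in \<open>simp only: greaterThanLessThan_iff atLeastAtMost_iff; linarith\<close>)+
    have "w b + w e \<noteq> 0" using a(2) by auto
    then have "w e = w' e" using * by simp
    moreover from this have "w b = w' b" using * by simp
    moreover have "w a = w' a" using * cf(4)[OF a(1)] cf(4)[OF a'(1)] by simp
    ultimately show "w = w'" using cell_outside[OF a(1)] cell_outside[OF a'(1)] unfolding S by (metis ext insertE singletonD)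
  qed
  show "cmap ` cell S = tri"
  proof
    show "cmap ` cell S \<subseteq> tri"
    proof (rule image_subsetI)
      fix w assume w: "w \<in> cell S"
      show "cmap w \<in> tri" unfolding tri_def cf(1)[OF w]
        by (intro image_eqI[of _ _ "(w b + w e, w e / (w b + w e))"] SigmaI cf(2,3)[OF w]) simp
    qed
    show "tri \<subseteq> cmap ` cell S"
    proof
      fix y assume "y \<in> tri"
      then obtain s t where st: "s \<in> {0..1}" "t \<in> {0..1}" "y = \<kappa> s t" by (auto simp: tri_def)
      \<comment> \<open>Barycentric coordinates from cone parameters: the weight s is shared by b
        and e in the ratio (1 - t) : t.\<close>
      let ?w = "\<lambda>x. if x = a then 1 - s else if x = b then s * (1 - t) else if x = e then s * t else 0"
      have "s * t \<le> s" using st(1,2) mult_left_le[of t s] by simp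
      then have "?w \<in> cell S" using st(1,2) dist by (auto simp: cell_def S algebra_simps)
      moreover have "cmap ?w = y"
      proof (cases "s = 0")
        case True
        then show ?thesis using cf(1)[OF \<open>?w \<in> cell S\<close>] st \<kappa>_side(1)[of 0] dist by simp
      next
        case False
        then have "?w b + ?w e = s" "?w e / s = t" using dist by (auto simp: algebra_simps)
        then show ?thesis using cf(1)[OF \<open>?w \<in> cell S\<close>] st by simp
      qed
      ultimately show "y \<in> cmap ` cell S" by blast
    qed
  qed
qed

lemma natural_map_cmap: "natural_map M \<delta> p cmap"
  unfolding natural_map_def
proof (intro conjI ballI continuous_on_cmap cmap_cell_vertex)
  fix S assume S: "S \<in> edges M \<delta> p"
  then have "card S = 2" by (simp add: edges_def)
  then obtain u v where uv: "S = {u,v}" "u \<noteq> v" by (auto simp: card_2_iff)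
  then show "\<exists>x y \<gamma>. S = {x, y} \<and> minimal_geodesic M x y \<gamma> \<and> cmap ` cell S = \<gamma> ` {0..1}"
    using seg_minimal[OF edge_small[of u v]] ocell_edge(3)[of u v] S by blast
next
  fix S assume "S \<in> faces M \<delta> p"
  then obtain c r a b e where f: "face_at S c r a b e" using face_data by blast
  interpret disk_triangle M \<delta> c a b e r using f by (simp add: face_at_def)
  have S: "S = {a,b,e}" using f by (auto simp: face_at_def)
  have "S \<subseteq> frontier (disk M c r)" using frontier_disk[OF r_pos] on_circle by (auto simp: S circle_def)
  then show "\<exists>D. empty_disk M \<delta> p D \<and> S \<subseteq> frontier D \<and> cmap ` cell S = geodesic_triangle M D S"
    using f geodesic_triangle_eq ocell_face(3)[OF f] S by (auto simp: face_at_def)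
qed

end

section \<open>Injectivity of the natural map\<close>

context config_complex
begin

text \<open>By convexity the inner points of an edge lie in its open empty disk.\<close>

lemma edge_interior_not_vertex:
  assumes e: "{u,v} \<in> edges M \<delta> p" "u \<noteq> v" and y: "y \<in> V" and t: "0 < t" "t < 1"
  shows "seg u v t \<noteq> y"
proof -
  obtain c r where c: "r < \<delta>" "0 < r" "d c u = r" "d c v = r" "\<And>y. y \<in> V \<Longrightarrow> r \<le> d c y"
    using edge_data[OF e] by blast
  have "d c (seg u v t) < r" by (rule seg_in_disk) (use c e t in auto)
  then show ?thesis using c(5)[OF y] by auto
qed

lemma edge_seg_vertex:
  assumes e: "{u,v} \<in> edges M \<delta> p" "u \<noteq> v" and t: "t \<in> {0..1}" and y: "seg u v t \<in> V"
  shows "seg u v t \<in> {u,v}"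
proof -
  have "\<not> (0 < t \<and> t < 1)" using edge_interior_not_vertex[OF e y] by blast
  then have "t = 0 \<or> t = 1" using t by auto
  then show ?thesis using seg_ends[OF edge_small[OF e]] by auto
qed

text \<open>\<open>edges_meet\<close> leaves only common vertices, which are not inner points of an
  edge. Its genericity hypothesis holds because no four points of the configuration lie on a circle
  of radius below \<delta>.\<close>

lemma edges_disjoint:
  assumes e: "{u,v} \<in> edges M \<delta> p" "u \<noteq> v" and e': "{x,y} \<in> edges M \<delta> p" "x \<noteq> y"
    and ne: "{u,v} \<noteq> {x,y}" and s: "0 < s" "s < 1" and t: "t \<in> {0..1}"
  shows "seg u v s \<noteq> seg x y t"
proof
  assume eq: "seg u v s = seg x y t"
  obtain c r where c: "r < \<delta>" "0 < r" "d c u = r" "d c v = r" "\<And>y. y \<in> V \<Longrightarrow> r \<le> d c y" "u \<in> V" "v \<in> V"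
    using edge_data[OF e] by blast
  obtain c' r' where c': "r' < \<delta>" "0 < r'" "d c' x = r'" "d c' y = r'" "\<And>y. y \<in> V \<Longrightarrow> r' \<le> d c' y" "x \<in> V" "y \<in> V"
    using edge_data[OF e'] by blast
  have s': "s \<in> {0..1}" using s by simp
  have gen: "\<not> (card {u,v,x,y} = 4 \<and> {u,v,x,y} \<subseteq> circle M c r)"
  proof -
    have "{u,v,x,y} \<subseteq> V" using c(6,7) c'(6,7) by simp
    then show ?thesis using no_four[OF _ _ c(1)] by blast
  qed
  have "{u,v} = {x,y} \<or> seg u v s \<in> {u,v} \<inter> {x,y}"
    by (rule edges_meet[OF c(1) c'(1) e(2) c(3,4) e'(2) c'(3,4) c(5)[OF c'(6)] c(5)[OF c'(7)] c'(5)[OF c(6)] c'(5)[OF c(7)] gen s' t eq])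
  then have "seg u v s \<in> {u,v}" using ne by blast
  moreover have "{u,v} \<subseteq> V" using c(6,7) by simp
  ultimately have "seg u v s \<in> V" by (rule rev_subsetD)
  then show False using edge_interior_not_vertex[OF e _ s] by blast
qed

lemma face_vertex_disjoint:
  assumes f: "face_at S c r a b e" and y: "y \<in> V" shows "y \<notin> disk_triangle.tri_int M \<delta> a b e"
proof -
  interpret disk_triangle M \<delta> c a b e r using f by (simp add: face_at_def)
  have r: "r \<le> d c y" using f y by (simp add: face_at_def)
  show ?thesis
  proof
    assume "y \<in> tri_int"
    then obtain s t where "s \<in> {0<..<1}" "t \<in> {0<..<1}" "y = \<kappa> s t" by (auto simp: tri_int_def)
    then show False using \<kappa>_interior[of s t] r by simp
  qed
qed

lemma face_side:
  assumes f: "face_at S c r a b e" and z: "z \<in> disk_triangle.sides M \<delta> a b e"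
  obtains x y t where "x \<in> S" "y \<in> S" "x \<noteq> y" "{x,y} \<in> edges M \<delta> p" "t \<in> {0..1}" "z = seg x y t"
proof -
  interpret disk_triangle M \<delta> c a b e r using f by (simp add: face_at_def)
  have S: "S = {a,b,e}" "S \<in> faces M \<delta> p" using f by (auto simp: face_at_def)
  have E: "{a,b} \<in> edges M \<delta> p" "{a,e} \<in> edges M \<delta> p" "{b,e} \<in> edges M \<delta> p"
    by (rule face_edges[OF S(2)]; use S(1) dist in blast)+
  from z consider "z \<in> seg a b ` {0..1}" | "z \<in> seg a e ` {0..1}" | "z \<in> seg b e ` {0..1}" unfolding sides_def by blast
  then show ?thesis
    by cases (use that S(1) E dist in blast)+
qed

text \<open>The interior of an edge that is not a side misses the sides, so it lies entirely inside
  or entirely outside the open triangle. In the first case its ends would be configuration points of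
  the closed triangle; only the corners are such points, and two corners span a side.\<close>

lemma face_edge_disjoint:
  assumes f: "face_at S c r a b e" and e: "{u,v} \<in> edges M \<delta> p" "u \<noteq> v"
  shows "disk_triangle.tri_int M \<delta> a b e \<inter> seg u v ` {0<..<1} = {}"
proof -
  interpret disk_triangle M \<delta> c a b e r using f by (simp add: face_at_def)
  have S: "S = {a,b,e}" using f by (auto simp: face_at_def)
  note sm = edge_small[OF e]
  show ?thesis
  proof (cases "{u,v} \<subseteq> S")
    case True
    then have "seg u v ` {0..1} \<subseteq> geodesic_sides M S"
      using seg_minimal[OF sm] e(2) unfolding geodesic_sides_def by blast
    then have "seg u v ` {0..1} \<subseteq> sides" using geodesic_sides_eq S by simp
    moreover have "seg u v ` {0<..<1} \<subseteq> seg u v ` {0..1}" by (rule image_mono) auto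
    ultimately show ?thesis using tri_int_sides by blast
  next
    case False
    let ?X = "seg u v ` {0<..<1}"
    have conn: "connected ?X"
      by (rule connected_continuous_image[OF continuous_on_subset[OF seg_cont[OF sm]]]) auto
    have no: "?X \<inter> sides = {}"
    proof (rule equals0I)
      fix z assume "z \<in> ?X \<inter> sides"
      then obtain s where s: "0 < s" "s < 1" "z = seg u v s" and z: "z \<in> sides" by auto
      obtain x y t where xy: "x \<in> S" "y \<in> S" "x \<noteq> y" "{x,y} \<in> edges M \<delta> p" "t \<in> {0..1}" "z = seg x y t"
        using face_side[OF f z] .
      have "{u,v} \<noteq> {x,y}" using False xy by auto
      then show False using edges_disjoint[OF e xy(4,3) _ s(1,2) xy(5)] s(3) xy(6) by simp
    qed
    show ?thesis
    proof (rule ccontr)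
      assume "tri_int \<inter> ?X \<noteq> {}"
      then have "?X \<subseteq> tri_int" using tri_int_clopen[OF conn no] by blast
      then have "?X \<subseteq> tri" by (auto simp: tri_eq)
      \<comment> \<open>The triangle is closed, so the ends of the edge belong to it as
        well.\<close>
      moreover have "closure {0<..<1::real} = {0..1}" by simp
      ultimately have X: "seg u v ` {0..1} \<subseteq> tri"
        using image_closure_subset[of "{0<..<1}" "seg u v" tri] seg_cont[OF sm] compact_imp_closed[OF compact_tri] by simp
      have uvV: "{u,v} \<subseteq> V" using e(1) by (auto simp: edges_def)
      have inS: "y \<in> S" if y: "y \<in> tri" "y \<in> V" for y
      proof -
        have "y \<in> sides" using y face_vertex_disjoint[OF f] by (auto simp: tri_eq)
        then obtain x x' t where x: "x \<in> S" "x' \<in> S" "x \<noteq> x'" "{x,x'} \<in> edges M \<delta> p" "t \<in> {0..1}" "y = seg x x' t"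
          using face_side[OF f] by metis
        have "y \<in> {x,x'}" using edge_seg_vertex[OF x(4,3,5)] x(6) y(2) by simp
        moreover have "{x,x'} \<subseteq> S" using x(1,2) by simp
        ultimately show ?thesis by (rule rev_subsetD)
      qed
      have "seg u v 0 \<in> tri" "seg u v 1 \<in> tri" using X by auto
      then have "u \<in> tri" "v \<in> tri" using seg_ends[OF sm] by auto
      then show False using inS uvV False by blast
    qed
  qed
qed

text \<open>The open triangle of S is connected and misses the sides of S', so as soon as the two
  open triangles meet it is contained in the other. The corners of S are then corners of S', and by
  symmetry the faces are equal.\<close>

lemma faces_disjoint:
  assumes f: "face_at S c r a b e" and f': "face_at S' c' r' a' b' e'" and ne: "S \<noteq> S'"
  shows "disk_triangle.tri_int M \<delta> a b e \<inter> disk_triangle.tri_int M \<delta> a' b' e' = {}"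
proof -
  have sub: "S \<subseteq> S'" if f: "face_at S c r a b e" and f': "face_at S' c' r' a' b' e'"
    and m: "disk_triangle.tri_int M \<delta> a b e \<inter> disk_triangle.tri_int M \<delta> a' b' e' \<noteq> {}" for S c r a b e S' c' r' a' b' e'
  proof -
    interpret A: disk_triangle M \<delta> c a b e r using f by (simp add: face_at_def)
    interpret B: disk_triangle M \<delta> c' a' b' e' r' using f' by (simp add: face_at_def)
    have S: "S = {a,b,e}" "S \<in> faces M \<delta> p" using f by (auto simp: face_at_def)
    have SV: "S \<subseteq> V" using S(2) by (auto simp: faces_def)
    have "A.tri_int \<inter> B.sides = {}"
    proof (rule equals0I)
      fix z assume z: "z \<in> A.tri_int \<inter> B.sides"
      obtain x y t where x: "x \<in> S'" "y \<in> S'" "x \<noteq> y" "{x,y} \<in> edges M \<delta> p" "t \<in> {0..1}" "z = seg x y t"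
        using face_side[OF f'] z by blast
      show False
      proof (cases "0 < t \<and> t < 1")
        case True
        then have "z \<in> seg x y ` {0<..<1}" using x(6) by auto
        then show False using face_edge_disjoint[OF f x(4,3)] z by blast
      next
        case False
        then have "t = 0 \<or> t = 1" using x(5) by auto
        then have "z \<in> {x,y}" using seg_ends[OF edge_small[OF x(4,3)]] x(6) by auto
        moreover have "{x,y} \<subseteq> V" using x(4) by (auto simp: edges_def)
        ultimately show False using face_vertex_disjoint[OF f] z by blast
      qed
    qed
    then have "A.tri_int \<subseteq> B.tri_int" using B.tri_int_clopen[OF A.connected_tri_int] m by blast
    then have "A.tri_int \<subseteq> B.tri" by (auto simp: B.tri_eq)
    moreover have "A.tri \<subseteq> B.tri"
    proof -
      have cl: "closure ({0<..<1::real} \<times> {0<..<1::real}) = {0..1} \<times> {0..1}" by (simp add: closure_Times)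
      have "(\<lambda>(s,t). A.\<kappa> s t) ` closure ({0<..<1} \<times> {0<..<1}) \<subseteq> B.tri"
      proof (rule image_closure_subset)
        show "continuous_on (closure ({0<..<1} \<times> {0<..<1})) (\<lambda>(s,t). A.\<kappa> s t)"
          unfolding cl by (rule A.continuous_on_\<kappa>)
        show "closed B.tri" by (rule compact_imp_closed[OF B.compact_tri])
        show "(\<lambda>(s,t). A.\<kappa> s t) ` ({0<..<1} \<times> {0<..<1}) \<subseteq> B.tri"
          using \<open>A.tri_int \<subseteq> B.tri\<close> unfolding A.tri_int_def .
      qed
      then show ?thesis unfolding cl A.tri_def .
    qed
    moreover have "S \<subseteq> A.tri"
    proof -
      have "seg a b 0 \<in> A.tri" "seg a b 1 \<in> A.tri" "seg a e 1 \<in> A.tri" unfolding A.tri_eq A.sides_def by simp_all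
      then show ?thesis using seg_ends[OF A.d_ab] seg_ends[OF A.d_ae] by (simp add: S(1))
    qed
    ultimately have ST: "S \<subseteq> B.tri" by blast
    show "S \<subseteq> S'"
    proof
      fix y assume y: "y \<in> S"
      have "y \<in> B.sides" using y ST SV face_vertex_disjoint[OF f'] by (auto simp: B.tri_eq)
      then obtain x x' t where x: "x \<in> S'" "x' \<in> S'" "x \<noteq> x'" "{x,x'} \<in> edges M \<delta> p" "t \<in> {0..1}" "y = seg x x' t"
        using face_side[OF f'] by metis
      have "y \<in> V" using y SV by blast
      then have "y \<in> {x,x'}" using edge_seg_vertex[OF x(4,3,5)] x(6) by simp
      moreover have "{x,x'} \<subseteq> S'" using x(1,2) by simp
      ultimately show "y \<in> S'" by (rule rev_subsetD)
    qed
  qed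
  show ?thesis
  proof (rule ccontr)
    assume m: "disk_triangle.tri_int M \<delta> a b e \<inter> disk_triangle.tri_int M \<delta> a' b' e' \<noteq> {}"
    then show False using sub[OF f f' m] sub[OF f' f] ne by blast
  qed
qed

lemma ocells_disjoint:
  assumes "S \<in> K" "T \<in> K" "S \<noteq> T"
  shows "cmap ` ocell S \<inter> cmap ` ocell T = {}"
proof -
  have vert: "cmap ` ocell {v} \<subseteq> {v}" for v using cmap_cell_vertex[of v] by (auto simp: ocell_def)
  have VE: "{y} \<inter> seg u v ` {0<..<1} = {}" if "y \<in> V" "u \<noteq> v" "{u,v} \<in> edges M \<delta> p" for y u v
    using edge_interior_not_vertex[OF that(3,2,1)] by fastforce
  have EE: "seg u v ` {0<..<1} \<inter> seg x y ` {0<..<1} = {}"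
    if "u \<noteq> v" "{u,v} \<in> edges M \<delta> p" "x \<noteq> y" "{x,y} \<in> edges M \<delta> p" "{u,v} \<noteq> {x,y}" for u v x y
    using edges_disjoint[OF that(2,1,4,3,5)] by fastforce
  show ?thesis
    using assms(1)
  proof (cases rule: simplex_cases)
    case (vertex v)
    show ?thesis using assms(2)
    proof (cases rule: simplex_cases)
      case (vertex v')
      then show ?thesis using vert[of v] vert[of v'] \<open>S = {v}\<close> assms(3) by blast
    next
      case (edge x y)
      then show ?thesis using vert[of v] ocell_edge(1)[OF edge(3,2)] VE[OF vertex(1) edge(2,3)] vertex(2) by blast
    next
      case (face c r a b e)
      then show ?thesis using vert[of v] ocell_face(1)[OF face] face_vertex_disjoint[OF face vertex(1)] vertex(2) by blast
    qed
  next
    case (edge u v)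
    show ?thesis using assms(2)
    proof (cases rule: simplex_cases)
      case (vertex y)
      then show ?thesis using vert[of y] ocell_edge(1)[OF edge(3,2)] VE[OF vertex(1) edge(2,3)] edge(1) by blast
    next
      case e': (edge x y)
      have "{u,v} \<noteq> {x,y}" using assms(3) edge(1) e'(1) by simp
      then show ?thesis using ocell_edge(1)[OF edge(3,2)] ocell_edge(1)[OF e'(3,2)] EE[OF edge(2,3) e'(2,3)] edge(1) e'(1) by blast
    next
      case (face c r a b e)
      then show ?thesis using ocell_edge(1)[OF edge(3,2)] ocell_face(1)[OF face] face_edge_disjoint[OF face edge(3,2)] edge(1) by blast
    qed
  next
    case (face c r a b e)
    show ?thesis using assms(2)
    proof (cases rule: simplex_cases)
      case (vertex y)
      then show ?thesis using vert[of y] ocell_face(1)[OF face] face_vertex_disjoint[OF face vertex(1)] by blast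
    next
      case (edge x y)
      then show ?thesis using ocell_edge(1)[OF edge(3,2)] ocell_face(1)[OF face] face_edge_disjoint[OF face edge(3,2)] by blast
    next
      case f': (face c' r' a' b' e')
      then show ?thesis using ocell_face(1)[OF face] ocell_face(1)[OF f'] faces_disjoint[OF face f' assms(3)] by blast
    qed
  qed
qed

lemma inj_on_cmap: "inj_on cmap (realization M \<delta> p)"
proof (rule inj_onI)
  fix w w' assume w: "w \<in> realization M \<delta> p" "w' \<in> realization M \<delta> p" and eq: "cmap w = cmap w'"
  let ?S = "{v. w v \<noteq> 0}" and ?S' = "{v. w' v \<noteq> 0}"
  note o = realization_ocell[OF w(1)] and o' = realization_ocell[OF w(2)]
  have SS: "?S = ?S'"
  proof (rule ccontr)
    assume "?S \<noteq> ?S'"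
    from ocells_disjoint[OF o(1) o'(1) this] show False using o(2) o'(2) eq by blast
  qed
  have "inj_on cmap (ocell ?S)" using o(1)
  proof (cases rule: simplex_cases)
    case (vertex v)
    have "ocell {v} \<subseteq> cell {v}" by (auto simp: ocell_def)
    then show ?thesis unfolding vertex(2) cell_singleton by (auto intro: inj_onI)
  next
    case (edge u v) then show ?thesis using ocell_edge(2)[OF edge(3,2)] by simp
  next
    case (face c r a b e) then show ?thesis using ocell_face(2) by blast
  qed
  then show "w = w'" using o(2) o'(2) eq unfolding SS by (meson inj_onD)
qed

end

section \<open>Surjectivity of self-maps of the surface\<close>

context riem_surface
begin

lemma open_image_injective:
  assumes f: "continuous_on UNIV f" "inj f" shows "open (range (f :: 'a \<Rightarrow> 'a))"
  unfolding open_subopen[of "range f"]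
proof
  fix q assume "q \<in> range f"
  then obtain y where y: "q = f y" by blast
  obtain c where c: "c \<in> atlas M" "f y \<in> fst c" using chart_at by blast
  have "open (f -` fst c)" using f(1) open_dom[OF c(1)] by (simp add: continuous_on_open_vimage)
  moreover have "y \<in> f -` fst c" using c(2) by simp
  ultimately obtain e \<rho> where e: "e \<in> atlas M" "y \<in> fst e" "\<rho> > 0" "cball (snd e y) \<rho> \<subseteq> img e"
    "chart_inv e ` cball (snd e y) \<rho> \<subseteq> f -` fst c" by (rule chart_ball)
  let ?U = "ball (snd e y) \<rho>" and ?g = "\<lambda>x. snd c (f (chart_inv e x))"
  have sub: "?U \<subseteq> img e" using e(4) ball_subset_cball by blast
  have dom: "f (chart_inv e x) \<in> fst c" if "x \<in> ?U" for x using e(5) that ball_subset_cball by blast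
  have "continuous_on ?U (\<lambda>x. f (chart_inv e x))"
    by (rule continuous_on_compose2[OF f(1) continuous_on_subset[OF continuous_chart_inv[OF e(1)] sub]]) simp
  then have "continuous_on ?U ?g"
    by (rule continuous_on_compose2[OF continuous_chart[OF c(1)]]) (use dom in blast)
  moreover have "inj_on ?g ?U"
  proof (rule inj_onI)
    fix x x' assume x: "x \<in> ?U" "x' \<in> ?U" "?g x = ?g x'"
    have "f (chart_inv e x) = f (chart_inv e x')" by (rule inj_onD[OF chart_inj[OF c(1)] x(3) dom[OF x(1)] dom[OF x(2)]])
    then have "chart_inv e x = chart_inv e x'" by (rule injD[OF f(2)])
    then have eq: "snd e (chart_inv e x) = snd e (chart_inv e x')" by (rule arg_cong)
    have "x \<in> img e" "x' \<in> img e" by (rule subsetD[OF sub x(1)], rule subsetD[OF sub x(2)])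
    show "x = x'" using eq unfolding snd_chart_inv[OF e(1) \<open>x \<in> img e\<close>] snd_chart_inv[OF e(1) \<open>x' \<in> img e\<close>] .
  qed
  ultimately have "open (?g ` ?U)" by (intro invariance_of_domain) auto
  moreover have "?g ` ?U \<subseteq> img c" using dom by blast
  ultimately have "open (chart_inv c ` ?g ` ?U)" by (rule chart_inv_open[OF c(1)])
  moreover have "chart_inv c ` ?g ` ?U = (\<lambda>x. f (chart_inv e x)) ` ?U"
    unfolding image_image by (rule image_cong[OF refl]) (rule chart_inv_snd[OF c(1) dom])
  moreover have "q \<in> (\<lambda>x. f (chart_inv e x)) ` ?U"
    using e(3) chart_inv_snd[OF e(1,2)] y by (intro image_eqI[of _ _ "snd e y"]) auto
  moreover have "(\<lambda>x. f (chart_inv e x)) ` ?U \<subseteq> range f" by blast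
  ultimately show "\<exists>T. open T \<and> q \<in> T \<and> T \<subseteq> range f" by metis
qed

text \<open>The image is compact, hence closed, and it is open by invariance of domain;
  connectedness does the rest.\<close>

lemma injective_imp_surj:
  assumes f: "continuous_on UNIV f" "inj f" shows "range (f :: 'a \<Rightarrow> 'a) = UNIV"
proof -
  have cl: "closed (range f)" by (rule compact_imp_closed[OF compact_continuous_image[OF f(1) compact_surface]])
  have op: "open (range f)" by (rule open_image_injective[OF f])
  have "openin (top_of_set UNIV) (range f) \<and> closedin (top_of_set UNIV) (range f)" using cl op by simp
  then have "range f = {} \<or> range f = UNIV" using connected_surface unfolding connected_clopen by blast
  then show ?thesis by simp
qed

lemma finite_disk_cover:
  assumes T: "compact T" and r: "\<And>x. x \<in> T \<Longrightarrow> r x > 0"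
  obtains X where "finite X" "X \<subseteq> T" "T \<subseteq> (\<Union>x\<in>X. disk M x (r x))"
proof (rule compactE_image[OF T])
  show "open (disk M x (r x))" for x by simp
  show "T \<subseteq> (\<Union>x\<in>T. disk M x (r x))" using r by (force simp: disk_def)
qed (use that in blast)

text \<open>Uniform continuity of a chart by a Lebesgue number argument: the cover uses half of the
  radius on which the local estimate holds, which leaves room for y.\<close>

lemma chart_uniform_near:
  assumes c: "c \<in> atlas M" and Q: "compact Q" "Q \<subseteq> fst c" and s: "s > 0"
  obtains \<rho> where "\<rho> > 0" "\<And>x y. x \<in> Q \<Longrightarrow> d x y < \<rho> \<Longrightarrow> y \<in> fst c \<and> dist (snd c x) (snd c y) < s"
proof -
  have "\<exists>r>0. \<forall>y. d x y < 2 * r \<longrightarrow> y \<in> fst c \<and> dist (snd c x) (snd c y) < s/2" if x: "x \<in> Q" for x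
  proof -
    have "open (fst c \<inter> snd c -` ball (snd c x) (s/2))"
      by (rule continuous_open_preimage[OF continuous_chart[OF c] open_dom[OF c]]) simp
    moreover have "x \<in> fst c \<inter> snd c -` ball (snd c x) (s/2)" using x Q(2) s by auto
    ultimately obtain e where e: "e > 0" "\<And>y. d x y < e \<Longrightarrow> y \<in> fst c \<inter> snd c -` ball (snd c x) (s/2)"
      unfolding open_iff_rdist by blast
    have "y \<in> fst c \<and> dist (snd c x) (snd c y) < s/2" if "d x y < 2 * (e/2)" for y
      using e(2)[of y] that by simp
    then show ?thesis using e(1) by (intro exI[of _ "e/2"]) simp
  qed
  then have "\<forall>x\<in>Q. \<exists>r. r > 0 \<and> (\<forall>y. d x y < 2 * r \<longrightarrow> y \<in> fst c \<and> dist (snd c x) (snd c y) < s/2)" by simp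
  from bchoice[OF this] obtain r where
    r': "\<forall>x\<in>Q. r x > 0 \<and> (\<forall>y. d x y < 2 * r x \<longrightarrow> y \<in> fst c \<and> dist (snd c x) (snd c y) < s/2)" ..
  then have r: "\<And>x. x \<in> Q \<Longrightarrow> r x > 0"
    "\<And>x y. x \<in> Q \<Longrightarrow> d x y < 2 * r x \<Longrightarrow> y \<in> fst c \<and> dist (snd c x) (snd c y) < s/2" by blast+
  obtain X where X: "finite X" "X \<subseteq> Q" "Q \<subseteq> (\<Union>x\<in>X. disk M x (r x))" 
  proof (rule finite_disk_cover[OF Q(1), of r])
    show "r x > 0" if "x \<in> Q" for x using r(1)[OF that] .
  qed (rule that)
  define \<rho> where "\<rho> = Min (insert 1 (r ` X))"
  have \<rho>: "\<rho> > 0" "\<And>x. x \<in> X \<Longrightarrow> \<rho> \<le> r x" using X r(1) by (auto simp: \<rho>_def)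
  have "y \<in> fst c \<and> dist (snd c x) (snd c y) < s" if x: "x \<in> Q" and y: "d x y < \<rho>" for x y
  proof -
    obtain z where z: "z \<in> X" "d z x < r z" using X(3) x by (auto simp: disk_def)
    have zQ: "z \<in> Q" using z X(2) by blast
    have 1: "d z x < 2 * r z" using z(2) r(1)[OF zQ] by linarith
    have 2: "d z y < 2 * r z" using rdist_triangle[of z y x] z(2) y \<rho>(2)[OF z(1)] by linarith
    have "dist (snd c x) (snd c y) \<le> dist (snd c z) (snd c x) + dist (snd c z) (snd c y)" by (rule dist_triangle3)
    then show ?thesis using r(2)[OF zQ 1] r(2)[OF zQ 2] by linarith
  qed
  then show ?thesis using that \<rho>(1) by blast
qed

text \<open>In a chart around the target point the map is a small perturbation of the identity, and
  Brouwer's theorem solves for a preimage. The admissible perturbation is locally uniform, and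
  compactness makes it uniform.\<close>

lemma near_identity_surj:
  obtains \<rho> where "\<rho> > 0" "\<And>g. continuous_on UNIV g \<Longrightarrow> (\<And>x. d x (g x) < \<rho>) \<Longrightarrow> range g = UNIV"
proof -
  define P where "P y0 \<rho> N \<longleftrightarrow> \<rho> > 0 \<and> open N \<and> y0 \<in> N \<and>
    (\<forall>g. continuous_on UNIV g \<longrightarrow> (\<forall>x. d x (g x) < \<rho>) \<longrightarrow> N \<subseteq> range g)" for y0 \<rho> and N :: "'a set"
  have "\<exists>\<rho> N. P y0 \<rho> N" for y0
  proof -
    obtain c \<rho>' where c: "c \<in> atlas M" "y0 \<in> fst c" "\<rho>' > 0" "cball (snd c y0) \<rho>' \<subseteq> img c"
      by (rule chart_ball[OF open_UNIV UNIV_I, of y0], rule that)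
    \<comment> \<open>Half the radius, so that balls of radius s around points of the smaller ball
      stay within the larger one.\<close>
    define s where "s = \<rho>' / 2"
    have s: "s > 0" using c(3) by (simp add: s_def)
    let ?Q = "chart_inv c ` cball (snd c y0) \<rho>'"
    have Q: "compact ?Q" "?Q \<subseteq> fst c"
      by (rule compact_continuous_image[OF continuous_on_subset[OF continuous_chart_inv[OF c(1)] c(4)] compact_cball])
        (use chart_inv_image[OF c(1)] image_mono[OF c(4), of "chart_inv c"] in simp)
    obtain \<rho> where \<rho>: "\<rho> > 0" "\<And>x y. x \<in> ?Q \<Longrightarrow> d x y < \<rho> \<Longrightarrow> y \<in> fst c \<and> dist (snd c x) (snd c y) < s"
      by (rule chart_uniform_near[OF c(1) Q s], rule that)
    let ?N = "chart_inv c ` ball (snd c y0) s"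
    have "ball (snd c y0) s \<subseteq> cball (snd c y0) \<rho>'" using c(3) by (auto simp: s_def)
    then have sub: "ball (snd c y0) s \<subseteq> img c" using c(4) by (rule subset_trans)
    have N: "open ?N" by (rule chart_inv_open[OF c(1) open_ball sub])
    have N': "y0 \<in> ?N"
      by (rule image_eqI[of _ _ "snd c y0"]) (use chart_inv_snd[OF c(1,2)] s in simp_all)
    have "y \<in> range g" if g: "continuous_on UNIV g" "\<And>x. d x (g x) < \<rho>" and y: "y \<in> ?N" for g y
    proof -
      obtain v0 where v0: "v0 \<in> ball (snd c y0) s" "y = chart_inv c v0" using y by blast
      have cb: "v \<in> cball (snd c y0) \<rho>'" if "v \<in> cball v0 s" for v
      proof -
        have "dist (snd c y0) v0 < s" "dist v0 v \<le> s" using v0(1) that by simp_all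
        then have "dist (snd c y0) v \<le> s + s" using dist_triangle[of "snd c y0" v v0] by linarith
        then show ?thesis by (simp add: s_def)
      qed
      have near: "g (chart_inv c v) \<in> fst c \<and> dist v (snd c (g (chart_inv c v))) < s" if v: "v \<in> cball v0 s" for v
      proof -
        have "chart_inv c v \<in> ?Q" using cb[OF v] by blast
        from \<rho>(2)[OF this g(2)] show ?thesis using snd_chart_inv[OF c(1) subsetD[OF c(4) cb[OF v]]] by simp
      qed
      have "continuous_on (cball v0 s) (\<lambda>v. g (chart_inv c v))"
        by (rule continuous_on_compose2[OF g(1) continuous_on_subset[OF continuous_chart_inv[OF c(1)]]]) (use cb c(4) in auto)
      then have cont: "continuous_on (cball v0 s) (\<lambda>v. snd c (g (chart_inv c v)))"
        by (rule continuous_on_compose2[OF continuous_chart[OF c(1)]]) (use near in blast)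
      \<comment> \<open>Subtracting the displacement from \<open>v0\<close> maps the ball to itself;
        a fixed point of this map is a preimage.\<close>
      have "\<exists>v\<in>cball v0 s. snd c (g (chart_inv c v)) = v0"
      proof (rule brouwer_surjective_cball[OF cont s])
        show "v0 \<in> {v0}" by simp
        fix x v assume "x \<in> {v0}" "v \<in> cball v0 s"
        then show "x + (v - snd c (g (chart_inv c v))) \<in> cball v0 s" using near[of v] by (simp add: dist_norm norm_minus_commute)
      qed
      then obtain v where v: "v \<in> cball v0 s" "snd c (g (chart_inv c v)) = v0" by blast
      have "chart_inv c (snd c (g (chart_inv c v))) = g (chart_inv c v)"
        by (rule chart_inv_snd[OF c(1)]) (use near[OF v(1)] in blast)
      then have "g (chart_inv c v) = y" using v(2) v0(2) by simp
      then show ?thesis by blast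
    qed
    then have "?N \<subseteq> range g" if "continuous_on UNIV g" "\<forall>x. d x (g x) < \<rho>" for g using that by blast
    then have "P y0 \<rho> ?N" unfolding P_def using \<rho>(1) N N' by blast
    then show ?thesis by blast
  qed
  then have "\<forall>y0. \<exists>\<rho>. \<exists>N. P y0 \<rho> N" by blast
  from choice[OF this] obtain \<rho> where "\<forall>y0. \<exists>N. P y0 (\<rho> y0) N" ..
  from choice[OF this] obtain N where PN: "\<forall>y0. P y0 (\<rho> y0) (N y0)" ..
  then have \<rho>: "\<And>y. \<rho> y > 0" "\<And>y. open (N y)" "\<And>y. y \<in> N y"
    "\<And>y g. continuous_on UNIV g \<Longrightarrow> (\<forall>x. d x (g x) < \<rho> y) \<Longrightarrow> N y \<subseteq> range g"
    unfolding P_def by simp_all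
  obtain Y where Y: "finite Y" "UNIV \<subseteq> (\<Union>y\<in>Y. N y)"
  proof (rule compactE_image[OF compact_surface, of UNIV N])
    show "open (N y)" for y by (rule \<rho>(2))
    show "UNIV \<subseteq> (\<Union>y\<in>UNIV. N y)" using \<rho>(3) by blast
  qed (use that in blast)
  define \<rho>0 where "\<rho>0 = Min (insert 1 (\<rho> ` Y))"
  have \<rho>0: "\<rho>0 > 0" "\<And>y. y \<in> Y \<Longrightarrow> \<rho>0 \<le> \<rho> y" using Y \<rho>(1) by (auto simp: \<rho>0_def)
  show ?thesis
  proof (rule that[OF \<rho>0(1)])
    fix g assume g: "continuous_on UNIV g" "\<And>x. d x (g x) < \<rho>0"
    have "N y \<subseteq> range g" if "y \<in> Y" for y
    proof (rule \<rho>(4)[OF g(1)], rule allI)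
      fix x show "d x (g x) < \<rho> y" using g(2)[of x] \<rho>0(2)[OF that] by (rule less_le_trans)
    qed
    then show "range g = UNIV" using Y(2) by blast
  qed
qed

end

section \<open>Delaunay configurations and the nerve map\<close>

context config_complex
begin

lemma delaunay_if_onto:
  assumes "cmap ` realization M \<delta> p = UNIV" shows "p \<in> delaunay_configs M \<delta>"
proof -
  obtain g where "homeomorphism (realization M \<delta> p) UNIV cmap g"
    using homeomorphism_compact[OF compact_realization continuous_on_cmap assms inj_on_cmap] by blast
  then show ?thesis using natural_map_cmap p unfolding delaunay_configs_def by blast
qed

text \<open>If \<open>h\<close> is any homeomorphism of the realization onto the surface, then \<open>cmap \<circ> h\<^sup>-\<^sup>1\<close> is an
  injective continuous self-map of a closed surface, hence onto.\<close>

lemma delaunay_iff: "p \<in> delaunay_configs M \<delta> \<longleftrightarrow> realization M \<delta> p homeomorphic (UNIV :: 'a set)"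
proof
  assume "p \<in> delaunay_configs M \<delta>"
  then show "realization M \<delta> p homeomorphic (UNIV :: 'a set)" unfolding delaunay_configs_def homeomorphic_def by blast
next
  assume "realization M \<delta> p homeomorphic (UNIV :: 'a set)"
  then obtain f g where "homeomorphism (realization M \<delta> p) (UNIV :: 'a set) f g" unfolding homeomorphic_def by blast
  then have g: "continuous_on UNIV g" "range g = realization M \<delta> p" "\<And>y. f (g y) = y" unfolding homeomorphism_def by auto
  have "continuous_on UNIV (\<lambda>y. cmap (g y))"
    by (rule continuous_on_compose2[OF continuous_on_cmap g(1)]) (use g(2) in simp)
  moreover have "inj (\<lambda>y. cmap (g y))"
  proof (rule injI)
    fix x y assume "cmap (g x) = cmap (g y)"
    then have "g x = g y" using inj_onD[OF inj_on_cmap] g(2) by blast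
    then show "x = y" using g(3) by metis
  qed
  ultimately have "range (\<lambda>y. cmap (g y)) = UNIV" by (rule injective_imp_surj)
  then have "cmap ` realization M \<delta> p = UNIV" unfolding g(2)[symmetric] by (simp add: image_image)
  then show "p \<in> delaunay_configs M \<delta>" by (rule delaunay_if_onto)
qed

text \<open>A point of the cone is no farther from the apex a than the corresponding point of the
  opposite side, and that point is reached by way of b; hence the factor 2.\<close>

lemma cmap_near:
  assumes S: "S \<in> K" and w: "w \<in> cell S" and D: "\<And>u v. u \<in> S \<Longrightarrow> v \<in> S \<Longrightarrow> d u v \<le> D"
  obtains v where "v \<in> S" "d v (cmap w) \<le> 2 * D"
  using S
proof (cases rule: simplex_cases)
  case (vertex v)
  then have "cmap w = v" using cmap_cell_vertex[of v] w by auto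
  then show ?thesis using that[of v] D[of v v] vertex by simp
next
  case (edge u v)
  note ce = cmap_edge[OF edge(2) edge_small[OF edge(3,2)] w[unfolded edge(1)]]
  have "d u (cmap w) = d u v * w v" using seg_dist_left[OF edge_small[OF edge(3,2)] ce(2)] ce(1) by simp
  also have "\<dots> \<le> d u v * 1" using ce(2) by (intro mult_left_mono) auto
  finally have 1: "d u (cmap w) \<le> d u v" by simp
  have uv: "u \<in> S" "v \<in> S" using edge(1) by auto
  have "d u (cmap w) \<le> 2 * D" using 1 D[OF uv] rdist_nonneg[of u v] by linarith
  then show ?thesis by (rule that[OF uv(1)])
next
  case (face c r a b e)
  interpret disk_triangle M \<delta> c a b e r using face by (simp add: face_at_def)
  have S: "S = {a,b,e}" using face by (auto simp: face_at_def)
  note cf = cmap_face[OF face w]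
  let ?t = "w e / (w b + w e)" and ?s = "w b + w e"
  have "d a (cmap w) = d a (seg b e ?t) * ?s"
    unfolding cf(1) \<kappa>_def by (rule seg_dist_left[OF d_side[OF cf(3)] cf(2)])
  also have "\<dots> \<le> d a (seg b e ?t) * 1" using cf(2) by (intro mult_left_mono) auto
  also have "\<dots> \<le> d a b + d b (seg b e ?t)" using rdist_triangle[of a "seg b e ?t" b] by simp
  also have "d b (seg b e ?t) = d b e * ?t" by (rule seg_dist_left[OF d_be cf(3)])
  also have "\<dots> \<le> d b e * 1" using cf(3) by (intro mult_left_mono) auto
  finally have "d a (cmap w) \<le> d a b + d b e" by simp
  moreover have abe: "a \<in> S" "b \<in> S" "e \<in> S" using S by auto
  ultimately have "d a (cmap w) \<le> 2 * D" using D[OF abe(1,2)] D[OF abe(2,3)] by linarith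
  then show ?thesis by (rule that[OF abe(1)])
qed

text \<open>The disk around x that reaches to its nearest points is empty, and at most three points
  lie on its circle. Radius 0 is a separate case, in which x is itself a vertex.\<close>

lemma nearest_simplex:
  assumes S: "S \<subseteq> V" "S \<noteq> {}" and r: "r < \<delta>" "\<And>v. v \<in> S \<Longrightarrow> d x v = r" "\<And>v. v \<in> V \<Longrightarrow> r \<le> d x v"
  shows "S \<in> K"
proof (cases "r = 0")
  case True
  then have "S = {x}" using S r(2) by auto
  then show ?thesis using S by (auto simp: simplices_def)
next
  case False
  obtain v where "v \<in> S" using S(2) by blast
  then have "0 \<le> r" using r(2) rdist_nonneg[of x v] by simp
  with False have r0: "0 < r" by simp
  have fin: "finite S" by (rule finite_subset[OF S(1) finite_V])
  have "card S \<le> 3"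
  proof (rule ccontr)
    assume "\<not> card S \<le> 3"
    then have "4 \<le> card S" by simp
    then obtain T where T: "T \<subseteq> S" "card T = 4" by (rule obtain_subset_with_card_n)
    have "T \<subseteq> circle M x r" using T(1) r(2) by (auto simp: circle_def)
    moreover have "T \<subseteq> V" using T(1) S(1) by (rule subset_trans)
    ultimately show False using no_four[OF _ T(2) r(1)] by simp
  qed
  moreover have "card S \<noteq> 0" using S(2) fin by simp
  ultimately consider "card S = 1" | "card S = 2" | "card S = 3" by linarith
  moreover have D: "empty_disk M \<delta> p (disk M x r)" "S \<subseteq> frontier (disk M x r)"
    by (rule empty_diskI[OF r(1) r0 r(2,3)], assumption+)+
  ultimately show ?thesis
  proof cases
    case 1 then show ?thesis using S(1) by (auto simp: simplices_def card_1_singleton_iff)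
  next
    case 2 then have "S \<in> edges M \<delta> p" unfolding edges_def using D S(1) by blast
    then show ?thesis by (simp add: simplices_def)
  next
    case 3 then have "S \<in> faces M \<delta> p" unfolding faces_def using D S(1) by blast
    then show ?thesis by (simp add: simplices_def)
  qed
qed

text \<open>\<open>\<phi>\<close> spreads x over its nearly nearest points by a partition of unity.
  Followed by \<open>cmap\<close> it moves x by less than 10\<epsilon>: the points involved are less
  than 2\<epsilon> from x, hence at most 4\<epsilon> from each other, and \<open>cmap_near\<close>
  doubles the latter.\<close>

lemma dense_onto:
  assumes \<rho>: "\<And>g. continuous_on UNIV g \<Longrightarrow> (\<And>x. d x (g x) < \<rho>) \<Longrightarrow> range g = (UNIV :: 'a set)"
    and \<epsilon>: "0 < \<epsilon>" "\<epsilon> \<le> \<delta>" "10 * \<epsilon> \<le> \<rho>" and dense: "\<And>x. \<exists>v\<in>V. d x v < \<epsilon>"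
  shows "cmap ` realization M \<delta> p = UNIV"
proof -
  have V: "V \<noteq> {}" "finite V" using dense finite_V by auto
  define R0 where "R0 x = Min ((\<lambda>v. d x v) ` V)" for x
  have R0_le: "R0 x \<le> d x v" if "v \<in> V" for x v using that V by (auto simp: R0_def)
  have R0_ex: "\<exists>v\<in>V. d x v = R0 x" for x
  proof -
    have "Min ((\<lambda>v. d x v) ` V) \<in> (\<lambda>v. d x v) ` V" using V by (intro Min_in) auto
    then show ?thesis unfolding R0_def by (metis imageE)
  qed
  have R0_lt: "R0 x < \<epsilon>" for x
  proof -
    obtain v where "v \<in> V" "d x v < \<epsilon>" using dense[of x] by blast
    then show ?thesis using R0_le[of v x] by linarith
  qed
  have R0_cont: "continuous_on UNIV R0"
  proof -
    have "continuous_on UNIV (\<lambda>x. Min ((\<lambda>v. d x v) ` W))" if "finite W" "W \<noteq> {}" for W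
      using that by (induction W rule: finite_ne_induct) (auto intro!: continuous_intros)
    then show ?thesis unfolding R0_def using V by blast
  qed
  \<comment> \<open>All members of S are nearest points of one and the same x; nonempty subsets of
    \<open>V\<close> of this kind are simplices.\<close>
  define active where "active S \<longleftrightarrow> (\<exists>x. \<forall>v\<in>S. d x v = R0 x)" for S
  \<comment> \<open>For any other set of points the total excess over the nearest distance has a
    positive minimum on the compact surface, so some member is always farther by a fixed
    amount.\<close>
  have gap: "\<exists>\<eta>>0. \<forall>x. \<exists>v\<in>S. R0 x + \<eta> \<le> d x v" if S: "S \<subseteq> V" "\<not> active S" for S
  proof -
    define h where "h x = (\<Sum>v\<in>S. d x v - R0 x)" for x
    have finS: "finite S" using S(1) V(2) finite_subset by blast
    have nn: "0 \<le> d x v - R0 x" if "v \<in> S" for x v using R0_le S(1) that by auto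
    have cont: "continuous_on UNIV h" unfolding h_def by (intro continuous_intros R0_cont)
    obtain x0 where x0: "\<And>x. h x0 \<le> h x" using continuous_attains_inf[OF compact_surface _ cont] by auto
    have S0: "S \<noteq> {}" using S(2) by (auto simp: active_def)
    have "h x0 \<noteq> 0"
    proof
      assume "h x0 = 0"
      then have "\<forall>v\<in>S. d x0 v - R0 x0 = 0"
        unfolding h_def using sum_nonneg_eq_0_iff[OF finS, of "\<lambda>v. d x0 v - R0 x0"] nn by blast
      then show False using S(2) by (auto simp: active_def)
    qed
    moreover have "0 \<le> h x0" unfolding h_def by (rule sum_nonneg) (rule nn)
    ultimately have h0: "h x0 > 0" by simp
    have card: "real (card S) > 0" using S0 finS by (simp add: card_gt_0_iff)
    have "\<exists>v\<in>S. R0 x + h x0 / card S \<le> d x v" for x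
    proof (rule ccontr)
      assume "\<not> (\<exists>v\<in>S. R0 x + h x0 / card S \<le> d x v)"
      then have "h x < (\<Sum>v\<in>S. h x0 / card S)" unfolding h_def by (intro sum_strict_mono finS S0) force
      also have "\<dots> = h x0" using card by simp
      finally show False using x0[of x] by simp
    qed
    then show ?thesis using h0 card by (intro exI[of _ "h x0 / card S"]) simp
  qed
  then have "\<forall>S. \<exists>\<eta>. S \<subseteq> V \<longrightarrow> \<not> active S \<longrightarrow> \<eta> > 0 \<and> (\<forall>x. \<exists>v\<in>S. R0 x + \<eta> \<le> d x v)" by blast
  from choice[OF this] obtain \<eta> where
    "\<forall>S. S \<subseteq> V \<longrightarrow> \<not> active S \<longrightarrow> \<eta> S > 0 \<and> (\<forall>x. \<exists>v\<in>S. R0 x + \<eta> S \<le> d x v)" ..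
  then have \<eta>: "\<And>S. S \<subseteq> V \<Longrightarrow> \<not> active S \<Longrightarrow> \<eta> S > 0 \<and> (\<forall>x. \<exists>v\<in>S. R0 x + \<eta> S \<le> d x v)" by blast
  define N where "N = {S. S \<subseteq> V \<and> \<not> active S}"
  \<comment> \<open>A tolerance that admits only active sets. Inserting \<epsilon> keeps it at most
    \<epsilon>, as the final distance estimate requires, and makes the set nonempty.\<close>
  define \<eta>0 where "\<eta>0 = Min (insert \<epsilon> (\<eta> ` N))"
  have finN: "finite N" unfolding N_def using V(2) by simp
  have \<eta>0: "\<eta>0 > 0" "\<eta>0 \<le> \<epsilon>" "\<And>S. S \<in> N \<Longrightarrow> \<eta>0 \<le> \<eta> S" using finN \<eta> \<epsilon>(1) by (auto simp: \<eta>0_def N_def)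
  define S where "S x = {v\<in>V. d x v < R0 x + \<eta>0}" for x
  have S_ne: "S x \<noteq> {}" for x using R0_ex[of x] \<eta>0(1) by (auto simp: S_def)
  have S_K: "S x \<in> K" for x
  proof -
    have "active (S x)"
    proof (rule ccontr)
      assume n: "\<not> active (S x)"
      then have "S x \<in> N" by (auto simp: N_def S_def)
      moreover obtain v where "v \<in> S x" "R0 x + \<eta> (S x) \<le> d x v" using \<eta>[of "S x"] n by (auto simp: S_def)
      ultimately show False using \<eta>0(3)[of "S x"] by (auto simp: S_def)
    qed
    then obtain x' where "\<forall>v\<in>S x. d x' v = R0 x'" by (auto simp: active_def)
    then show ?thesis using R0_lt[of x'] \<epsilon>(2) R0_le S_ne by (intro nearest_simplex[of _ "R0 x'" x']) (auto simp: S_def)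
  qed
  define wt where "wt x v = (if v \<in> V then max 0 (R0 x + \<eta>0 - d x v) else 0)" for x v
  define \<phi> where "\<phi> x v = wt x v / (\<Sum>u\<in>V. wt x u)" for x v
  have wt: "0 \<le> wt x v" "wt x v \<noteq> 0 \<longleftrightarrow> v \<in> S x" for x v by (auto simp: wt_def S_def)
  have tot: "(\<Sum>u\<in>V. wt x u) > 0" for x
  proof -
    obtain v where v: "v \<in> S x" using S_ne[of x] by blast
    then have "v \<in> V" "0 < wt x v" using wt[of x v] by (auto simp: S_def)
    then show ?thesis using sum_pos2[OF V(2)] wt(1) by metis
  qed
  have supp: "{v. \<phi> x v \<noteq> 0} = S x" for x
  proof -
    have "\<phi> x v \<noteq> 0 \<longleftrightarrow> wt x v \<noteq> 0" for v using tot[of x] by (simp add: \<phi>_def)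
    then show ?thesis using wt(2) by simp
  qed
  have \<phi>_cell: "\<phi> x \<in> cell (S x)" for x
  proof -
    have "sum (\<phi> x) V = 1" using tot[of x] unfolding \<phi>_def sum_divide_distrib[symmetric] by simp
    moreover have "sum (\<phi> x) V = sum (\<phi> x) (S x)"
      by (rule sum.mono_neutral_right[OF V(2)]) (use supp[of x] in \<open>auto simp: S_def\<close>)
    moreover have "0 \<le> \<phi> x v" for v using wt(1) tot[of x] by (simp add: \<phi>_def)
    ultimately show ?thesis using supp[of x] by (simp add: cell_def)
  qed
  have "continuous_on UNIV (\<lambda>x. \<phi> x v)" for v
  proof (cases "v \<in> V")
    case True
    have "continuous_on UNIV (\<lambda>x. wt x u)" if "u \<in> V" for u unfolding wt_def using that by (auto intro!: continuous_intros R0_cont)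
    then show ?thesis unfolding \<phi>_def using True tot by (intro continuous_intros) (auto simp: less_le)
  next
    case False
    then show ?thesis by (simp add: \<phi>_def wt_def)
  qed
  then have c\<phi>: "continuous_on UNIV \<phi>" by (rule continuous_on_coordinatewise_then_product)
  have \<phi>_real: "\<phi> x \<in> realization M \<delta> p" for x using \<phi>_cell S_K by (auto simp: realization_def)
  have "continuous_on UNIV (\<lambda>x. cmap (\<phi> x))"
    by (rule continuous_on_compose2[OF continuous_on_cmap c\<phi>]) (use \<phi>_real in auto)
  moreover have "d x (cmap (\<phi> x)) < \<rho>" for x
  proof -
    have b: "d x v < 2 * \<epsilon>" if "v \<in> S x" for v using that R0_lt[of x] \<eta>0(2) by (simp add: S_def)
    have D: "d u v \<le> 4 * \<epsilon>" if "u \<in> S x" "v \<in> S x" for u v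
      using rdist_triangle[of u v x] rdist_sym[of u x] b[OF that(1)] b[OF that(2)] by linarith
    obtain v where v: "v \<in> S x" "d v (cmap (\<phi> x)) \<le> 2 * (4 * \<epsilon>)"
    proof (rule cmap_near[of "S x" "\<phi> x" "4 * \<epsilon>"])
      show "S x \<in> K" "\<phi> x \<in> cell (S x)" by (rule S_K, rule \<phi>_cell)
      show "d u v \<le> 4 * \<epsilon>" if "u \<in> S x" "v \<in> S x" for u v by (rule D[OF that])
    qed (rule that)
    then show ?thesis using rdist_triangle[of x "cmap (\<phi> x)" v] b[OF v(1)] \<epsilon>(3) by linarith
  qed
  ultimately have "range (\<lambda>x. cmap (\<phi> x)) = UNIV" by (rule \<rho>)
  then show ?thesis using \<phi>_real by blast
qed

end

context delta_surface
begin

text \<open>\<epsilon> is the same for all configurations, which lets finitely many fixed disks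
  control the failure of the triangulation.\<close>

lemma dense_delaunay:
  obtains \<epsilon> where "\<epsilon> > 0" "\<And>p. p \<in> topspace (config_topology M \<delta>) \<Longrightarrow> (\<And>x. \<exists>v\<in>points p. d x v < \<epsilon>) \<Longrightarrow> p \<in> delaunay_configs M \<delta>"
proof -
  obtain \<rho> where \<rho>: "\<rho> > 0" "\<And>g. continuous_on UNIV g \<Longrightarrow> (\<And>x. d x (g x) < \<rho>) \<Longrightarrow> range g = UNIV"
  proof (rule near_identity_surj)
    fix \<rho> :: real assume r: "\<rho> > 0" "\<And>g. continuous_on UNIV g \<Longrightarrow> (\<And>x. d x (g x) < \<rho>) \<Longrightarrow> range g = UNIV"
    show thesis by (rule that[OF r])
  qed
  define \<epsilon> where "\<epsilon> = min \<delta> (\<rho> / 10)"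
  have \<epsilon>: "0 < \<epsilon>" "\<epsilon> \<le> \<delta>" "10 * \<epsilon> \<le> \<rho>" using \<rho>(1) delta_pos by (auto simp: \<epsilon>_def)
  show ?thesis
  proof (rule that[OF \<epsilon>(1)])
    fix p assume p: "p \<in> topspace (config_topology M \<delta>)" and dense: "\<And>x. \<exists>v\<in>points p. d x v < \<epsilon>"
    interpret config_complex M \<delta> p by (intro config_complex.intro config_complex_axioms.intro delta_surface_axioms p)
    show "p \<in> delaunay_configs M \<delta>" by (rule delaunay_if_onto[OF dense_onto[OF \<rho>(2) \<epsilon> dense]])
  qed
qed

end

section \<open>The area measure\<close>

text \<open>Bridge between the absolutely integrable functions of the change of variables theorem
  and the nonnegative integrals that define area.\<close>

lemma absolutely_integrable_nn_integral:
  fixes f :: "'b::euclidean_space \<Rightarrow> real"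
  assumes f: "set_borel_measurable borel A f" "\<And>x. x \<in> A \<Longrightarrow> 0 \<le> f x" and b: "0 \<le> b"
  shows "f absolutely_integrable_on A \<and> integral A f = b \<longleftrightarrow>
    (\<integral>\<^sup>+x. ennreal (f x) * indicator A x \<partial>lborel) = ennreal b"
proof
  assume "f absolutely_integrable_on A \<and> integral A f = b"
  then have "(f has_integral b) A"
    using set_lebesgue_integral_eq_integral(1) by (auto simp: has_integral_integrable_integral)
  then show "(\<integral>\<^sup>+x. ennreal (f x) * indicator A x \<partial>lborel) = ennreal b"
    using f(2) by (rule nn_integral_has_integral_lebesgue'[rotated])
next
  assume eq: "(\<integral>\<^sup>+x. ennreal (f x) * indicator A x \<partial>lborel) = ennreal b"
  have "(\<integral>\<^sup>+x. ennreal (indicator A x * f x) \<partial>lborel) = ennreal b"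
    unfolding eq[symmetric] by (intro nn_integral_cong) (auto simp: indicator_def)
  then have "((\<lambda>x. indicator A x * f x) has_integral b) UNIV"
    using f b by (intro nn_integral_has_integral) (auto simp: set_borel_measurable_def indicator_def)
  moreover have "(\<lambda>x. indicator A x * f x) = (\<lambda>x. if x \<in> A then f x else 0)" by auto
  ultimately have h: "(f has_integral b) A" by (simp add: has_integral_restrict_UNIV)
  then have "f absolutely_integrable_on A"
    using f(2) by (intro nonnegative_absolutely_integrable_1) auto
  then show "f absolutely_integrable_on A \<and> integral A f = b" using h by blast
qed

text \<open>Each finite value is attained by one integral iff by the other, so both are infinite
  together. The Jacobian times f has its own name h so that measurability can be assumed for the
  product instead of the Jacobian.\<close>

lemma nn_integral_change_of_variables:
  fixes g :: "real^'m::{finite,wellorder} \<Rightarrow> real^'m::_" and f :: "real^'m::_ \<Rightarrow> real"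
  assumes T: "T \<in> sets borel" and der: "\<And>x. x \<in> T \<Longrightarrow> (g has_derivative g' x) (at x)"
    and inj: "inj_on g T" and f: "set_borel_measurable borel (g ` T) f" "\<And>y. y \<in> g ` T \<Longrightarrow> 0 \<le> f y"
    and h: "set_borel_measurable borel T h" "\<And>x. x \<in> T \<Longrightarrow> h x = \<bar>det (matrix (g' x))\<bar> * f (g x)"
  shows "(\<integral>\<^sup>+x. ennreal (h x) * indicator T x \<partial>lborel) = (\<integral>\<^sup>+y. ennreal (f y) * indicator (g ` T) y \<partial>lborel)"
    (is "?l = ?r")
proof -
  have h0: "x \<in> T \<Longrightarrow> 0 \<le> h x" for x using h(2) f(2) by simp
  have iff: "?l = ennreal b \<longleftrightarrow> ?r = ennreal b" if b: "0 \<le> b" for b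
  proof -
    have "(\<lambda>x. \<bar>det (matrix (g' x))\<bar> *\<^sub>R vec (f (g x)) :: real^1) absolutely_integrable_on T \<and>
        integral T (\<lambda>x. \<bar>det (matrix (g' x))\<bar> *\<^sub>R vec (f (g x))) = (vec b :: real^1)
      \<longleftrightarrow> (\<lambda>x. vec (f x) :: real^1) absolutely_integrable_on (g ` T) \<and>
        integral (g ` T) (\<lambda>x. vec (f x)) = (vec b :: real^1)"
      by (rule has_absolute_integral_change_of_variables[OF _ has_derivative_at_withinI[OF der] inj])
        (use T in auto)
    then have "(\<lambda>x. \<bar>det (matrix (g' x))\<bar> * f (g x)) absolutely_integrable_on T \<and>
        integral T (\<lambda>x. \<bar>det (matrix (g' x))\<bar> * f (g x)) = b
      \<longleftrightarrow> f absolutely_integrable_on (g ` T) \<and> integral (g ` T) f = b"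
      by (simp add: absolutely_integrable_on_1_iff integral_on_1_eq)
    moreover have "(\<lambda>x. \<bar>det (matrix (g' x))\<bar> * f (g x)) absolutely_integrable_on T \<longleftrightarrow> h absolutely_integrable_on T"
      by (intro set_integrable_cong) (auto simp: h(2))
    moreover have "integral T (\<lambda>x. \<bar>det (matrix (g' x))\<bar> * f (g x)) = integral T h"
      by (intro integral_cong) (auto simp: h(2))
    ultimately show ?thesis
      using absolutely_integrable_nn_integral[OF h(1) h0 b] absolutely_integrable_nn_integral[OF f b] by simp
  qed
  show ?thesis
  proof (cases ?l rule: ennreal_cases)
    case (real b) then show ?thesis using iff by auto
  next
    case top
    then show ?thesis using iff by (cases ?r rule: ennreal_cases) auto
  qed
qed

context riem_surface
begin

abbreviation dens :: "'a chart \<Rightarrow> real^2 \<Rightarrow> real" where "dens c x \<equiv> sqrt (det (metric M c x))"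

lemma det_metric_pos: "c \<in> atlas M \<Longrightarrow> x \<in> img c \<Longrightarrow> 0 < det (metric M c x)"
  using metric_det_pos by (simp add: det_2)

lemma continuous_on_dens: assumes c: "c \<in> atlas M" shows "continuous_on (img c) (dens c)"
  unfolding det_2
  by (intro continuous_intros smooth_on_continuous_on[OF metric_smooth[OF c]])

lemma dens_measurable:
  assumes c: "c \<in> atlas M" and A: "A \<in> sets borel" "A \<subseteq> img c"
  shows "set_borel_measurable borel A (dens c)"
proof -
  have "set_borel_measurable borel (img c) (dens c)"
    using borel_measurable_continuous_on_indicator[OF _ continuous_on_dens[OF c]] open_img[OF c]
    by (simp add: set_borel_measurable_def)
  then have "(\<lambda>x. indicator A x *\<^sub>R (indicator (img c) x *\<^sub>R dens c x)) \<in> borel_measurable borel"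
    using A(1) unfolding set_borel_measurable_def by (rule borel_measurable_scaleR[OF borel_measurable_indicator, rotated])
  moreover have "(\<lambda>x. indicator A x *\<^sub>R (indicator (img c) x *\<^sub>R dens c x)) = (\<lambda>x. indicator A x *\<^sub>R dens c x)"
    using A(2) by (auto simp: indicator_def fun_eq_iff)
  ultimately show ?thesis unfolding set_borel_measurable_def by (simp only:)
qed

lemma chart_image_borel:
  assumes c: "c \<in> atlas M" and S: "S \<in> sets borel" "S \<subseteq> fst c"
  shows "snd c ` S \<in> sets borel"
proof -
  have "snd c ` S = img c \<inter> chart_inv c -` S"
    using S(2) chart_inv_snd[OF c] snd_chart_inv[OF c] chart_inv_in[OF c] by force
  moreover have "chart_inv c \<in> measurable (restrict_space borel (img c)) borel"
    by (rule borel_measurable_continuous_on_restrict[OF continuous_chart_inv[OF c]])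
  then have "chart_inv c -` S \<inter> img c \<in> sets (restrict_space borel (img c))"
    using S(1) measurable_sets[of "chart_inv c" "restrict_space borel (img c)" borel S]
    by (simp add: space_restrict_space)
  ultimately show ?thesis
    using open_img[OF c] by (auto simp: sets_restrict_space_iff Int_commute)
qed

text \<open>As matrices, the transformation law is the congruence of the two metrics by the
  derivative of the transition map; its determinant enters squared.\<close>

lemma det_metric_transition:
  assumes c: "c \<in> atlas M" and e: "e \<in> atlas M" and p: "p \<in> fst c" "p \<in> fst e"
  shows "dens c (snd c p) = \<bar>det (matrix (Dtrans c e p))\<bar> * dens e (snd e p)"
proof -
  let ?D = "Dtrans c e p" and ?G = "metric M c (snd c p)" and ?H = "metric M e (snd e p)"
  have tr: "(transition c e has_derivative ?D) (at (snd c p))"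
    using p by (intro smooth_on_has_derivative[OF transition_smooth[OF c e]]) auto
  define A where "A = matrix ?D"
  have D: "?D v = A *v v" for v
    unfolding A_def using matrix_works[of ?D v] has_derivative_linear[OF tr]
    by (simp add: linear_matrix_vector_mul_eq)
  have law: "v \<bullet> (?G *v w) = ?D v \<bullet> (?H *v ?D w)" for v w
    using surf c e p unfolding compact_riemannian_surface_def Let_def by blast
  have m: "v \<bullet> (?G *v w) = v \<bullet> ((transpose A ** ?H ** A) *v w)" for v w
  proof -
    have "v \<bullet> (?G *v w) = (v v* transpose A) \<bullet> (?H *v (A *v w))" unfolding law D vector_transpose_matrix ..
    then show ?thesis unfolding dot_lmul_matrix matrix_vector_mul_assoc matrix_mul_assoc .
  qed
  have "?G *v w = (transpose A ** ?H ** A) *v w" for w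
    by (rule vector_eq_ldot[THEN iffD1]) (rule allI, rule m)
  then have "?G = transpose A ** ?H ** A" by (intro matrix_eq[THEN iffD2] allI)
  then have "det ?G = (det (matrix ?D))\<^sup>2 * det ?H" unfolding A_def[symmetric]
    by (simp add: det_mul det_transpose power2_eq_square)
  then show ?thesis by (simp add: real_sqrt_mult)
qed

definition chart_area :: "'a chart \<Rightarrow> 'a set \<Rightarrow> ennreal" where
  "chart_area c S = (\<integral>\<^sup>+x. ennreal (dens c x) * indicator (snd c ` S) x \<partial>lborel)"

lemma chart_area_eq:
  assumes c: "c \<in> atlas M" and e: "e \<in> atlas M" and S: "S \<in> sets borel" "S \<subseteq> fst c" "S \<subseteq> fst e"
  shows "chart_area c S = chart_area e S"
proof -
  have im: "transition c e ` snd c ` S = snd e ` S"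
    unfolding image_image using S(2) transition_eq[OF c, of _ e] by (intro image_cong) auto
  have "chart_area c S = (\<integral>\<^sup>+y. ennreal (dens e y) * indicator (transition c e ` snd c ` S) y \<partial>lborel)"
    unfolding chart_area_def
  proof (rule nn_integral_change_of_variables)
    show "snd c ` S \<in> sets borel" by (rule chart_image_borel[OF c S(1,2)])
    show "set_borel_measurable borel (snd c ` S) (dens c)"
      using S(2) by (intro dens_measurable[OF c] chart_image_borel[OF c S(1,2)]) auto
    show "set_borel_measurable borel (transition c e ` snd c ` S) (dens e)"
      unfolding im using S(3) by (intro dens_measurable[OF e] chart_image_borel[OF e S(1,3)]) auto
    show "inj_on (transition c e) (snd c ` S)"
    proof (intro inj_onI, clarsimp)
      fix x y assume xy: "x \<in> S" "y \<in> S" "transition c e (snd c x) = transition c e (snd c y)"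
      then have "snd e x = snd e y" using S(2) transition_eq[OF c, of _ e] by (metis subsetD)
      then show "snd c x = snd c y" using inj_onD[OF chart_inj[OF e]] xy S(3) by (metis subsetD)
    qed
    show "0 \<le> dens e y" if "y \<in> transition c e ` snd c ` S" for y
    proof -
      have "y \<in> img e" using that S(3) unfolding im by auto
      then show ?thesis using det_metric_pos[OF e] by (simp add: less_imp_le)
    qed
    fix x assume "x \<in> snd c ` S"
    then obtain p where p: "p \<in> S" "x = snd c p" by blast
    show "(transition c e has_derivative frechet_derivative (transition c e) (at x)) (at x)"
      unfolding p(2) using p(1) S by (intro smooth_on_has_derivative[OF transition_smooth[OF c e]]) auto
    show "dens c x = \<bar>det (matrix (frechet_derivative (transition c e) (at x)))\<bar> * dens e (transition c e x)"
      unfolding p(2) using det_metric_transition[OF c e, of p] transition_eq[OF c, of p e] p(1) S(2,3)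
      by (metis subsetD)
  qed
  then show ?thesis unfolding im chart_area_def .
qed

text \<open>Push-forward of the area density. The arbitrary value outside the chart image carries no
  mass, as the density vanishes there.\<close>

definition chart_measure :: "'a chart \<Rightarrow> 'a measure" where
  "chart_measure c = distr (density lborel (\<lambda>x. ennreal (indicator (img c) x * dens c x))) borel
     (\<lambda>x. if x \<in> img c then chart_inv c x else undefined)"

lemma sets_chart_measure [measurable_cong, simp]: "sets (chart_measure c) = sets borel"
  by (simp add: chart_measure_def)

lemma emeasure_chart_measure:
  assumes c: "c \<in> atlas M" and S: "S \<in> sets borel" "S \<subseteq> fst c"
  shows "emeasure (chart_measure c) S = chart_area c S"
proof -
  have m[measurable]: "(\<lambda>x. if x \<in> img c then chart_inv c x else undefined) \<in> measurable borel borel"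
    using open_img[OF c] by (intro borel_measurable_continuous_on_if continuous_chart_inv[OF c] continuous_on_const) auto
  have m2[measurable]: "(\<lambda>x. indicator (img c) x * dens c x) \<in> borel_measurable borel"
    using dens_measurable[OF c, of "img c"] open_img[OF c] by (simp add: set_borel_measurable_def)
  have m3[measurable]: "snd c ` S \<in> sets borel" by (rule chart_image_borel[OF c S])
  let ?h = "\<lambda>x. if x \<in> img c then chart_inv c x else undefined"
  have hm: "?h \<in> measurable (density lborel (\<lambda>x. ennreal (indicator (img c) x * dens c x))) borel" by simp
  have vm: "?h -` S \<in> sets borel" using measurable_sets[OF m S(1)] by simp
  have "emeasure (chart_measure c) S = emeasure (density lborel (\<lambda>x. ennreal (indicator (img c) x * dens c x))) (?h -` S)"
    unfolding chart_measure_def using S(1) hm by (subst emeasure_distr) auto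
  also have "\<dots> = (\<integral>\<^sup>+x. ennreal (indicator (img c) x * dens c x) * indicator (?h -` S) x \<partial>lborel)"
    using vm by (subst emeasure_density) auto
  also have "\<dots> = chart_area c S" unfolding chart_area_def
  proof (rule nn_integral_cong)
    fix x
    have "x \<in> snd c ` S \<longleftrightarrow> chart_inv c x \<in> S" if "x \<in> img c"
    proof
      show "x \<in> snd c ` S \<Longrightarrow> chart_inv c x \<in> S" using S(2) chart_inv_snd[OF c] by auto
      show "chart_inv c x \<in> S \<Longrightarrow> x \<in> snd c ` S" using snd_chart_inv[OF c that] by force
    qed
    moreover have "x \<notin> snd c ` S" if "x \<notin> img c" using that S(2) by auto
    ultimately show "ennreal (indicator (img c) x * dens c x) * indicator (?h -` S) x = ennreal (dens c x) * indicator (snd c ` S) x"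
      by (auto simp: indicator_def)
  qed
  finally show ?thesis .
qed

lemma chart_partition:
  obtains m :: nat and cs A where
    "\<forall>i<m. cs i \<in> atlas M \<and> A i \<in> sets (borel :: 'a measure) \<and> A i \<subseteq> fst (cs i)"
    "disjoint_family_on A {..<m}" "(\<Union>i<m. A i) = UNIV"
proof -
  have cov: "UNIV \<subseteq> (\<Union>c\<in>atlas M. fst c)" using smooth_atlas by (simp add: smooth_surface_atlas_def)
  obtain C where C: "C \<subseteq> atlas M" "finite C" "UNIV \<subseteq> (\<Union>c\<in>C. fst c)"
    using open_dom by (rule compactE_image[OF compact_surface _ cov])
  obtain cs where cs: "bij_betw cs {0..<card C} C" using ex_bij_betw_nat_finite[OF C(2)] by blast
  \<comment> \<open>Each chart domain minus the earlier ones.\<close>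
  define A where "A i = fst (cs i) - (\<Union>j<i. fst (cs j))" for i
  have a: "cs i \<in> atlas M" if "i < card C" for i
    using cs that C(1) by (auto simp: bij_betw_def)
  have cover: "\<exists>i<card C. x \<in> A i" for x
  proof -
    have "x \<in> (\<Union>i\<in>{0..<card C}. fst (cs i))"
      using C(3) bij_betw_imp_surj_on[OF cs] by (metis UNIV_I image_image subsetD)
    then have "\<exists>i. i < card C \<and> x \<in> fst (cs i)" by auto
    then obtain i where i: "i < card C" "x \<in> fst (cs i)" "\<And>j. j < i \<Longrightarrow> \<not> (j < card C \<and> x \<in> fst (cs j))"
      using exists_least_iff[of "\<lambda>i. i < card C \<and> x \<in> fst (cs i)"] by blast
    then have "x \<in> A i" unfolding A_def by auto
    then show ?thesis using i(1) by blast
  qed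
  have borel: "A i \<in> sets borel" if "i < card C" for i
    unfolding A_def using open_dom a that by (intro sets.Diff sets.finite_UN) auto
  have "disjoint_family_on A {..<card C}"
  proof (unfold disjoint_family_on_def, intro ballI impI)
    fix i j :: nat assume "i \<noteq> j"
    then show "A i \<inter> A j = {}" unfolding A_def by (cases i j rule: linorder_cases) auto
  qed
  moreover have "(\<Union>i<card C. A i) = UNIV" using cover by auto
  moreover have "A i \<subseteq> fst (cs i)" for i by (auto simp: A_def)
  ultimately show ?thesis using a borel by (intro that[of "card C" cs A]) blast+
qed

text \<open>The property that singles out \<open>area_measure\<close> in its definite
  description.\<close>

definition area_law :: "'a measure \<Rightarrow> bool" where
  "area_law \<mu> \<longleftrightarrow> sets \<mu> = sets borel \<and>
     (\<forall>c\<in>atlas M. \<forall>S\<in>sets borel. S \<subseteq> fst c \<longrightarrow> emeasure \<mu> S = chart_area c S)"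

text \<open>The chart measures of a finite partition are added up; by the change of variables the
  charts assigned to the pieces do not influence the result.\<close>

lemma area_law_exists: "\<exists>\<mu>. area_law \<mu>"
proof -
  obtain m :: nat and cs A where
    P0: "\<forall>i<m. cs i \<in> atlas M \<and> A i \<in> sets (borel :: 'a measure) \<and> A i \<subseteq> fst (cs i)"
    and P4: "disjoint_family_on A {..<m}" "(\<Union>i<m. A i) = UNIV"
    by (rule chart_partition)
  have P: "cs i \<in> atlas M" "A i \<in> sets borel" "A i \<subseteq> fst (cs i)" if "i < m" for i
    using P0 that by auto
  define F where "F S = (\<Sum>i<m. emeasure (chart_measure (cs i)) (S \<inter> A i))" for S
  define \<mu> where "\<mu> = measure_of (UNIV :: 'a set) (sets borel) F"
  have sets: "sets \<mu> = sets borel"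
    unfolding \<mu>_def using sets.sigma_sets_eq[of "borel :: 'a measure"] by (simp add: sets_measure_of)
  have em: "emeasure \<mu> S = F S" if "S \<in> sets borel" for S
  proof (rule emeasure_measure_of[OF \<mu>_def])
    show "positive (sets \<mu>) F" by (simp add: positive_def F_def)
    show "countably_additive (sets \<mu>) F"
    proof (unfold countably_additive_def, intro allI impI)
      fix X :: "nat \<Rightarrow> 'a set" assume X: "range X \<subseteq> sets \<mu>" "disjoint_family X" "\<Union> (range X) \<in> sets \<mu>"
      have "(\<Sum>n. F (X n)) = (\<Sum>i<m. \<Sum>n. emeasure (chart_measure (cs i)) (X n \<inter> A i))"
        unfolding F_def by (intro suminf_sum) auto
      also have "\<dots> = (\<Sum>i<m. emeasure (chart_measure (cs i)) (\<Union>n. X n \<inter> A i))"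
        using X(1,2) P(2) sets by (intro sum.cong refl suminf_emeasure disjoint_family_on_bisimulation[OF X(2)]) auto
      also have "\<dots> = F (\<Union> (range X))" unfolding F_def by (intro sum.cong) (auto intro!: arg_cong2[of _ _ _ _ emeasure])
      finally show "(\<Sum>n. F (X n)) = F (\<Union> (range X))" .
    qed
  qed (use that sets in auto)
  have "emeasure \<mu> S = chart_area c S" if c: "c \<in> atlas M" and S: "S \<in> sets borel" "S \<subseteq> fst c" for c S
  proof -
    have "emeasure \<mu> S = (\<Sum>i<m. emeasure (chart_measure (cs i)) (S \<inter> A i))" using em[OF S(1)] by (simp add: F_def)
    also have "\<dots> = (\<Sum>i<m. emeasure (chart_measure c) (S \<inter> A i))"
    proof (rule sum.cong[OF refl])
      fix i assume "i \<in> {..<m}"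
      then have i: "i < m" by simp
      have b: "S \<inter> A i \<in> sets borel" using S P(2)[OF i] by simp
      have sub: "S \<inter> A i \<subseteq> fst c" "S \<inter> A i \<subseteq> fst (cs i)" using S(2) P(3)[OF i] by auto
      show "emeasure (chart_measure (cs i)) (S \<inter> A i) = emeasure (chart_measure c) (S \<inter> A i)"
        unfolding emeasure_chart_measure[OF P(1)[OF i] b sub(2)] emeasure_chart_measure[OF c b sub(1)]
        by (rule chart_area_eq[OF P(1)[OF i] c b sub(2,1)])
    qed
    also have "\<dots> = emeasure (chart_measure c) (\<Union>i<m. S \<inter> A i)"
      using S P(2) disjoint_family_on_bisimulation[OF P4(1), of "\<lambda>i. S \<inter> A i"] by (intro sum_emeasure) auto
    also have "(\<Union>i<m. S \<inter> A i) = S" using P4(2) by auto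
    finally show ?thesis using emeasure_chart_measure[OF c S] by simp
  qed
  then show ?thesis unfolding area_law_def using sets by blast
qed

lemma area_law_unique:
  assumes "area_law \<mu>" "area_law \<mu>'" shows "\<mu> = \<mu>'"
proof (rule measure_eqI)
  show "sets \<mu> = sets \<mu>'" using assms by (simp add: area_law_def)
  fix S assume "S \<in> sets \<mu>"
  then have S: "S \<in> sets borel" using assms by (simp add: area_law_def)
  obtain m :: nat and cs A where
    P0: "\<forall>i<m. cs i \<in> atlas M \<and> A i \<in> sets (borel :: 'a measure) \<and> A i \<subseteq> fst (cs i)"
    and P4: "disjoint_family_on A {..<m}" "(\<Union>i<m. A i) = UNIV"
    by (rule chart_partition)
  have P: "cs i \<in> atlas M" "A i \<in> sets borel" "A i \<subseteq> fst (cs i)" if "i < m" for i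
    using P0 that by auto
  have split: "emeasure \<rho> S = (\<Sum>i<m. chart_area (cs i) (S \<inter> A i))" if r: "area_law \<rho>" for \<rho>
  proof -
    have sets: "sets \<rho> = sets borel" using r by (simp add: area_law_def)
    have "emeasure \<rho> (\<Union>i<m. S \<inter> A i) = (\<Sum>i<m. emeasure \<rho> (S \<inter> A i))"
      using S P(2) sets disjoint_family_on_bisimulation[OF P4(1), of "\<lambda>i. S \<inter> A i"]
      by (intro sum_emeasure[symmetric]) auto
    also have "\<dots> = (\<Sum>i<m. chart_area (cs i) (S \<inter> A i))"
    proof (rule sum.cong[OF refl])
      fix i assume "i \<in> {..<m}"
      then have i: "i < m" by simp
      have "S \<inter> A i \<in> sets borel" "S \<inter> A i \<subseteq> fst (cs i)" using S P(2)[OF i] P(3)[OF i] by auto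
      then show "emeasure \<rho> (S \<inter> A i) = chart_area (cs i) (S \<inter> A i)"
        using r P(1)[OF i] unfolding area_law_def by blast
    qed
    also have "(\<Union>i<m. S \<inter> A i) = S" using P4(2) by auto
    finally show ?thesis .
  qed
  show "emeasure \<mu> S = emeasure \<mu>' S" using split assms by simp
qed

lemma area_law_area_measure: "area_law (area_measure M)"
proof -
  have "\<exists>!\<mu>. area_law \<mu>" using area_law_exists area_law_unique by blast
  from theI'[OF this] show ?thesis
    unfolding area_measure_def by (simp add: area_law_def chart_area_def)
qed

lemma sets_area_measure [measurable_cong, simp]: "sets (area_measure M) = sets borel"
  using area_law_area_measure by (simp add: area_law_def)

lemma space_area_measure [simp]: "space (area_measure M) = UNIV"
  using sets_eq_imp_space_eq[OF sets_area_measure] by simp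

text \<open>On the compact closed ball the density lies between two positive constants.\<close>

lemma emeasure_area_chart_ball:
  assumes c: "c \<in> atlas M" and b: "\<rho> > 0" "cball x \<rho> \<subseteq> img c"
  shows "emeasure (area_measure M) (chart_inv c ` ball x \<rho>) < \<infinity>"
    and "0 < emeasure (area_measure M) (chart_inv c ` ball x \<rho>)"
proof -
  let ?B = "chart_inv c ` ball x \<rho>"
  have sub: "ball x \<rho> \<subseteq> img c" using b(2) ball_subset_cball by blast
  have "open ?B" by (rule chart_inv_open[OF c _ sub]) simp
  moreover have "?B \<subseteq> fst c" using sub chart_inv_in[OF c] by auto
  moreover have im: "snd c ` ?B = ball x \<rho>"
    unfolding image_image using sub snd_chart_inv[OF c] by force
  ultimately have eq: "emeasure (area_measure M) ?B = (\<integral>\<^sup>+y. ennreal (dens c y) * indicator (ball x \<rho>) y \<partial>lborel)"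
    using area_law_area_measure c unfolding area_law_def chart_area_def by simp
  have cont: "continuous_on (cball x \<rho>) (dens c)" using continuous_on_subset[OF continuous_on_dens[OF c] b(2)] .
  have ne: "cball x \<rho> \<noteq> {}" using b(1) by simp
  obtain z where z: "z \<in> cball x \<rho>" "\<And>y. y \<in> cball x \<rho> \<Longrightarrow> dens c z \<le> dens c y"
    using continuous_attains_inf[OF compact_cball ne cont] by blast
  obtain w where w: "w \<in> cball x \<rho>" "\<And>y. y \<in> cball x \<rho> \<Longrightarrow> dens c y \<le> dens c w"
    using continuous_attains_sup[OF compact_cball ne cont] by blast
  have fin: "emeasure lborel (ball x \<rho>) < \<infinity>" by (rule emeasure_lborel_ball_finite)
  have "(\<integral>\<^sup>+y. ennreal (dens c y) * indicator (ball x \<rho>) y \<partial>lborel) \<le> (\<integral>\<^sup>+y. ennreal (dens c w) * indicator (ball x \<rho>) y \<partial>lborel)"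
    by (intro nn_integral_mono) (auto simp: indicator_def intro!: ennreal_leI w(2))
  also have "\<dots> = ennreal (dens c w) * emeasure lborel (ball x \<rho>)" by (intro nn_integral_cmult_indicator) simp
  also have "\<dots> < \<infinity>" using fin by (simp add: ennreal_mult_less_top)
  finally show "emeasure (area_measure M) ?B < \<infinity>" unfolding eq .
  have "\<not> negligible (ball x \<rho>)" using b(1) by (intro open_not_negligible) auto
  then have "emeasure lborel (ball x \<rho>) \<noteq> 0"
    by (auto simp: negligible_iff_null_sets null_sets_def)
  moreover have "0 < dens c z" using det_metric_pos[OF c] z(1) b(2) by auto
  ultimately have "0 < ennreal (dens c z) * emeasure lborel (ball x \<rho>)"
    by (simp add: zero_less_iff_neq_zero)
  also have "\<dots> = (\<integral>\<^sup>+y. ennreal (dens c z) * indicator (ball x \<rho>) y \<partial>lborel)"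
    by (intro nn_integral_cmult_indicator[symmetric]) simp
  also have "\<dots> \<le> (\<integral>\<^sup>+y. ennreal (dens c y) * indicator (ball x \<rho>) y \<partial>lborel)"
    by (intro nn_integral_mono) (auto simp: indicator_def intro!: ennreal_leI z(2))
  finally show "0 < emeasure (area_measure M) ?B" unfolding eq .
qed

lemma finite_area: "emeasure (area_measure M) UNIV < \<infinity>"
proof -
  let ?P = "\<lambda>B. open B \<and> emeasure (area_measure M) B < \<infinity>"
  have "\<exists>B. ?P B \<and> p \<in> B" for p
  proof -
    obtain c \<rho> where c: "c \<in> atlas M" "p \<in> fst c" "\<rho> > 0" "cball (snd c p) \<rho> \<subseteq> img c"
      by (rule chart_ball[OF open_UNIV, of p]) auto
    have sub: "ball (snd c p) \<rho> \<subseteq> img c" using c(4) ball_subset_cball by blast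
    have "p \<in> chart_inv c ` ball (snd c p) \<rho>"
      using c by (intro image_eqI[of _ _ "snd c p"]) (auto simp: chart_inv_snd)
    then show ?thesis
      using emeasure_area_chart_ball(1)[OF c(1,3,4)] chart_inv_open[OF c(1) open_ball sub] by blast
  qed
  then have "UNIV \<subseteq> \<Union> {B. ?P B}" by blast
  then obtain \<B> where B: "\<B> \<subseteq> {B. ?P B}" "finite \<B>" "UNIV \<subseteq> \<Union> \<B>"
    by (rule compactE[OF compact_surface]) auto
  have "emeasure (area_measure M) UNIV = emeasure (area_measure M) (\<Union>B\<in>\<B>. B)" using B(3) by (simp add: top.extremum_unique)
  also have "\<dots> \<le> (\<Sum>B\<in>\<B>. emeasure (area_measure M) B)"
    using B by (intro emeasure_subadditive_finite) auto
  also have "\<dots> < \<infinity>" using B by (auto simp: ennreal_sum_less_top)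
  finally show ?thesis .
qed

lemma open_area_pos:
  assumes "open U" "U \<noteq> {}" shows "0 < emeasure (area_measure M) U"
proof -
  obtain p where "p \<in> U" using assms(2) by blast
  then obtain c \<rho> where c: "c \<in> atlas M" "p \<in> fst c" "\<rho> > 0" "cball (snd c p) \<rho> \<subseteq> img c"
    "chart_inv c ` cball (snd c p) \<rho> \<subseteq> U"
    by (rule chart_ball[OF assms(1)])
  have "chart_inv c ` ball (snd c p) \<rho> \<subseteq> U" using c(5) ball_subset_cball by blast
  then have "emeasure (area_measure M) (chart_inv c ` ball (snd c p) \<rho>) \<le> emeasure (area_measure M) U"
    using assms(1) by (intro emeasure_mono) auto
  then show ?thesis using emeasure_area_chart_ball(2)[OF c(1,3,4)] by (rule less_le_trans[rotated])
qed

lemma finite_measure_area: "finite_measure (area_measure M)"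
  using finite_area by (intro finite_measureI) (simp add: less_top)

end

section \<open>Measurability\<close>

lemma countable_dense_subset:
  fixes T :: "'b::second_countable_topology set"
  obtains D where "countable D" "D \<subseteq> T" "\<And>U. open U \<Longrightarrow> U \<inter> T \<noteq> {} \<Longrightarrow> U \<inter> D \<noteq> {}"
proof -
  obtain B :: "'b set set" where B: "countable B" "topological_basis B" using ex_countable_basis by blast
  define D where "D = (\<lambda>b. SOME y. y \<in> b \<inter> T) ` {b \<in> B. b \<inter> T \<noteq> {}}"
  have some: "(SOME y. y \<in> b \<inter> T) \<in> b \<inter> T" if "b \<inter> T \<noteq> {}" for b using that unfolding some_in_eq .
  have "U \<inter> D \<noteq> {}" if U: "open U" "U \<inter> T \<noteq> {}" for U
  proof -
    obtain x where x: "x \<in> U" "x \<in> T" using U(2) by blast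
    obtain b where b: "b \<in> B" "x \<in> b" "b \<subseteq> U" using topological_basisE[OF B(2) U(1) x(1)] by blast
    then have "b \<inter> T \<noteq> {}" using x by blast
    then have "(SOME y. y \<in> b \<inter> T) \<in> U \<inter> D" using some[of b] b unfolding D_def by blast
    then show ?thesis by blast
  qed
  moreover have "countable D" unfolding D_def using B(1) by simp
  moreover have "D \<subseteq> T" unfolding D_def using some by blast
  ultimately show ?thesis by (intro that)
qed

text \<open>Projecting along a compact set preserves measurability, since a continuous function vanishes
  somewhere on it iff its infimum over a countable dense subset is \<open>0\<close>.\<close>

lemma measurable_compact_projection:
  fixes T :: "'b::{second_countable_topology,t2_space} set"
  assumes T: "compact T" and cont: "\<And>x. x \<in> space N \<Longrightarrow> continuous_on T (\<lambda>q. \<phi> q x)"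
    and meas: "\<And>q. q \<in> T \<Longrightarrow> (\<phi> q :: _ \<Rightarrow> real) \<in> borel_measurable N"
  shows "{x \<in> space N. \<exists>q\<in>T. \<phi> q x \<le> 0} \<in> sets N"
proof -
  obtain D where D: "countable D" "D \<subseteq> T" "\<And>U. open U \<Longrightarrow> U \<inter> T \<noteq> {} \<Longrightarrow> U \<inter> D \<noteq> {}"
    using countable_dense_subset by blast
  have eq: "(\<exists>q\<in>T. \<phi> q x \<le> 0) \<longleftrightarrow> (\<forall>m::nat. \<exists>q\<in>D. \<phi> q x < inverse (real (Suc m)))" if x: "x \<in> space N" for x
  proof
    assume "\<exists>q\<in>T. \<phi> q x \<le> 0"
    then obtain q where q: "q \<in> T" "\<phi> q x \<le> 0" by blast
    show "\<forall>m::nat. \<exists>q\<in>D. \<phi> q x < inverse (real (Suc m))"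
    proof
      fix m :: nat
      obtain U where U: "open U" "U \<inter> T = (\<lambda>q. \<phi> q x) -` {..<inverse (real (Suc m))} \<inter> T"
        using cont[OF x] open_lessThan[of "inverse (real (Suc m))"] unfolding continuous_on_open_invariant by blast
      have "0 < inverse (real (Suc m))" by simp
      then have "\<phi> q x < inverse (real (Suc m))" using q(2) by (rule le_less_trans[rotated])
      then have "U \<inter> T \<noteq> {}" using U(2) q(1) by blast
      then obtain y where "y \<in> U" "y \<in> D" using D(3)[OF U(1)] by blast
      then show "\<exists>q\<in>D. \<phi> q x < inverse (real (Suc m))" using U(2) D(2) by blast
    qed
  next
    assume h: "\<forall>m::nat. \<exists>q\<in>D. \<phi> q x < inverse (real (Suc m))"
    then have ne: "T \<noteq> {}" using D(2) by blast
    obtain q where q: "q \<in> T" "\<And>y. y \<in> T \<Longrightarrow> \<phi> q x \<le> \<phi> y x"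
      using continuous_attains_inf[OF T ne cont[OF x]] by blast
    have "\<phi> q x \<le> 0"
    proof (rule ccontr)
      assume "\<not> \<phi> q x \<le> 0"
      then obtain m where "inverse (real (Suc m)) < \<phi> q x" using reals_Archimedean[of "\<phi> q x"] by auto
      moreover obtain y where "y \<in> D" "\<phi> y x < inverse (real (Suc m))" using h by blast
      ultimately show False using q(2)[of y] D(2) by (meson less_trans not_less subsetD)
    qed
    then show "\<exists>q\<in>T. \<phi> q x \<le> 0" using q(1) by blast
  qed
  have "{x \<in> space N. \<exists>q\<in>T. \<phi> q x \<le> 0} = {x \<in> space N. \<forall>m::nat. \<exists>q\<in>D. \<phi> q x < inverse (real (Suc m))}"
    using eq by blast
  also have "\<dots> \<in> sets N"
  proof (rule sets.sets_Collect_countable_All)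
    fix m :: nat
    have "{x \<in> space N. \<phi> q x < inverse (real (Suc m))} \<in> sets N" if "q \<in> D" for q
    proof -
      have "\<phi> q \<in> borel_measurable N" using meas D(2) that by blast
      then show ?thesis by simp
    qed
    then have "(\<Union>q\<in>D. {x \<in> space N. \<phi> q x < inverse (real (Suc m))}) \<in> sets N"
      using D(1) by (intro sets.countable_UN') auto
    also have "(\<Union>q\<in>D. {x \<in> space N. \<phi> q x < inverse (real (Suc m))})
        = {x \<in> space N. \<exists>q\<in>D. \<phi> q x < inverse (real (Suc m))}" by blast
    finally show "{x \<in> space N. \<exists>q\<in>D. \<phi> q x < inverse (real (Suc m))} \<in> sets N" .
  qed
  finally show ?thesis .
qed

abbreviation PiB :: "nat \<Rightarrow> (nat \<Rightarrow> 'b::topological_space) measure" where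
  "PiB n \<equiv> PiM {..<n} (\<lambda>_. borel)"

text \<open>A countable base of the factor reduces the union of open boxes that makes up S to a
  countable one.\<close>

lemma openin_product_measurable:
  fixes S :: "(nat \<Rightarrow> 'b::second_countable_topology) set"
  assumes S: "openin (product_topology (\<lambda>_. euclidean) {..<n}) S"
  shows "S \<in> sets (PiB n)"
proof -
  obtain B :: "'b set set" where B: "countable B" "topological_basis B" using ex_countable_basis by blast
  define \<U> where "\<U> = {U \<in> Pi\<^sub>E {..<n} (\<lambda>_. B). Pi\<^sub>E {..<n} U \<subseteq> S}"
  have "countable (Pi\<^sub>E {..<n} (\<lambda>_. B))" using B(1) by (intro countable_PiE) auto
  then have "countable \<U>" unfolding \<U>_def by (rule countable_subset[rotated]) blast
  moreover have "Pi\<^sub>E {..<n} U \<in> sets (PiB n)" if "U \<in> \<U>" for U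
  proof (rule sets_PiM_I_finite)
    fix i assume "i \<in> {..<n}"
    then have "U i \<in> B" using that by (auto simp: \<U>_def)
    then show "U i \<in> sets borel" using topological_basis_open[OF B(2)] by simp
  qed simp
  ultimately have "(\<Union>U\<in>\<U>. Pi\<^sub>E {..<n} U) \<in> sets (PiB n)" by (intro sets.countable_UN') auto
  moreover have "S = (\<Union>U\<in>\<U>. Pi\<^sub>E {..<n} U)"
  proof (intro equalityI subsetI)
    fix x assume x: "x \<in> S"
    have "\<exists>W. (\<forall>i\<in>{..<n}. open (W i)) \<and> x \<in> Pi\<^sub>E {..<n} W \<and> Pi\<^sub>E {..<n} W \<subseteq> S"
      using S x unfolding openin_product_topology_alt by auto
    then obtain W where W0: "\<forall>i\<in>{..<n}. open (W i)" and W2: "x \<in> Pi\<^sub>E {..<n} W" and W3: "Pi\<^sub>E {..<n} W \<subseteq> S"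
      by (elim exE conjE)
    have W1: "open (W i)" if "i < n" for i using W0 that by blast
    note W = W1 W2 W3
    have "\<exists>b. b \<in> B \<and> x i \<in> b \<and> b \<subseteq> W i" if "i < n" for i
    proof -
      have "x i \<in> W i" using W(2) that by (auto simp: PiE_iff)
      from topological_basisE[OF B(2) W(1)[OF that] this] show ?thesis by blast
    qed
    then obtain b where b: "\<And>i. i < n \<Longrightarrow> b i \<in> B \<and> x i \<in> b i \<and> b i \<subseteq> W i" by metis
    let ?b = "restrict b {..<n}"
    have "Pi\<^sub>E {..<n} ?b \<subseteq> S"
      by (rule order_trans[OF PiE_mono W(3)]) (use b in force)
    then have "?b \<in> \<U>" using b by (auto simp: \<U>_def)
    moreover have "x \<in> Pi\<^sub>E {..<n} ?b" using b W(2) by (auto simp: PiE_iff)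
    ultimately show "x \<in> (\<Union>U\<in>\<U>. Pi\<^sub>E {..<n} U)" by blast
  qed (auto simp: \<U>_def)
  ultimately show ?thesis by simp
qed

lemma config_component_PiE: "config_component M \<delta> n \<subseteq> {..<n} \<rightarrow>\<^sub>E UNIV"
  by (auto simp: config_component_def)

lemma topspace_config: "topspace (config_topology M \<delta>) = Sigma UNIV (config_component M \<delta>)"
  by (simp add: config_topology_def topspace_sum_topology o_def Int_absorb1 config_component_PiE)

lemma openin_config:
  "openin (config_topology M \<delta>) U \<longleftrightarrow> U \<subseteq> Sigma UNIV (config_component M \<delta>) \<and>
    (\<forall>n. openin (subtopology (product_topology (\<lambda>_. euclidean) {..<n}) (config_component M \<delta> n)) {x. (n, x) \<in> U})"
  unfolding config_topology_def openin_sum_topology by (simp add: o_def Int_absorb1 config_component_PiE)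

lemma
  shows sets_config_borel: "sets (config_borel M \<delta>) = sigma_sets (topspace (config_topology M \<delta>)) {U. openin (config_topology M \<delta>) U}"
    and space_config_borel: "space (config_borel M \<delta>) = Sigma UNIV (config_component M \<delta>)"
  unfolding config_borel_def topspace_config[symmetric]
  by (auto intro!: sets_measure_of space_measure_of dest: openin_subset)

text \<open>Together with \<open>config_borel_slice\<close> this identifies the sigma-algebra: a set
  of configurations is measurable iff all of its slices are. The set is cut into its components, on
  which the coordinates are measurable.\<close>

lemma config_borelI:
  assumes S: "S \<subseteq> Sigma UNIV (config_component M \<delta>)" and sl: "\<And>n. {x. (n, x) \<in> S} \<in> sets (PiB n)"
  shows "S \<in> sets (config_borel M \<delta>)"
proof -
  have "S \<inter> {p. fst p = n} \<in> sets (config_borel M \<delta>)" for n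
  proof -
    let ?T = "Sigma UNIV (config_component M \<delta>)"
    let ?\<Omega> = "?T \<inter> {p. fst p = n}"
    have op: "{p \<in> ?\<Omega>. snd p \<in> W} \<in> sets (config_borel M \<delta>)"
      if W: "openin (product_topology (\<lambda>_. euclidean) {..<n}) W" for W
    proof -
      have "openin (subtopology (product_topology (\<lambda>_. euclidean) {..<k}) (config_component M \<delta> k))
          {x. (k, x) \<in> {p \<in> ?\<Omega>. snd p \<in> W}}" for k
      proof (cases "k = n")
        case True
        then have "{x. (k, x) \<in> {p \<in> ?\<Omega>. snd p \<in> W}} = W \<inter> config_component M \<delta> k" by auto
        then show ?thesis using W True by (simp only: openin_subtopology_Int)
      qed simp
      then have "openin (config_topology M \<delta>) {p \<in> ?\<Omega>. snd p \<in> W}" unfolding openin_config by auto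
      then show ?thesis unfolding sets_config_borel by (intro sigma_sets.Basic) simp
    qed
    have om: "?\<Omega> \<in> sets (config_borel M \<delta>)"
    proof -
      have "{p \<in> ?\<Omega>. snd p \<in> topspace (product_topology (\<lambda>_. euclidean) {..<n})} = ?\<Omega>"
        using config_component_PiE[of M \<delta> n] by (simp add: set_eq_iff) blast
      then show ?thesis using op[OF openin_topspace] by simp
    qed
    have ext: "snd p \<in> {..<n} \<rightarrow>\<^sub>E UNIV" if "p \<in> ?\<Omega>" for p
    proof -
      have "snd p \<in> config_component M \<delta> n" using that by auto
      then show ?thesis using config_component_PiE[of M \<delta> n] by (rule subsetD[rotated])
    qed
    have rs: "A \<in> sets (restrict_space (config_borel M \<delta>) ?\<Omega>) \<longleftrightarrow> A \<subseteq> ?\<Omega> \<and> A \<in> sets (config_borel M \<delta>)" for A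
      using om by (intro sets_restrict_space_iff) (simp add: sets.Int_space_eq2)
    have sp: "space (restrict_space (config_borel M \<delta>) ?\<Omega>) = ?\<Omega>"
      by (auto simp: space_restrict_space space_config_borel)
    \<comment> \<open>Measurability into the product is tested on single coordinates, for which
      preimages of open sets are open in the configuration space.\<close>
    have "snd \<in> measurable (restrict_space (config_borel M \<delta>) ?\<Omega>) (PiB n)"
    proof (rule measurable_PiM_single')
      show "snd \<in> space (restrict_space (config_borel M \<delta>) ?\<Omega>) \<rightarrow> {..<n} \<rightarrow>\<^sub>E space borel"
        unfolding sp space_borel by (rule Pi_I) (rule ext)
      fix i assume i: "i \<in> {..<n}"
      show "(\<lambda>p. snd p i) \<in> borel_measurable (restrict_space (config_borel M \<delta>) ?\<Omega>)"
      proof (rule borel_measurableI)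
        fix U :: "'a set" assume "open U"
        then have W: "openin (product_topology (\<lambda>_. euclidean) {..<n})
            {x \<in> topspace (product_topology (\<lambda>_. euclidean) {..<n}). x i \<in> U}"
          using i by (intro openin_continuous_map_preimage[OF continuous_map_product_projection]) auto
        have "{p \<in> ?\<Omega>. snd p \<in> {x \<in> topspace (product_topology (\<lambda>_. euclidean) {..<n}). x i \<in> U}}
            = (\<lambda>p. snd p i) -` U \<inter> ?\<Omega>"
          using ext by (auto simp del: PiE_iff PiE_UNIV_domain)
        then have "(\<lambda>p. snd p i) -` U \<inter> ?\<Omega> \<in> sets (config_borel M \<delta>)" using op[OF W] by simp
        then show "(\<lambda>p. snd p i) -` U \<inter> space (restrict_space (config_borel M \<delta>) ?\<Omega>)
            \<in> sets (restrict_space (config_borel M \<delta>) ?\<Omega>)"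
          unfolding sp rs by blast
      qed
    qed
    from measurable_sets[OF this sl[of n]]
    have "snd -` {x. (n, x) \<in> S} \<inter> ?\<Omega> \<in> sets (restrict_space (config_borel M \<delta>) ?\<Omega>)" unfolding sp .
    then have "snd -` {x. (n, x) \<in> S} \<inter> ?\<Omega> \<in> sets (config_borel M \<delta>)"
      unfolding rs by blast
    moreover have "snd -` {x. (n, x) \<in> S} \<inter> ?\<Omega> = S \<inter> {p. fst p = n}" using S by auto
    ultimately show ?thesis by simp
  qed
  then have "(\<Union>n. S \<inter> {p. fst p = n}) \<in> sets (config_borel M \<delta>)" by blast
  moreover have "(\<Union>n. S \<inter> {p. fst p = n}) = S" by blast
  ultimately show ?thesis by simp
qed

section \<open>Measurability of cocircularity and of the configuration spaces\<close>

context riem_surface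
begin

text \<open>One closed condition that serves several events: two points coincide (radius 0), points
  violate genericity (K empty), points lie on the boundary of an empty disk (K all indices).\<close>

definition cocirc :: "real \<Rightarrow> real \<Rightarrow> nat set \<Rightarrow> nat set \<Rightarrow> (nat \<Rightarrow> 'a) \<Rightarrow> bool" where
  "cocirc lo hi J K x \<longleftrightarrow> (\<exists>c r. lo \<le> r \<and> r \<le> hi \<and> (\<forall>i\<in>J. d c (x i) = r) \<and> (\<forall>k\<in>K. r \<le> d c (x k)))"

lemma rdist_measurable:
  assumes "i < n" shows "(\<lambda>x. d c (x i)) \<in> borel_measurable (PiB n)"
proof -
  have "(\<lambda>x. x i) \<in> measurable (PiB n) (borel :: 'a measure)" using assms by simp
  moreover have "d c \<in> borel_measurable borel"
    by (intro borel_measurable_continuous_onI continuous_intros)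
  ultimately show ?thesis by (rule measurable_compose)
qed

lemma measurable_cocirc:
  assumes J: "J \<subseteq> {..<n}" and K: "K \<subseteq> {..<n}"
  shows "{x \<in> space (PiB n). cocirc lo hi J K x} \<in> sets (PiB n)"
proof -
  \<comment> \<open>Total violation of the conditions: nonnegative, continuous in centre and radius,
    and 0 exactly when all of them hold.\<close>
  define \<phi> where "\<phi> q x = (\<Sum>i\<in>J. \<bar>d (fst q) (x i) - snd q\<bar>) + (\<Sum>k\<in>K. max 0 (snd q - d (fst q) (x k)))"
    for q :: "'a \<times> real" and x
  have fin: "finite J" "finite K" using J K finite_subset by blast+
  let ?T = "(UNIV :: 'a set) \<times> {lo..hi}"
  have T: "compact ?T" by (intro compact_Times compact_surface compact_Icc)
  have "{x \<in> space (PiB n). \<exists>q\<in>?T. \<phi> q x \<le> 0} \<in> sets (PiB n)"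
  proof (rule measurable_compact_projection[OF T])
    show "continuous_on ?T (\<lambda>q. \<phi> q x)" for x unfolding \<phi>_def by (intro continuous_intros)
    show "\<phi> q \<in> borel_measurable (PiB n)" for q
      unfolding \<phi>_def
    proof (intro borel_measurable_add borel_measurable_sum borel_measurable_abs borel_measurable_diff
        borel_measurable_max borel_measurable_const rdist_measurable)
    qed (use J K in auto)
  qed
  moreover have "(\<exists>q\<in>?T. \<phi> q x \<le> 0) \<longleftrightarrow> cocirc lo hi J K x" for x
  proof -
    have "\<phi> q x \<le> 0 \<longleftrightarrow> (\<forall>i\<in>J. d (fst q) (x i) = snd q) \<and> (\<forall>k\<in>K. snd q \<le> d (fst q) (x k))" for q
    proof -
      have "\<phi> q x \<le> 0 \<longleftrightarrow> (\<Sum>i\<in>J. \<bar>d (fst q) (x i) - snd q\<bar>) = 0 \<and> (\<Sum>k\<in>K. max 0 (snd q - d (fst q) (x k))) = 0"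
      proof -
        have "0 \<le> (\<Sum>i\<in>J. \<bar>d (fst q) (x i) - snd q\<bar>)" "0 \<le> (\<Sum>k\<in>K. max 0 (snd q - d (fst q) (x k)))"
          by (auto intro!: sum_nonneg)
        then show ?thesis unfolding \<phi>_def by linarith
      qed
      also have "\<dots> \<longleftrightarrow> (\<forall>i\<in>J. d (fst q) (x i) = snd q) \<and> (\<forall>k\<in>K. snd q \<le> d (fst q) (x k))"
        using fin by (force simp: sum_nonneg_eq_0_iff max_def)
      finally show ?thesis .
    qed
    then show ?thesis unfolding cocirc_def by force
  qed
  ultimately show ?thesis by simp
qed

text \<open>The bound on radii in the definition of configurations is an extended real. An infinite
  one may be replaced by the diameter of the surface, and minus infinity by a negative
  number.\<close>

lemma radius_bound:
  obtains hi where "\<forall>c v. ereal (d c v) \<le> \<rho> \<longleftrightarrow> d c v \<le> hi"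
proof (cases \<rho>)
  case (real r)
  show ?thesis by (rule that[of r]) (simp add: real)
next
  case PInf
  have "compact (UNIV :: ('a \<times> 'a) set)" using compact_Times[OF compact_surface compact_surface] by simp
  moreover have "continuous_on UNIV (\<lambda>q. d (fst q) (snd q))" by (intro continuous_intros)
  ultimately have "\<exists>q\<in>UNIV. \<forall>y\<in>UNIV. d (fst y) (snd y) \<le> d (fst q) (snd q)"
    by (intro continuous_attains_sup) auto
  then obtain q where q: "\<forall>y\<in>UNIV. d (fst y) (snd y) \<le> d (fst q) (snd q)" by (rule bexE)
  have "d c v \<le> d (fst q) (snd q)" for c v using q[rule_format, of "(c, v)"] by simp
  then show ?thesis using that[of "d (fst q) (snd q)"] PInf by simp
next
  case MInf
  have "\<not> d c v \<le> -1" for c v using rdist_nonneg[of c v] by linarith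
  then show ?thesis using that[of "-1"] MInf by simp
qed

text \<open>Injectivity allows sets of points to be replaced by sets of indices, after which every
  excluded event is a finite union of conditions \<open>cocirc\<close>.\<close>

lemma config_component_measurable: "config_component M \<delta> n \<in> sets (PiB n)"
proof -
  obtain hi where hi: "\<forall>c v. ereal (d c v) \<le> min (inj_radius M / 6) (convexity_radius M) \<longleftrightarrow> d c v \<le> hi"
    by (rule radius_bound)
  have subsets: "(\<exists>S\<subseteq>x ` {..<n}. card S = k \<and> Q S) \<longleftrightarrow> (\<exists>J\<subseteq>{..<n}. card J = k \<and> Q (x ` J))"
    if x: "inj_on x {..<n}" for x :: "nat \<Rightarrow> 'a" and k Q
  proof
    assume "\<exists>S\<subseteq>x ` {..<n}. card S = k \<and> Q S"
    then obtain J where J: "J \<subseteq> {..<n}" "card (x ` J) = k" "Q (x ` J)" unfolding subset_image_iff by blast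
    have "card J = k" using J card_image[OF inj_on_subset[OF x J(1)]] by simp
    then show "\<exists>J\<subseteq>{..<n}. card J = k \<and> Q (x ` J)" using J by blast
  next
    assume "\<exists>J\<subseteq>{..<n}. card J = k \<and> Q (x ` J)"
    then obtain J where J: "J \<subseteq> {..<n}" "card J = k" "Q (x ` J)" by blast
    have "card (x ` J) = k" using J card_image[OF inj_on_subset[OF x J(1)]] by simp
    then show "\<exists>S\<subseteq>x ` {..<n}. card S = k \<and> Q S" using J by blast
  qed
  have four: "(\<exists>c r. ereal r \<le> min (inj_radius M / 6) (convexity_radius M) \<and> x ` J \<subseteq> circle M c r) \<longleftrightarrow> cocirc 0 hi J {} x"
    if ne: "J \<noteq> {}" for x J
  proof -
    obtain i where i: "i \<in> J" using ne by blast
    have "ereal r \<le> min (inj_radius M / 6) (convexity_radius M) \<and> x ` J \<subseteq> circle M c r \<longleftrightarrow>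
        0 \<le> r \<and> r \<le> hi \<and> (\<forall>i\<in>J. d c (x i) = r) \<and> (\<forall>k\<in>{}. r \<le> d c (x k))" for c r
      using i hi[rule_format, of c "x i"] rdist_nonneg[of c "x i"] unfolding circle_def by auto
    then show ?thesis unfolding cocirc_def by blast
  qed
  have three: "(\<exists>c. x ` J \<subseteq> circle M c \<delta>) \<longleftrightarrow> cocirc \<delta> \<delta> J {} x" for x J
    unfolding cocirc_def circle_def by (force simp: image_subset_iff)
  have two: "cocirc 0 0 {i, j} {} x \<longleftrightarrow> x i = x j" for i j x
  proof -
    have "d a b \<le> 0 \<longleftrightarrow> a = b" for a b
      using rdist_nonneg[of a b] rdist_eq_0[of a b] by linarith
    then have "cocirc 0 0 {i, j} {} x \<longleftrightarrow> (\<exists>c. c = x i \<and> c = x j)"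
      unfolding cocirc_def by (intro arg_cong[of _ _ Ex] ext) auto
    then show ?thesis by simp
  qed
  have "x \<in> config_component M \<delta> n \<longleftrightarrow> x \<in> space (PiB n) \<and>
      (\<forall>i<n. \<forall>j<n. i \<noteq> j \<longrightarrow> x i \<noteq> x j) \<and>
      (\<forall>J\<subseteq>{..<n}. card J = 4 \<longrightarrow> \<not> cocirc 0 hi J {} x) \<and>
      (\<forall>J\<subseteq>{..<n}. card J = 3 \<longrightarrow> \<not> cocirc \<delta> \<delta> J {} x)" for x
  proof (cases "inj_on x {..<n}")
    case True
    have ne: "card J = 4 \<Longrightarrow> J \<noteq> {}" for J :: "nat set" by auto
    have 4: "card J = 4 \<and> (\<exists>c r. ereal r \<le> min (inj_radius M / 6) (convexity_radius M) \<and> x ` J \<subseteq> circle M c r)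
        \<longleftrightarrow> card J = 4 \<and> cocirc 0 hi J {} x" for J
      using four[OF ne] by blast
    have i: "\<forall>i<n. \<forall>j<n. i \<noteq> j \<longrightarrow> x i \<noteq> x j" using True unfolding inj_on_def by blast
    show ?thesis
      unfolding config_component_def mem_Collect_eq subsets[OF True] three 4 space_PiM space_borel
      using True i by blast
  next
    case False
    then have "\<not> (\<forall>i<n. \<forall>j<n. i \<noteq> j \<longrightarrow> x i \<noteq> x j)" unfolding inj_on_def by blast
    moreover have "x \<notin> config_component M \<delta> n" using False unfolding config_component_def by blast
    ultimately show ?thesis by blast
  qed
  then have eq: "config_component M \<delta> n = {x \<in> space (PiB n).
      (\<forall>a\<in>{a\<in>{..<n}\<times>{..<n}. fst a \<noteq> snd a}. \<not> cocirc 0 0 {fst a, snd a} {} x) \<and>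
      (\<forall>J\<in>{J\<in>Pow {..<n}. card J = 4}. \<not> cocirc 0 hi J {} x) \<and>
      (\<forall>J\<in>{J\<in>Pow {..<n}. card J = 3}. \<not> cocirc \<delta> \<delta> J {} x)}"
    unfolding two by (intro set_eqI) (simp del: space_PiM, blast)
  have meas: "{x \<in> space (PiB n). \<not> cocirc lo h J {} x} \<in> sets (PiB n)" if "J \<subseteq> {..<n}" for lo h J
    by (intro sets.sets_Collect_neg measurable_cocirc that) simp
  show ?thesis unfolding eq
  proof (intro sets.sets_Collect_conj sets.sets_Collect_finite_All meas)
    show "finite {a\<in>{..<n}\<times>{..<n}. fst a \<noteq> snd a}" by (rule finite_subset[of _ "{..<n}\<times>{..<n}"]) auto
  qed auto
qed

end

section \<open>The combinatorial type of a configuration\<close>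

context delta_surface
begin

text \<open>Indices in place of points make the complexes of different configurations comparable,
  and for n points only finitely many types are possible.\<close>

definition index_complex :: "'a config \<Rightarrow> nat set set" where
  "index_complex p = {J. J \<subseteq> {..<fst p} \<and> snd p ` J \<in> edges M \<delta> p \<union> faces M \<delta> p}"

lemma config_inj: "p \<in> topspace (config_topology M \<delta>) \<Longrightarrow> inj_on (snd p) {..<fst p}"
  by (cases p) (auto simp: topspace_config config_component_def)

text \<open>Radii of empty disks range over the open interval from 0 to \<delta>. It is exhausted by
  the closed intervals from 1/(m+1) to \<delta> - 1/(m+1), whose compactness the projection argument
  requires.\<close>

lemma index_complex_iff:
  assumes p: "p \<in> topspace (config_topology M \<delta>)" and J: "J \<subseteq> {..<fst p}"
  shows "J \<in> index_complex p \<longleftrightarrow> card J \<in> {2, 3} \<and>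
    (\<exists>m::nat. cocirc (inverse (real (Suc m))) (\<delta> - inverse (real (Suc m))) J {..<fst p} (snd p))"
proof -
  interpret config_complex M \<delta> p by unfold_locales (rule p)
  have card: "card (snd p ` J) = card J" using J config_inj[OF p] by (intro card_image) (rule inj_on_subset)
  have "J \<in> index_complex p \<longleftrightarrow> card J \<in> {2, 3} \<and> (\<exists>D. empty_disk M \<delta> p D \<and> snd p ` J \<subseteq> frontier D)"
    using J unfolding index_complex_def edges_def faces_def points_def mem_Collect_eq Un_iff card by auto
  also have "\<dots> \<longleftrightarrow> card J \<in> {2, 3} \<and>
    (\<exists>m::nat. cocirc (inverse (real (Suc m))) (\<delta> - inverse (real (Suc m))) J {..<fst p} (snd p))"
  proof (rule conj_cong[OF refl])
    assume c: "card J \<in> {2, 3}"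
    then have ne: "snd p ` J \<noteq> {}" by auto
    show "(\<exists>D. empty_disk M \<delta> p D \<and> snd p ` J \<subseteq> frontier D) \<longleftrightarrow>
        (\<exists>m::nat. cocirc (inverse (real (Suc m))) (\<delta> - inverse (real (Suc m))) J {..<fst p} (snd p))"
    proof
      assume "\<exists>D. empty_disk M \<delta> p D \<and> snd p ` J \<subseteq> frontier D"
      then obtain D where D: "empty_disk M \<delta> p D" "snd p ` J \<subseteq> frontier D" by blast
      have "\<exists>c r. r < \<delta> \<and> 0 < r \<and> (\<forall>v\<in>snd p ` J. d c v = r) \<and> (\<forall>v\<in>V. r \<le> d c v)"
        by (rule empty_disk_data[OF D ne]) blast
      then obtain c r where cr: "r < \<delta>" "0 < r" "\<forall>v\<in>snd p ` J. d c v = r" "\<forall>v\<in>V. r \<le> d c v" by (elim exE conjE)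
      obtain m where m: "inverse (real (Suc m)) < min r (\<delta> - r)"
        using reals_Archimedean[of "min r (\<delta> - r)"] cr by auto
      show "\<exists>m::nat. cocirc (inverse (real (Suc m))) (\<delta> - inverse (real (Suc m))) J {..<fst p} (snd p)"
        unfolding cocirc_def using m cr(3,4) by (intro exI[of _ m] exI[of _ c] exI[of _ r]) (auto simp: points_def)
    next
      assume "\<exists>m::nat. cocirc (inverse (real (Suc m))) (\<delta> - inverse (real (Suc m))) J {..<fst p} (snd p)"
      then obtain m :: nat and c r where m: "inverse (real (Suc m)) \<le> r" "r \<le> \<delta> - inverse (real (Suc m))"
        and cr: "\<forall>i\<in>J. d c (snd p i) = r" "\<forall>k\<in>{..<fst p}. r \<le> d c (snd p k)"
        unfolding cocirc_def by blast
      have "0 < inverse (real (Suc m))" by simp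
      then have r: "r < \<delta>" "0 < r" using m by linarith+
      have 1: "d c v = r" if "v \<in> snd p ` J" for v using cr that by blast
      have 2: "r \<le> d c v" if "v \<in> V" for v using cr that by (auto simp: points_def)
      show "\<exists>D. empty_disk M \<delta> p D \<and> snd p ` J \<subseteq> frontier D"
        using empty_diskI[OF r 1 2] by blast
    qed
  qed
  finally show ?thesis .
qed

lemma index_complex_measurable:
  "{x \<in> config_component M \<delta> n. index_complex (n, x) = \<J>} \<in> sets (PiB n)"
proof (cases "\<J> \<subseteq> Pow {..<n}")
  case True
  let ?Q = "\<lambda>J x. card J \<in> {2, 3} \<and> (\<exists>m::nat. cocirc (inverse (real (Suc m))) (\<delta> - inverse (real (Suc m))) J {..<n} x)"
  have Q: "{x \<in> space (PiB n). ?Q J x} \<in> sets (PiB n)" if "J \<subseteq> {..<n}" for J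
    by (intro sets.sets_Collect_conj sets.sets_Collect_const sets.sets_Collect_countable_Ex measurable_cocirc that) simp
  have eq: "{x \<in> config_component M \<delta> n. index_complex (n, x) = \<J>} =
      config_component M \<delta> n \<inter> {x \<in> space (PiB n). \<forall>J\<in>Pow {..<n}. ?Q J x \<longleftrightarrow> J \<in> \<J>}"
  proof (intro set_eqI)
    fix x
    show "x \<in> {x \<in> config_component M \<delta> n. index_complex (n, x) = \<J>} \<longleftrightarrow>
      x \<in> config_component M \<delta> n \<inter> {x \<in> space (PiB n). \<forall>J\<in>Pow {..<n}. ?Q J x \<longleftrightarrow> J \<in> \<J>}"
    proof (cases "x \<in> config_component M \<delta> n")
      case x: True
      have sp: "x \<in> space (PiB n)" using config_component_PiE[of M \<delta> n] x unfolding space_PiM space_borel by blast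
      have Qx: "?Q J x \<longleftrightarrow> J \<in> index_complex (n, x)" if "J \<in> Pow {..<n}" for J
        using index_complex_iff[of "(n, x)" J] that x by (simp add: topspace_config)
      have "index_complex (n, x) \<subseteq> Pow {..<n}" by (auto simp: index_complex_def)
      then have "index_complex (n, x) = \<J> \<longleftrightarrow> (\<forall>J\<in>Pow {..<n}. J \<in> index_complex (n, x) \<longleftrightarrow> J \<in> \<J>)"
        using True by blast
      also have "\<dots> \<longleftrightarrow> (\<forall>J\<in>Pow {..<n}. ?Q J x \<longleftrightarrow> J \<in> \<J>)" using Qx by (intro ball_cong) simp_all
      finally show ?thesis unfolding Int_iff mem_Collect_eq using x sp by (simp only: simp_thms)
    qed simp
  qed
  show ?thesis unfolding eq
  proof (rule sets.Int[OF config_component_measurable sets.sets_Collect_finite_All])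
    fix J assume J: "J \<in> Pow {..<n}"
    show "{x \<in> space (PiB n). ?Q J x \<longleftrightarrow> J \<in> \<J>} \<in> sets (PiB n)"
    proof (cases "J \<in> \<J>")
      case True
      have "J \<subseteq> {..<n}" using J by blast
      from Q[OF this] True show ?thesis by (simp only: simp_thms)
    next
      case False
      have "{x \<in> space (PiB n). \<not> ?Q J x} \<in> sets (PiB n)" using Q[of J] J by (intro sets.sets_Collect_neg) blast
      then show ?thesis using False by (simp only: simp_thms)
    qed
  qed simp
next
  case False
  then have "{x \<in> config_component M \<delta> n. index_complex (n, x) = \<J>} = {}" by (auto simp: index_complex_def)
  then show ?thesis by (simp only: sets.empty_sets)
qed

text \<open>For each number of points there are finitely many index complexes, each on a measurable
  set, so F may be arbitrary.\<close>

lemma index_complex_determined_measurable: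
  fixes f :: "'a config \<Rightarrow> real"
  assumes f: "\<And>p. p \<in> topspace (config_topology M \<delta>) \<Longrightarrow> f p = F (fst p) (index_complex p)"
  shows "f \<in> borel_measurable (config_borel M \<delta>)"
proof (rule measurableI)
  fix A :: "real set" assume "A \<in> sets borel"
  let ?S = "f -` A \<inter> space (config_borel M \<delta>)"
  show "?S \<in> sets (config_borel M \<delta>)"
  proof (rule config_borelI)
    show "?S \<subseteq> Sigma UNIV (config_component M \<delta>)" by (auto simp: space_config_borel)
    fix n
    have fx: "f (n, x) = F n (index_complex (n, x))" "index_complex (n, x) \<in> Pow (Pow {..<n})"
      if "x \<in> config_component M \<delta> n" for x
      using f[of "(n, x)"] that by (auto simp: topspace_config index_complex_def)
    have "{x. (n, x) \<in> ?S} = {x \<in> config_component M \<delta> n. f (n, x) \<in> A}"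
      by (auto simp: space_config_borel)
    also have "\<dots> = (\<Union>\<J>\<in>{\<J>\<in>Pow (Pow {..<n}). F n \<J> \<in> A}. {x \<in> config_component M \<delta> n. index_complex (n, x) = \<J>})"
      using fx by auto
    also have "\<dots> \<in> sets (PiB n)" by (intro sets.finite_UN index_complex_measurable) simp
    finally show "{x. (n, x) \<in> ?S} \<in> sets (PiB n)" .
  qed
qed simp

lemma image_index_complex: "(\<lambda>J. snd p ` J) ` index_complex p = edges M \<delta> p \<union> faces M \<delta> p"
proof (intro equalityI subsetI)
  fix S assume S: "S \<in> edges M \<delta> p \<union> faces M \<delta> p"
  then have "S \<subseteq> snd p ` {..<fst p}" by (auto simp: edges_def faces_def points_def)
  then obtain J where "J \<subseteq> {..<fst p}" "S = snd p ` J" unfolding subset_image_iff by blast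
  then show "S \<in> (\<lambda>J. snd p ` J) ` index_complex p" using S unfolding index_complex_def by blast
qed (auto simp: index_complex_def)

lemma simplices_index_complex:
  "simplices M \<delta> p = (\<lambda>J. snd p ` J) ` ((\<lambda>i. {i}) ` {..<fst p} \<union> index_complex p)"
proof -
  have "{{v} | v. v \<in> points p} = (\<lambda>J. snd p ` J) ` (\<lambda>i. {i}) ` {..<fst p}" by (auto simp: points_def)
  then show ?thesis unfolding simplices_def image_Un image_index_complex Un_assoc by (rule arg_cong)
qed

text \<open>Transports barycentric coordinates along the index bijection between the points of p and
  those of q.\<close>

definition relabel :: "'a config \<Rightarrow> 'a config \<Rightarrow> ('a \<Rightarrow> real) \<Rightarrow> 'a \<Rightarrow> real" where
  "relabel p q b w = (if w \<in> points q then b (snd p (the_inv_into {..<fst q} (snd q) w)) else 0)"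

lemma continuous_on_relabel: "continuous_on S (relabel p q)"
proof (rule continuous_on_coordinatewise_then_product)
  fix w
  show "continuous_on S (\<lambda>b. relabel p q b w)"
    unfolding relabel_def
    by (cases "w \<in> points q") (auto intro!: continuous_intros continuous_on_product_coordinates[THEN continuous_on_subset])
qed

lemma relabel_at:
  assumes q: "q \<in> topspace (config_topology M \<delta>)" and i: "i < fst q"
  shows "relabel p q b (snd q i) = b (snd p i)"
  using the_inv_into_f_f[OF config_inj[OF q], of i] i by (simp add: relabel_def points_def)

lemma relabel_cell:
  assumes p: "p \<in> topspace (config_topology M \<delta>)" and q: "q \<in> topspace (config_topology M \<delta>)"
    and n: "fst p = fst q" and J: "J \<subseteq> {..<fst q}" and b: "b \<in> cell (snd p ` J)"
  shows "relabel p q b \<in> cell (snd q ` J)" "relabel q p (relabel p q b) = b"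
proof -
  have inj: "inj_on (snd p) J" "inj_on (snd q) J"
    using config_inj[OF p] config_inj[OF q] J n inj_on_subset by auto
  have at: "relabel p q b (snd q i) = b (snd p i)" if "i < fst q" for i by (rule relabel_at[OF q that])
  have out: "relabel p q b w = 0" if "w \<notin> points q" for w using that by (simp add: relabel_def)
  have b0: "0 \<le> b v" "v \<notin> snd p ` J \<Longrightarrow> b v = 0" for v using cell_nonneg[OF b] cell_outside[OF b] by auto
  have pin: "snd p i \<in> snd p ` J \<Longrightarrow> i < fst p \<Longrightarrow> i \<in> J" for i
    using inj_on_image_mem_iff[OF config_inj[OF p]] J n by auto
  show "relabel p q b \<in> cell (snd q ` J)"
    unfolding cell_def mem_Collect_eq
  proof (intro conjI allI subsetI)
    fix w
    show "0 \<le> relabel p q b w" unfolding relabel_def using b0(1) by simp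
  next
    fix w assume "w \<in> {w. relabel p q b w \<noteq> 0}"
    then have w: "relabel p q b w \<noteq> 0" by simp
    then have "w \<in> points q" using out by blast
    then obtain i where i: "i < fst q" "w = snd q i" by (auto simp: points_def)
    then have "b (snd p i) \<noteq> 0" using w at by simp
    then have "i \<in> J" using b0(2) pin i(1) n by metis
    then show "w \<in> snd q ` J" using i by blast
  next
    have "sum (relabel p q b) (snd q ` J) = (\<Sum>i\<in>J. relabel p q b (snd q i))"
      by (simp add: sum.reindex[OF inj(2)])
    also have "\<dots> = (\<Sum>i\<in>J. b (snd p i))" using at J by (intro sum.cong) auto
    also have "\<dots> = sum b (snd p ` J)" by (simp add: sum.reindex[OF inj(1)])
    finally show "sum (relabel p q b) (snd q ` J) = 1" using cell_sum[OF b] by simp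
  qed
  show "relabel q p (relabel p q b) = b"
  proof
    fix v
    show "relabel q p (relabel p q b) v = b v"
    proof (cases "v \<in> points p")
      case True
      then obtain i where i: "i < fst p" "v = snd p i" by (auto simp: points_def)
      then show ?thesis using relabel_at[OF p i(1), of q "relabel p q b"] at n by simp
    next
      case False
      then have "v \<notin> snd p ` J" using J n by (auto simp: points_def)
      then show ?thesis using False b0(2) by (simp add: relabel_def)
    qed
  qed
qed

lemma relabel_realization:
  assumes p: "p \<in> topspace (config_topology M \<delta>)" and q: "q \<in> topspace (config_topology M \<delta>)"
    and n: "fst p = fst q" and ic: "index_complex p = index_complex q" and b: "b \<in> realization M \<delta> p"
  shows "relabel p q b \<in> realization M \<delta> q" "relabel q p (relabel p q b) = b"
proof -
  obtain J where J: "J \<in> (\<lambda>i. {i}) ` {..<fst p} \<union> index_complex p" "b \<in> cell (snd p ` J)"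
    using b unfolding realization_def simplices_index_complex by blast
  have sub: "J \<subseteq> {..<fst q}" using J(1) n by (auto simp: index_complex_def)
  show "relabel q p (relabel p q b) = b" by (rule relabel_cell(2)[OF p q n sub J(2)])
  have "J \<in> (\<lambda>i. {i}) ` {..<fst q} \<union> index_complex q" using J(1) unfolding n ic .
  then show "relabel p q b \<in> realization M \<delta> q"
    using relabel_cell(1)[OF p q n sub J(2)] unfolding realization_def simplices_index_complex by blast
qed

lemma realization_homeomorphic:
  assumes "p \<in> topspace (config_topology M \<delta>)" "q \<in> topspace (config_topology M \<delta>)"
    "fst p = fst q" "index_complex p = index_complex q"
  shows "realization M \<delta> p homeomorphic realization M \<delta> q"
proof -
  have "homeomorphism (realization M \<delta> p) (realization M \<delta> q) (relabel p q) (relabel q p)"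
    by (rule homeomorphismI)
      (use relabel_realization[OF assms] relabel_realization[OF assms(2,1) assms(3,4)[symmetric]] continuous_on_relabel in auto)
  then show ?thesis unfolding homeomorphic_def by blast
qed

lemma delaunay_iff_homeomorphic:
  assumes "p \<in> topspace (config_topology M \<delta>)"
  shows "p \<in> delaunay_configs M \<delta> \<longleftrightarrow> realization M \<delta> p homeomorphic (UNIV :: 'a set)"
proof -
  interpret config_complex M \<delta> p by unfold_locales (rule assms)
  show ?thesis by (rule delaunay_iff)
qed

lemma delaunay_measurable:
  "(indicator (delaunay_configs M \<delta>) :: 'a config \<Rightarrow> real) \<in> borel_measurable (config_borel M \<delta>)"
proof (rule index_complex_determined_measurable)
  fix p assume p: "p \<in> topspace (config_topology M \<delta>)"
  \<comment> \<open>Whether some Delaunay configuration has this number of points and this index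
    complex; homeomorphic realizations make one witness decide for all.\<close>
  let ?F = "\<lambda>n \<J>. of_bool (\<exists>q\<in>topspace (config_topology M \<delta>). fst q = n \<and> index_complex q = \<J> \<and> q \<in> delaunay_configs M \<delta>) :: real"
  have "p \<in> delaunay_configs M \<delta>"
    if q: "q \<in> topspace (config_topology M \<delta>)" "fst q = fst p" "index_complex q = index_complex p" "q \<in> delaunay_configs M \<delta>" for q
    using realization_homeomorphic[OF p q(1) q(2,3)[symmetric]] q(4)
    unfolding delaunay_iff_homeomorphic[OF p] delaunay_iff_homeomorphic[OF q(1)] by (rule homeomorphic_trans)
  then show "indicator (delaunay_configs M \<delta>) p = ?F (fst p) (index_complex p)"
    using p by (auto simp: indicator_def)
qed

lemma card_index_complex:
  assumes p: "p \<in> topspace (config_topology M \<delta>)"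
  shows "card (edges M \<delta> p) = card {J \<in> index_complex p. card J = 2}"
    and "card (faces M \<delta> p) = card {J \<in> index_complex p. card J = 3}"
proof -
  have inj: "inj_on (\<lambda>J. snd p ` J) {J \<in> index_complex p. Q J}" for Q
    by (rule inj_on_subset[OF inj_on_image_Pow[OF config_inj[OF p]]]) (auto simp: index_complex_def)
  have card: "card (snd p ` J) = card J" if "J \<in> index_complex p" for J
    using that config_inj[OF p] by (intro card_image) (auto simp: index_complex_def intro: inj_on_subset)
  have im: "S \<in> (\<lambda>J. snd p ` J) ` index_complex p" if "S \<in> edges M \<delta> p \<union> faces M \<delta> p" for S
    using that unfolding image_index_complex .
  have split: "snd p ` J \<in> edges M \<delta> p \<longleftrightarrow> card J = 2" "snd p ` J \<in> faces M \<delta> p \<longleftrightarrow> card J = 3"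
    if J: "J \<in> index_complex p" for J
  proof -
    have "snd p ` J \<in> edges M \<delta> p \<union> faces M \<delta> p" using J by (simp add: index_complex_def)
    then show "snd p ` J \<in> edges M \<delta> p \<longleftrightarrow> card J = 2" "snd p ` J \<in> faces M \<delta> p \<longleftrightarrow> card J = 3"
      using card[OF J] by (auto simp: edges_def faces_def)
  qed
  have "edges M \<delta> p = (\<lambda>J. snd p ` J) ` {J \<in> index_complex p. card J = 2}"
  proof (intro equalityI subsetI)
    fix S assume S: "S \<in> edges M \<delta> p"
    then obtain J where "J \<in> index_complex p" "S = snd p ` J" using im by blast
    then show "S \<in> (\<lambda>J. snd p ` J) ` {J \<in> index_complex p. card J = 2}" using S split(1) by blast
  qed (use split in blast)
  then show "card (edges M \<delta> p) = card {J \<in> index_complex p. card J = 2}" by (simp add: card_image inj)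
  have "faces M \<delta> p = (\<lambda>J. snd p ` J) ` {J \<in> index_complex p. card J = 3}"
  proof (intro equalityI subsetI)
    fix S assume S: "S \<in> faces M \<delta> p"
    then obtain J where "J \<in> index_complex p" "S = snd p ` J" using im by blast
    then show "S \<in> (\<lambda>J. snd p ` J) ` {J \<in> index_complex p. card J = 3}" using S split(2) by blast
  qed (use split in blast)
  then show "card (faces M \<delta> p) = card {J \<in> index_complex p. card J = 3}" by (simp add: card_image inj)
qed

lemma num_measurable:
  "num_vertices \<in> borel_measurable (config_borel M \<delta>)"
  "num_edges M \<delta> \<in> borel_measurable (config_borel M \<delta>)"
  "num_faces M \<delta> \<in> borel_measurable (config_borel M \<delta>)"
proof -
  show "num_vertices \<in> borel_measurable (config_borel M \<delta>)"
    by (rule index_complex_determined_measurable[where F = "\<lambda>n _. real n"])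
      (simp add: num_vertices_def points_def card_image[OF config_inj])
  show "num_edges M \<delta> \<in> borel_measurable (config_borel M \<delta>)"
    by (rule index_complex_determined_measurable[where F = "\<lambda>_ \<J>. real (card {J \<in> \<J>. card J = 2})"])
      (simp add: num_edges_def card_index_complex)
  show "num_faces M \<delta> \<in> borel_measurable (config_borel M \<delta>)"
    by (rule index_complex_determined_measurable[where F = "\<lambda>_ \<J>. real (card {J \<in> \<J>. card J = 3})"])
      (simp add: num_faces_def card_index_complex)
qed

end

section \<open>The Poisson process\<close>

text \<open>The cube of x <= exp x at x = \<kappa> n / 3 with \<kappa> = ln t, combined with 1 <=
  t^n.\<close>

lemma power3_plus_1_le_power:
  fixes t :: real
  assumes t: "1 < t"
  obtains C where "0 < C" "\<And>n::nat. real n ^ 3 + 1 \<le> C * t ^ n"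
proof
  define \<kappa> where "\<kappa> = ln t"
  have k: "0 < \<kappa>" using t by (simp add: \<kappa>_def)
  show "0 < (3 / \<kappa>) ^ 3 + 1" using k by (simp add: add_pos_pos)
  fix n :: nat
  have "real n = 3 / \<kappa> * (\<kappa> * n / 3)" using k by simp
  also have "\<dots> \<le> 3 / \<kappa> * exp (\<kappa> * n / 3)"
  proof (rule mult_left_mono)
    show "\<kappa> * n / 3 \<le> exp (\<kappa> * n / 3)" using exp_ge_add_one_self[of "\<kappa> * n / 3"] by linarith
  qed (use k in simp)
  finally have "real n ^ 3 \<le> (3 / \<kappa> * exp (\<kappa> * n / 3)) ^ 3" by (rule power_mono) simp
  also have "\<dots> = (3 / \<kappa>) ^ 3 * exp (3 * (\<kappa> * n / 3))"
    unfolding power_mult_distrib exp_of_nat_mult[symmetric] by simp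
  also have "exp (3 * (\<kappa> * n / 3)) = t ^ n" using t by (simp add: \<kappa>_def exp_of_nat2_mult)
  finally have "real n ^ 3 \<le> (3 / \<kappa>) ^ 3 * t ^ n" .
  moreover have "1 \<le> t ^ n" using t by (simp add: one_le_power)
  ultimately show "real n ^ 3 + 1 \<le> ((3 / \<kappa>) ^ 3 + 1) * t ^ n" by (simp add: distrib_right)
qed

text \<open>The quotient by 1/x^k is dominated by a constant multiple of y^k / exp y at y = c
  x.\<close>

lemma exp_decay_smallo:
  fixes f :: "real \<Rightarrow> real"
  assumes c: "0 < c" and f: "\<And>x. 0 < x \<Longrightarrow> \<bar>f x\<bar> \<le> K * exp (- c * x)"
  shows "f \<in> o[at_top](\<lambda>x. 1 / x ^ k)"
proof (rule smalloI_tendsto)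
  have "((\<lambda>x. (c * x) ^ k / exp (c * x)) \<longlongrightarrow> 0) at_top"
    by (rule filterlim_compose[OF tendsto_power_div_exp_0])
      (use c in \<open>auto intro!: filterlim_tendsto_pos_mult_at_top filterlim_ident tendsto_const\<close>)
  then have lim: "((\<lambda>x. K / c ^ k * ((c * x) ^ k / exp (c * x))) \<longlongrightarrow> 0) at_top"
    by (rule tendsto_mult_right_zero)
  show "((\<lambda>x. f x / (1 / x ^ k)) \<longlongrightarrow> 0) at_top"
  proof (rule Lim_null_comparison[OF _ lim])
    show "\<forall>\<^sub>F x in at_top. norm (f x / (1 / x ^ k)) \<le> K / c ^ k * ((c * x) ^ k / exp (c * x))"
      using eventually_gt_at_top[of 0]
    proof eventually_elim
      case (elim x)
      have "norm (f x / (1 / x ^ k)) = \<bar>f x\<bar> * x ^ k" using elim by (simp add: abs_mult)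
      also have "\<dots> \<le> K * exp (- c * x) * x ^ k" using elim f by (intro mult_right_mono) auto
      also have "\<dots> = K / c ^ k * ((c * x) ^ k / exp (c * x))"
        using c by (simp add: power_mult_distrib exp_minus field_simps)
      finally show ?case .
    qed
  qed
  show "\<forall>\<^sub>F x in at_top. (1 :: real) / x ^ k \<noteq> 0"
    using eventually_gt_at_top[of "0::real"] by eventually_elim simp
qed

context delta_surface
begin

abbreviation \<A> where "\<A> \<equiv> total_area M"
abbreviation PiA where "PiA n \<equiv> PiM {..<n} (\<lambda>_. area_measure M)"

lemma emeasure_area: "emeasure (area_measure M) UNIV = ennreal \<A>"
  unfolding total_area_def using finite_area by (simp add: emeasure_eq_ennreal_measure less_top)

lemma measure_area_pos:
  assumes "open U" "U \<noteq> {}" shows "0 < measure (area_measure M) U"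
proof -
  interpret finite_measure "area_measure M" by (rule finite_measure_area)
  show ?thesis using open_area_pos[OF assms] by (simp add: emeasure_eq_measure)
qed

lemma total_area_pos: "0 < \<A>"
  unfolding total_area_def by (rule measure_area_pos) auto

lemma sets_PiA: "sets (PiA n) = sets (PiB n)"
  by (intro sets_PiM_cong) auto

lemma emeasure_PiA_cube:
  assumes "U \<in> sets borel"
  shows "emeasure (PiA n) ({..<n} \<rightarrow>\<^sub>E U) = emeasure (area_measure M) U ^ n"
proof -
  interpret finite_measure "area_measure M" by (rule finite_measure_area)
  interpret product_sigma_finite "\<lambda>_::nat. area_measure M" by unfold_locales
  show ?thesis using assms by (subst emeasure_PiM) auto
qed

text \<open>Converse of \<open>config_borelI\<close>, by induction over the generated sigma-algebra;
  for open sets it rests on \<open>openin_product_measurable\<close>.\<close>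

lemma config_borel_slice:
  assumes "S \<in> sets (config_borel M \<delta>)" shows "{x. (n, x) \<in> S} \<in> sets (PiB n)"
  using assms unfolding sets_config_borel
proof (induction rule: sigma_sets.induct)
  case (Basic U)
  then have "openin (subtopology (product_topology (\<lambda>_. euclidean) {..<n}) (config_component M \<delta> n)) {x. (n, x) \<in> U}"
    unfolding openin_config by blast
  then obtain T where T: "openin (product_topology (\<lambda>_. euclidean) {..<n}) T"
    and U: "{x. (n, x) \<in> U} = T \<inter> config_component M \<delta> n"
    unfolding openin_subtopology by blast
  show ?case unfolding U by (rule sets.Int[OF openin_product_measurable[OF T] config_component_measurable])
next
  case (Compl S)
  have "{x. (n, x) \<in> topspace (config_topology M \<delta>) - S} = config_component M \<delta> n - {x. (n, x) \<in> S}"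
    unfolding topspace_config by auto
  then show ?case using Compl config_component_measurable by (simp only: sets.Diff)
next
  case (Union S)
  have "{x. (n, x) \<in> (\<Union>i. S i)} = (\<Union>i. {x. (n, x) \<in> S i})" by auto
  then show ?case using Union by auto
qed simp

definition poisson_weight :: "real \<Rightarrow> nat \<Rightarrow> real" where
  "poisson_weight lam n = lam ^ n / fact n * exp (- lam * \<A>)"

lemma
  shows sets_poisson [measurable_cong, simp]: "sets (poisson_process M \<delta> lam) = sets (config_borel M \<delta>)"
    and space_poisson: "space (poisson_process M \<delta> lam) = Sigma UNIV (config_component M \<delta>)"
  unfolding poisson_process_def sets_config_borel topspace_config[symmetric]
  by (auto intro!: sets_measure_of space_measure_of dest: openin_subset)

text \<open>\<open>measure_of\<close> takes the prescribed values only if they are countably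
  additive. This follows from additivity on each component and the exchange of two sums of
  nonnegative terms.\<close>

lemma emeasure_poisson:
  assumes S: "S \<in> sets (config_borel M \<delta>)"
  shows "emeasure (poisson_process M \<delta> lam) S =
    (\<Sum>n. ennreal (poisson_weight lam n) * emeasure (PiA n) {x. (n, x) \<in> S})"
proof -
  define F where "F S = (\<Sum>n. ennreal (poisson_weight lam n) * emeasure (PiA n) {x. (n, x) \<in> S})" for S
  have eq: "poisson_process M \<delta> lam =
      measure_of (topspace (config_topology M \<delta>)) {U. openin (config_topology M \<delta>) U} F"
    unfolding poisson_process_def F_def poisson_weight_def ..
  have "emeasure (poisson_process M \<delta> lam) S = F S"
  proof (rule emeasure_measure_of[OF eq])
    show "{U. openin (config_topology M \<delta>) U} \<subseteq> Pow (topspace (config_topology M \<delta>))"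
      by (auto dest: openin_subset)
    show "S \<in> sets (poisson_process M \<delta> lam)" using S by simp
    show "positive (sets (poisson_process M \<delta> lam)) F" by (simp add: positive_def F_def)
    show "countably_additive (sets (poisson_process M \<delta> lam)) F"
    proof (unfold countably_additive_def, intro allI impI)
      fix X :: "nat \<Rightarrow> 'a config set"
      assume X: "range X \<subseteq> sets (poisson_process M \<delta> lam)" "disjoint_family X" "\<Union> (range X) \<in> sets (poisson_process M \<delta> lam)"
      have ad: "(\<Sum>k. emeasure (PiA n) {x. (n, x) \<in> X k}) = emeasure (PiA n) {x. (n, x) \<in> \<Union> (range X)}" for n
      proof -
        have "range (\<lambda>k. {x. (n, x) \<in> X k}) \<subseteq> sets (PiA n)"
          using X(1) config_borel_slice unfolding sets_PiA by auto
        moreover have "disjoint_family (\<lambda>k. {x. (n, x) \<in> X k})" using X(2) unfolding disjoint_family_on_def by blast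
        ultimately have "(\<Sum>k. emeasure (PiA n) {x. (n, x) \<in> X k}) = emeasure (PiA n) (\<Union>k. {x. (n, x) \<in> X k})"
          by (rule suminf_emeasure)
        also have "(\<Union>k. {x. (n, x) \<in> X k}) = {x. (n, x) \<in> \<Union> (range X)}" by auto
        finally show ?thesis .
      qed
      let ?g = "\<lambda>k n. ennreal (poisson_weight lam n) * emeasure (PiA n) {x. (n, x) \<in> X k}"
      have "(\<Sum>k. F (X k)) = (\<Sum>k. \<integral>\<^sup>+n. ?g k n \<partial>count_space UNIV)" by (simp add: nn_integral_count_space_nat F_def)
      also have "\<dots> = (\<integral>\<^sup>+n. (\<Sum>k. ?g k n) \<partial>count_space UNIV)" by (rule nn_integral_suminf[symmetric]) simp
      also have "\<dots> = (\<Sum>n. \<Sum>k. ?g k n)" by (simp add: nn_integral_count_space_nat)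
      also have "\<dots> = F (\<Union> (range X))" by (simp only: ennreal_suminf_cmult ad F_def)
      finally show "(\<Sum>k. F (X k)) = F (\<Union> (range X))" .
    qed
  qed
  then show ?thesis by (simp only: F_def)
qed

text \<open>Splitting by the number of points turns a bound h on the integrand and a bound b on the
  slices of Q into a series. It is applied with Q the whole space for integrability and with Q the
  non-Delaunay configurations for the error term.\<close>

lemma nn_integral_poisson_le:
  fixes g :: "'a config \<Rightarrow> ennreal" and b h :: "nat \<Rightarrow> real"
  assumes lam: "0 < lam" and Q: "Q \<in> sets (config_borel M \<delta>)" and h: "\<And>n. 0 \<le> h n" and b: "\<And>n. 0 \<le> b n"
    and g: "\<And>p. p \<in> space (poisson_process M \<delta> lam) \<Longrightarrow> g p \<le> ennreal (h (fst p)) * indicator Q p"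
    and bound: "\<And>n. emeasure (PiA n) {x. (n, x) \<in> Q} \<le> ennreal (b n)"
    and s: "(\<lambda>n. h n * poisson_weight lam n * b n) sums s"
  shows "(\<integral>\<^sup>+p. g p \<partial>poisson_process M \<delta> lam) \<le> ennreal s"
proof -
  let ?P = "poisson_process M \<delta> lam"
  have pw: "0 \<le> poisson_weight lam n" for n using lam by (simp add: poisson_weight_def)
  have Bn: "Q \<inter> {p. fst p = n} \<in> sets (config_borel M \<delta>)" for n
  proof (rule config_borelI)
    show "Q \<inter> {p. fst p = n} \<subseteq> Sigma UNIV (config_component M \<delta>)"
      using sets.sets_into_space[OF Q] by (auto simp: space_config_borel)
    fix k
    have "{x. (k, x) \<in> Q \<inter> {p. fst p = n}} = (if k = n then {x. (n, x) \<in> Q} else {})" by auto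
    then show "{x. (k, x) \<in> Q \<inter> {p. fst p = n}} \<in> sets (PiB k)" using config_borel_slice[OF Q] by auto
  qed
  have em: "emeasure ?P (Q \<inter> {p. fst p = n}) = ennreal (poisson_weight lam n) * emeasure (PiA n) {x. (n, x) \<in> Q}" for n
  proof -
    have "emeasure ?P (Q \<inter> {p. fst p = n}) =
        (\<Sum>k. if k = n then ennreal (poisson_weight lam n) * emeasure (PiA n) {x. (n, x) \<in> Q} else 0)"
      unfolding emeasure_poisson[OF Bn] by (intro suminf_cong) auto
    also have "\<dots> = ennreal (poisson_weight lam n) * emeasure (PiA n) {x. (n, x) \<in> Q}"
      by (rule sums_unique[symmetric], rule sums_single[where f = "\<lambda>_. ennreal (poisson_weight lam n) * emeasure (PiA n) {x. (n, x) \<in> Q}"])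
    finally show ?thesis .
  qed
  have "(\<integral>\<^sup>+p. g p \<partial>?P) \<le> (\<integral>\<^sup>+p. (\<Sum>n. ennreal (h n) * indicator (Q \<inter> {p. fst p = n}) p) \<partial>?P)"
  proof (rule nn_integral_mono)
    fix p assume "p \<in> space ?P"
    then have "g p \<le> ennreal (h (fst p)) * indicator Q p" by (rule g)
    \<comment> \<open>For a fixed p only the summand with n equal to its number of points
      survives.\<close>
    also have "\<dots> = (\<Sum>n. if n = fst p then ennreal (h n) * indicator Q p else 0)"
      by (rule sums_unique, rule sums_single[where f = "\<lambda>n. ennreal (h n) * indicator Q p"])
    also have "\<dots> = (\<Sum>n. ennreal (h n) * indicator (Q \<inter> {p. fst p = n}) p)"
      by (intro suminf_cong) (auto simp: indicator_def)
    finally show "g p \<le> (\<Sum>n. ennreal (h n) * indicator (Q \<inter> {p. fst p = n}) p)" .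
  qed
  also have "\<dots> = (\<Sum>n. \<integral>\<^sup>+p. ennreal (h n) * indicator (Q \<inter> {p. fst p = n}) p \<partial>?P)"
    using Bn by (intro nn_integral_suminf) auto
  also have "\<dots> = (\<Sum>n. ennreal (h n) * emeasure ?P (Q \<inter> {p. fst p = n}))"
    using Bn by (intro suminf_cong nn_integral_cmult_indicator) auto
  also have "\<dots> \<le> (\<Sum>n. ennreal (h n * poisson_weight lam n * b n))"
  proof (rule suminf_le)
    fix n
    have "ennreal (h n) * emeasure ?P (Q \<inter> {p. fst p = n}) \<le> ennreal (h n) * (ennreal (poisson_weight lam n) * ennreal (b n))"
      unfolding em by (intro mult_left_mono bound) auto
    also have "\<dots> = ennreal (h n * poisson_weight lam n * b n)"
      using h pw b by (simp add: ennreal_mult[symmetric] mult.assoc)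
    finally show "ennreal (h n) * emeasure ?P (Q \<inter> {p. fst p = n}) \<le> ennreal (h n * poisson_weight lam n * b n)" .
  qed auto
  also have "\<dots> = ennreal s" using h pw b s by (intro suminf_ennreal_eq) auto
  finally show ?thesis .
qed

text \<open>Exponential series: growth t^n of the integrand and volume q^n of the slices combine to
  the exponential of lam t q, against the normalization by the total area.\<close>

lemma poisson_exp_sums:
  "(\<lambda>n. (C * t ^ n) * poisson_weight lam n * (m * q ^ n)) sums (C * m * exp (lam * (t * q) - lam * \<A>))"
proof -
  have "(\<lambda>n. C * m * exp (- lam * \<A>) * ((lam * (t * q)) ^ n /\<^sub>R fact n)) sums (C * m * exp (- lam * \<A>) * exp (lam * (t * q)))"
    by (intro sums_mult exp_converges)
  moreover have "(\<lambda>n. C * m * exp (- lam * \<A>) * ((lam * (t * q)) ^ n /\<^sub>R fact n))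
      = (\<lambda>n. (C * t ^ n) * poisson_weight lam n * (m * q ^ n))"
    by (rule ext) (simp add: poisson_weight_def power_mult_distrib divide_inverse)
  moreover have "C * m * exp (- lam * \<A>) * exp (lam * (t * q)) = C * m * exp (lam * (t * q) - lam * \<A>)"
    by (simp add: exp_diff exp_minus divide_inverse)
  ultimately show ?thesis by (simp only:)
qed

lemma delaunay_sets: "delaunay_configs M \<delta> \<in> sets (config_borel M \<delta>)"
proof -
  have "(indicator (delaunay_configs M \<delta>) :: 'a config \<Rightarrow> real) -` {1} \<inter> space (config_borel M \<delta>) \<in> sets (config_borel M \<delta>)"
    by (rule measurable_sets[OF delaunay_measurable]) simp
  moreover have "delaunay_configs M \<delta> \<subseteq> space (config_borel M \<delta>)"
    unfolding space_config_borel delaunay_configs_def topspace_config by blast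
  then have "(indicator (delaunay_configs M \<delta>) :: 'a config \<Rightarrow> real) -` {1} \<inter> space (config_borel M \<delta>) = delaunay_configs M \<delta>"
    by (auto simp: indicator_def split: if_splits)
  ultimately show ?thesis by simp
qed

text \<open>A configuration that is not a Delaunay triangulation misses one of finitely many fixed disks.\<close>

lemma emeasure_not_delaunay:
  obtains m a where "0 \<le> m" "0 < a" "a \<le> \<A>"
    "\<And>n. emeasure (PiA n) {x. (n, x) \<in> space (config_borel M \<delta>) - delaunay_configs M \<delta>} \<le> ennreal (m * (\<A> - a) ^ n)"
proof -
  interpret finite_measure "area_measure M" by (rule finite_measure_area)
  obtain \<epsilon> where e: "\<epsilon> > 0" and del: "\<And>p. p \<in> topspace (config_topology M \<delta>) \<Longrightarrow> (\<And>x. \<exists>v\<in>points p. d x v < \<epsilon>) \<Longrightarrow> p \<in> delaunay_configs M \<delta>"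
    using dense_delaunay by blast
  have "\<exists>X. finite X \<and> (UNIV :: 'a set) \<subseteq> (\<Union>x\<in>X. disk M x (\<epsilon> / 2))"
    by (rule finite_disk_cover[OF compact_surface, of "\<lambda>_. \<epsilon> / 2"]) (use e in auto)
  then obtain X where X: "finite X" "(UNIV :: 'a set) \<subseteq> (\<Union>x\<in>X. disk M x (\<epsilon> / 2))" by blast
  have ne: "X \<noteq> {}" using X(2) by auto
  let ?D = "\<lambda>y. disk M y (\<epsilon> / 2)"
  \<comment> \<open>The least area of a covering disk: missing one of them confines every point to a
    set of area at most the total area minus a.\<close>
  define a where "a = Min ((\<lambda>y. measure (area_measure M) (?D y)) ` X)"
  have a: "0 < a" unfolding a_def
  proof (subst Min_gr_iff)
    have "y \<in> ?D y" for y using e by (simp add: disk_def)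
    then show "\<forall>r\<in>(\<lambda>y. measure (area_measure M) (?D y)) ` X. 0 < r" using measure_area_pos[OF open_disk] by blast
  qed (use X ne in auto)
  have aD: "a \<le> measure (area_measure M) (?D y)" if "y \<in> X" for y
    unfolding a_def using X that by (intro Min_le) auto
  have DA: "measure (area_measure M) (?D y) \<le> \<A>" for y
    unfolding total_area_def by (intro finite_measure_mono) auto
  have aA: "a \<le> \<A>" using ne aD DA order_trans by blast
  have comp: "emeasure (area_measure M) (- ?D y) \<le> ennreal (\<A> - a)" if "y \<in> X" for y
  proof -
    have "measure (area_measure M) (- ?D y) = \<A> - measure (area_measure M) (?D y)"
      using finite_measure_compl[of "?D y"] by (simp add: total_area_def Compl_eq_Diff_UNIV)
    then show ?thesis using aD[OF that] by (simp add: emeasure_eq_measure ennreal_leI)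
  qed
  have borel: "- ?D y \<in> sets borel" for y by (intro borel_comp) simp
  have "emeasure (PiA n) {x. (n, x) \<in> space (config_borel M \<delta>) - delaunay_configs M \<delta>} \<le> ennreal (real (card X) * (\<A> - a) ^ n)" for n
  proof -
    have "{x. (n, x) \<in> space (config_borel M \<delta>) - delaunay_configs M \<delta>} \<subseteq> (\<Union>y\<in>X. {..<n} \<rightarrow>\<^sub>E - ?D y)"
    proof
      fix x assume x: "x \<in> {x. (n, x) \<in> space (config_borel M \<delta>) - delaunay_configs M \<delta>}"
      then have xc: "x \<in> config_component M \<delta> n" "(n, x) \<notin> delaunay_configs M \<delta>" by (auto simp: space_config_borel)
      then have "\<not> (\<forall>z. \<exists>v\<in>points (n, x). d z v < \<epsilon>)" using del[of "(n, x)"] by (auto simp: topspace_config)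
      then obtain z where z: "\<forall>v\<in>points (n, x). \<epsilon> \<le> d z v" by (auto simp: not_less)
      \<comment> \<open>No point of the configuration is within \<epsilon> of z, so a disk of radius
        \<epsilon>/2 that contains z has no point of it either.\<close>
      obtain y where y: "y \<in> X" "d y z < \<epsilon> / 2" using X(2) by (auto simp: disk_def)
      have "x i \<in> - ?D y" if "i < n" for i
      proof -
        have "\<epsilon> \<le> d z (x i)" using z that by (auto simp: points_def)
        also have "\<dots> \<le> d y z + d y (x i)" using rdist_triangle[of z "x i" y] rdist_sym[of z y] by simp
        finally show ?thesis using y(2) by (simp add: disk_def)
      qed
      moreover have "x \<in> {..<n} \<rightarrow>\<^sub>E UNIV" using xc(1) config_component_PiE[of M \<delta> n] by (rule subsetD[rotated])
      ultimately show "x \<in> (\<Union>y\<in>X. {..<n} \<rightarrow>\<^sub>E - ?D y)" using y(1) by (auto simp: PiE_def Pi_def)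
    qed
    moreover have cube: "({..<n} \<rightarrow>\<^sub>E - ?D y) \<in> sets (PiA n)" for y
      unfolding sets_PiA using borel by (intro sets_PiM_I_finite) auto
    ultimately have "emeasure (PiA n) {x. (n, x) \<in> space (config_borel M \<delta>) - delaunay_configs M \<delta>}
        \<le> emeasure (PiA n) (\<Union>y\<in>X. {..<n} \<rightarrow>\<^sub>E - ?D y)"
      using X(1) by (intro emeasure_mono sets.finite_UN) auto
    also have "\<dots> \<le> (\<Sum>y\<in>X. emeasure (PiA n) ({..<n} \<rightarrow>\<^sub>E - ?D y))"
      using X(1) cube by (intro emeasure_subadditive_finite) auto
    also have "\<dots> \<le> (\<Sum>y\<in>X. ennreal ((\<A> - a) ^ n))"
    proof (rule sum_mono)
      fix y assume "y \<in> X"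
      then have "emeasure (area_measure M) (- ?D y) ^ n \<le> ennreal (\<A> - a) ^ n" using comp by (intro power_mono) auto
      then show "emeasure (PiA n) ({..<n} \<rightarrow>\<^sub>E - ?D y) \<le> ennreal ((\<A> - a) ^ n)"
        using aA by (simp add: emeasure_PiA_cube[OF borel] ennreal_power)
    qed
    also have "\<dots> = ennreal (real (card X) * (\<A> - a) ^ n)"
      using aA by (simp add: ennreal_mult ennreal_of_nat_eq_real_of_nat)
    finally show ?thesis .
  qed
  then show ?thesis by (intro that[of "real (card X)" a] a aA) auto
qed

text \<open>The two expectations differ by an integral over the non-Delaunay configurations. The
  cubic growth of L is absorbed into t^n with t so close to 1 that the loss of area a still
  prevails, leaving the decay rate a/2.\<close>

lemma expectation_difference:
  fixes L :: "'a config \<Rightarrow> real"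
  assumes L: "L \<in> borel_measurable (config_borel M \<delta>)"
    and bd: "\<And>p. p \<in> topspace (config_topology M \<delta>) \<Longrightarrow> \<bar>L p\<bar> \<le> real (fst p) ^ 3 + 1"
  shows "0 < lam \<Longrightarrow> integrable (poisson_process M \<delta> lam) L"
    and "(\<lambda>lam. (\<integral>p. L p \<partial>poisson_process M \<delta> lam)
        - (\<integral>p. L p * indicator (delaunay_configs M \<delta>) p \<partial>poisson_process M \<delta> lam)) \<in> o[at_top](\<lambda>lam. 1 / lam ^ k)"
proof -
  let ?T = "delaunay_configs M \<delta>"
  let ?B = "space (config_borel M \<delta>) - ?T"
  obtain m a where a: "0 \<le> m" "0 < a" "a \<le> \<A>" "\<forall>n. emeasure (PiA n) {x. (n, x) \<in> ?B} \<le> ennreal (m * (\<A> - a) ^ n)"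
    using emeasure_not_delaunay by metis
  \<comment> \<open>With total area A this choice gives t (A - a) = A - a/2 - a^2/(2A).\<close>
  define t where "t = 1 + a / (2 * \<A>)"
  have t: "1 < t" using a total_area_pos by (simp add: t_def)
  have tq: "t * (\<A> - a) \<le> \<A> - a / 2"
  proof -
    have "t * (\<A> - a) = \<A> - a / 2 - a * a / (2 * \<A>)" using total_area_pos by (simp add: t_def field_simps)
    also have "\<dots> \<le> \<A> - a / 2" using a total_area_pos by simp
    finally show ?thesis .
  qed
  obtain C where C0: "0 < C" and C1: "\<forall>n::nat. real n ^ 3 + 1 \<le> C * t ^ n"
    using power3_plus_1_le_power[OF t] by metis
  have nb: "ennreal (norm (L p)) \<le> ennreal (C * t ^ fst p)" if "p \<in> space (poisson_process M \<delta> lam)" for p lam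
    using bd[of p] C1[rule_format, of "fst p"] that by (intro ennreal_leI) (auto simp: space_poisson topspace_config)
  have meas: "L \<in> borel_measurable (poisson_process M \<delta> lam)" for lam using L by simp
  have T: "?T \<in> sets (poisson_process M \<delta> lam)" for lam using delaunay_sets by simp
  have int: "integrable (poisson_process M \<delta> lam) L" if lam: "0 < lam" for lam
  proof (rule integrableI_bounded[OF meas])
    have "(\<integral>\<^sup>+p. ennreal (norm (L p)) \<partial>poisson_process M \<delta> lam) \<le> ennreal (C * 1 * exp (lam * (t * \<A>) - lam * \<A>))"
    \<comment> \<open>Here q is the full area, so the bound is finite but does not decay; the error
      term below uses the area reduced by a.\<close>
    proof (rule nn_integral_poisson_le[OF lam sets.top[of "config_borel M \<delta>"] _ _ _ _ poisson_exp_sums])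
      show "0 \<le> C * t ^ n" "0 \<le> 1 * \<A> ^ n" for n using C0 t total_area_pos by auto
      show "ennreal (norm (L p)) \<le> ennreal (C * t ^ fst p) * indicator (space (config_borel M \<delta>)) p"
        if "p \<in> space (poisson_process M \<delta> lam)" for p
        using nb[OF that] that by (simp add: space_poisson space_config_borel)
      fix n
      have "emeasure (PiA n) {x. (n, x) \<in> space (config_borel M \<delta>)} \<le> emeasure (PiA n) ({..<n} \<rightarrow>\<^sub>E UNIV)"
        using config_component_PiE[of M \<delta> n] by (intro emeasure_mono) (auto simp: space_config_borel sets_PiA intro!: sets_PiM_I_finite)
      also have "\<dots> = ennreal (\<A> ^ n)" using total_area_pos by (simp add: emeasure_PiA_cube emeasure_area ennreal_power)
      finally show "emeasure (PiA n) {x. (n, x) \<in> space (config_borel M \<delta>)} \<le> ennreal (1 * \<A> ^ n)" by simp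
    qed
    also have "\<dots> < \<infinity>" by simp
    finally show "(\<integral>\<^sup>+p. ennreal (norm (L p)) \<partial>poisson_process M \<delta> lam) < \<infinity>" .
  qed
  show "0 < lam \<Longrightarrow> integrable (poisson_process M \<delta> lam) L" by (rule int)
  show "(\<lambda>lam. (\<integral>p. L p \<partial>poisson_process M \<delta> lam)
        - (\<integral>p. L p * indicator ?T p \<partial>poisson_process M \<delta> lam)) \<in> o[at_top](\<lambda>lam. 1 / lam ^ k)"
  proof (rule exp_decay_smallo)
    show "0 < a / 2" using a by simp
    fix lam :: real assume lam: "0 < lam"
    let ?P = "poisson_process M \<delta> lam"
    have intT: "integrable ?P (\<lambda>p. L p * indicator ?T p)"
      by (rule integrable_real_mult_indicator[OF T int[OF lam]])
    have "ennreal (norm (\<integral>p. L p - L p * indicator ?T p \<partial>?P)) \<le> (\<integral>\<^sup>+p. ennreal (norm (L p - L p * indicator ?T p)) \<partial>?P)"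
      by (rule integral_norm_bound_ennreal) (intro Bochner_Integration.integrable_diff int[OF lam] intT)
    also have "\<dots> \<le> ennreal (C * m * exp (lam * (t * (\<A> - a)) - lam * \<A>))"
    proof (rule nn_integral_poisson_le[OF lam sets.compl_sets[OF delaunay_sets] _ _ _ _ poisson_exp_sums])
      show "0 \<le> C * t ^ n" "0 \<le> m * (\<A> - a) ^ n" for n using C0 t a by auto
      show "emeasure (PiA n) {x. (n, x) \<in> ?B} \<le> ennreal (m * (\<A> - a) ^ n)" for n using a(4) by blast
      show "ennreal (norm (L p - L p * indicator ?T p)) \<le> ennreal (C * t ^ fst p) * indicator ?B p"
        if "p \<in> space ?P" for p
        using nb[OF that] that by (auto simp: space_poisson space_config_borel indicator_def)
    qed
    also have "\<dots> \<le> ennreal (C * m * exp (- (a / 2) * lam))"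
    proof (intro ennreal_leI mult_left_mono)
      have "lam * (t * (\<A> - a)) \<le> lam * (\<A> - a / 2)" using lam tq by (intro mult_left_mono) auto
      then show "exp (lam * (t * (\<A> - a)) - lam * \<A>) \<le> exp (- (a / 2) * lam)" by (simp add: algebra_simps)
    qed (use C0 a in auto)
    finally have "norm (\<integral>p. L p - L p * indicator ?T p \<partial>?P) \<le> C * m * exp (- (a / 2) * lam)"
      using C0 a by (subst (asm) ennreal_le_iff) auto
    moreover have "(\<integral>p. L p - L p * indicator ?T p \<partial>?P) = (\<integral>p. L p \<partial>?P) - (\<integral>p. L p * indicator ?T p \<partial>?P)"
      by (rule Bochner_Integration.integral_diff[OF int[OF lam] intT])
    ultimately show "\<bar>(\<integral>p. L p \<partial>?P) - (\<integral>p. L p * indicator ?T p \<partial>?P)\<bar> \<le> C * m * exp (- (a / 2) * lam)" by simp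
  qed
qed

text \<open>There are at most n^k sets of k points. The summand 1 covers n = 0 with k = 0, and it
  makes the same bound valid for the indicator function.\<close>

lemma card_subfamily_le:
  assumes "F \<subseteq> {S. S \<subseteq> points p \<and> card S = k}" "k \<le> 3"
  shows "real (card F) \<le> real (fst p) ^ 3 + 1"
proof -
  have fin: "finite (points p)" by (simp add: points_def)
  have n: "card (points p) \<le> fst p" unfolding points_def using card_image_le[of "{..<fst p}" "snd p"] by simp
  have "finite {S. S \<subseteq> points p \<and> card S = k}"
    by (rule finite_subset[of _ "Pow (points p)"]) (use fin in auto)
  then have "card F \<le> card {S. S \<subseteq> points p \<and> card S = k}" by (rule card_mono[OF _ assms(1)])
  also have "\<dots> = card (points p) choose k" by (rule n_subsets[OF fin])
  also have "\<dots> \<le> fst p ^ 3 + 1"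
  proof (cases "k \<le> card (points p)")
    case True
    have "card (points p) choose k \<le> card (points p) ^ k" using True by (rule binomial_le_pow)
    also have "\<dots> \<le> fst p ^ k" using n by (rule power_mono) simp
    also have "\<dots> \<le> fst p ^ 3 + 1"
    proof (cases "fst p = 0")
      case False
      then have "fst p ^ k \<le> fst p ^ 3" using assms(2) by (intro power_increasing) auto
      then show ?thesis by simp
    qed (simp add: power_0_left)
    finally show ?thesis .
  qed (simp add: binomial_eq_0)
  finally have "real (card F) \<le> real (fst p ^ 3 + 1)" by (rule of_nat_mono)
  then show ?thesis by simp
qed

lemma num_bounds:
  "\<bar>num_edges M \<delta> p\<bar> \<le> real (fst p) ^ 3 + 1" "\<bar>num_faces M \<delta> p\<bar> \<le> real (fst p) ^ 3 + 1"
  "\<bar>num_vertices p\<bar> \<le> real (fst p) ^ 3 + 1"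
proof -
  show "\<bar>num_edges M \<delta> p\<bar> \<le> real (fst p) ^ 3 + 1"
    unfolding num_edges_def using card_subfamily_le[of "edges M \<delta> p" p 2] by (auto simp: edges_def)
  show "\<bar>num_faces M \<delta> p\<bar> \<le> real (fst p) ^ 3 + 1"
    unfolding num_faces_def using card_subfamily_le[of "faces M \<delta> p" p 3] by (auto simp: faces_def)
  have "(\<lambda>v. {v}) ` points p \<subseteq> {S. S \<subseteq> points p \<and> card S = 1}" by auto
  from card_subfamily_le[OF this] show "\<bar>num_vertices p\<bar> \<le> real (fst p) ^ 3 + 1"
    by (simp add: num_vertices_def card_image)
qed

end

theorem theorem2:
  fixes M :: "'a::{t2_space,second_countable_topology} riemannian_structure"
    and \<delta> :: real
    and L :: "'a config \<Rightarrow> real"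
  assumes surface: "compact_riemannian_surface M"
    and delta_pos: "0 < \<delta>"
    and delta_le: "ereal \<delta> \<le> min (inj_radius M / 6) (convexity_radius M)"
    and L: "L \<in> {indicator (delaunay_configs M \<delta>), num_edges M \<delta>, num_vertices, num_faces M \<delta>}"
  shows "L \<in> borel_measurable (config_borel M \<delta>)
    \<and> (\<forall>lam>0. integrable (poisson_process M \<delta> lam) L)
    \<and> (\<forall>k::nat. (\<lambda>lam. (\<integral>p. L p \<partial>poisson_process M \<delta> lam)
            - (\<integral>p. L p * indicator (delaunay_configs M \<delta>) p \<partial>poisson_process M \<delta> lam))
          \<in> o[at_top](\<lambda>lam::real. 1 / lam ^ k))"
proof -
  interpret delta_surface M \<delta>
    by unfold_locales (rule surface, rule delta_pos, rule delta_le)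
  have meas: "L \<in> borel_measurable (config_borel M \<delta>)"
    using L delaunay_measurable num_measurable by blast
  have "\<bar>indicator (delaunay_configs M \<delta>) p\<bar> \<le> real (fst p) ^ 3 + 1" for p :: "'a config"
    by (simp add: indicator_def)
  then have "\<bar>L p\<bar> \<le> real (fst p) ^ 3 + 1" for p
    using L num_bounds by blast
  then show ?thesis using meas expectation_difference[OF meas] by blast
qed

end
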